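(* Let $f$ be a transcendental entire function, $z_0$ a repelling or parabolic fixed point of $f$, and assume $f$ has an admissible expansion domain $U$ at $z_0$. Then for every leg $\gamma$ there exist integers $0\le m<n$ such that ${\mathscr L}^m(\gamma)$ and ${\mathscr L}^n(\gamma)$ are equivalent. In other words, the orbit of the equivalence class of $\gamma$ under the leg map is finite.
   Context: Admissible expansion domain of $f$ at $z_0$: a domain $U\subset\mathbb C$ with (a) $U\subset\mathbb C\setminus(P(f)\cup\{z_0\})$ and $\infty$ an isolated boundary point of $U$; (b) $f^{-1}(U)\subsetneq U$; (c) $U$ finitely connected and $U\ne\mathbb C\setminus P(f)$; (d) $z_0\in\partial U$ accessible from $U$, and $K_0\setminus\{z_0\}$ has finitely many components where $K_0$ is the component of $\mathbb C\setminus U$ containing $z_0$. Here $P(f)=\overline{\bigcup_{n\ge0}f^n(S(f))}$ with $S(f)$ the closure of finite critical and asymptotic values. A leg is an injective curve $\gamma:[0,\infty]\to U\cup\{z_0,\infty\}$ with $\gamma((0,\infty))\subset U$, $\gamma(0)=z_0$, $\gamma(\infty)=\infty$. Two legs are equivalent if they are homotopic in $U$ relative to $\{z_0,\infty\}$. The leg map ${\mathscr L}$ sends a leg $\gamma$ to the unique preimage curve of $\gamma$ under $f$ starting at $z_0$ (a leg, since $z_0$ is not critical and $f^{-1}(U)\subset U$); ${\mathscr L}^n$ is its $n$-th iterate. *)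

theory Defs
  imports "HOL-Analysis.Analysis" "HOL-Computational_Algebra.Polynomial"
begin

definition transcendental_entire :: "(complex \<Rightarrow> complex) \<Rightarrow> bool" where
  "transcendental_entire f \<longleftrightarrow> f holomorphic_on UNIV \<and> \<not> (\<exists>p. \<forall>z. f z = poly p z)"

definition critical_values :: "(complex \<Rightarrow> complex) \<Rightarrow> complex set" where
  "critical_values f = {f z | z. deriv f z = 0}"

definition asymptotic_values :: "(complex \<Rightarrow> complex) \<Rightarrow> complex set" where
  "asymptotic_values f = {a. \<exists>\<gamma>::real \<Rightarrow> complex. continuous_on {0..} \<gamma> \<and>
       filterlim \<gamma> at_infinity at_top \<and> ((f \<circ> \<gamma>) \<longlongrightarrow> a) at_top}"

definition singular_set :: "(complex \<Rightarrow> complex) \<Rightarrow> complex set" where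
  "singular_set f = closure (critical_values f \<union> asymptotic_values f)"

definition postsingular_set :: "(complex \<Rightarrow> complex) \<Rightarrow> complex set" where
  "postsingular_set f = closure (\<Union>n. (f ^^ n) ` singular_set f)"

definition repelling_fixed_point :: "(complex \<Rightarrow> complex) \<Rightarrow> complex \<Rightarrow> bool" where
  "repelling_fixed_point f z0 \<longleftrightarrow> f z0 = z0 \<and> 1 < cmod (deriv f z0)"

definition parabolic_fixed_point :: "(complex \<Rightarrow> complex) \<Rightarrow> complex \<Rightarrow> bool" where
  "parabolic_fixed_point f z0 \<longleftrightarrow> f z0 = z0 \<and> (\<exists>n::nat. n > 0 \<and> deriv f z0 ^ n = 1)"

text \<open>Admissible expansion domain, conditions (a)--(d).  The point infinity being an isolated
  boundary point of the domain U means that U contains a punctured neighbourhood of infinity.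
  Since that makes the complement bounded, finite connectivity of U (on the sphere) is
  equivalent to the complement of U in the plane having finitely many components.\<close>
definition admissible_expansion_domain ::
  "(complex \<Rightarrow> complex) \<Rightarrow> complex \<Rightarrow> complex set \<Rightarrow> bool" where
  "admissible_expansion_domain f z0 U \<longleftrightarrow>
     open U \<and> connected U \<and>
     U \<subseteq> - (postsingular_set f \<union> {z0}) \<and>
     (\<exists>R. {z. R < cmod z} \<subseteq> U) \<and>
     f -` U \<subset> U \<and>
     finite (components (- U)) \<and> U \<noteq> - postsingular_set f \<and>
     z0 \<in> frontier U \<and>
     (\<exists>g. path g \<and> pathstart g = z0 \<and> g ` {0<..1} \<subseteq> U) \<and>
     finite (components (connected_component_set (- U) z0 - {z0}))"

text \<open>A leg: parametrised by [0,\<infinity>) with the value \<infinity> at \<infinity> expressed by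
  convergence to infinity.\<close>
definition is_leg :: "complex set \<Rightarrow> complex \<Rightarrow> (real \<Rightarrow> complex) \<Rightarrow> bool" where
  "is_leg U z0 \<gamma> \<longleftrightarrow> continuous_on {0..} \<gamma> \<and> inj_on \<gamma> {0..} \<and> \<gamma> 0 = z0 \<and>
     \<gamma> ` {0<..} \<subseteq> U \<and> filterlim \<gamma> at_infinity at_top"

text \<open>Homotopy in U relative to {z0, \<infinity>}; continuity at t = \<infinity> (on the compact
  parameter interval) is the uniform divergence to infinity.\<close>
definition legs_equivalent ::
  "complex set \<Rightarrow> complex \<Rightarrow> (real \<Rightarrow> complex) \<Rightarrow> (real \<Rightarrow> complex) \<Rightarrow> bool" where
  "legs_equivalent U z0 \<gamma> \<delta> \<longleftrightarrow>
     (\<exists>H :: real \<times> real \<Rightarrow> complex.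
        continuous_on ({0..1} \<times> {0..}) H \<and>
        (\<forall>t\<ge>0. H (0, t) = \<gamma> t) \<and> (\<forall>t\<ge>0. H (1, t) = \<delta> t) \<and>
        (\<forall>s\<in>{0..1}. H (s, 0) = z0) \<and>
        (\<forall>s\<in>{0..1}. \<forall>t>0. H (s, t) \<in> U) \<and>
        (\<forall>R. \<exists>T. \<forall>s\<in>{0..1}. \<forall>t\<ge>T. R < cmod (H (s, t))))"

text \<open>Leg map: the (unique) lift of \<gamma> under f starting at z0.\<close>
definition leg_map :: "(complex \<Rightarrow> complex) \<Rightarrow> complex \<Rightarrow> (real \<Rightarrow> complex) \<Rightarrow> (real \<Rightarrow> complex)" where
  "leg_map f z0 \<gamma> = (SOME \<delta>. continuous_on {0..} \<delta> \<and> \<delta> 0 = z0 \<and> (\<forall>t\<ge>0. f (\<delta> t) = \<gamma> t))"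

end

theory Submission
 imports Defs "HOL-Complex_Analysis.Complex_Analysis"
begin

text \<open>Let \<open>K\<close> be the complement of \<open>U\<close>. The iterated lifts \<open>Ga n\<close> of the leg are simple curves, and simple curves landing
at \<open>z0\<close> use only finitely many accesses through the complement of the component of \<open>z0\<close>. After passing to an iterate of
\<open>f\<close>, the germs of \<open>Ga 0\<close> and \<open>Ga 1\<close> are therefore homotopic; if \<open>z0\<close> is isolated in \<open>K\<close>, this is automatic. The endpoints of the
homotopy form a path \<open>aa 0\<close> whose successive lifts \<open>aa k\<close> shrink, by normality of the inverse branches of the iterates, and
land at a fixed point \<open>ze\<close>. It is repelling or parabolic, and a further iterate makes its multiplier \<open>1\<close> in the second case.

Up to equivalence, \<open>Ga n\<close> follows the germ, then \<open>aa 0, \<dots>, aa (n - 1)\<close>, then lifts of radial segments in a neighbourhood of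
infinity. Since an orbit that enters a small disc around \<open>ze\<close> near its boundary stays close to \<open>ze\<close>, all of this lies in that
disc, except for an initial part that does not depend on \<open>n\<close> and a final part that is uniformly Lipschitz with values in a
compact subset of \<open>U\<close>. By Arzela--Ascoli the final parts of two of these curves are close. Their middle parts lie in the disc
and are homotopic in \<open>U\<close> if \<open>ze\<close> is not isolated in \<open>K\<close>. If \<open>ze\<close> is isolated and different from \<open>z0\<close>, simplicity of the legs
bounds the winding of the middle parts around \<open>ze\<close>, so two of them wind equally often. If \<open>ze = z0\<close> is isolated, the winding
is undone by rotating the germ at \<open>z0\<close>.\<close>

text \<open>The preimage of \<open>U\<close> is a proper subset of \<open>U\<close>, so there is
  \<open>a\<close> in \<open>U\<close> with \<open>f a\<close> outside \<open>U\<close>. Inverse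
  branches of all positive iterates over discs in \<open>U\<close> omit both \<open>a\<close> and
  \<open>f a\<close>. This takes the place of a hyperbolic metric: Schottky's theorem makes the
  branches normal, and a nonconstant limit would yield branches converging to the identity, which is
  impossible at \<open>a\<close>. Normality does not keep successive lifts from escaping to
  infinity; there the branches are seen in logarithmic coordinates, where Bloch's theorem makes them
  contract by a factor two. The main obstacle is topological. Since \<open>U\<close> need not be
  simply connected, curves can be close without being homotopic, and the middle parts get longer
  with \<open>n\<close>. At infinity this does no harm, as a homotopy of legs may turn freely there;
  each leg is therefore cut off at a fixed circle and continued by a ray. Around \<open>z0\<close> a
  loop can be pushed into the germ. Around another isolated point nothing of the kind is available,
  and only the simplicity of the true lifts bounds the turning. The curves actually compared are not
  simple, so this bound has to be a homotopy invariant.\<close>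

abbreviation (input) "cont == continuous_on"
lemmas cont_sub = continuous_on_subset and cont_comp = continuous_on_compose2 and holo_cont = holomorphic_on_imp_continuous_on

section \<open>Unique lifting, and coverings from inverse branches\<close>

text \<open>The set where two lifts agree is closed by continuity and open because \<open>f\<close>
  is injective near a common value, so on a connected domain it is empty or everything.\<close>

lemma lift_unique_local_inj:
 fixes f :: "complex => complex" and h k :: "'a::topological_space => complex"
 assumes inj: "!!w. f w:U ==> EX N. open N & w:N & inj_on f N"
  and T: "connected T" and h: "cont T h" and k: "cont T k"
  and eq: "!!z. z:T ==> f (h z)=f (k z)" and im: "!!z. z:T ==> f (h z):U"
  and b: "b:T" "h b=k b" and z: "z:T"
 shows "h z=k z"
proof -
 let ?E = "{z:T. h z-k z=0}"
 have "closedin (top_of_set T) ?E"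
  by (intro continuous_closedin_preimage_constant continuous_intros h k)
 moreover have "openin (top_of_set T) ?E"
 proof (subst openin_subopen, clarify)
  fix x assume x: "x:T" "h x-k x=0"
  then obtain N where N: "open N" "h x:N" "inj_on f N" using inj[of "h x"] im by blast
  let ?V = "(T Int h -` N) Int (T Int k -` N)"
  have "openin (top_of_set T) ?V"
   by (intro openin_Int continuous_openin_preimage_gen h k N)
  moreover have "x:?V" using x N by auto
  moreover have "?V<=?E" using N(3) eq by (auto dest: inj_onD)
  ultimately show "EX V. openin (top_of_set T) V & x:V & V<=?E" by blast
 qed
 ultimately have "?E={} | ?E=T" using T unfolding connected_clopen by blast
 then show ?thesis using b z by auto
qed

lemma local_inverse:
 assumes "f holomorphic_on UNIV" "deriv f w~=0"
 obtains N g where "open N" "w:N" "inj_on f N" "open (f ` N)" "g holomorphic_on f ` N"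
  "ALL z:N. g (f z)=z"
proof -
 obtain r where r: "r>0" "open (f ` ball w r)" "inj_on f (ball w r)"
  using has_complex_derivative_locally_invertible[OF assms(1) UNIV_I open_UNIV assms(2)] by blast
 have hol: "f holomorphic_on ball w r" using assms(1) holomorphic_on_subset by blast
 show ?thesis
 proof (rule holomorphic_has_inverse[OF hol open_ball r(3)])
  fix g assume "g holomorphic_on f ` ball w r" "!!z. z:ball w r ==> g (f z)=z"
  then show ?thesis using that[of "ball w r" g] r by simp
 qed
qed

lemma tends_to_infinity_iff:
 "filterlim ga at_infinity at_top \<longleftrightarrow> (ALL R. EX T. ALL t>=T. R<cmod (ga t))" for ga :: "real => complex"
 unfolding filterlim_at_infinity_conv_norm_at_top filterlim_at_top_dense eventually_at_top_linorder by blast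

text \<open>The sheets over a small disc are the images of all continuous sections of
  \<open>f\<close> on it. They are open by invariance of domain, and equal or disjoint by unique
  lifting. Surjectivity onto \<open>U\<close> comes from connectedness: the range of
  \<open>f\<close> is clopen in \<open>U\<close>.\<close>

lemma covering_space_of_branches:
 fixes f :: "complex => complex"
 assumes f: "cont UNIV f" and U: "open U" "connected U" and ne: "f -` U~={}"
  and branch: "!!r w. r>0 ==> ball (f w) r<=U ==>
   EX h. cont (ball (f w) r) h & h (f w)=w & (ALL z:ball (f w) r. f (h z)=z)"
 shows "covering_space (f -` U) f U"
proof
 show "cont (f -` U) f" using f cont_sub by blast
 have inj: "EX N. open N & w:N & inj_on f N" if w: "f w:U" for w
 proof -
  obtain r where r: "r>0" "ball (f w) r<=U" using U w openE by blast
  let ?B = "ball (f w) r"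
  obtain h where h: "cont ?B h" "h (f w)=w" "ALL z:?B. f (h z)=z" using branch[OF r] by blast
  have "inj_on h ?B" using h(3) by (intro inj_on_inverseI[of ?B f h]) auto
  then have "open (h ` ?B)" using invariance_of_domain h(1) by blast
  moreover have "inj_on f (h ` ?B)" using h(3) by (auto intro!: inj_onI)
  moreover have "w:h ` ?B" using h(2) r(1) by (intro image_eqI[of _ _ "f w"]) auto
  ultimately show ?thesis by blast
 qed
 have br: "EX r>0. ball x r<=U & (ALL w. f w:ball x r --> (EX h. cont (ball x r) h & h (f w)=w & (ALL z:ball x r. f (h z)=z)))"
  if x: "x:U" for x
 proof -
  obtain e where e: "e>0" "ball x e<=U" using U x openE by blast
  \<comment> \<open>Branches are supplied only on discs centred at an image point
    \<open>f w\<close>. The radius \<open>e/3\<close> leaves room for such a disc that contains the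
    disc around \<open>x\<close> and still lies in \<open>U\<close>.\<close>
  have "EX h. cont (ball x (e/3)) h & h (f w)=w & (ALL z:ball x (e/3). f (h z)=z)" if w: "f w:ball x (e/3)" for w
  proof -
   have s: "ball (f w) (2 * e/3)<=ball x e" "ball x (e/3)<=ball (f w) (2 * e/3)"
    using w by (auto simp: ball_subset_ball_iff dist_commute)
   then have "ball (f w) (2 * e/3)<=U" using e(2) by blast
   then obtain h where "cont (ball (f w) (2 * e/3)) h" "h (f w)=w" "ALL z:ball (f w) (2 * e/3). f (h z)=z"
    using branch[of "2 * e/3" w] e(1) by auto
   then show ?thesis using s(2) cont_sub[OF _ s(2)] by (intro exI[of _ h]) (simp add: subset_iff)
  qed
  moreover have "ball x (e/3)<=ball x e" using e by (intro subset_ball) simp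
  ultimately show ?thesis using e by (intro exI[of _ "e/3"]) auto
 qed
 have "x:range f" if x: "x:U" for x
 proof -
  have "openin (top_of_set U) (U Int range f)"
  proof (subst openin_subopen, clarify)
   fix w assume "f w:U"
   from br[OF this] obtain r where r: "r>0" "ball (f w) r<=U" "f w:ball (f w) r --> (EX h. ALL z:ball (f w) r. f (h z)=z)" by blast
   then obtain h where h: "ALL z:ball (f w) r. f (h z)=z" by auto
   have "z:U Int range f" if "z:ball (f w) r" for z using h r(2) that by (metis IntI rangeI subsetD)
   then show "EX T. openin (top_of_set U) T & f w:T & T<=U Int range f"
    using r by (intro exI[of _ "ball (f w) r"]) (auto simp: open_subset)
  qed
  moreover have "closedin (top_of_set U) (U Int range f)"
   unfolding closedin_limpt
  proof (intro conjI allI impI)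
   fix x assume x: "x islimpt U Int range f & x:U"
   then obtain r where r: "r>0" "ALL w. f w:ball x r --> (EX h. ALL z:ball x r. f (h z)=z)" using br[of x] by blast
   then obtain w where "f w:ball x r" using x unfolding islimpt_approachable by (auto simp: dist_commute)
   then obtain h where "ALL z:ball x r. f (h z)=z" using r(2) by blast
   then show "x:U Int range f" using r(1) x by (metis IntI rangeI centre_in_ball)
  qed auto
  moreover have "U Int range f~={}" using ne by auto
  ultimately show ?thesis using U(2) x unfolding connected_clopen by blast
 qed
 then show "f ` (f -` U)=U" by auto
 fix x assume "x:U"
 then obtain r where r: "r>0" "ball x r<=U" and
  branch: "!!w. f w:ball x r ==> EX h. cont (ball x r) h & h (f w)=w & (ALL z:ball x r. f (h z)=z)" using br[of x] by blast
 let ?T = "ball x r"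
 define v where "v={h ` ?T | h. cont ?T h & (ALL z:?T. f (h z)=z)}"
 have "\<Union>v=f -` U Int f -` ?T"
 proof (intro equalityI subsetI)
  fix w assume "w:\<Union>v"
  then obtain h z where "w=h z" "z:?T" "f (h z)=z" unfolding v_def by auto
  then show "w:f -` U Int f -` ?T" using r(2) by auto
 next
  fix w assume "w:f -` U Int f -` ?T"
  then have fw: "f w:?T" by simp
  then obtain h where h: "cont ?T h" "h (f w)=w" "ALL z:?T. f (h z)=z" using branch by blast
  then show "w:\<Union>v" unfolding v_def using fw by (intro UnionI[of "h ` ?T"]) (auto intro: rev_image_eqI)
 qed
 moreover have "openin (top_of_set (f -` U)) u & (EX q. homeomorphism u ?T f q)" if u: "u:v" for u
 proof -
  obtain h where h: "u=h ` ?T" "cont ?T h" "ALL z:?T. f (h z)=z"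
   using u unfolding v_def by blast
  have "inj_on h ?T" using h(3) by (metis inj_onI)
  then have "open u" using invariance_of_domain h by blast
  moreover have "u<=f -` U" using h r by auto
  moreover have "homeomorphism u ?T f h"
   unfolding homeomorphism_def using f h by (auto simp: image_image intro: cont_sub)
  ultimately show ?thesis by (auto simp: open_subset)
 qed
 moreover have "pairwise disjnt v"
 proof (rule pairwiseI, rule ccontr)
  fix s t assume st: "s:v" "t:v" "s~=t" "~  disjnt s t"
  obtain h k where h: "s=h ` ?T" "cont ?T h" "ALL z:?T. f (h z)=z" and k: "t=k ` ?T" "cont ?T k" "ALL z:?T. f (k z)=z"
   using st unfolding v_def by blast
  obtain a where a: "a:?T" "h a=k a" using h k st(4) unfolding disjnt_def by force
  have "h z=k z" if z: "z:?T" for z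
   by (rule lift_unique_local_inj[of f U ?T h k a z, OF inj _ h(2) k(2) _ _ a z]) (use h k r(2) in auto)
  then show False using h k st by auto
 qed
 ultimately show "EX T. x:T & openin (top_of_set U) T &
    (EX v. \<Union>v=f -` U Int f -` T & (ALL u:v. openin (top_of_set (f -` U)) u) &
      pairwise disjnt v & (ALL u:v. EX q. homeomorphism u T f q))"
  using r by (intro exI[of _ ?T] conjI exI[of _ v]) (auto simp: open_subset)
qed

text \<open>A branch on a maximal disc extends across every boundary point: since the point is not an asymptotic value,
  the branch has a finite limit value along a sequence on the radius, where \<open>f\<close> is locally invertible.\<close>

lemma disc_branch:
 assumes f: "f holomorphic_on UNIV" and U: "open U" and crit: "!!w. f w:U ==> deriv f w~=0"
  and asym: "asymptotic_values f Int U={}" and c: "r>0" "ball (f w) r<=U"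
 shows "EX h. cont (ball (f w) r) h & h (f w)=w & (ALL z:ball (f w) r. f (h z)=z)"
proof -
 define b where "b=f w"
 define P where "P ro h \<longleftrightarrow> cont (ball b ro) h & h b=w & (ALL z:ball b ro. f (h z)=z)" for ro h
 have inj: "EX N. open N & w:N & inj_on f N" if "f w:U" for w using local_inverse[OF f crit[OF that]] by metis
 have loc: "EX N g e. open N & q:N & e>0 & ball (f q) e<=U & cont (ball (f q) e) g & (ALL z:ball (f q) e. f (g z)=z) & (ALL z:N. g (f z)=z)"
  if q: "f q:U" for q
 proof -
  obtain N g where N: "open N" "q:N" "inj_on f N" "open (f ` N)" "g holomorphic_on f ` N" "ALL z:N. g (f z)=z"
   using local_inverse[OF f crit[OF q]] by blast
  have "open (f ` N Int U)" "f q:f ` N Int U" using N U q by auto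
  then obtain e where e: "e>0" "ball (f q) e<=f ` N Int U" using openE by blast
  have "f (g z)=z" if "z:ball (f q) e" for z
  proof -
   have "z:f ` N" using e(2) that by blast
   then show ?thesis using N(6) by auto
  qed
  moreover have "cont (ball (f q) e) g" using e(2) N(5) by (meson cont_sub holo_cont le_inf_iff)
  ultimately show ?thesis using N e by (intro exI[of _ N] exI[of _ g] exI[of _ e]) auto
 qed
 have uniq: "h z=k z" if "convex T" "T<=U" "cont T h" "cont T k" "ALL z:T. f (h z)=z & f (k z)=z" "a:T" "h a=k a" "z:T" for T h k a z
  by (rule lift_unique_local_inj[of f U T h k a z, OF inj convex_connected]) (use that in auto)
 have Pdown: "P ro h" if "P ro' h" "ro<=ro'" for ro ro' h
  using that subset_ball[OF that(2), of b] cont_sub unfolding P_def by blast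
 have BU: "ball b ro<=U" if "ro<=r" for ro using c(2) subset_ball[OF that, of b] unfolding b_def by blast
 have Puniq: "h z=k z" if "P ro h" "P ro' k" "ro<=r" "ro'<=r" "z:ball b ro" "z:ball b ro'" for h k ro ro' z
 proof (rule uniq[of "ball b (min ro ro')" h k b])
  have "P (min ro ro') h" "P (min ro ro') k" using Pdown that(1,2) by auto
  then show "cont (ball b (min ro ro')) h" "cont (ball b (min ro ro')) k" "h b=k b"
   "ALL z:ball b (min ro ro'). f (h z)=z & f (k z)=z" unfolding P_def by auto
  show "b:ball b (min ro ro')" using that(5,6) le_less_trans[OF zero_le_dist] by (auto simp: min_def)
 qed (use that BU[of "min ro ro'"] in auto)
 define S where "S={ro. 0<ro & ro<=r & (EX h. P ro h)}"
 have "EX ro. ro:S"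
 proof -
  obtain N g e where g: "w:N" "e>0" "cont (ball b e) g" "ALL z:ball b e. f (g z)=z" "ALL z:N. g (f z)=z"
   using loc[of w] c unfolding b_def by (metis centre_in_ball subsetD)
  then have "P e g" unfolding P_def b_def by blast
  then have "min e r:S" using g(2) c(1) Pdown[of e g "min e r"] unfolding S_def by auto
  then show ?thesis by blast
 qed
 then obtain ro0 where ro0: "ro0:S" by blast
 \<comment> \<open>Branches through \<open>w\<close> on concentric discs are unique, so those on
   smaller discs glue to one on the open disc of the supremal radius \<open>s\<close>. It remains to
   exclude \<open>s<r\<close>.\<close>
 define s where "s=Sup S"
 have sle: "ro<=s" if "ro:S" for ro using that unfolding s_def by (rule cSup_upper) (auto simp: S_def intro: bdd_aboveI[of _ r])
 have s: "s<=r" "s>0" unfolding s_def using ro0 sle[OF ro0] by (auto simp: S_def s_def intro: cSup_least)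
 have "EX h. P ro h" if "ro<s" for ro
 proof -
  obtain ro' where ro': "ro':S" "ro<ro'" using less_cSupD[of S ro] ro0 \<open>ro<s\<close> unfolding s_def by blast
  then obtain h where "P ro' h" unfolding S_def by blast
  then show ?thesis using Pdown[of ro' h ro] ro'(2) by auto
 qed
 then obtain F where F: "P ro (F ro)" if "ro<s" for ro by metis
 define h where "h z=F ((dist b z + s)/2) z" for z
 have hF: "h z=F ro z" if "z:ball b ro" "ro<s" for ro z
  unfolding h_def using that s by (intro Puniq[OF F F, of _ ro]) auto
 have h: "P s h" unfolding P_def
 proof (intro conjI ballI)
  have "cont (UN ro:{..<s}. ball b ro) h"
  proof (rule continuous_on_open_UN)
   show "cont (ball b ro) h" if "ro:{..<s}" for ro using F[of ro] that hF unfolding P_def by (auto cong: continuous_on_cong_simp)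
  qed auto
  moreover have "z:(UN ro:{..<s}. ball b ro)" if "z:ball b s" for z using that by (intro UN_I[of "(dist b z + s)/2"]) auto
  ultimately show "cont (ball b s) h" by (meson cont_sub subsetI)
  show "h b=w" using F[of "s/2"] hF[of b "s/2"] s unfolding P_def by auto
  show "f (h z)=z" if "z:ball b s" for z
   using F[of "(dist b z + s)/2"] that unfolding P_def h_def by auto
 qed
 define Q where "Q T k \<longleftrightarrow> T<=U & cont T k & (ALL z:T. f (k z)=z) & (ALL z:T Int ball b s. k z=h z)" for T k
 have "s=r"
 proof (rule ccontr)
  assume "s~=r"
  then have s1: "s<r" using s by simp
  have ext: "EX ep k. ep>0 & Q (ball e ep) k" if e: "e:cball b s" for e
  proof -
   have eU: "e:U" using BU[of r] e s1 by auto
   define p where "p t=b + of_real t * (e-b)" for t :: real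
   have pB: "p t:ball b s" if t: "0<=t" "t<1" for t
   proof -
    have "t * cmod (e-b)<=t * s" using e t by (intro mult_left_mono) (auto simp: dist_norm norm_minus_commute)
    also have "... < s" using t s by simp
    finally show ?thesis using t by (simp add: p_def dist_norm norm_mult)
   qed
   have p1: "p 1=e" and contp: "isCont p t" "cont A p" for t A by (auto simp: p_def[abs_def] intro!: continuous_intros)
   have "EX M. ALL t0<1. EX t>=t0. 0<=t & t<1 & cmod (h (p t))<=M"
   proof (rule ccontr)
    assume "~  ?thesis"
    then have far: "EX t0<1. ALL t>=t0. 0<=t --> t<1 --> M<cmod (h (p t))" for M by (meson not_le)
    define th where "th x=x/(1 + x)" for x :: real
    have th: "0<=th x & th x<1" if "x>=0" for x using that by (simp add: th_def field_simps)
    have lim1: "(th \<longlongrightarrow> 1) at_top" unfolding th_def by real_asymp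
    define g where "g x=h (p (th x))" for x
    have "cont {0..} th" unfolding th_def by (intro continuous_intros) auto
    then have c1: "cont {0..} (%x. p (th x))" by (rule cont_comp[OF contp(2) _ subset_UNIV])
    have hc: "cont (ball b s) h" "!!z. z:ball b s ==> f (h z)=z" using h unfolding P_def by auto
    have "cont {0..} g" unfolding g_def by (rule cont_comp[OF hc(1) c1]) (rule image_subsetI, rule pB, use th in auto)
    moreover have "filterlim g at_infinity at_top" unfolding tends_to_infinity_iff
    proof
     fix M :: real
     obtain t0 where t0: "t0<1" "ALL t>=t0. 0<=t --> t<1 --> M<cmod (h (p t))" using far by blast
     have "\<forall>\<^sub>F x in at_top. th x>t0 & x>=0" using order_tendstoD(1)[OF lim1 t0(1)] eventually_ge_at_top by (rule eventually_conj)
     then obtain T where "ALL x>=T. th x>t0 & x>=0" unfolding eventually_at_top_linorder by blast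
     then show "EX T. ALL x>=T. M<cmod (g x)" using t0(2) th unfolding g_def by (meson less_imp_le)
    qed
    moreover have "((f o g) \<longlongrightarrow> e) at_top"
    proof (rule Lim_transform_eventually)
     show "((%x. p (th x)) \<longlongrightarrow> e) at_top" using isCont_tendsto_compose[OF contp(1) lim1] p1 by simp
     show "\<forall>\<^sub>F x in at_top. p (th x)=(f o g) x" using eventually_ge_at_top[of 0]
      by eventually_elim (use hc(2)[OF pB] th in "simp add: g_def")
    qed
    ultimately have "e:asymptotic_values f" unfolding asymptotic_values_def by blast
    then show False using asym eU by (simp add: disjoint_iff)
   qed
   then obtain M where M: "ALL t0<1. EX t>=t0. 0<=t & t<1 & cmod (h (p t))<=M" by (rule exE)
   have "EX t. 1-1/Suc n<=t & 0<=t & t<1 & cmod (h (p t))<=M" for n :: nat by (rule M[rule_format, simplified conj_assoc]) simp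
   from choice[OF allI[OF this]] obtain t where t: "ALL n. 1-1/Suc n<=t n & 0<=t n & t n<1 & cmod (h (p (t n)))<=M" by (rule exE)
   have "(%n. 1-1/real (Suc n)) \<longlonglongrightarrow> 1" by real_asymp
   then have "t \<longlonglongrightarrow> 1" by (intro tendsto_sandwich[of "%n. 1-1/real (Suc n)" t sequentially "%n. 1"]) (use t in "auto intro!: always_eventually less_imp_le")
   from isCont_tendsto_compose[OF contp(1) this] have pt: "(%n. p (t n)) \<longlonglongrightarrow> e" unfolding p1 .
   have "bounded (range (%n. h (p (t n))))" unfolding bounded_iff using t by auto
   from bounded_imp_convergent_subsequence[OF this]
   obtain q sy where q: "strict_mono (sy :: nat => nat)" "((%n. h (p (t n))) o sy) \<longlonglongrightarrow> q" by (elim exE conjE)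
   note pt=LIMSEQ_subseq_LIMSEQ[OF pt q(1)]
   have fh: "f (h (p (t n)))=p (t n)" for n using h pB t unfolding P_def by blast
   have "isCont f q" using f by (metis UNIV_I continuous_on_eq_continuous_at holo_cont open_UNIV)
   from isCont_tendsto_compose[OF this q(2)] have fq: "f q=e" using pt LIMSEQ_unique by (simp add: o_def fh)
   then obtain N g ep where g: "open N" "q:N" "ep>0" "ball e ep<=U" "cont (ball e ep) g" "ALL z:ball e ep. f (g z)=z" "ALL z:N. g (f z)=z"
    using loc[of q] eU by auto
   have "\<forall>\<^sub>F n in sequentially. h (p (t (sy n))):N" "\<forall>\<^sub>F n in sequentially. p (t (sy n)):ball e ep"
    using topological_tendstoD[OF q(2) g(1,2)] topological_tendstoD[OF pt open_ball, of e ep] g(3) by (simp_all add: o_def)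
   then obtain n where n: "h (p (t (sy n))):N" "p (t (sy n)):ball e ep"
    using eventually_happens'[OF trivial_limit_sequentially eventually_conj] by blast
   define a where "a=p (t (sy n))"
   have a: "h a=g a" "a:ball e ep Int ball b s" using g(7) n fh pB t unfolding a_def by (metis, blast)
   have "g z=h z" if z: "z:ball e ep Int ball b s" for z
    by (rule uniq[of "ball e ep Int ball b s" g h a]) (use z a g h in "auto simp: P_def intro: convex_Int cont_sub simp del: mem_ball")
   then show ?thesis using g(3-6) unfolding Q_def by blast
  qed
  have "EX de>0. ALL x:cball b s. EX k. Q (ball x de) k"
  proof -
   have "cball b s<=\<Union>{T. open T & (EX k. Q T k)}" using ext by (force intro: centre_in_ball[THEN iffD2])
   from Heine_Borel_lemma[OF compact_cball this] obtain de where de: "0<de" "!!x. x:cball b s ==> EX G:{T. open T & (EX k. Q T k)}. ball x de<=G" by auto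
   have "EX k. Q (ball x de) k" if x: "x:cball b s" for x
   proof -
    obtain G k where G: "ball x de<=G" "Q G k" using de(2)[OF x] by blast
    then have "Q (ball x de) k" unfolding Q_def by (meson IntD1 IntD2 IntI cont_sub order_trans subsetD)
    then show ?thesis by blast
   qed
   then show ?thesis using de(1) by blast
  qed
  then obtain de k where de: "de>0" and k: "!!x. x:cball b s ==> Q (ball x de) (k x)" by metis
  \<comment> \<open>The radial retraction onto the closed disc decides which local extension is used
    at a point of the larger disc. Extensions for nearby centres agree, because their common domain
    meets the open disc of radius \<open>s\<close>, where both equal \<open>h\<close>.\<close>
  define \<pi> where "\<pi> z=b + of_real (s/max s (dist b z))*(z-b)" for z
  have \<pi>c: "cont A \<pi>" for A unfolding \<pi>_def using s by (intro continuous_intros) auto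
  have \<pi>: "\<pi> z:cball b s" "dist b z<s + de ==> dist (\<pi> z) z<de" "\<pi> b=b" for z
  proof -
   let ?m = "max s (dist b z)"
   have m: "?m>0" using s by simp
   have "dist b (\<pi> z)=s/?m * dist b z" using s by (simp add: \<pi>_def dist_norm norm_mult norm_divide norm_minus_commute)
   also have "... <= s/?m * ?m" using s m by (intro mult_left_mono) auto
   finally show "\<pi> z:cball b s" using m by simp
   have "z-\<pi> z = of_real (1-s/?m)*(z-b)" by (simp add: \<pi>_def algebra_simps)
   then have "dist (\<pi> z) z=\<bar>1-s/?m\<bar> * dist b z" by (metis dist_norm norm_minus_commute norm_mult norm_of_real)
   also have "\<bar>1-s/?m\<bar>=1-s/?m" using s m by (auto simp: divide_simps)
   finally show "dist (\<pi> z) z<de" if "dist b z<s + de" using that de m s by (cases "dist b z<=s") (auto simp: max_def field_simps)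
   show "\<pi> b=b" by (simp add: \<pi>_def)
  qed
  define g where "g z=k (\<pi> z) z" for z
  have agree: "k x z=k x' z" if x: "x:cball b s" "x':cball b s" "dist x x'<de" and z: "z:ball x de Int ball x' de" for x x' z
  proof -
   have "x:closure (ball b s)" "x:ball x de Int ball x' de" using x s de by (auto simp: dist_commute)
   then obtain a where a: "a:ball b s" "a:ball x de Int ball x' de"
    using open_Int_closure_eq_empty[of "ball x de Int ball x' de" "ball b s"] by blast
   show ?thesis
    by (rule uniq[of "ball x de Int ball x' de" "k x" "k x'" a, OF _ _ _ _ _ a(2) _ z])
     (use k[OF x(1)] k[OF x(2)] a in "auto simp: Q_def intro: convex_Int cont_sub simp del: mem_ball")
  qed
  define V where "V z=ball z (de-dist (\<pi> z) z) Int \<pi> -` ball (\<pi> z) de Int ball b (s + de)" for z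
  have "cont (UN z:ball b (s + de). V z) g"
  proof (rule continuous_on_open_UN)
   fix z assume z: "z:ball b (s + de)"
   show "open (V z)" unfolding V_def by (intro open_Int open_vimage open_ball \<pi>c)
   have V: "y:ball (\<pi> z) de" "g y=k (\<pi> z) y" if y: "y:V z" for y
   proof -
    show b: "y:ball (\<pi> z) de" using dist_triangle[of "\<pi> z" y z] y unfolding V_def by auto
    show "g y=k (\<pi> z) y" unfolding g_def
     using agree[OF \<pi>(1) \<pi>(1), of y z y] b y \<pi>(2)[of y] unfolding V_def by (simp add: dist_commute)
   qed
   have "cont (V z) (k (\<pi> z))" using k[OF \<pi>(1), of z] V(1) unfolding Q_def by (meson cont_sub subsetI)
   then show "cont (V z) g" by (rule continuous_on_eq) (simp add: V(2))
  qed
  moreover have "z:V z" if "z:ball b (s + de)" for z using \<pi>(2)[of z] de that by (simp add: V_def)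
  then have "ball b (s + de)<=(UN z:ball b (s + de). V z)" by (rule_tac subsetI) (rule UN_I)
  ultimately have "cont (ball b (s + de)) g" by (rule cont_sub)
  moreover have "g b=w"
   using k[OF \<pi>(1), of b] \<pi>(3) h s de unfolding g_def Q_def P_def by auto
  moreover have "f (g z)=z" if "z:ball b (s + de)" for z using k[OF \<pi>(1), of z] \<pi>(2)[of z] that unfolding g_def Q_def by auto
  ultimately have "P (s + de) g" unfolding P_def by blast
  then have "min r (s + de):S" using Pdown[of "s + de" g "min r (s + de)"] c(1) s de unfolding S_def by auto
  then show False using sle[of "min r (s + de)"] s1 de by auto
 qed
 then show ?thesis using h by (auto simp: P_def b_def)
qed

section \<open>The setting of an expanding map, and its iterates\<close>

text \<open>Preimages of compact sets are compact, and a proper entire map is a polynomial. This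
  converts transcendence into contradictions, for iterates and for inverse branches near
  infinity.\<close>

lemma polynomial_of_tends_to_infinity:
 assumes f: "f holomorphic_on UNIV" and inf: "!!B. EX R. ALL z. R<cmod z --> B<cmod (f z)"
 shows "EX p. ALL z. f z=poly p z"
proof -
 have cont: "cont UNIV f" using f holo_cont by blast
 have "compact {z. f z:k}" if k: "compact k" for k
 proof -
  have "closed (f -` k)" using closed_vimage[OF compact_imp_closed[OF k] cont] .
  moreover have "bounded (f -` k)"
  proof -
   obtain B where B: "!!w. w:k ==> cmod w<=B" using compact_imp_bounded[OF k] bounded_iff by metis
   obtain R where R: "!!z. R<cmod z ==> B<cmod (f z)" using inf by blast
   have "cmod z<=R" if "z:f -` k" for z using R[of z] B[of "f z"] that by fastforce
   then show ?thesis using bounded_iff by blast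
  qed
  ultimately show ?thesis by (simp add: compact_eq_bounded_closed vimage_def)
 qed
 then obtain c n where "f=(%z. \<Sum>i\<le>n. c i * z ^ i)" using proper_map_polyfun_eq[OF f] by blast
 then have "f z=poly (\<Sum>i\<le>n. monom (c i) i) z" for z by (simp add: poly_sum poly_monom)
 then show ?thesis by blast
qed

text \<open>A continuous section is injective, so its image is open by invariance of domain;
  \<open>F\<close> is injective on that image, and the section is its holomorphic inverse.\<close>

lemma holomorphic_right_inverse:
 assumes T: "open T" and h: "cont T h" and F: "F holomorphic_on UNIV"
  and inv: "!!z. z:T ==> F (h z)=z"
 shows "h holomorphic_on T"
proof -
 have "inj_on h T" using inv by (metis inj_onI)
 then have op: "open (h ` T)" using invariance_of_domain h T by blast
 have inj: "inj_on F (h ` T)" using inv by (auto intro!: inj_onI)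
 have "F holomorphic_on h ` T" using F holomorphic_on_subset by blast
 then obtain g where g: "g holomorphic_on F ` h ` T" "!!w. w:h ` T ==> g (F w)=w"
  using holomorphic_has_inverse[OF _ op inj] by metis
 have "F ` h ` T=T" using inv by force
 moreover have "g z=h z" if "z:T" for z using g(2)[of "h z"] inv that by auto
 ultimately show ?thesis using g(1) holomorphic_transform by metis
qed

text \<open>The assumptions are chosen to survive passing to an iterate, which happens several
  times. \<open>pt\<close> expresses that the preimage of \<open>U\<close> is a proper subset, and
  \<open>cov\<close> is the form in which the absence of singular values in \<open>U\<close> is
  remembered.\<close>

locale expansion =
 fixes f :: "complex => complex" and U :: "complex set" and R0 :: real
 assumes holf: "f holomorphic_on UNIV" and notpoly: "~  (EX p. ALL z. f z=poly p z)"
  and openU: "open U" and connU: "connected U" and R0: "R0>0"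
  and bigU: "!!z. R0<cmod z ==> z:U" and sub: "!!z. f z:U ==> z:U"
  and pt: "EX a:U. f a ~: U" and cov: "covering_space (f -` U) f U"
  and fin: "finite (components (- U))"
begin

lemma contf: "cont A f"
 using holf holo_cont cont_sub subset_UNIV by blast

lemma holf_iter: "(f ^^ n) holomorphic_on UNIV"
proof (induction n)
 case (Suc n)
 then have "f o (f ^^ n) holomorphic_on UNIV"
  using holf by (intro holomorphic_on_compose) (auto intro: holomorphic_on_subset)
 then show ?case by (simp add: o_def)
qed (simp add: id_def[abs_def])

lemma contf_iter: "cont A (f ^^ n)"
 using holf_iter holo_cont cont_sub subset_UNIV by blast

lemma sub_iter: "(f ^^ n) z:U ==> z:U"
 by (induction n arbitrary: z) (auto dest: sub simp: funpow_Suc_right simp del: funpow.simps)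

lemma sub_iter_pos:
 assumes "n>0" "(f ^^ n) z:U" shows "f z:U"
proof -
 obtain m where "n=Suc m" using assms gr0_implies_Suc by blast
 then have "(f ^^ m) (f z):U" using assms(2) by (simp add: funpow_Suc_right del: funpow.simps)
 then show ?thesis by (rule sub_iter)
qed

lemma lift_iter:
 fixes g :: "'a::real_normed_vector => complex"
 assumes T: "simply_connected T" "locally path_connected T"
 shows "cont T g ==> g ` T<=U ==> b:T ==> (f ^^ n) w=g b ==>
  EX h. cont T h & h b=w & (ALL z:T. h z:U & (f ^^ n) (h z)=g z)"
proof (induction n arbitrary: g)
 case 0
 then show ?case by (intro exI[of _ g]) auto
next
 case (Suc n)
 have "f ((f ^^ n) w)=g b" using Suc.prems by simp
 then have a: "(f ^^ n) w:f -` U" "g b=f ((f ^^ n) w)" using Suc.prems by auto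
 have "g:T \<rightarrow> U" using Suc.prems(2) by auto
 then have "EX k. cont T k & k:T \<rightarrow> f -` U & k b=(f ^^ n) w & (ALL y:T. f (k y)=g y)"
  by (rule covering_space_lift_strong[OF cov a(1) Suc.prems(3) T Suc.prems(1) _ a(2)]) blast
 then obtain k where k: "cont T k" "k:T \<rightarrow> f -` U" "k b=(f ^^ n) w" "ALL y:T. f (k y)=g y"
  by blast
 have "k ` T<=U" using k(2) sub by blast
 from Suc.IH[OF k(1) this Suc.prems(3) k(3)[symmetric]]
 obtain h where h: "cont T h" "h b=w" "ALL z:T. h z:U & (f ^^ n) (h z)=k z" by blast
 have "(f ^^ Suc n) (h z)=g z" if "z:T" for z using h(3) k(4) that by simp
 then show ?case using h by blast
qed

lemma inj_loc: assumes "f w:U" shows "EX N. open N & w:N & inj_on f N"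
proof -
 have "w:f -` U" using assms by simp
 then obtain T u q where T: "w:T" "openin (top_of_set (f -` U)) T" "f w:u"
   "openin (top_of_set U) u" "homeomorphism T u f q"
  by (rule covering_space_local_homeomorphism[OF cov])
 have "open (f -` U)" using open_vimage[OF openU] contf by blast
 then have "open T" using T(2) openin_open_trans by blast
 moreover have "inj_on f T" using T(5) unfolding homeomorphism_def by (metis inj_onI)
 ultimately show ?thesis using T(1) by blast
qed

lemma lift_unique:
 fixes h k :: "'a::topological_space => complex"
 assumes T: "connected T" "cont T h" "cont T k" "b:T" "h b=k b" "z:T"
 shows "(!!z. z:T ==> (f ^^ n) (h z)=(f ^^ n) (k z)) ==> (!!z. z:T ==> (f ^^ n) (h z):U) ==> h z=k z"
proof (induction n)
 case 0
 then show ?case using T by simp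
next
 case (Suc n)
 have c: "cont T (%z. (f ^^ n) (h z))" "cont T (%z. (f ^^ n) (k z))"
  using T by (auto intro!: cont_comp[OF contf_iter[of UNIV]])
 have *: "(f ^^ n) (h z)=(f ^^ n) (k z)" if z: "z:T" for z
 proof (rule lift_unique_local_inj[of f U T "%z. (f ^^ n) (h z)" "%z. (f ^^ n) (k z)" b z, OF inj_loc])
  show "f ((f ^^ n) (h z))=f ((f ^^ n) (k z))" "f ((f ^^ n) (h z)):U" if "z:T" for z
   using Suc.prems(1)[OF that] Suc.prems(2)[OF that] by simp_all
  show "(f ^^ n) (h b)=(f ^^ n) (k b)" using T by simp
 qed (use T c z in auto)
 show ?case
 proof (rule Suc.IH[OF *])
  show "(f ^^ n) (h z):U" if "z:T" for z using Suc.prems(2)[OF that] sub by simp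
 qed
qed

lemma branch_iter:
 assumes "ball c r<=U" "(f ^^ n) w:ball c r"
 obtains h where "h holomorphic_on ball c r" "h ((f ^^ n) w)=w"
  "ALL z:ball c r. h z:U & (f ^^ n) (h z)=z"
proof -
 have sc: "simply_connected (ball c r)" "locally path_connected (ball c r)"
  by (auto intro: convex_imp_simply_connected convex_imp_locally_path_connected)
 obtain h where h: "cont (ball c r) h" "h ((f ^^ n) w)=w" "ALL z:ball c r. h z:U & (f ^^ n) (h z)=z"
  using lift_iter[OF sc, of "%z. z" "(f ^^ n) w" n w] assms by auto
 have "h holomorphic_on ball c r"
  using holomorphic_right_inverse[OF open_ball h(1) holf_iter] h(3) by blast
 then show ?thesis using h that by blast
qed

lemma surj: assumes "z:U" shows "EX w. f w=z"
proof -
 have "z:f ` (f -` U)" using covering_space_imp_surjective[OF cov] assms by simp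
 then show ?thesis by auto
qed

lemma beyond_R0: "x>R0 ==> of_real x:U"
 using R0 by (intro bigU) simp

lemma surj_iter: "z:U ==> EX w. (f ^^ n) w=z"
proof (induction n arbitrary: z)
 case (Suc n)
 obtain w where "f w=z" using surj Suc.prems by blast
 then have "w:U" using sub Suc.prems by blast
 then obtain v where "(f ^^ n) v=w" using Suc.IH by blast
 then show ?case using \<open>f w=z\<close> by auto
qed simp

text \<open>A nonconstant polynomial \<open>f ^^ q\<close> tends to infinity. Since
  \<open>f ^^ (q-1)\<close> is bounded on discs, \<open>f\<close> itself must then tend to infinity,
  so it would be a polynomial. A constant is impossible because iterates take every value in
  \<open>U\<close>.\<close>

lemma notpoly_iter: assumes "q>0" shows "~  (EX p. ALL z. (f ^^ q) z=poly p z)"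
proof
 assume "EX p. ALL z. (f ^^ q) z=poly p z"
 then obtain p where p: "!!z. (f ^^ q) z=poly p z" by blast
 have "degree p>0"
 proof (rule ccontr)
  assume "~  degree p>0"
  then obtain c where "p=[:c:]" using degree_eq_zeroE by blast
  then have c: "(f ^^ q) z=c" for z using p by simp
  have zc: "z=c" if "z:U" for z using surj_iter[OF that, of q] c by auto
  have "of_real (R0+1)=c" by (rule zc, rule beyond_R0) simp
  moreover have "of_real (R0+2)=c" by (rule zc, rule beyond_R0) simp
  ultimately have "(of_real (R0+1) :: complex) = of_real (R0+2)" by (simp only:)
  then show False by (simp only: of_real_eq_iff)
 qed
 then have lim: "filterlim (poly p) at_infinity at_infinity" by (rule filterlim_poly_at_infinity)
 have "EX R. ALL z. R<cmod z --> B<cmod (f z)" for B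
 proof -
  obtain m where m: "q=Suc m" using assms gr0_implies_Suc by blast
  have "compact ((f ^^ m) ` cball 0 B)" by (rule compact_continuous_image[OF contf_iter compact_cball])
  then have "bounded ((f ^^ m) ` cball 0 B)" by (rule compact_imp_bounded)
  then obtain M where "ALL x:(f ^^ m) ` cball 0 B. cmod x<=M" unfolding bounded_iff by blast
  then have M: "cmod ((f ^^ m) w)<=M" if "w:cball 0 B" for w using that by blast
  have "\<forall>\<^sub>F z in at_infinity. M<cmod (poly p z)"
   using lim unfolding filterlim_at_infinity_conv_norm_at_top filterlim_at_top_dense by blast
  then obtain R where R: "!!z. R<=cmod z ==> M<cmod (poly p z)" unfolding eventually_at_infinity by blast
  have "B<cmod (f z)" if "R<cmod z" for z
  proof (rule ccontr)
   assume "~  B<cmod (f z)"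
   then have "cmod ((f ^^ m) (f z))<=M" using M by simp
   moreover have "(f ^^ m) (f z)=poly p z" using p[of z] m by (simp add: funpow_Suc_right del: funpow.simps)
   ultimately show False using R[of z] that by simp
  qed
  then show ?thesis by blast
 qed
 then show False using polynomial_of_tends_to_infinity[OF holf] notpoly by blast
qed

lemma iterate: assumes q: "q>0" shows "expansion (f ^^ q) U R0"
proof
 show "(f ^^ q) holomorphic_on UNIV" by (rule holf_iter)
 show "~  (EX p. ALL z. (f ^^ q) z=poly p z)" by (rule notpoly_iter[OF q])
 show "(f ^^ q) z:U ==> z:U" for z by (rule sub_iter)
 show "EX a:U. (f ^^ q) a ~: U" using pt sub_iter_pos[OF q] by blast
 show "covering_space ((f ^^ q) -` U) (f ^^ q) U"
 proof (rule covering_space_of_branches)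
  have "of_real (R0+1):U" by (rule beyond_R0) simp
  then show "(f ^^ q) -` U~={}" using surj_iter by blast
  show "EX h. cont (ball ((f ^^ q) w) r) h & h ((f ^^ q) w)=w & (ALL z:ball ((f ^^ q) w) r. (f ^^ q) (h z)=z)"
   if "r>0" and c: "ball ((f ^^ q) w) r<=U" for r w
   using branch_iter[OF c, where w=w] holo_cont \<open>r>0\<close> by (metis centre_in_ball)
 qed (rule contf_iter openU connU)+
qed (use openU connU R0 bigU fin in auto)

end

section \<open>Normality of inverse branches, and shrinking of lifted paths\<close>

text \<open>A quantitative Hurwitz theorem. On the sphere \<open>F\<close> keeps at least the
  distance \<open>et/2\<close> from \<open>F z0\<close>, so by the open mapping theorem its image
  contains the disc of that radius about \<open>F z0\<close>, hence a disc about \<open>g z0\<close>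
  that is the same for all \<open>F\<close> close to \<open>g\<close>.\<close>

lemma approx_covers:
 assumes g: "g holomorphic_on S" "open S" "cball z0 s<=S" "s>0"
  and F: "F holomorphic_on S"
  and sph: "!!z. dist z0 z=s ==> 2 * et<=cmod (g z-g z0)" "et>0"
  and close: "!!z. z:cball z0 s ==> cmod (F z-g z)<=et/4"
 shows "ball (g z0) (et/4)<=F ` ball z0 s"
proof -
 have hol: "F holomorphic_on cball z0 s" using F g holomorphic_on_subset by blast
 have nc: "~  F constant_on ball z0 s"
 proof
  assume "F constant_on ball z0 s"
  then obtain k where k: "!!z. z:ball z0 s ==> F z=k" unfolding constant_on_def by blast
  have "F z=k" if "z:cball z0 s" for z
  proof (rule continuous_constant_on_closure[of "ball z0 s" F])
   show "cont (closure (ball z0 s)) F"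
    using holo_cont[OF hol] g(4) by simp
  qed (use k that g(4) in auto)
  moreover have "z0 + of_real s:cball z0 s" "z0:cball z0 s" using g(4) by (auto simp: dist_norm)
  ultimately have "F (z0 + of_real s)=F z0" by simp
  moreover have d: "dist z0 (z0 + of_real s)=s" using g(4) by (simp add: dist_norm)
  have "2 * et<=cmod (g (z0 + of_real s)-g z0)" using sph(1)[OF d] .
  moreover have "cmod (F (z0 + of_real s)-g (z0 + of_real s))<=et/4" "cmod (F z0-g z0)<=et/4"
   using close g(4) d by auto
  ultimately show False
   using norm_triangle_ineq4[of "F z0-g z0" "F (z0 + of_real s)-g (z0 + of_real s)"] sph(2)
   by (simp add: algebra_simps)
 qed
 have "ball (F z0) (et/2)<=F ` ball z0 s"
 proof (rule ball_subset_open_map_image)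
  show "cont (closure (ball z0 s)) F"
   using holo_cont[OF hol] g(4) by simp
  have "F holomorphic_on ball z0 s" using hol holomorphic_on_subset ball_subset_cball by blast
  then have "open (F ` ball z0 s)"
   by (rule open_mapping_thm[of F "ball z0 s"]) (use nc in auto)
  then show "open (F ` interior (ball z0 s))" by simp
  show "et/2<=cmod (F z-F z0)" if "z:frontier (ball z0 s)" for z
  proof -
   have d: "dist z0 z=s" using that g(4) by (simp add: frontier_ball)
   have "2 * et<=cmod (g z-g z0)" using sph(1)[OF d] .
   moreover have "cmod (F z-g z)<=et/4" "cmod (F z0-g z0)<=et/4"
    using close g(4) d by auto
   moreover have "g z-g z0=(F z-F z0)+((F z0-g z0)-(F z-g z))" by simp
   then have "cmod (g z-g z0)<=cmod (F z-F z0)+(cmod (F z0-g z0) + cmod (F z-g z))"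
    by (metis norm_triangle_ineq norm_triangle_ineq4 order_trans add_left_mono)
   ultimately show ?thesis using sph(2) by linarith
  qed
 qed (use g sph in auto)
 moreover have "ball (g z0) (et/4)<=ball (F z0) (et/2)"
 proof
  fix w assume w: "w:ball (g z0) (et/4)"
  have "dist (F z0) (g z0)<=et/4" using close[of z0] g(4) by (simp add: dist_norm)
  then show "w:ball (F z0) (et/2)" using w dist_triangle[of "F z0" w "g z0"] by simp
 qed
 ultimately show ?thesis by blast
qed

context expansion
begin

definition branch :: "nat => complex => real => (complex => complex) => bool" where
 "branch n c r h \<longleftrightarrow> h holomorphic_on ball c r & (ALL z:ball c r. (f ^^ n) (h z)=z)"

lemma branch_subset: "branch n c r h ==> ball c' r'<=ball c r ==> branch n c' r' h"
 unfolding branch_def using holomorphic_on_subset by blast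

text \<open>For \<open>n>=1\<close> the values of a branch and their images under \<open>f\<close>
  lie in \<open>U\<close>. Hence it omits \<open>f a\<close>, which is outside \<open>U\<close>, and
  \<open>a\<close>, whose image is. Schottky's theorem for functions omitting two values then
  spreads a bound at one point over a disc.\<close>

lemma branch_bound:
 "EX M. ALL n c r h. n>=1 --> 0<r --> ball c (4 * r)<=U --> branch n c (4 * r) h -->
  (EX z:cball c r. cmod (h z)<=R1) --> (ALL z:cball c r. cmod (h z)<=M)"
proof -
 obtain a where a: "a:U" "f a ~: U" using pt by blast
 define p where "p=f a"
 have ap: "a-p~=0" using a p_def by auto
 define ro where "ro=(R1 + cmod p)/cmod (a-p)"
 define E where "E=exp (pi * exp (pi * (2+2 * ro+12*(4/5)/(1-4/5))))"
 show ?thesis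
 proof (intro exI[of _ "cmod p + cmod (a-p) * E"] allI impI ballI)
  fix n c r h z
  assume n: "n>=(1::nat)" and r: "(0::real)<r" and U: "ball c (4 * r)<=U" and h: "branch n c (4 * r) h"
   and ex: "EX z:cball c r. cmod (h z)<=R1" and z: "z:cball c r"
  obtain z1 where z1: "z1:cball c r" "cmod (h z1)<=R1" using ex by blast
  define ph where "ph ze=z1 + of_real (5/2 * r) * ze" for ze :: complex
  have ph: "ph ze:ball c (4 * r)" if "ze:cball 0 1" for ze
  proof -
   have "dist z1 (ph ze)=5/2 * r * cmod ze" using r by (simp add: ph_def dist_norm norm_mult)
   also have "... <= 5/2 * r" using that r by (simp add: mult_left_le)
   finally show ?thesis using z1(1) dist_triangle[of c "ph ze" z1] r by simp
  qed
  have omit: "h w~=p & h w~=a" if "w:ball c (4 * r)" for w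
  proof -
   have "(f ^^ n) (h w)=w" using h that unfolding branch_def by blast
   then have "(f ^^ n) (h w):U" using that U by auto
   then show ?thesis using sub_iter[of n "h w"] sub_iter_pos[of n "h w"] n a p_def by auto
  qed
  define g where "g ze=(h (ph ze)-p)/(a-p)" for ze
  have "g holomorphic_on cball 0 1"
   unfolding g_def
  proof (intro holomorphic_intros)
   have "(h o ph) holomorphic_on cball 0 1"
   proof (rule holomorphic_on_compose_gen[of ph _ h "ball c (4 * r)"])
    show "ph holomorphic_on cball 0 1" unfolding ph_def by (intro holomorphic_intros)
    show "h holomorphic_on ball c (4 * r)" using h unfolding branch_def by blast
   qed (use ph in auto)
   then show "(%ze. h (ph ze)) holomorphic_on cball 0 1" by (simp add: o_def)
  qed (use ap in auto)
  moreover have "cmod (g 0)<=ro"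
  proof -
   have "cmod (h z1-p)<=R1 + cmod p" using z1(2) norm_triangle_ineq4[of "h z1" p] by linarith
   then show ?thesis using ap by (simp add: g_def ph_def ro_def norm_divide divide_right_mono)
  qed
  moreover have "~  (g ze=0 | g ze=1)" if "ze:cball 0 1" for ze
   using omit[OF ph[OF that]] ap by (auto simp: g_def)
  moreover have "cmod ((z-z1) / of_real (5/2 * r))<=4/5"
  proof -
   have "cmod (z-z1)<=2 * r"
    using z z1(1) dist_triangle[of z z1 c] by (simp add: dist_norm norm_minus_commute)
   then have "cmod (z-z1)/(5/2 * r)<=4/5" using r by (simp add: field_simps)
   moreover have "cmod ((z-z1) / of_real (5/2 * r))=cmod (z-z1)/(5/2 * r)"
    using r by (simp only: norm_divide norm_of_real)
   ultimately show ?thesis by simp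
  qed
  ultimately have "cmod (g ((z-z1) / of_real (5/2 * r)))<=E"
   unfolding E_def by (intro Schottky) auto
  moreover have "ph ((z-z1) / of_real (5/2 * r))=z"
  proof -
   have "of_real (5/2 * r)~=(0::complex)" using r by simp
   then show ?thesis unfolding ph_def by (metis add.commute diff_add_cancel nonzero_mult_div_cancel_left times_divide_eq_right)
  qed
  ultimately have "cmod ((h z-p)/(a-p))<=E" by (simp add: g_def)
  then have "cmod (h z-p)<=cmod (a-p) * E" using ap by (simp add: norm_divide field_simps)
  then show "cmod (h z)<=cmod p + cmod (a-p) * E"
   using norm_triangle_ineq2[of "h z" p] by linarith
 qed
qed

lemma branch_montel:
 assumes r: "0<r" "ball c (8 * r)<=U"
  and h: "!!i::nat. m i>=1 & branch (m i) c (8 * r) (h i) & (EX z:cball c (2 * r). cmod (h i z)<=R1)"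
 obtains g sy where "strict_mono (sy :: nat => nat)" "g holomorphic_on ball c (2 * r)"
  "ALL z:ball c (2 * r). (%i. h (sy i) z) \<longlonglongrightarrow> g z"
  "ALL K. compact K --> K<=ball c (2 * r) --> uniform_limit K (%i. h (sy i)) g sequentially"
proof -
 obtain M where M: "!!n c r h. n>=1 ==> 0<r ==> ball c (4 * r)<=U ==> branch n c (4 * r) h ==>
  (EX z:cball c r. cmod (h z)<=R1) ==> (ALL z:cball c r. cmod (h z)<=M)"
  using branch_bound by blast
 define H where "H={h. h holomorphic_on ball c (2 * r) & (ALL z:ball c (2 * r). cmod (h z)<=M)}"
 have hH: "h i:H" for i
 proof -
  have "ALL z:cball c (2 * r). cmod (h i z)<=M"
   using M[of "m i" "2 * r" c "h i"] h[of i] r by simp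
  moreover have "h i holomorphic_on ball c (2 * r)"
   using h[of i] r(1) unfolding branch_def by (auto elim!: holomorphic_on_subset)
  ultimately show ?thesis unfolding H_def by auto
 qed
 show ?thesis
 proof (rule Montel[of "ball c (2 * r)" H h])
  show "k holomorphic_on ball c (2 * r)" if "k:H" for k using that H_def by blast
  show "EX B. ALL h:H. ALL z:K. cmod (h z)<=B" if "compact K" "K<=ball c (2 * r)" for K
   using that unfolding H_def by (intro exI[of _ M]) blast
  show "range h<=H" using hH by auto
 next
  fix g sy assume g: "g holomorphic_on ball c (2 * r)" "strict_mono (sy :: nat => nat)"
   "!!x. x:ball c (2 * r) ==> (%n. h (sy n) x) \<longlonglongrightarrow> g x"
   "!!K. compact K ==> K<=ball c (2 * r) ==> uniform_limit K (h o sy) g sequentially"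
  have "ALL K. compact K --> K<=ball c (2 * r) --> uniform_limit K (%i. h (sy i)) g sequentially"
   using g(4) by (simp add: o_def)
  then show thesis using that[of sy g] g(1-3) by blast
 qed simp
qed

text \<open>The obstruction to shrinking, introduced only to be refuted in
  \<open>not_near_id\<close>.\<close>

definition near_id :: "complex => bool" where
 "near_id x \<longleftrightarrow> (EX s>0. ball x s<=U & (EX m ka. (ALL i::nat. m i>=1 & branch (m i) x s (ka i)) &
   (ALL z:ball x s. (%i. ka i z) \<longlonglongrightarrow> z)))"

text \<open>The branches near \<open>y\<close> continue to a disc around \<open>x\<close> of
  controlled size and are normal there. Their limit is the identity near \<open>y\<close>, hence on
  the whole smaller disc by analytic continuation.\<close>

lemma near_id_extend:
 assumes r: "0<r" "ball x (8 * r)<=U" and y: "y:ball x r" "near_id y"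
 obtains m h where "ALL i::nat. m i>=1 & branch (m i) x (8 * r) (h i)"
  "ALL z:ball x (2 * r). (%i. h i z) \<longlonglongrightarrow> z"
  "uniform_limit (cball x r) (%i. h i) (%z. z) sequentially"
proof -
 obtain s m ka where s: "s>0" "ball y s<=U" and ka: "!!i::nat. m i>=1" "!!i. branch (m i) y s (ka i)"
  "!!z. z:ball y s ==> (%i. ka i z) \<longlonglongrightarrow> z"
  using y(2) unfolding near_id_def by blast
 define s' where "s'=min s (r-dist x y)"
 have s': "s'>0" "ball y s'<=ball y s" "ball y s'<=ball x r"
  using s(1) y(1) by (auto simp: s'_def subset_eq) (smt (verit) dist_triangle)
 have kay: "(f ^^ m i) (ka i y)=y" for i using ka(2)[of i] s(1) unfolding branch_def by simp
 have "EX h. branch (m i) x (8 * r) h & h y=ka i y" for i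
 proof -
  have "(f ^^ m i) (ka i y):ball x (8 * r)" using y(1) r(1) kay by simp
  then show ?thesis using branch_iter[OF r(2)] kay[of i] unfolding branch_def by metis
 qed
 then obtain h where h: "!!i. branch (m i) x (8 * r) (h i)" "!!i. h i y=ka i y" by metis
 have eq: "h i z=ka i z" if z: "z:ball y s'" for i z
 proof (rule lift_unique[of "ball y s'" "h i" "ka i" y z "m i"])
  have b1: "branch (m i) y s' (h i)" by (rule branch_subset[OF h(1)]) (use s' r in auto)
  have b2: "branch (m i) y s' (ka i)" by (rule branch_subset[OF ka(2)]) (use s' in auto)
  show "cont (ball y s') (h i)" "cont (ball y s') (ka i)"
   using b1 b2 holo_cont unfolding branch_def by blast+
  show "(f ^^ m i) (h i z)=(f ^^ m i) (ka i z)" if "z:ball y s'" for z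
   using b1 b2 that unfolding branch_def by simp
  show "(f ^^ m i) (h i z):U" if "z:ball y s'" for z
   using b1 that s s' unfolding branch_def by auto
 qed (use h z s' in auto)
 have "convergent (%i. h i y)" using ka(3)[of y] s(1) h(2) convergent_def by auto
 then have "Bseq (%i. h i y)" by (rule convergent_imp_Bseq)
 then obtain R1 where "!!i. cmod (h i y)<=R1" unfolding Bseq_def by blast
 then have H: "m i>=1 & branch (m i) x (8 * r) (h i) & (EX z:cball x (2 * r). cmod (h i z)<=R1)" for i
  using ka(1) h(1) y(1) r(1) by (intro conjI bexI[of _ y]) auto
 obtain g sy where g: "strict_mono (sy :: nat => nat)" "g holomorphic_on ball x (2 * r)"
  "ALL z:ball x (2 * r). (%i. h (sy i) z) \<longlonglongrightarrow> g z"
  "ALL K. compact K --> K<=ball x (2 * r) --> uniform_limit K (%i. h (sy i)) g sequentially"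
  by (rule branch_montel[OF r H])
 have gid: "g z=z" if z: "z:ball x (2 * r)" for z
 proof (rule analytic_continuation_open[of "ball y s'" "ball x (2 * r)" g "%z. z"])
  show "g z=z" if z: "z:ball y s'" for z
  proof (rule LIMSEQ_unique)
   show "(%i. h (sy i) z) \<longlonglongrightarrow> g z" using g(3) z s'(3) r(1) by auto
   have "(%i. ka i z) \<longlonglongrightarrow> z" using ka(3) z s'(2) by blast
   from LIMSEQ_subseq_LIMSEQ[OF this g(1)]
   show "(%i. h (sy i) z) \<longlonglongrightarrow> z" using eq[OF z] by (simp add: o_def)
  qed
 qed (use s' r g z in auto)
 show ?thesis
 proof (rule that[of "m o sy" "h o sy"])
  show "ALL i. (m o sy) i>=1 & branch ((m o sy) i) x (8 * r) ((h o sy) i)" using ka(1) h(1) by simp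
  show "ALL z:ball x (2 * r). (%i. (h o sy) i z) \<longlonglongrightarrow> z" using g(3) gid by simp
  have sub2: "cball x r<=ball x (2 * r)" using r(1) by auto
  then have u: "uniform_limit (cball x r) (%i. h (sy i)) g sequentially" using g(4) compact_cball by blast
  have "g z=z" if "z:cball x r" for z using gid sub2 that by blast
  then show "uniform_limit (cball x r) (%i. (h o sy) i) (%z. z) sequentially"
   using u uniform_limit_cong'[of "cball x r" "%i. h (sy i)" "%i. (h o sy) i" g "%z. z" sequentially]
   by (simp add: o_def)
 qed
qed

text \<open>The property is open, and closed in \<open>U\<close> by \<open>near_id_extend\<close>,
  so it would reach the point \<open>a\<close>. A branch close to the identity near \<open>a\<close>
  takes the value \<open>a\<close>, so some positive iterate maps \<open>a\<close> into
  \<open>U\<close>; then \<open>f a\<close> is in \<open>U\<close>, a contradiction.\<close>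

lemma not_near_id: "~  near_id x"
proof
 assume x: "near_id x"
 let ?X = "{x:U. near_id x}"
 have "openin (top_of_set U) ?X"
 proof (subst openin_subopen, intro ballI)
  fix x assume "x:?X"
  then obtain s m ka where s: "s>0" "ball x s<=U" and ka: "!!i::nat. m i>=1" "!!i. branch (m i) x s (ka i)"
   "!!z. z:ball x s ==> (%i. ka i z) \<longlonglongrightarrow> z"
   unfolding near_id_def by blast
  have "near_id y" if y: "y:ball x s" for y
  proof -
   obtain e where e: "e>0" "ball y e<=ball x s" using y openE[OF open_ball] by blast
   have "branch (m i) y e (ka i)" for i by (rule branch_subset[OF ka(2) e(2)])
   then show ?thesis unfolding near_id_def using e s ka
    by (intro exI[of _ e] conjI exI[of _ m] exI[of _ ka]) auto
  qed
  then show "EX T. openin (top_of_set U) T & x:T & T<=?X"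
   using s by (intro exI[of _ "ball x s"]) (auto simp: open_subset)
 qed
 moreover have "closedin (top_of_set U) ?X"
  unfolding closedin_limpt
 proof (intro conjI allI impI)
  fix z assume z: "z islimpt ?X & z:U"
  then obtain e where e: "e>0" "ball z e<=U" using openU openE by blast
  define r where "r=e/8"
  have r: "r>0" "ball z (8 * r)<=U" using e by (auto simp: r_def)
  obtain y where "y:?X" "dist y z<r" using z r(1) islimpt_approachable by blast
  then have y: "y:ball z r" "near_id y" by (auto simp: dist_commute)
  obtain m h where mh: "ALL i::nat. m i>=1 & branch (m i) z (8 * r) (h i)"
   "ALL w:ball z (2 * r). (%i. h i w) \<longlonglongrightarrow> w"
   "uniform_limit (cball z r) (%i. h i) (%w. w) sequentially"
   by (rule near_id_extend[OF r y])
  have sub2: "ball z (2 * r)<=ball z (8 * r)" using r(1) by auto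
  have "branch (m i) z (2 * r) (h i)" for i
   by (rule branch_subset[OF _ sub2]) (use mh(1) in blast)
  then have "ALL i. m i>=1 & branch (m i) z (2 * r) (h i)" using mh(1) by blast
  moreover have "0<2 * r" "ball z (2 * r)<=U" using r sub2 by (simp, blast)
  ultimately have "near_id z" unfolding near_id_def using mh(2) by blast
  then show "z:?X" using z by blast
 qed auto
 moreover have "?X~={}"
 proof -
  obtain s where "s>0" "ball x s<=U" using x unfolding near_id_def by blast
  then have "x:U" by auto
  then show ?thesis using x by blast
 qed
 ultimately have "?X=U" using connU unfolding connected_clopen by blast
 obtain a where a: "a:U" "f a ~: U" using pt by blast
 then have na: "near_id a" using \<open>?X=U\<close> by blast
 obtain e where e: "e>0" "ball a e<=U" using a openU openE by blast
 define r where "r=e/8"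
 have r: "r>0" "ball a (8 * r)<=U" using e by (auto simp: r_def)
 have "a:ball a r" using r(1) by simp
 then obtain m h where mh: "ALL i::nat. m i>=1 & branch (m i) a (8 * r) (h i)"
  "ALL w:ball a (2 * r). (%i. h i w) \<longlonglongrightarrow> w"
  "uniform_limit (cball a r) (%i. h i) (%z. z) sequentially"
  by (rule near_id_extend[OF r _ na])
 have "\<forall>\<^sub>F i in sequentially. ALL z:cball a r. dist (h i z) z<r/8"
  using uniform_limitD[OF mh(3), of "r/8"] r(1) by auto
 then obtain i where i: "ALL z:cball a r. dist (h i z) z<r/8"
  using eventually_happens' trivial_limit_sequentially by blast
 have hol: "h i holomorphic_on ball a (8 * r)" using mh(1) unfolding branch_def by blast
 have "ball a ((r/2)/4)<=h i ` ball a r"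
 proof (rule approx_covers[of "%z. z" "ball a (8 * r)"])
  show "cmod (h i z-z)<=r/2/4" if "z:cball a r" for z
   using i that by (auto simp: dist_norm less_imp_le)
 qed (use r hol in "auto simp: dist_norm norm_minus_commute")
 then have "a:h i ` ball a r" using r(1) by auto
 then obtain z where z: "z:ball a r" "a=h i z" by (rule imageE)
 then have "z:ball a (8 * r)" using r(1) by simp
 then have "(f ^^ m i) a=z" "z:U" using mh(1) z r(2) unfolding branch_def by auto
 moreover have "m i>0" using mh(1) by (simp add: Suc_le_lessD)
 ultimately have "f a:U" using sub_iter_pos[of "m i" a] by simp
 then show False using a by blast
qed

text \<open>Otherwise branches of orders \<open>N i\<close> have a nonconstant limit
  \<open>g\<close>. Applying \<open>f ^^ N i\<close> to the next branch gives a branch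
  \<open>ka i\<close> of order \<open>N (Suc i)-N i\<close>. Consecutive branches are both close to
  \<open>g\<close>, so \<open>ka i\<close> tends to the identity, which \<open>not_near_id\<close>
  forbids.\<close>

lemma shrink_ball:
 assumes r: "0<r" "ball c (8 * r)<=U" and ep: "ep>0"
 shows "EX J. ALL n>=J. ALL h. branch n c (8 * r) h --> (EX z:cball c r. cmod (h z)<=R1) -->
  (ALL z:cball c r. ALL w:cball c r. cmod (h z-h w)<ep)"
proof (rule ccontr)
 assume neg: "~  ?thesis"
 define bad where "bad n h \<longleftrightarrow> n>=1 & branch n c (8 * r) h & (EX z:cball c r. cmod (h z)<=R1) &
  (EX z:cball c r. EX w:cball c r. ep<=cmod (h z-h w))" for n :: nat and h
 have "EX n>=J. EX h. bad n h" for J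
 proof -
  obtain n h where "n>=max 1 J" "branch n c (8 * r) h" "EX z:cball c r. cmod (h z)<=R1"
   "~  (ALL z:cball c r. ALL w:cball c r. cmod (h z-h w)<ep)"
   using neg by blast
  then have "bad n h" "n>=J" unfolding bad_def by (auto simp: not_less)
  then show ?thesis by blast
 qed
 then have "infinite {n. EX h. bad n h}" unfolding infinite_nat_iff_unbounded_le by blast
 from infinite_enumerate[OF this] obtain n :: "nat => nat" where n: "strict_mono n" "ALL i. EX h. bad (n i) h" by auto
 then obtain h where h: "!!i. bad (n i) (h i)" by metis
 have 0: "n i>=1 & branch (n i) c (8 * r) (h i) & (EX z:cball c (2 * r). cmod (h i z)<=R1)" for i
 proof -
  have "cball c r<=cball c (2 * r)" using r by auto
  then show ?thesis using h[of i] unfolding bad_def by blast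
 qed
 obtain g sy where sy: "strict_mono (sy :: nat => nat)" and g: "g holomorphic_on ball c (2 * r)"
  and "ALL z:ball c (2 * r). (%i. h (sy i) z) \<longlonglongrightarrow> g z"
  and ul: "ALL K. compact K --> K<=ball c (2 * r) --> uniform_limit K (%i. h (sy i)) g sequentially"
  by (rule branch_montel[OF r 0])
 define H where "H i=h (sy i)" for i
 define N where "N i=n (sy i)" for i
 have smN: "strict_mono N" using strict_mono_o[OF n(1) sy] by (simp add: N_def[abs_def] o_def)
 have bH: "branch (N i) c (8 * r) (H i)" for i using h[of "sy i"] by (simp add: bad_def H_def N_def)
 have sub2: "cball c r<=ball c (2 * r)" "ball c (2 * r)<=ball c (8 * r)" "ball c r<=ball c (2 * r)" using r by auto
 have holH: "H i holomorphic_on ball c (2 * r)" for i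
  using bH sub2(2) holomorphic_on_subset unfolding branch_def by blast
 have ulc: "\<forall>\<^sub>F i in sequentially. ALL z:K. cmod (H i z-g z)<e"
  if K: "compact K" "K<=ball c (2 * r)" and e: "e>0" for K e
 proof -
  have "uniform_limit K (%i. h (sy i)) g sequentially" using ul K by blast
  from uniform_limitD[OF this e] show ?thesis by (simp add: H_def dist_norm)
 qed
 have nonconst: "EX be:ball c (2 * r). g be~=k" for k
 proof (rule ccontr)
  assume "~  ?thesis"
  then have gk: "g z=k" if "z:cball c r" for z using sub2(1) that by blast
  have "\<forall>\<^sub>F i in sequentially. ALL z:cball c r. cmod (H i z-g z)<ep/2"
   by (rule ulc[OF compact_cball sub2(1)]) (use ep in simp)
  then obtain i where i: "ALL z:cball c r. cmod (H i z-g z)<ep/2"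
   using eventually_happens' trivial_limit_sequentially by blast
  obtain z w where zw: "z:cball c r" "w:cball c r" "ep<=cmod (H i z-H i w)"
   using h[of "sy i"] unfolding bad_def H_def by blast
  have "cmod (H i z-k)<ep/2" "cmod (H i w-k)<ep/2" using i zw gk by auto
  then show False using zw(3) norm_triangle_ineq4[of "H i z-k" "H i w-k"] by simp
 qed
 define ka where "ka i z=(f ^^ N i) (H (Suc i) z)" for i z
 define m where "m i=N (Suc i)-N i" for i
 have mpos: "m i>=1" for i using smN unfolding m_def strict_mono_Suc_iff by (simp add: Suc_le_eq)
 have "branch (m i) c r (ka i)" for i
  unfolding branch_def
 proof
  have "(f ^^ N i) o H (Suc i) holomorphic_on ball c r"
   by (rule holomorphic_on_compose_gen[of _ _ _ UNIV])
    (use holomorphic_on_subset[OF holH sub2(3)] holf_iter in auto)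
  then show "ka i holomorphic_on ball c r" by (simp add: ka_def[abs_def] o_def)
  show "ALL z:ball c r. (f ^^ m i) (ka i z)=z"
  proof
   fix z assume z: "z:ball c r"
   have "N (Suc i)=m i + N i" using mpos[of i] unfolding m_def by simp
   then have "(f ^^ m i) (ka i z)=(f ^^ N (Suc i)) (H (Suc i) z)" by (simp add: ka_def funpow_add)
   moreover have "z:ball c (8 * r)" using z sub2 by blast
   ultimately show "(f ^^ m i) (ka i z)=z" using bH[of "Suc i"] unfolding branch_def by simp
  qed
 qed
 moreover have "(%i. ka i w) \<longlonglongrightarrow> w" if w: "w:ball c r" for w
 proof (rule LIMSEQ_I)
  fix e :: real assume e: "e>0"
  have w2: "w:ball c (2 * r)" using w sub2 by blast
  obtain be where be: "be:ball c (2 * r)" "g be~=g w" using nonconst by blast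
  have hol: "(%z. g z-g w) holomorphic_on ball c (2 * r)" using g by (intro holomorphic_intros)
  have "g w-g w=0" "g be-g w~=0" using be by auto
  then have "EX ro>0. ball w ro<=ball c (2 * r) & (ALL z:ball w ro-{w}. g z-g w~=0)"
   by (rule isolated_zeros[OF hol open_ball connected_ball w2 _ be(1)]) blast
  then obtain ro where ro: "ro>0" "ball w ro<=ball c (2 * r)" "ALL z:ball w ro-{w}. g z-g w~=0"
   by blast
  \<comment> \<open>On the circle of radius \<open>s\<close> about \<open>w\<close> the limit avoids
    the value \<open>g w\<close>, so \<open>approx_covers\<close> finds \<open>H (Suc i) w\<close>
    among the values of \<open>H i\<close> on that disc. Applying \<open>f ^^ N i\<close> shows that
    \<open>ka i w\<close> is within \<open>s\<close> of \<open>w\<close>.\<close>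
  define s where "s=min (ro/2) (e/2)"
  have s: "s>0" "s<e" "s<ro" using ro(1) e by (auto simp: s_def)
  have cs: "cball w s<=ball c (2 * r)" using ro(2) s by (auto simp: subset_eq)
  have "EX et>0. ALL z:sphere w s. 2 * et<=cmod (g z-g w)"
  proof -
   have "cont (sphere w s) (%z. cmod (g z-g w))"
    by (intro continuous_intros cont_sub[OF holo_cont[OF g]])
     (use cs in auto)
   moreover have "sphere w s~={}" using s(1) by simp
   ultimately obtain z0 where z0: "z0:sphere w s" "!!z. z:sphere w s ==> cmod (g z0-g w)<=cmod (g z-g w)"
    using continuous_attains_inf[of "sphere w s"] compact_sphere by blast
   have "g z0-g w~=0" by (rule ro(3)[rule_format]) (use z0(1) s in auto)
   then show ?thesis using z0(2) by (intro exI[of _ "cmod (g z0-g w)/2"]) auto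
  qed
  then obtain et where et: "et>0" "!!z. z:sphere w s ==> 2 * et<=cmod (g z-g w)" by blast
  have "\<forall>\<^sub>F i in sequentially. ALL z:cball w s. cmod (H i z-g z)<et/4"
   by (rule ulc[OF compact_cball cs]) (use et(1) in simp)
  then obtain I where I: "!!i. i>=I ==> ALL z:cball w s. cmod (H i z-g z)<et/4"
   unfolding eventually_sequentially by blast
  have "norm (ka i w-w)<e" if i: "i>=I" for i
  proof -
   have "ball (g w) (et/4)<=H i ` ball w s"
   proof (rule approx_covers[OF g open_ball cs s(1) holH])
    show "2 * et<=cmod (g z-g w)" if "dist w z=s" for z using et(2)[of z] that by simp
    show "cmod (H i z-g z)<=et/4" if "z:cball w s" for z using I[OF i] that by fastforce
   qed (rule et(1))
   moreover have "H (Suc i) w:ball (g w) (et/4)"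
    using I[of "Suc i"] i s(1) by (simp add: dist_norm norm_minus_commute)
   ultimately obtain z where z: "z:ball w s" "H (Suc i) w=H i z" by blast
   then have "z:cball w s" by simp
   then have "z:ball c (8 * r)" using cs sub2 by blast
   then have "ka i w=z" using z(2) bH[of i] unfolding ka_def branch_def by simp
   then show ?thesis using z(1) s by (simp add: dist_norm norm_minus_commute)
  qed
  then show "EX I. ALL i>=I. norm (ka i w-w)<e" by blast
 qed
 moreover have "ball c r<=U" using r sub2 by blast
 ultimately have "near_id c" unfolding near_id_def using r(1) mpos by blast
 then show False using not_near_id by blast
qed

lemma branch_through:
 assumes T: "connected T" "cont T de" "t0:T"
  and im: "ball c r<=U" "!!t. t:T ==> (f ^^ n) (de t):ball c r"
 obtains h where "branch n c r h" "ALL t:T. de t=h ((f ^^ n) (de t))"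
proof -
 obtain h where h: "h holomorphic_on ball c r" "h ((f ^^ n) (de t0))=de t0"
  "ALL z:ball c r. h z:U & (f ^^ n) (h z)=z"
  by (rule branch_iter[OF im(1) im(2)[OF T(3)]])
 have "de t=h ((f ^^ n) (de t))" if t: "t:T" for t
 proof (rule lift_unique[OF T(1,2) _ T(3) _ t, of "%t. h ((f ^^ n) (de t))" n])
  have "cont T (%t. (f ^^ n) (de t))"
   by (rule cont_comp[OF contf_iter[of UNIV] T(2)]) auto
  then show "cont T (%t. h ((f ^^ n) (de t)))"
   by (rule cont_comp[OF holo_cont[OF h(1)]]) (use im in auto)
  show "(f ^^ n) (de z):U" if "z:T" for z using im that by blast
  show "(f ^^ n) (de z)=(f ^^ n) (h ((f ^^ n) (de z)))" if "z:T" for z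
   using im(2)[OF that] h(3) by simp
 qed (simp add: h(2))
 then show ?thesis using that[of h] h unfolding branch_def by blast
qed

text \<open>A family of paths that is uniformly continuous into a compact subset of the domain is covered
  by a bounded chain of balls; \<open>traj\<close> records lifts of members of such a family.\<close>

definition traj :: "complex set => real => real => nat => nat => (real => complex) => real => real => bool" where
 "traj Q r d N n de a b \<longleftrightarrow> a<=b & b-a<=real N * d & cont {a..b} de &
  (ALL t:{a..b}. (f ^^ n) (de t):Q) &
  (ALL s:{a..b}. ALL t:{a..b}. \<bar>s-t\<bar><=d --> cmod ((f ^^ n) (de s)-(f ^^ n) (de t))<=r)"

lemma traj_sub: "traj Q r d N n de a b ==> a<=a' ==> a'<=b' ==> b'<=b ==> b'-a'<=real N' * d ==>
  traj Q r d N' n de a' b'"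
 unfolding traj_def by (auto elim: cont_sub)

text \<open>One radius for all later uses; the largest discs needed around points of
  \<open>Q\<close> have radius \<open>8*(2 * r)\<close>.\<close>

definition good_radius :: "complex set => real => bool" where
 "good_radius Q r \<longleftrightarrow> compact Q & r>0 & (ALL q:Q. ball q (32 * r)<=U)"

lemma good_radius_exists:
 assumes "compact Q" "Q<=U" obtains r where "good_radius Q r"
proof -
 obtain d where d: "d>0" "(UN x:Q. ball x d)<=U"
  using compact_subset_open_imp_ball_epsilon_subset[OF assms(1) openU assms(2)] by blast
 have "good_radius Q (d/32)" unfolding good_radius_def using d assms by auto
 then show ?thesis by (rule that)
qed

lemma traj_bound_step:
 assumes Q: "good_radius Q r"
 shows "EX M. ALL n de a b. n>=1 --> traj Q r d 1 n de a b --> (EX t:{a..b}. cmod (de t)<=R1) -->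
  (ALL t:{a..b}. cmod (de t)<=M)"
proof -
 obtain M where M: "ALL n c r h. n>=1 --> 0<r --> ball c (4 * r)<=U --> branch n c (4 * r) h -->
  (EX z:cball c r. cmod (h z)<=R1) --> (ALL z:cball c r. cmod (h z)<=M)"
  using branch_bound[of R1] by (rule exE)
 have "cmod (de t)<=M" if n: "n>=1" and T: "traj Q r d 1 n de a b" and t0: "t0:{a..b}" "cmod (de t0)<=R1"
  and t: "t:{a..b}" for n de a b t0 t
 proof -
  define c where "c=(f ^^ n) (de t0)"
  have cQ: "c:Q" using T t0 unfolding traj_def c_def by blast
  have r: "r>0" using Q unfolding good_radius_def by blast
  have "ball c (4 * r)<=ball c (32 * r)" using r by auto
  then have cU: "ball c (4 * r)<=U" using Q cQ unfolding good_radius_def by blast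
  have near: "(f ^^ n) (de s):cball c r" if s: "s:{a..b}" for s
  proof -
   have "\<bar>s-t0\<bar><=d" using T s t0 unfolding traj_def by auto
   then have "cmod ((f ^^ n) (de s)-c)<=r" using T s t0 unfolding traj_def c_def by blast
   then show ?thesis by (simp add: dist_norm norm_minus_commute)
  qed
  have "cball c r<=ball c (4 * r)" using r by auto
  then have near4: "(f ^^ n) (de s):ball c (4 * r)" if "s:{a..b}" for s using near[OF that] by blast
  have cd: "cont {a..b} de" using T unfolding traj_def by blast
  obtain h where h: "branch n c (4 * r) h" "ALL t:{a..b}. de t=h ((f ^^ n) (de t))"
   by (rule branch_through[OF connected_Icc cd t0(1) cU near4])
  have "EX z:cball c r. cmod (h z)<=R1" using near[OF t0(1)] h(2) t0 by (intro bexI[of _ "(f ^^ n) (de t0)"]) auto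
  then have "ALL z:cball c r. cmod (h z)<=M" using M n r cU h(1) by blast
  then show ?thesis using near[OF t] h(2) t by metis
 qed
 then show ?thesis by blast
qed

lemma traj_split:
 assumes "traj Q r d (Suc N) n de a b" "d>0"
 obtains m where "a<=m" "m<=b" "traj Q r d N n de a m" "traj Q r d 1 n de m b"
proof -
 have ab: "a<=b" "b-a<=real (Suc N) * d" using assms(1) unfolding traj_def by auto
 define m where "m=max a (b-d)"
 have m: "a<=m" "m<=b" "b-m<=real 1 * d" using ab assms(2) by (auto simp: m_def)
 have "m-a<=real N * d" using ab assms(2) by (auto simp: m_def algebra_simps)
 then have "traj Q r d N n de a m" using traj_sub[OF assms(1)] m by simp
 moreover have "traj Q r d 1 n de m b" using traj_sub[OF assms(1) m(1) m(2) order_refl m(3)] .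
 ultimately show ?thesis using that m by blast
qed

text \<open>Normality bounds one piece from any one of its points, and the bound travels along the
  chain. \<open>M1\<close> and \<open>M2\<close> serve when the given point precedes the last piece,
  \<open>M2\<close> and \<open>M3\<close> when it lies in it.\<close>

lemma traj_bound:
 assumes Q: "good_radius Q r" and d: "d>0"
 shows "EX M. ALL n de a b. n>=1 --> traj Q r d N n de a b --> (EX t:{a..b}. cmod (de t)<=R1) -->
  (ALL t:{a..b}. cmod (de t)<=M)"
proof (induction N arbitrary: R1)
 case 0
 have "cmod (de t)<=R1" if "traj Q r d 0 n de a b" "t0:{a..b}" "cmod (de t0)<=R1" "t:{a..b}" for n de a b t0 t
 proof -
  have "t=t0" using that unfolding traj_def by auto
  then show ?thesis using that by simp
 qed
 then show ?case by blast
next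
 case (Suc N)
 obtain M1 where M1: "ALL n de a b. n>=1 --> traj Q r d N n de a b --> (EX t:{a..b}. cmod (de t)<=R1) -->
  (ALL t:{a..b}. cmod (de t)<=M1)" using Suc.IH[of R1] by (rule exE)
 obtain M2 where M2: "ALL n de a b. n>=1 --> traj Q r d 1 n de a b --> (EX t:{a..b}. cmod (de t)<=max R1 M1) -->
  (ALL t:{a..b}. cmod (de t)<=M2)" using traj_bound_step[OF Q, of d "max R1 M1"] by (rule exE)
 obtain M3 where M3: "ALL n de a b. n>=1 --> traj Q r d N n de a b --> (EX t:{a..b}. cmod (de t)<=max R1 M2) -->
  (ALL t:{a..b}. cmod (de t)<=M3)" using Suc.IH[of "max R1 M2"] by (rule exE)
 have "cmod (de t)<=max (max M1 M2) M3" if n: "n>=1" and T: "traj Q r d (Suc N) n de a b"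
  and t0: "t0:{a..b}" "cmod (de t0)<=R1" and t: "t:{a..b}" for n de a b t0 t
 proof -
  obtain m where m: "a<=m" "m<=b" "traj Q r d N n de a m" "traj Q r d 1 n de m b"
   by (rule traj_split[OF T d])
  show ?thesis
  proof (cases "t0<=m")
   case True
   then have 1: "ALL t:{a..m}. cmod (de t)<=M1" using M1 n m(3) t0 by (metis atLeastAtMost_iff)
   then have "cmod (de m)<=M1" using m by simp
   then have "cmod (de m)<=max R1 M1" by simp
   then have "ALL t:{m..b}. cmod (de t)<=M2" using M2 n m(2,4) by (metis atLeastAtMost_iff order_refl)
   then show ?thesis using 1 t by (cases "t<=m") (auto simp: le_max_iff_disj)
  next
   case False
   have t0m: "t0:{m..b}" "cmod (de t0)<=max R1 M1" using False t0 by auto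
   have 1: "ALL t:{m..b}. cmod (de t)<=M2" using M2 n m(4) t0m by blast
   then have "cmod (de m)<=M2" using m by simp
   then have "cmod (de m)<=max R1 M2" by simp
   then have "ALL t:{a..m}. cmod (de t)<=M3" using M3 n m(1,3) by (metis atLeastAtMost_iff order_refl)
   then show ?thesis using 1 t by (cases "t<=m") (auto simp: le_max_iff_disj)
  qed
 qed
 then show ?case by blast
qed

text \<open>\<open>shrink_ball\<close> gives a threshold for each disc. Compactness of
  \<open>Q\<close> reduces the discs to finitely many centres, and thus to one threshold
  \<open>J0\<close>.\<close>

lemma traj_shrink_step:
 assumes Q: "good_radius Q r" and ep: "ep>0"
 shows "EX J. ALL n>=J. ALL de a b. traj Q r d 1 n de a b --> (EX t:{a..b}. cmod (de t)<=R1) -->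
  (ALL s:{a..b}. ALL t:{a..b}. cmod (de s-de t)<ep)"
proof -
 have r: "r>0" and cQ: "compact Q" using Q unfolding good_radius_def by auto
 have "Q<=(UN q:Q. ball q r)" using r by auto
 then obtain C where C: "C<=Q" "finite C" "Q<=(UN q:C. ball q r)"
  using compactE_image[OF cQ, of Q "%q. ball q r"] by (metis open_ball)
 have "EX J. ALL n>=J. ALL h. branch n c (8*(2 * r)) h --> (EX z:cball c (2 * r). cmod (h z)<=R1) -->
  (ALL z:cball c (2 * r). ALL w:cball c (2 * r). cmod (h z-h w)<ep)" if c: "c:C" for c
 proof (rule shrink_ball)
  have "ball c (8*(2 * r))<=ball c (32 * r)" using r by auto
  then show "ball c (8*(2 * r))<=U" using Q C(1) c unfolding good_radius_def by blast
 qed (use r ep in auto)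
 then obtain J where J: "!!c. c:C ==> ALL n>=J c. ALL h. branch n c (8*(2 * r)) h --> (EX z:cball c (2 * r). cmod (h z)<=R1) -->
  (ALL z:cball c (2 * r). ALL w:cball c (2 * r). cmod (h z-h w)<ep)" by metis
 define J0 where "J0=Max (insert 0 (J ` C))"
 have "cmod (de s-de t)<ep" if n: "n>=J0" and T: "traj Q r d 1 n de a b"
  and t0: "t0:{a..b}" "cmod (de t0)<=R1" and st: "s:{a..b}" "t:{a..b}" for n de a b t0 s t
 proof -
  have "(f ^^ n) (de t0):Q" using T t0 unfolding traj_def by blast
  then obtain c where c: "c:C" "dist c ((f ^^ n) (de t0))<r" using C(3) by auto
  have nJ: "n>=J c" using n c(1) C(2) unfolding J0_def by (simp add: Max_ge_iff)
  have near: "(f ^^ n) (de s):cball c (2 * r)" if s: "s:{a..b}" for s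
  proof -
   have "\<bar>s-t0\<bar><=d" using T s t0 unfolding traj_def by auto
   then have "cmod ((f ^^ n) (de s)-(f ^^ n) (de t0))<=r" using T s t0 unfolding traj_def by blast
   then have "dist ((f ^^ n) (de t0)) ((f ^^ n) (de s))<=r" by (simp add: dist_norm norm_minus_commute)
   then show ?thesis using c(2) dist_triangle[of c "(f ^^ n) (de s)" "(f ^^ n) (de t0)"] by simp
  qed
  have sub2: "cball c (2 * r)<=ball c (8*(2 * r))" "ball c (8*(2 * r))<=ball c (32 * r)" using r by auto
  then have near4: "(f ^^ n) (de s):ball c (8*(2 * r))" if "s:{a..b}" for s using near[OF that] by blast
  have cU: "ball c (8*(2 * r))<=U" using Q C(1) c(1) sub2 unfolding good_radius_def by blast
  have cd: "cont {a..b} de" using T unfolding traj_def by blast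
  obtain h where h: "branch n c (8*(2 * r)) h" "ALL t:{a..b}. de t=h ((f ^^ n) (de t))"
   by (rule branch_through[OF connected_Icc cd t0(1) cU near4])
  have "EX z:cball c (2 * r). cmod (h z)<=R1" using near[OF t0(1)] h(2) t0 by (intro bexI[of _ "(f ^^ n) (de t0)"]) auto
  then have "ALL z:cball c (2 * r). ALL w:cball c (2 * r). cmod (h z-h w)<ep" using J[OF c(1)] nJ h(1) by blast
  then have "cmod (h ((f ^^ n) (de s))-h ((f ^^ n) (de t)))<ep" using near st by blast
  then show ?thesis using h(2) st by metis
 qed
 then show ?thesis by blast
qed

text \<open>The estimate passes through the common point \<open>m\<close> of two consecutive parts;
  the enlarged bound \<open>R1 + ep\<close> allows for the displacement up to
  \<open>m\<close>.\<close>

lemma traj_shrink: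
 assumes Q: "good_radius Q r" and d: "d>0"
 shows "ep>0 ==> EX J. ALL n>=J. ALL de a b. traj Q r d N n de a b --> (EX t:{a..b}. cmod (de t)<=R1) -->
  (ALL s:{a..b}. ALL t:{a..b}. cmod (de s-de t)<ep)"
proof (induction N arbitrary: R1 ep)
 case 0
 have "cmod (de s-de t)<ep" if "traj Q r d 0 n de a b" "s:{a..b}" "t:{a..b}" for n de a b s t
 proof -
  have "s=t" using that unfolding traj_def by auto
  then show ?thesis using 0 by simp
 qed
 then show ?case by blast
next
 case (Suc N)
 obtain J1 where J1: "ALL n>=J1. ALL de a b. traj Q r d N n de a b --> (EX t:{a..b}. cmod (de t)<=R1 + ep) -->
  (ALL s:{a..b}. ALL t:{a..b}. cmod (de s-de t)<ep/2)" using Suc.IH[of "ep/2" "R1 + ep"] Suc.prems by auto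
 obtain J2 where J2: "ALL n>=J2. ALL de a b. traj Q r d 1 n de a b --> (EX t:{a..b}. cmod (de t)<=R1 + ep) -->
  (ALL s:{a..b}. ALL t:{a..b}. cmod (de s-de t)<ep/2)" using traj_shrink_step[OF Q, of "ep/2" d "R1 + ep"] Suc.prems by auto
 have "cmod (de s-de t)<ep" if n: "n>=max J1 J2" and T: "traj Q r d (Suc N) n de a b"
  and t0: "t0:{a..b}" "cmod (de t0)<=R1" and st: "s:{a..b}" "t:{a..b}" for n de a b t0 s t
 proof -
  have n12: "n>=J1" "n>=J2" using n by auto
  obtain m where m: "a<=m" "m<=b" "traj Q r d N n de a m" "traj Q r d 1 n de m b"
   by (rule traj_split[OF T d])
  have mm: "m:{a..m}" "m:{m..b}" using m by auto
  have both: "(ALL s:{a..m}. ALL t:{a..m}. cmod (de s-de t)<ep/2) & (ALL s:{m..b}. ALL t:{m..b}. cmod (de s-de t)<ep/2)"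
  proof (cases "t0<=m")
   case True
   then have t0m: "t0:{a..m}" "cmod (de t0)<=R1 + ep" using t0 Suc.prems by auto
   have 1: "ALL s:{a..m}. ALL t:{a..m}. cmod (de s-de t)<ep/2" using J1 n12 m(3) t0m by blast
   then have "cmod (de m-de t0)<ep/2" using mm t0m by blast
   then have "cmod (de m)<=R1 + ep" using t0(2) norm_triangle_ineq2[of "de m" "de t0"] Suc.prems by linarith
   then show ?thesis using 1 J2 n12 m(4) mm by blast
  next
   case False
   then have t0m: "t0:{m..b}" "cmod (de t0)<=R1 + ep" using t0 Suc.prems by auto
   have 1: "ALL s:{m..b}. ALL t:{m..b}. cmod (de s-de t)<ep/2" using J2 n12 m(4) t0m by blast
   then have "cmod (de m-de t0)<ep/2" using mm t0m by blast
   then have "cmod (de m)<=R1 + ep" using t0(2) norm_triangle_ineq2[of "de m" "de t0"] Suc.prems by linarith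
   then show ?thesis using 1 J1 n12 m(3) mm by blast
  qed
  have 2: "cmod (de u-de m)<ep/2" if "u:{a..b}" for u
  proof (cases "u<=m")
   case True then show ?thesis using both mm that by auto
  next
   case False then show ?thesis using both mm that by auto
  qed
  have "cmod (de s-de t)<=cmod (de s-de m) + cmod (de t-de m)"
   using norm_triangle_ineq4[of "de s-de m" "de t-de m"] by simp
  then show ?thesis using 2[OF st(1)] 2[OF st(2)] by linarith
 qed
 then show ?case by blast
qed

end

section \<open>Logarithms, and landing of a chain of lifts\<close>

lemma continuous_log_convex:
 fixes g :: "'a::euclidean_space => complex"
 assumes "convex S" "cont S g" "!!z. z:S ==> g z~=0"
 shows "EX l. cont S l & (ALL z:S. exp (l z)=g z)"
 by (rule continuous_logarithm_on_contractible[OF assms(2) convex_imp_contractible[OF assms(1)]])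
  (use assms(3) in "auto intro!: exI")

lemma holomorphic_log_convex:
 assumes "convex S" "g holomorphic_on S" "!!z. z:S ==> g z~=0"
 shows "EX l. l holomorphic_on S & (ALL z:S. exp (l z)=g z)"
 by (rule contractible_imp_holomorphic_log[OF assms(2) convex_imp_contractible[OF assms(1)]])
  (use assms(3) in "auto intro!: exI")

text \<open>The difference, divided by \<open>2 pi i\<close>, is continuous with integer values.
  This is the device by which turning is compared throughout.\<close>

lemma continuous_log_diff:
 fixes l l' :: "'a::topological_space => complex"
 assumes "connected S" "cont S l" "cont S l'" "!!z. z:S ==> exp (l z)=exp (l' z)"
  "a:S" "b:S"
 shows "l a-l' a=l b-l' b"
proof -
 have "(%z. (l z-l' z)/(2 * of_real pi * \<i>)) constant_on S"
 proof (rule continuous_discrete_range_constant[OF assms(1)])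
  show "cont S (%z. (l z-l' z)/(2 * of_real pi * \<i>))"
   using assms by (intro continuous_intros) auto
  have int: "EX n::int. (l z-l' z)/(2 * of_real pi * \<i>) = of_int n" if "z:S" for z
  proof -
   have "EX n::int. l z=l' z + of_int (2 * n) * pi * \<i>" using assms(4)[OF that] exp_eq by blast
   then show ?thesis by (auto simp: field_simps)
  qed
  show "EX e>0. ALL y. y:S & (l y-l' y)/(2 * of_real pi * \<i>)~=(l x-l' x)/(2 * of_real pi * \<i>) -->
    e<=norm ((l y-l' y)/(2 * of_real pi * \<i>)-(l x-l' x)/(2 * of_real pi * \<i>))" if x: "x:S" for x
  proof (intro exI[of _ 1] conjI allI impI)
   fix y assume y: "y:S & (l y-l' y)/(2 * of_real pi * \<i>)~=(l x-l' x)/(2 * of_real pi * \<i>)"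
   obtain n m :: int where nm: "(l y-l' y)/(2 * of_real pi * \<i>) = of_int n" "(l x-l' x)/(2 * of_real pi * \<i>) = of_int m"
    using int x y by blast
   then have "n~=m" using y by auto
   then have "1<=\<bar>real_of_int (n-m)\<bar>" by linarith
   then have "1<=norm (of_int (n-m) :: complex)" by (simp only: norm_of_int)
   then show "1<=norm ((l y-l' y)/(2 * of_real pi * \<i>)-(l x-l' x)/(2 * of_real pi * \<i>))"
    unfolding nm by simp
  qed simp
 qed
 then have "(l a-l' a)/(2 * of_real pi * \<i>)=(l b-l' b)/(2 * of_real pi * \<i>)"
  using assms(5,6) unfolding constant_on_def by metis
 then show ?thesis by simp
qed

context expansion
begin

lemma path_traj:
 fixes p :: "real => complex"
 assumes p: "cont {a..b} p" "p ` {a..b}<=U" "a<=b"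
 shows "EX Q r d N. good_radius Q r & d>0 &
  (ALL n de. cont {a..b} de --> (ALL t:{a..b}. (f ^^ n) (de t)=p t) --> traj Q r d N n de a b)"
proof -
 have Q: "compact (p ` {a..b})" by (rule compact_continuous_image[OF p(1)]) simp
 obtain r where r: "good_radius (p ` {a..b}) r" by (rule good_radius_exists[OF Q p(2)])
 then have r0: "r>0" unfolding good_radius_def by blast
 have "uniformly_continuous_on {a..b} p" by (rule compact_uniformly_continuous[OF p(1)]) simp
 then obtain d where d: "d>0" "ALL x:{a..b}. ALL y:{a..b}. dist y x<d --> dist (p y) (p x)<r"
  using r0 unfolding uniformly_continuous_on_def by blast
 obtain N :: nat where N: "(b-a)/(d/2)<=real N" using real_arch_simple by blast
 have "traj (p ` {a..b}) r (d/2) N n de a b"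
  if "cont {a..b} de" "ALL t:{a..b}. (f ^^ n) (de t)=p t" for n de
  unfolding traj_def
 proof (intro conjI ballI impI)
  show "b-a<=real N * (d/2)" using N d(1) by (simp add: field_simps)
  show "cmod ((f ^^ n) (de s)-(f ^^ n) (de t))<=r" if st: "s:{a..b}" "t:{a..b}" "\<bar>s-t\<bar><=d/2" for s t
  proof -
   have "dist t s<d" using st d(1) unfolding dist_real_def by linarith
   then have "dist (p t) (p s)<r" using d(2) st by blast
   then show ?thesis using \<open>ALL t:{a..b}. (f ^^ n) (de t)=p t\<close> st by (simp add: dist_norm norm_minus_commute)
  qed
 qed (use that p in auto)
 then show ?thesis using r d(1) by (intro exI[of _ "p ` {a..b}"] exI[of _ r] exI[of _ "d/2"] exI[of _ N]) auto
qed

lemma path_shrink: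
 fixes p :: "real => complex"
 assumes p: "cont {a..b} p" "p ` {a..b}<=U" "a<=b" and ep: "ep>0"
 shows "EX J. ALL n>=J. ALL de. cont {a..b} de --> (ALL t:{a..b}. (f ^^ n) (de t)=p t) -->
  (EX t:{a..b}. cmod (de t)<=R1) --> (ALL s:{a..b}. ALL t:{a..b}. cmod (de s-de t)<ep)"
proof -
 obtain Q r d N where *: "good_radius Q r" "d>0"
  "ALL n de. cont {a..b} de --> (ALL t:{a..b}. (f ^^ n) (de t)=p t) --> traj Q r d N n de a b"
  using path_traj[OF p] by blast
 obtain J where "ALL n>=J. ALL de a b. traj Q r d N n de a b --> (EX t:{a..b}. cmod (de t)<=R1) -->
  (ALL s:{a..b}. ALL t:{a..b}. cmod (de s-de t)<ep)" using traj_shrink[OF *(1,2) ep, of N R1] by blast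
 then show ?thesis using *(3) by (intro exI[of _ J]) blast
qed

text \<open>Each path lifts its predecessor and starts where that one ends, so the points
  \<open>aa k 0\<close> form a backward orbit whose consecutive members are joined by lifts of
  \<open>aa 0\<close>.\<close>

definition bchain :: "(nat => real => complex) => bool" where
 "bchain aa \<longleftrightarrow> (ALL k. cont {0..1} (aa k)) &
  (ALL k. ALL t:{0..1}. aa k t:U & f (aa (Suc k) t)=aa k t) & (ALL k. aa k 1=aa (Suc k) 0)"

lemma bchain_iter: "bchain aa ==> t:{0..1} ==> (f ^^ n) (aa (n + k) t)=aa k t"
proof (induction n)
 case (Suc n)
 have "(f ^^ Suc n) (aa (Suc n + k) t)=(f ^^ n) (f (aa (Suc (n + k)) t))"
  by (simp add: funpow_Suc_right del: funpow.simps)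
 also have "... = (f ^^ n) (aa (n + k) t)" using Suc.prems unfolding bchain_def by metis
 finally show ?case using Suc by simp
qed simp

lemma bchain_shrink:
 assumes b: "bchain aa" and ep: "ep>0"
 shows "EX J. ALL n>=J. (EX t:{0..1}. cmod (aa n t)<=R1) --> (ALL s:{0..1}. ALL t:{0..1}. cmod (aa n s-aa n t)<ep)"
proof -
 have c: "cont {0..1} (aa n)" for n using b unfolding bchain_def by blast
 have im: "aa 0 ` {0..1}<=U" using b unfolding bchain_def by blast
 have it: "ALL t:{0..1}. (f ^^ n) (aa n t)=aa 0 t" for n using bchain_iter[OF b, of _ n 0] by simp
 obtain J where "ALL n>=J. ALL de. cont {0..1} de --> (ALL t:{0..1}. (f ^^ n) (de t)=aa 0 t) -->
  (EX t:{0..1}. cmod (de t)<=R1) --> (ALL s:{0..1}. ALL t:{0..1}. cmod (de s-de t)<ep)"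
  using path_shrink[OF c im _ ep, of R1] by auto
 then show ?thesis using c it by (intro exI[of _ J]) blast
qed

lemma holomorphic_lift:
 assumes T: "open T" and h: "cont T h" and g: "g holomorphic_on T" "g ` T<=U"
  and eq: "!!z. z:T ==> (f ^^ n) (h z)=g z"
 shows "h holomorphic_on T"
proof -
 have "h field_differentiable at z0" if z0: "z0:T" for z0
 proof -
  obtain r where r: "r>0" "ball (g z0) r<=U" using openU g(2) z0 openE by blast
  have op: "open (g -` ball (g z0) r Int T)"
   using continuous_on_open_vimage[OF T] holo_cont[OF g(1)] open_ball by blast
  then obtain s where s: "s>0" "ball z0 s<=g -` ball (g z0) r Int T"
   using r(1) z0 openE[of _ z0] by (metis Int_iff centre_in_ball vimageI2)
  have "(f ^^ n) (h z0):ball (g z0) r" using eq[OF z0] r(1) by simp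
  then obtain k where k: "k holomorphic_on ball (g z0) r" "k ((f ^^ n) (h z0))=h z0"
   "ALL z:ball (g z0) r. k z:U & (f ^^ n) (k z)=z" by (rule branch_iter[OF r(2)])
  have gh: "g holomorphic_on ball z0 s" using g(1) s(2) holomorphic_on_subset by blast
  have "k o g holomorphic_on ball z0 s"
   by (rule holomorphic_on_compose_gen[OF gh k(1)]) (use s(2) in auto)
  moreover have "h z=(k o g) z" if z: "z:ball z0 s" for z
  proof (rule lift_unique[of "ball z0 s" h "k o g" z0 z n])
   show "cont (ball z0 s) h" using h s(2) cont_sub by blast
   show "cont (ball z0 s) (k o g)" using calculation holo_cont by blast
   show "h z0=(k o g) z0" using k(2) eq[OF z0] by simp
   show "(f ^^ n) (h z)=(f ^^ n) ((k o g) z)" "(f ^^ n) (h z):U" if "z:ball z0 s" for z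
   proof -
    have "z:T" "g z:ball (g z0) r" using that s(2) by auto
    then show "(f ^^ n) (h z)=(f ^^ n) ((k o g) z)" "(f ^^ n) (h z):U"
     using eq[of z] k(3) r(2) by auto
   qed
  qed (use s z in auto)
  ultimately have "h holomorphic_on ball z0 s" using holomorphic_transform by fastforce
  then show ?thesis using s(1) holomorphic_on_imp_differentiable_at by (metis centre_in_ball open_ball)
 qed
 then show ?thesis unfolding holomorphic_on_def using field_differentiable_at_within by blast
qed

text \<open>Meant contrapositively: when the values of \<open>f\<close> tend to infinity, so do the
  arguments.\<close>

lemma bounded_preimage: "EX M. ALL z. cmod z<=B --> cmod (f z)<=M"
proof -
 have "compact (f ` cball 0 B)" by (rule compact_continuous_image[OF contf compact_cball])
 then have "bounded (f ` cball 0 B)" by (rule compact_imp_bounded)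
 then obtain M where "ALL x:f ` cball 0 B. cmod x<=M" unfolding bounded_iff by blast
 then show ?thesis by (intro exI[of _ M]) auto
qed

text \<open>If the logarithmic lift of an inverse branch near infinity were not injective modulo
  \<open>2 \<pi> i\<close>, the branch would be defined on a punctured neighbourhood of infinity and
  the map would have a pole there.\<close>

lemma log_lift_inj:
 assumes Ps: "Ps holomorphic_on {om. L<Re om}" and L: "R0 + cmod k<exp L"
  and eq: "!!om. L<Re om ==> f (k + exp (Ps om))=k + exp om"
  and w: "L<Re om1" "L<Re om2" "exp (Ps om1)=exp (Ps om2)"
 shows "om1 = om2"
proof (rule ccontr)
 assume ne: "om1 ~= om2"
 let ?H = "{om. L<Re om}"
 define G where "G om=k + exp (Ps om)" for om
 have Gf: "f (G om)=k + exp om" if "L<Re om" for om using eq[OF that] by (simp add: G_def)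
 have inU: "k + exp om:U" if "L<Re om" for om
 proof (rule bigU)
  have "cmod (exp om)>R0 + cmod k" using L that by (smt (verit) exp_less_mono norm_exp_eq_Re)
  then show "R0<cmod (k + exp om)" using norm_triangle_ineq2[of "exp om" "- k"] by (simp add: add.commute)
 qed
 have holG: "G holomorphic_on ?H" unfolding G_def by (intro holomorphic_intros Ps)
 have H: "open ?H" "convex ?H" using open_halfspace_Re_gt[of L] convex_halfspace_Re_gt[of L] by (simp_all add: )
 have "EX m>0. ALL om. L<Re om --> G (om+2 * of_nat m * of_real pi * \<i>)=G om"
 proof -
  have "exp om1=exp om2" using Gf[OF w(1)] Gf[OF w(2)] w(3) by (simp add: G_def)
  then obtain n :: int where n: "om1 = om2 + of_int (2 * n) * pi * \<i>" using exp_eq by blast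
  have n0: "n~=0" using n ne by auto
  \<comment> \<open>A coincidence at one point spreads over the half plane, since both sides are
    lifts of the same map.\<close>
  have key: "G (om+2 * of_int j * of_real pi * \<i>)=G om"
   if om: "L<Re om" and a: "L<Re a" "G (a+2 * of_int j * of_real pi * \<i>)=G a" for om a and j :: int
  proof (rule lift_unique[of ?H "%om. G (om+2 * of_int j * of_real pi * \<i>)" G a om 1])
   show "connected ?H" using H(2) convex_connected by blast
   have c: "cont ?H G" using holG holo_cont by blast
   then show "cont ?H G" .
   show "cont ?H (%om. G (om+2 * of_int j * of_real pi * \<i>))"
    by (rule cont_comp[OF c]) (auto intro!: continuous_intros)
   show "(f ^^ 1) (G (z+2 * of_int j * of_real pi * \<i>))=(f ^^ 1) (G z)" if "z:?H" for z
   proof -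
    have "exp (2 * of_int j * of_real pi * \<i>)=(1::complex)"
     using exp_integer_2pi[of "of_int j"] by (simp add: mult.assoc)
    then show ?thesis using that by (simp add: Gf exp_add)
   qed
   show "(f ^^ 1) (G (z+2 * of_int j * of_real pi * \<i>)):U" if "z:?H" for z
    using that by (simp add: Gf inU)
  qed (use om a in auto)
  show ?thesis
  proof (cases "n>0")
   case True
   have "G (om2+2 * of_int n * of_real pi * \<i>)=G om2" using n w(3) by (simp add: G_def)
   from key[OF _ w(2) this] show ?thesis using True by (intro exI[of _ "nat n"]) auto
  next
   case False
   have "om1+2 * of_int (- n) * of_real pi * \<i> = om2" using n by simp
   then have "G (om1+2 * of_int (- n) * of_real pi * \<i>)=G om1" using w(3) by (simp add: G_def)
   from key[OF _ w(1) this] show ?thesis using False n0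
    by (intro exI[of _ "nat (- n)"]) auto
  qed
 qed
 then obtain m where m: "m>0" and per: "!!om. L<Re om ==> G (om+2 * of_nat m * of_real pi * \<i>)=G om" by blast
 have per': "G (om-2 * of_nat m * of_real pi * \<i>)=G om" if "L<Re om" for om
  using per[of "om-2 * of_nat m * of_real pi * \<i>"] that by simp
 have perj: "G (om+2 * of_nat m * of_real pi * \<i> * of_nat j)=G om" if "L<Re om" for om j
  using that
 proof (induction j)
  case (Suc j)
  have "om+2 * of_nat m * of_real pi * \<i> * of_nat (Suc j)=(om+2 * of_nat m * of_real pi * \<i> * of_nat j)+2 * of_nat m * of_real pi * \<i>"
   by (simp add: algebra_simps)
  then have "G (om+2 * of_nat m * of_real pi * \<i> * of_nat (Suc j)) =
    G ((om+2 * of_nat m * of_real pi * \<i> * of_nat j)+2 * of_nat m * of_real pi * \<i>)" by (rule arg_cong)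
  also have "... = G (om+2 * of_nat m * of_real pi * \<i> * of_nat j)"
   by (rule per) (use Suc.prems in simp)
  finally show ?case using Suc by simp
 qed simp
 have same: "G om=G om'" if L1: "L<Re om" and L2: "L<Re om'" and ee: "exp (om / of_nat m)=exp (om' / of_nat m)" for om om'
 proof -
  obtain n :: int where n: "om / of_nat m = om' / of_nat m + of_int (2 * n) * pi * \<i>" using ee exp_eq by blast
  then have e: "om = om'+2 * of_nat m * of_real pi * \<i> * of_int n" using m by (simp add: field_simps)
  show ?thesis
  proof (cases "n>=0")
   case True
   then show ?thesis using perj[OF L2, of "nat n"] e by simp
  next
   case False
   then have "om' = om+2 * of_nat m * of_real pi * \<i> * of_nat (nat (- n))" using e by simp
   then show ?thesis using perj[OF L1, of "nat (- n)"] by metis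
  qed
 qed
 define s where "s=exp (- L/m)"
 have s0: "s>0" by (simp add: s_def)
 have reL: "L<Re (- of_nat m * Ln v)" if "v~=0" "cmod v<s" for v
 proof -
  have "ln (cmod v) < - L/m" using that unfolding s_def by (metis exp_less_cancel_iff exp_ln zero_less_norm_iff)
  then show ?thesis using m that by (simp add: field_simps)
 qed
 \<comment> \<open>In the coordinate \<open>v=exp (- om/m)\<close> the function \<open>G\<close>,
   which has period \<open>2 pi i m\<close>, is single valued near the puncture \<open>0\<close>,
   and \<open>e\<close> is \<open>1/(G-k)\<close> there. It tends to \<open>0\<close> because
   \<open>f\<close> is bounded on bounded sets while \<open>f (G om)\<close> is large.\<close>
 define e where "e v=exp (- Ps (- of_nat m * Ln v))" for v
 have eG: "e v=inverse (G (- of_nat m * Ln v)-k)" for v by (simp add: e_def G_def exp_minus)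
 have "e holomorphic_on ball 0 s-{0}"
 proof -
  have "e field_differentiable at v0" if v0: "v0:ball 0 s-{0}" for v0
  proof -
   define ro where "ro=min (s-cmod v0) (cmod v0)"
   have ro: "ro>0" using v0 by (auto simp: ro_def)
   have B: "v~=0 & cmod v<s & 0<Re (v/v0)" if "v:ball v0 ro" for v
   proof -
    have d: "cmod (v-v0)<ro" using that by (simp add: dist_norm norm_minus_commute)
    then have 1: "cmod v<s" using norm_triangle_ineq2[of v v0] unfolding ro_def by linarith
    have "cmod (v/v0-1)<1"
    proof -
     have "v/v0-1=(v-v0)/v0" using v0 by (simp add: field_simps)
     then show ?thesis using d v0 by (simp add: norm_divide ro_def)
    qed
    then have "0<Re (v/v0)" using abs_Re_le_cmod[of "v/v0-1"] by simp
    moreover from this have "v~=0" by auto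
    ultimately show ?thesis using 1 by blast
   qed
   define l where "l v = - of_nat m * (Ln (v/v0) + Ln v0)" for v
   have expl: "exp (l v / of_nat m)=inverse v" if "v:ball v0 ro" for v
   proof -
    have "l v / of_nat m = - (Ln (v/v0) + Ln v0)" using m by (simp add: l_def)
    then show ?thesis using B[OF that] v0 by (simp add: exp_minus exp_add exp_diff inverse_eq_divide)
   qed
   have Rel: "L<Re (l v)" if "v:ball v0 ro" for v
   proof -
    have "Re (l v)=Re (- of_nat m * Ln v)" using B[OF that] v0 by (simp add: l_def norm_divide ln_div)
    then show ?thesis using reL B[OF that] by auto
   qed
   have "(%v. inverse (G (l v)-k)) holomorphic_on ball v0 ro"
   proof (intro holomorphic_intros)
    have im: "l ` ball v0 ro<=?H" using Rel by blast
    have "l holomorphic_on ball v0 ro" unfolding l_def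
    proof (intro holomorphic_intros)
     show "v/v0 ~: \<real>\<^sub>\<le>\<^sub>0" if "v:ball v0 ro" for v using B[OF that] by (auto simp: complex_nonpos_Reals_iff)
    qed (use v0 in auto)
    then show "(%v. G (l v)) holomorphic_on ball v0 ro"
     using holomorphic_on_compose_gen[OF _ holG im] by (simp add: o_def)
    show "G (l v)-k~=0" for v by (simp add: G_def)
   qed
   moreover have "inverse (G (l v)-k)=e v" if "v:ball v0 ro" for v
   proof -
    have "G (l v)=G (- of_nat m * Ln v)"
    proof (rule same)
     show "L<Re (l v)" by (rule Rel[OF that])
     show "L<Re (- of_nat m * Ln v)" using reL B[OF that] by blast
     have "exp (- of_nat m * Ln v / of_nat m)=inverse v" using B[OF that] m by (simp add: exp_minus)
     then show "exp (l v / of_nat m)=exp (- of_nat m * Ln v / of_nat m)" using expl[OF that] by simp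
    qed
    then show ?thesis by (simp add: eG)
   qed
   ultimately have "e holomorphic_on ball v0 ro" using holomorphic_transform by blast
   then show ?thesis using ro holomorphic_on_imp_differentiable_at by (metis centre_in_ball open_ball)
  qed
  then show ?thesis unfolding holomorphic_on_def using field_differentiable_at_within by blast
 qed
 moreover have fe: "cmod (f (G (- of_nat m * Ln v)))>=inverse (cmod v ^ m)-cmod k" if "v~=0" "cmod v<s" for v
 proof -
  have "exp (- of_nat m * Ln v)=inverse (v ^ m)"
   using that(1) by (simp add: exp_minus exp_of_nat_mult)
  then have "f (G (- of_nat m * Ln v))=k + inverse (v ^ m)" using Gf[OF reL[OF that]] by simp
  then show ?thesis using norm_triangle_ineq2[of "inverse (v ^ m)" "- k"]
   by (simp add: norm_inverse norm_power add.commute)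
 qed
 have small: "EX t>0. ALL v. v~=0 & cmod v<t --> cmod v<s & B<inverse (cmod v ^ m)-cmod k" for B
 proof -
  define t where "t=min (min s 1) (1/(\<bar>B\<bar> + cmod k+1))"
  have pos: "\<bar>B\<bar> + cmod k+1>0" by (smt (verit) norm_ge_zero)
  have t: "t>0" using s0 pos by (auto simp: t_def)
  have "B<inverse (cmod v ^ m)-cmod k" if v: "v~=0" "cmod v<t" for v
  proof -
   have "cmod v ^ m<=cmod v" using v m by (intro power_le_one_iff[THEN iffD2] order_trans[OF power_decreasing[of 1 m "cmod v"]]) (auto simp: t_def)
   then have "cmod v ^ m<1/(\<bar>B\<bar> + cmod k+1)" using v by (auto simp: t_def)
   then have "inverse (1/(\<bar>B\<bar> + cmod k+1))<inverse (cmod v ^ m)"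
    using v by (intro less_imp_inverse_less) auto
   then show ?thesis using pos by simp
  qed
  then show ?thesis using t by (intro exI[of _ t]) (auto simp: t_def)
 qed
 have "e \<midarrow>0\<rightarrow> 0"
 proof (rule LIM_I)
  fix r :: real assume r: "r>0"
  obtain M where M: "ALL z. cmod z<=cmod k+1/r --> cmod (f z)<=M" using bounded_preimage by blast
  obtain t where t: "t>0" "ALL v. v~=0 & cmod v<t --> cmod v<s & M<inverse (cmod v ^ m)-cmod k"
   using small by blast
  have "cmod (e v)<r" if v: "v~=0" "cmod v<t" for v
  proof -
   have "M<cmod (f (G (- of_nat m * Ln v)))" using t(2) fe[of v] v by fastforce
   then have "cmod k+1/r<cmod (G (- of_nat m * Ln v))" using M by (meson not_le)
   then have "1/r<cmod (G (- of_nat m * Ln v)-k)"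
    using norm_triangle_ineq2[of "G (- of_nat m * Ln v)" k] by linarith
   then have "inverse (cmod (G (- of_nat m * Ln v)-k))<inverse (1/r)"
    using r by (intro less_imp_inverse_less) auto
   then show ?thesis using r by (simp add: eG norm_inverse)
  qed
  then show "EX t>0. ALL v. v~=0 & norm (v-0)<t --> norm (e v-0)<r" using t(1) by auto
 qed
 ultimately have hol: "(%v. if v=0 then 0 else e v) holomorphic_on ball 0 s"
  using removable_singularity[of e "ball 0 s" 0 0] by simp
 define e0 where "e0 v=(if v=0 then 0 else e v)" for v
 have e0: "e0 holomorphic_on ball 0 s" using hol by (simp add: e0_def[abs_def])
 have nc: "~  e0 constant_on ball 0 s"
 proof
  assume "e0 constant_on ball 0 s"
  then have "e0 (of_real (s/2))=e0 0" using s0 unfolding constant_on_def by (metis centre_in_ball dist_0_norm half_gt_zero_iff field_sum_of_halves less_add_same_cancel1 mem_ball norm_of_real abs_of_pos)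
  then show False using s0 by (simp add: e0_def e_def)
 qed
 \<comment> \<open>By the open mapping theorem \<open>e0\<close> takes all small values, so
   \<open>G\<close> covers a neighbourhood of infinity. There \<open>f\<close> is large, which would
   make it a polynomial.\<close>
 have "EX R. ALL z. R<cmod z --> B<cmod (f z)" for B
 proof -
  obtain t where t: "t>0" "ALL v. v~=0 & cmod v<t --> cmod v<s & B<inverse (cmod v ^ m)-cmod k"
   using small by blast
  have "open (e0 ` ball 0 (min s t))"
   by (rule open_mapping_thm[OF e0 open_ball connected_ball open_ball _ nc]) auto
  moreover have "0:e0 ` ball 0 (min s t)" using s0 t(1) by (intro image_eqI[of _ _ 0]) (auto simp: e0_def)
  ultimately obtain de where de: "de>0" "ball 0 de<=e0 ` ball 0 (min s t)" using openE by blast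
  have "B<cmod (f z)" if z: "cmod k+1/de<cmod z" for z
  proof -
   have "1/de<cmod (z-k)" using z norm_triangle_ineq2[of z k] by linarith
   then have "inverse (cmod (z-k))<inverse (1/de)" using de(1) by (intro less_imp_inverse_less) auto
   then have "inverse (z-k):ball 0 de" using de(1) by (simp add: norm_inverse)
   then obtain v where v: "v:ball 0 (min s t)" "inverse (z-k)=e0 v" using de(2) by blast
   have zk: "z-k~=0" using \<open>1/de<cmod (z-k)\<close> de(1) by (metis norm_zero not_less_iff_gr_or_eq zero_less_divide_1_iff less_trans)
   then have "v~=0" using v(2) by (auto simp: e0_def)
   then have "inverse (z-k)=inverse (G (- of_nat m * Ln v)-k)" using v(2) by (simp add: e0_def eG)
   then have "z=G (- of_nat m * Ln v)" by simp
   moreover have "cmod v<t" using v(1) by simp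
   ultimately show ?thesis using fe[of v] t(2) \<open>v~=0\<close> by fastforce
  qed
  then show ?thesis by blast
 qed
 then show False using polynomial_of_tends_to_infinity[OF holf] notpoly by blast
qed

text \<open>With a derivative above \<open>1/2\<close> on a disc of radius \<open>100\<close>,
  Bloch's theorem with constant \<open>1/12\<close> puts a disc of radius \<open>4\<close>, larger
  than \<open>pi\<close>, into the image. It contains two points that differ by
  \<open>2 pi i\<close>, against \<open>log_lift_inj\<close>. The margin \<open>100\<close> in the
  hypotheses makes room for that disc.\<close>

lemma log_lift_contracts:
 assumes Ps: "Ps holomorphic_on {om. L<Re om}" and L: "R0 + cmod k<exp L"
  and eq: "!!om. L<Re om ==> f (k + exp (Ps om))=k + exp om"
  and w: "L+100<Re om1" "L+100<Re om2"
 shows "cmod (Ps om1-Ps om2)<=cmod (om1 - om2)/2"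
proof -
 let ?H = "{om. L+100<Re om}"
 have H0: "open {om. L<Re om}" using open_halfspace_Re_gt[of L] by simp
 have der: "cmod (deriv Ps om)<=1/2" if om: "om:?H" for om
 proof (rule ccontr)
  assume "~  ?thesis"
  then have d: "1/2<cmod (deriv Ps om)" by simp
  have sub: "ball om 100<={om. L<Re om}"
  proof
   fix z assume "z:ball om 100"
   then have "cmod (om-z)<100" by (simp add: dist_norm)
   then show "z:{om. L<Re om}" using abs_Re_le_cmod[of "om-z"] om by simp
  qed
  have "Ps holomorphic_on ball om 100" using Ps sub holomorphic_on_subset by blast
  then obtain b where b: "ball b 4<=Ps ` ball om 100"
   by (rule Bloch[of Ps om 100 4]) (use d in auto)
  have "b + of_real pi * \<i>:ball b 4" "b - of_real pi * \<i>:ball b 4"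
   using pi_less_4 by (auto simp: dist_norm norm_mult)
  then obtain z1 z2 where z: "z1:ball om 100" "b + of_real pi * \<i>=Ps z1" "z2:ball om 100" "b - of_real pi * \<i>=Ps z2"
   using b by blast
  have e: "Ps z1=Ps z2+2 * of_real pi * \<i>" unfolding z(2)[symmetric] z(4)[symmetric] by simp
  have ex: "exp (Ps z1)=exp (Ps z2)" unfolding e by (simp add: exp_add)
  have "L<Re z1" "L<Re z2" using z(1,3) sub by auto
  then have "z1=z2" using log_lift_inj[OF Ps L eq _ _ ex] by simp
  then show False using e by simp
 qed
 have conv: "convex ?H" using convex_halfspace_Re_gt[of "L+100"] by simp
 have "norm (Ps om1-Ps om2)<=(1/2) * norm (om1 - om2)"
 proof (rule field_differentiable_bound[OF conv])
  show "(Ps has_field_derivative deriv Ps z) (at z within ?H)" if "z:?H" for z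
   using holomorphic_derivI[OF Ps H0, of z] that by (simp add: has_field_derivative_at_within)
  show "norm (deriv Ps z)<=1/2" if "z:?H" for z using der[OF that] .
 qed (use w in auto)
 then show ?thesis by simp
qed

lemma log_lift_exists:
 assumes L: "R0 + cmod k<exp L" and k: "k ~: U" and w: "f w=k + exp om0" "L<Re om0"
 shows "EX Ps. Ps holomorphic_on {om. L<Re om} & (ALL om. L<Re om --> f (k + exp (Ps om))=k + exp om) &
  k + exp (Ps om0)=w"
proof -
 let ?H = "{om. L<Re om}"
 have conv: "convex ?H" using convex_halfspace_Re_gt[of L] by simp
 have op: "open ?H" using open_halfspace_Re_gt[of L] by simp
 have inU: "k + exp om:U" if "L<Re om" for om
 proof (rule bigU)
  have "cmod (exp om)>R0 + cmod k" using L that by (smt (verit) exp_less_mono norm_exp_eq_Re)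
  then show "R0<cmod (k + exp om)" using norm_triangle_ineq2[of "exp om" "- k"] by (simp add: add.commute)
 qed
 have g: "(%om. k + exp om) holomorphic_on ?H" "(%om. k + exp om) ` ?H<=U"
  using inU by (auto intro!: holomorphic_intros)
 obtain G where G: "cont ?H G" "G om0=w" "ALL z:?H. G z:U & (f ^^ 1) (G z)=k + exp z"
  using lift_iter[OF convex_imp_simply_connected[OF conv] convex_imp_locally_path_connected[OF conv]
   holo_cont[OF g(1)] g(2), of om0 1 w] w by auto
 have "G holomorphic_on ?H"
  by (rule holomorphic_lift[OF op G(1) g, of 1]) (use G(3) in blast)
 then have "(%om. G om-k) holomorphic_on ?H" by (intro holomorphic_intros)
 moreover have "G om-k~=0" if "om:?H" for om using G(3) that k by auto
 ultimately obtain l where l: "l holomorphic_on ?H" "ALL z:?H. exp (l z)=G z-k"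
  using holomorphic_log_convex[OF conv] by blast
 have "k + exp (l z)=G z" if "L<Re z" for z using l(2) that by simp
 then show ?thesis using l(1) G w(2) by (intro exI[of _ l]) auto
qed

text \<open>If the backward orbit escaped, then in a logarithmic coordinate centred at
  \<open>k\<close> every lift would halve the increment \<open>D n\<close> along
  \<open>aa n\<close>. The increments are then summable, so the real parts stay bounded, and so do
  the points.\<close>

lemma bchain_not_escaping:
 assumes b: "bchain aa" shows "~  (ALL B. EX J. ALL n>=J. B<cmod (aa n 0))"
proof
 assume esc: "ALL B. EX J. ALL n>=J. B<cmod (aa n 0)"
 have esc': "EX J. ALL n>=J. ALL t:{0..1}. B<cmod (aa n t)" for B
 proof -
  obtain J1 where J1: "ALL n>=J1. (EX t:{0..1}. cmod (aa n t)<=B) --> (ALL s:{0..1}. ALL t:{0..1}. cmod (aa n s-aa n t)<1)"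
   using bchain_shrink[OF b, of 1 B] by auto
  obtain J2 where J2: "ALL n>=J2. B+1<cmod (aa n 0)" using esc by blast
  have "B<cmod (aa n t)" if n: "n>=max J1 J2" and t: "t:{0..1}" for n t
  proof (rule ccontr)
   assume "~  ?thesis"
   then have "cmod (aa n 0-aa n t)<1" "cmod (aa n t)<=B" using J1 n t by (auto simp: not_less)
   moreover have "B+1<cmod (aa n 0)" using J2 n by auto
   ultimately show False using norm_triangle_ineq2[of "aa n 0" "aa n t"] by linarith
  qed
  then show ?thesis by blast
 qed
 obtain a where a: "a:U" "f a ~: U" using pt by blast
 define k where "k=f a"
 have kU: "k ~: U" using a by (simp add: k_def)
 define L where "L=ln (R0 + cmod k+1)"
 have pos: "R0 + cmod k+1>0" using R0 by (smt (verit) norm_ge_zero)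
 have L: "R0 + cmod k<exp L" using pos by (simp add: L_def)
 obtain J where J: "ALL n>=J. ALL t:{0..1}. exp (L+100) + cmod k<cmod (aa n t)" using esc' by blast
 have far: "exp (L+100)<cmod (aa n t-k)" if "n>=J" "t:{0..1}" for n t
  using J that norm_triangle_ineq2[of "aa n t" k] by fastforce
 have cont: "cont {0..1} (aa n)" for n using b unfolding bchain_def by blast
 have "EX l. cont {0..1} l & (ALL t:{0..1}. exp (l t)=aa n t-k)" for n
 proof (rule continuous_log_convex)
  show "cont {0..1} (%t. aa n t-k)" by (intro continuous_intros cont)
  show "aa n t-k~=0" if "t:{0..1}" for t using b kU that unfolding bchain_def by (metis eq_iff_diff_eq_0)
 qed simp
 then obtain l where l: "!!n. cont {0..1} (l n)" "!!n t. t:{0..1} ==> exp (l n t)=aa n t-k" by metis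
 have Rel: "L+100<Re (l n t)" if "n>=J" "t:{0..1}" for n t
  using far[OF that] l(2)[OF that(2), of n] by (metis exp_less_cancel_iff norm_exp_eq_Re)
 define D where "D n=cmod (l n 1-l n 0)" for n
 have half: "D (Suc n)<=D n/2" if n: "n>=J" for n
 proof -
  have 0: "(0::real):{0..1}" "(1::real):{0..1}" by auto
  have f0: "f (aa (Suc n) t)=k + exp (l n t)" if "t:{0..1}" for t
   using b l(2)[OF that, of n] that unfolding bchain_def by simp
  have "L<Re (l n 0)" using Rel[OF n 0(1)] by simp
  then obtain Ps where Ps: "Ps holomorphic_on {om. L<Re om}" "ALL om. L<Re om --> f (k + exp (Ps om))=k + exp om"
   "k + exp (Ps (l n 0))=aa (Suc n) 0" using log_lift_exists[OF L kU f0[OF 0(1)]] by blast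
  have im: "l n ` {0..1}<={om. L<Re om}" using Rel[OF n] by fastforce
  have cPs: "cont {0..1} (%t. Ps (l n t))"
   by (rule cont_comp[OF holo_cont[OF Ps(1)] l(1) im])
  have same: "k + exp (Ps (l n t))=aa (Suc n) t" if t: "t:{0..1}" for t
  proof (rule lift_unique[of "{0..1}" "%t. k + exp (Ps (l n t))" "aa (Suc n)" 0 t 1])
   show "cont {0..1} (%t. k + exp (Ps (l n t)))" by (intro continuous_intros cPs)
   show "(f ^^ 1) (k + exp (Ps (l n z)))=(f ^^ 1) (aa (Suc n) z)" "(f ^^ 1) (k + exp (Ps (l n z))):U"
    if z: "z:{0..1}" for z
   proof -
    have "L<Re (l n z)" using im z by blast
    then have *: "f (k + exp (Ps (l n z)))=k + exp (l n z)" using Ps(2) by blast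
    then show "(f ^^ 1) (k + exp (Ps (l n z)))=(f ^^ 1) (aa (Suc n) z)" using f0[OF z] by simp
    have "k + exp (l n z)=aa n z" using l(2)[OF z, of n] by simp
    then show "(f ^^ 1) (k + exp (Ps (l n z))):U" using * b z unfolding bchain_def by simp
   qed
  qed (use t cont Ps(3) in auto)
  have "l (Suc n) 1-Ps (l n 1)=l (Suc n) 0-Ps (l n 0)"
  proof (rule continuous_log_diff[OF _ l(1) cPs])
   show "exp (l (Suc n) t)=exp (Ps (l n t))" if "t:{0..1}" for t
    using l(2)[OF that, of "Suc n"] same[OF that] by (metis add_diff_cancel_left')
  qed auto
  then have "l (Suc n) 1-l (Suc n) 0=Ps (l n 1)-Ps (l n 0)" by (simp add: algebra_simps)
  then show ?thesis unfolding D_def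
   using log_lift_contracts[OF Ps(1) L _ Rel[OF n 0(2)] Rel[OF n 0(1)]] Ps(2) by simp
 qed
 have Re0: "Re (l n 0)=ln (cmod (aa n 0-k))" "Re (l n 1)=ln (cmod (aa n 1-k))" for n
  using l(2)[of 0 n] l(2)[of 1 n] by (metis atLeastAtMost_iff ln_exp norm_exp_eq_Re order_refl zero_le_one)+
 have step: "Re (l (Suc n) 0)<=Re (l n 0) + D n" for n
 proof -
  have "Re (l (Suc n) 0)=Re (l n 1)" using b unfolding bchain_def Re0 by simp
  then show ?thesis unfolding D_def using abs_Re_le_cmod[of "l n 1-l n 0"] by simp
 qed
 \<comment> \<open>One step adds at most \<open>D n\<close> to the real part and halves
   \<open>D n\<close>, so this sum cannot increase.\<close>
 have "Re (l (J + i) 0)+2 * D (J + i)<=Re (l J 0)+2 * D J" for i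
 proof (induction i)
  case (Suc i)
  then show ?case using step[of "J + i"] half[of "J + i"] by simp
 qed simp
 then have bd: "Re (l (J + i) 0)<=Re (l J 0)+2 * D J" for i unfolding D_def by (smt (verit) norm_ge_zero)
 obtain J' where J': "ALL n>=J'. exp (Re (l J 0)+2 * D J) + cmod k<cmod (aa n 0)" using esc by blast
 have "exp (Re (l (J + J') 0))=cmod (aa (J + J') 0-k)"
  using l(2)[of 0 "J + J'"] by (metis atLeastAtMost_iff norm_exp_eq_Re order_refl zero_le_one)
 moreover have "exp (Re (l (J + J') 0))<=exp (Re (l J 0)+2 * D J)" using bd by simp
 moreover have "exp (Re (l J 0)+2 * D J) + cmod k<cmod (aa (J + J') 0)" using J' by simp
 ultimately show False using norm_triangle_ineq2[of "aa (J + J') 0" k] by linarith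
qed

lemma fixed_points_isolated:
 assumes "f ze=ze"
 obtains r where "r>0" "ALL z. 0<cmod (z-ze) & cmod (z-ze)<r --> f z~=z"
proof -
 have hol: "(%z. f z-z) holomorphic_on UNIV" using holf by (intro holomorphic_intros)
 obtain be where be: "f be-be~=0"
 proof -
  have "~  (ALL z. f z=poly [:0, 1:] z)" using notpoly by blast
  then show ?thesis using that by auto
 qed
 have "f ze-ze=0" using assms by simp
 then have "EX r>0. ball ze r<=UNIV & (ALL z:ball ze r-{ze}. f z-z~=0)"
  by (rule isolated_zeros[OF hol open_UNIV connected_UNIV UNIV_I _ UNIV_I be]) blast
 then obtain r where r: "r>0" "ALL z:ball ze r-{ze}. f z-z~=0" by blast
 have "f z~=z" if "0<cmod (z-ze)" "cmod (z-ze)<r" for z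
 proof -
  have "z:ball ze r-{ze}" using that by (auto simp: dist_norm norm_minus_commute)
  then show ?thesis using r(2) by force
 qed
 then show ?thesis using that r(1) by blast
qed

text \<open>While the orbit is bounded its steps become small, so every accumulation point is fixed.
  Fixed points are isolated, and an orbit with tiny steps cannot cross an annulus that it no longer
  enters; hence it converges.\<close>

lemma bchain_lands:
 assumes b: "bchain aa"
 obtains ze where "f ze=ze" "ALL ep>0. EX J. ALL n>=J. ALL t:{0..1}. cmod (aa n t-ze)<ep"
proof -
 define x where "x n=aa n 0" for n
 have fx: "f (x (Suc n))=x n" and xs: "x (Suc n)=aa n 1" for n using b unfolding bchain_def x_def by auto
 obtain B where B: "ALL J. EX n>=J. cmod (x n)<=B" using bchain_not_escaping[OF b] unfolding x_def by (meson not_le)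
 have small: "EX J. ALL n>=J. cmod (x n)<=R1 --> (ALL t:{0..1}. cmod (aa n t-x n)<ep)" if e0: "ep>0" for ep R1
 proof -
  obtain J where J: "ALL n>=J. (EX t:{0..1}. cmod (aa n t)<=R1) --> (ALL s:{0..1}. ALL t:{0..1}. cmod (aa n s-aa n t)<ep)"
   using bchain_shrink[OF b e0] by blast
  have "cmod (aa n t-x n)<ep" if "n>=J" "cmod (x n)<=R1" "t:{0..1}" for n t
  proof -
   have "EX t:{0..1}. cmod (aa n t)<=R1" using that unfolding x_def by (intro bexI[of _ 0]) auto
   then show ?thesis using J that unfolding x_def by simp
  qed
  then show ?thesis by blast
 qed
 have acc: "f p=p" if p: "ALL e>0. ALL J. EX n>=J. cmod (x n-p)<e" for p
 proof -
  have "cmod (f p-p)<=e" if e: "e>0" for e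
  proof -
   have "isCont f p" using contf[of UNIV] by (simp add: continuous_on_eq_continuous_at)
   then obtain d where d: "d>0" "ALL y. dist y p<d --> dist (f y) (f p)<e/2"
    using e unfolding continuous_at_eps_delta by (metis half_gt_zero)
   obtain J where J: "ALL n>=J. cmod (x n)<=cmod p+1 --> (ALL t:{0..1}. cmod (aa n t-x n)<d/2)"
    using small[of "d/2" "cmod p+1"] d(1) by auto
   have "min (min 1 (d/2)) (e/2)>0" using d(1) e by simp
   then obtain n where n: "n>=J" "cmod (x n-p)<min (min 1 (d/2)) (e/2)" using p by blast
   have "cmod (x n)<=cmod p+1" using n(2) norm_triangle_ineq2[of "x n" p] by simp
   then have "cmod (aa n 1-x n)<d/2" using J n(1) by auto
   then have "cmod (x (Suc n)-p)<d"
    using n(2) norm_triangle_ineq[of "x (Suc n)-x n" "x n-p"] by (simp add: xs)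
   then have "cmod (x n-f p)<e/2" using d(2) fx[of n] by (metis dist_norm)
   then show ?thesis using n(2) norm_triangle_ineq4[of "x n-p" "x n-f p"] by simp
  qed
  then have "cmod (f p-p)<=0" by (meson field_le_epsilon add_0 order_refl le_less_trans not_le dense)
  then show ?thesis by simp
 qed
 have "EX p. ALL e>0. ALL J. EX n>=J. cmod (x n-p)<e"
 proof -
  obtain sy where sy: "!!J. sy J>=J & cmod (x (sy J))<=B" using B by metis
  have "compact (cball (0::complex) B)" by simp
  moreover have "ALL n. x (sy n):cball 0 B" using sy by simp
  ultimately have "EX p:cball 0 B. EX ro. strict_mono ro & ((%n. x (sy n)) o ro) \<longlonglongrightarrow> p"
   unfolding compact_def by (elim allE[of _ "%n. x (sy n)"]) simp
  then obtain p ro where p: "strict_mono (ro :: nat => nat)" "((%n. x (sy n)) o ro) \<longlonglongrightarrow> p" by blast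
  have "EX n>=J. cmod (x n-p)<e" if e: "e>0" for e J
  proof -
   obtain I where I: "ALL i>=I. norm (((%n. x (sy n)) o ro) i-p)<e" using LIMSEQ_D[OF p(2) e] by blast
   have "sy (ro (max I J))>=J" using sy[of "ro (max I J)"] seq_suble[OF p(1), of "max I J"] by linarith
   then show ?thesis using I[rule_format, of "max I J"] by (intro exI[of _ "sy (ro (max I J))"]) simp
  qed
  then show ?thesis by blast
 qed
 then obtain ze where ze: "ALL e>0. ALL J. EX n>=J. cmod (x n-ze)<e" by blast
 have fz: "f ze=ze" by (rule acc[OF ze])
 obtain r0 where r0: "r0>0" "ALL z. 0<cmod (z-ze) & cmod (z-ze)<r0 --> f z~=z"
  by (rule fixed_points_isolated[OF fz])
 have conv: "EX J. ALL n>=J. cmod (x n-ze)<ep" if ep: "ep>0" for ep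
 proof -
  \<comment> \<open>The annulus \<open>A\<close> contains no fixed point, so it is eventually
    avoided. Its width is \<open>r/2\<close>, and the steps are shorter than that.\<close>
  define r where "r=min (ep/2) (r0/2)"
  have r: "r>0" "r<ep" "r<r0" using ep r0(1) by (auto simp: r_def)
  define A where "A={z. r/2<=cmod (z-ze) & cmod (z-ze)<=r}"
  have cA: "compact A"
  proof -
   have "A=cball ze r-ball ze (r/2)" by (auto simp: A_def dist_norm norm_minus_commute)
   then show ?thesis by (simp add: compact_diff)
  qed
  have "EX J. ALL n>=J. x n ~: A"
  proof (rule ccontr)
   assume "~  ?thesis"
   then obtain sy where sy: "!!J. sy J>=J & x (sy J):A" by metis
   have "ALL n. x (sy n):A" using sy by simp
   with cA have "EX p:A. EX ro. strict_mono ro & ((%n. x (sy n)) o ro) \<longlonglongrightarrow> p"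
    unfolding compact_def by (elim allE[of _ "%n. x (sy n)"]) simp
   then obtain p ro where pA: "p:A" and p: "strict_mono (ro :: nat => nat)" "((%n. x (sy n)) o ro) \<longlonglongrightarrow> p" by blast
   have "EX n>=J. cmod (x n-p)<e" if e: "e>0" for e J
   proof -
    obtain I where I: "ALL i>=I. norm (((%n. x (sy n)) o ro) i-p)<e" using LIMSEQ_D[OF p(2) e] by blast
    have "sy (ro (max I J))>=J" using sy[of "ro (max I J)"] seq_suble[OF p(1), of "max I J"] by linarith
    then show ?thesis using I[rule_format, of "max I J"] by (intro exI[of _ "sy (ro (max I J))"]) simp
   qed
   then have "f p=p" by (intro acc) blast
   moreover have "0<cmod (p-ze)" "cmod (p-ze)<r0" using pA r by (auto simp: A_def)
   ultimately show False using r0(2) by blast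
  qed
  then obtain J1 where J1: "ALL n>=J1. x n ~: A" by blast
  obtain J2 where J2: "ALL n>=J2. cmod (x n)<=cmod ze + r --> (ALL t:{0..1}. cmod (aa n t-x n)<r/2)"
   using small[of "r/2" "cmod ze + r"] r(1) by auto
  have "r/2>0" using r(1) by simp
  then obtain n0 where n0: "n0>=max J1 J2" "cmod (x n0-ze)<r/2" using ze by blast
  have "cmod (x (n0 + i)-ze)<r/2" for i
  proof (induction i)
   case (Suc i)
   have "cmod (x (n0 + i))<=cmod ze + r" using Suc norm_triangle_ineq2[of "x (n0 + i)" ze] r(1) by linarith
   then have "cmod (x (Suc (n0 + i))-x (n0 + i))<r/2" using J2 n0(1) by (auto simp: xs)
   then have "cmod (x (Suc (n0 + i))-ze)<=r"
    using Suc norm_triangle_ineq[of "x (Suc (n0 + i))-x (n0 + i)" "x (n0 + i)-ze"] by simp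
   moreover have "x (Suc (n0 + i)) ~: A" using J1 n0(1) by auto
   ultimately show ?case by (simp add: A_def)
  qed (use n0 in simp)
  then have near: "cmod (x (n0 + i)-ze)<ep" for i using r by (smt (verit) half_gt_zero field_sum_of_halves)
  have "cmod (x n-ze)<ep" if "n>=n0" for n using near[of "n-n0"] that by simp
  then show ?thesis by blast
 qed
 have "EX J. ALL n>=J. ALL t:{0..1}. cmod (aa n t-ze)<ep" if ep: "ep>0" for ep
 proof -
  define e where "e=min (ep/2) 1"
  have e: "e>0" "e<=1" "e + e<=ep" using ep by (auto simp: e_def)
  obtain J1 where J1: "ALL n>=J1. cmod (x n-ze)<e" using conv[OF e(1)] by blast
  obtain J2 where J2: "ALL n>=J2. cmod (x n)<=cmod ze+1 --> (ALL t:{0..1}. cmod (aa n t-x n)<e)"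
   using small[OF e(1)] by blast
  have "cmod (aa n t-ze)<ep" if n: "n>=max J1 J2" and t: "t:{0..1}" for n t
  proof -
   have 1: "cmod (x n-ze)<e" using J1 n by simp
   then have "cmod (x n)<=cmod ze+1" using e(2) norm_triangle_ineq2[of "x n" ze] by linarith
   then have "cmod (aa n t-x n)<e" using J2 n t by simp
   then show ?thesis using 1 e(3) norm_triangle_ineq[of "aa n t-x n" "x n-ze"] by simp
  qed
  then show ?thesis by blast
 qed
 then show ?thesis using that fz by blast
qed

end

section \<open>The multiplier at the landing point\<close>

text \<open>Turning in steps of the small angle \<open>ph\<close>, the last position before
  completing the circle is within one step of \<open>1\<close>. The number of steps depends on
  \<open>ph\<close> only, which makes \<open>J\<close> uniform in \<open>w\<close>.\<close>

lemma unit_rotation_returns: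
 assumes mw: "mw=exp (\<i> * of_real ph)" and ph: "ph>0" "ph<=pi" and near: "cmod (mw-1)<et"
 shows "EX J. ALL w. cmod w=1 --> (EX j<=J. cmod (mw ^ j * w-1)<2 * et)"
proof -
 have small: "cmod (exp (\<i> * of_real t)-1)<=cmod (mw-1)" if t: "0<=t" "t<=ph" for t
 proof -
  have sq: "(cmod (exp (\<i> * of_real s)-1))\<^sup>2=2-2 * cos s" for s
  proof -
   have "exp (\<i> * of_real s)=cis s" by (simp add: cis_conv_exp)
   then show ?thesis using sin_cos_squared_add[of s] unfolding cmod_power2 by (simp add: power2_eq_square algebra_simps)
  qed
  have "cos ph<=cos t" using t ph by (intro cos_monotone_0_pi_le) auto
  then have "(cmod (exp (\<i> * of_real t)-1))\<^sup>2<=(cmod (exp (\<i> * of_real ph)-1))\<^sup>2" unfolding sq by simp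
  then show ?thesis unfolding mw by (metis norm_ge_zero power2_le_imp_le)
 qed
 define J where "J=nat \<lceil>2 * pi/ph\<rceil>"
 have "EX j<=J. cmod (mw ^ j * w-1)<2 * et" if w: "cmod w=1" for w
 proof -
  define ps where "ps=(if Arg w>0 then Arg w else Arg w+2 * pi)"
  have ps: "0<ps" "ps<=2 * pi" using Arg_le_pi[of w] mpi_less_Arg[of w] pi_gt_zero by (auto simp: ps_def)
  have "w~=0" using w by auto
  then have "w=exp (\<i> * of_real (Arg w))" using Arg_eq[of w] w by simp
  then have wps: "w=exp (\<i> * of_real ps)" by (auto simp: ps_def exp_add algebra_simps)
  define j where "j=nat \<lfloor>(2 * pi-ps)/ph\<rfloor>"
  have q0: "(2 * pi-ps)/ph>=0" using ps ph by simp
  have jq: "real j<=(2 * pi-ps)/ph" "(2 * pi-ps)/ph<real j+1"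
   using q0 unfolding j_def by (auto simp: of_nat_nat) 
  have "real j<=2 * pi/ph" using jq(1) ps ph by (smt (verit) divide_right_mono)
  then have jJ: "j<=J" unfolding J_def by linarith
  define t where "t=2 * pi-ps-real j * ph"
  have t: "0<=t" "t<=ph" using jq ph by (auto simp: t_def field_simps)
  have "mw ^ j * w=exp (\<i> * of_real (2 * pi-t))"
  proof -
   have "mw ^ j=exp (of_nat j * (\<i> * of_real ph))" unfolding mw by (simp add: exp_of_nat_mult)
   then show ?thesis unfolding wps by (simp add: t_def exp_add[symmetric] algebra_simps)
  qed
  also have "... = inverse (exp (\<i> * of_real t))"
  proof -
   have "cis (2 * pi-t)=inverse (cis t)" unfolding cis_divide[symmetric] by (simp add: inverse_eq_divide)
   then show ?thesis by (simp add: cis_conv_exp inverse_eq_divide del: of_real_diff of_real_mult flip: cis_conv_exp)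
  qed
  finally have e: "mw ^ j * w=inverse (exp (\<i> * of_real t))" .
  have "cmod (mw ^ j * w-1)=cmod (inverse (exp (\<i> * of_real t))*(1-exp (\<i> * of_real t)))"
   unfolding e by (simp add: algebra_simps)
  also have "... = cmod (exp (\<i> * of_real t)-1)" by (simp add: norm_mult norm_inverse norm_minus_commute)
  also have "... < 2 * et" using small[OF t] near norm_ge_zero[of "mw-1"] by linarith
  finally show ?thesis using jJ by blast
 qed
 then show ?thesis by blast
qed

text \<open>By compactness two powers of \<open>nu\<close> are close, so some \<open>nu ^ k\<close>
  is a small nontrivial rotation. When it turns clockwise, its conjugate is used.\<close>

lemma irrational_rotation_dense:
 fixes nu :: complex
 assumes l: "cmod nu=1" "!!n. n>0 ==> nu ^ n~=1" and et: "et>0"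
 shows "EX J. ALL w. cmod w=1 --> (EX j<=J. cmod (nu ^ j * w-1)<et)"
proof -
 have "compact (sphere (0::complex) 1)" by simp
 moreover have "ALL n. nu ^ n:sphere 0 1" using l(1) by (simp add: norm_power)
 ultimately have "EX p:sphere 0 1. EX sy. strict_mono sy & ((%n. nu ^ n) o sy) \<longlonglongrightarrow> p"
  unfolding compact_def by (elim allE[of _ "%n. nu ^ n"]) simp
 then obtain p sy where sy: "strict_mono (sy :: nat => nat)" "((%n. nu ^ n) o sy) \<longlonglongrightarrow> p" by blast
 have "et/4>0" using et by simp
 from LIMSEQ_D[OF sy(2) this] obtain N where N: "ALL n>=N. norm (((%n. nu ^ n) o sy) n-p)<et/4" by blast
 define k where "k=sy (Suc N)-sy N"
 have k: "k>0" "sy (Suc N)=sy N + k" using sy(1) by (auto simp: k_def strict_mono_Suc_iff less_imp_le)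
 have "cmod (nu ^ sy (Suc N)-nu ^ sy N)<et/2"
  using N[rule_format, of N] N[rule_format, of "Suc N"] norm_triangle_ineq4[of "nu ^ sy (Suc N)-p" "nu ^ sy N-p"]
  by simp
 moreover have "nu ^ sy (Suc N)-nu ^ sy N=nu ^ sy N * (nu ^ k-1)" by (simp add: k(2) power_add algebra_simps)
 ultimately have mu: "cmod (nu ^ k-1)<et/2" using l(1) by (simp add: norm_mult norm_power)
 have mu1: "cmod (nu ^ k)=1" "nu ^ k~=1" using l k by (auto simp: norm_power)
 define ph where "ph=Arg (nu ^ k)"
 have "nu ^ k~=0" using mu1(1) by (metis norm_zero zero_neq_one)
 then have e: "nu ^ k=exp (\<i> * of_real ph)" using Arg_eq[of "nu ^ k"] mu1 by (simp add: ph_def)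
 have "ph~=0"
 proof
  assume "ph=0"
  with e have "nu ^ k=1" by simp
  with mu1(2) show False by contradiction
 qed
 then have ph: "ph<=pi" "- pi<=ph" "ph~=0"
  using Arg_le_pi[of "nu ^ k"] mpi_less_Arg[of "nu ^ k"] unfolding ph_def by linarith+
 have "EX J. ALL w. cmod w=1 --> (EX j<=J. cmod ((nu ^ k) ^ j * w-1)<2*(et/2))"
 proof (cases "ph>0")
  case True
  show ?thesis by (rule unit_rotation_returns[OF e True ph(1) mu])
 next
  case False
  have e': "cnj (nu ^ k)=exp (\<i> * of_real (- ph))" unfolding e by (simp add: exp_cnj)
  have "cmod (cnj (nu ^ k)-1)<et/2" using mu by (metis complex_cnj_diff complex_cnj_one complex_mod_cnj)
  then obtain J where J: "ALL w. cmod w=1 --> (EX j<=J. cmod (cnj (nu ^ k) ^ j * w-1)<2*(et/2))"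
   using unit_rotation_returns[OF e', of "et/2"] False ph by auto
  have "EX j<=J. cmod ((nu ^ k) ^ j * w-1)<2*(et/2)" if w: "cmod w=1" for w
  proof -
   have "cmod (cnj w)=1" using w by simp
   then obtain j where j: "j<=J" "cmod (cnj (nu ^ k) ^ j * cnj w-1)<2*(et/2)" using J by blast
   have "cnj ((nu ^ k) ^ j * w-1)=cnj (nu ^ k) ^ j * cnj w-1" by simp
   then show ?thesis using j by (metis complex_mod_cnj)
  qed
  then show ?thesis by blast
 qed
 then obtain J where J: "ALL w. cmod w=1 --> (EX j<=J. cmod (nu ^ (k * j) * w-1)<et)" by (auto simp: power_mult)
 have "EX j<=k * J. cmod (nu ^ j * w-1)<et" if w: "cmod w=1" for w
 proof -
  obtain j where "j<=J" "cmod (nu ^ (k * j) * w-1)<et" using J w by blast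
  then show ?thesis by (intro exI[of _ "k * j"]) auto
 qed
 then show ?thesis by blast
qed

text \<open>The square root of a nonvanishing injective function, normalised to be \<open>1\<close> at the centre,
  omits \<open>0\<close> and \<open>-1\<close>, so Schottky's theorem bounds its distortion absolutely.\<close>

lemma nonvanishing_injective_bound:
 "EX M. ALL c r h. r>0 --> h holomorphic_on ball c (4 * r) --> inj_on h (ball c (4 * r)) -->
  (ALL z:ball c (4 * r). h z~=(0::complex)) --> (ALL z:cball c r. cmod (h z/h c)<=M)"
proof -
 define E where "E=exp (pi * exp (pi * (2+2*1+12*(1/2)/(1-1/2))))"
 have "cmod (h z/h c)<=E\<^sup>2" if r: "(r::real)>0" and h: "h holomorphic_on ball c (4 * r)" and inj: "inj_on h (ball c (4 * r))"
  and nz: "ALL z:ball c (4 * r). h z~=0" and z: "z:cball c r" for c r h z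
 proof -
  obtain l where l: "l holomorphic_on ball c (4 * r)" "ALL z:ball c (4 * r). exp (l z)=h z"
   using holomorphic_log_convex[OF convex_ball h] nz by blast
  define k where "k z=exp ((l z-l c)/2)" for z
  have cB: "c:ball c (4 * r)" using r by simp
  have k2: "(k z)\<^sup>2=h z/h c" if "z:ball c (4 * r)" for z
  proof -
   have "(k z)\<^sup>2=exp (l z-l c)" by (simp add: k_def power2_eq_square exp_add[symmetric])
   then show ?thesis using l(2) that cB by (simp add: exp_diff)
  qed
  have km: "k z ~= - 1" if zB: "z:ball c (4 * r)" for z
  proof
   assume "k z = - 1"
   then have "h z/h c=1" using k2[OF zB] by simp
   then have "h z=h c" using nz cB by (simp add: field_simps)
   then have "z=c" using inj zB cB by (meson inj_onD)
   then show False using \<open>k z = - 1\<close> by (simp add: k_def)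
  qed
  define ph where "ph xi=c + of_real (2 * r) * xi" for xi :: complex
  have ph: "ph xi:ball c (4 * r)" if "xi:cball 0 1" for xi
  proof -
   have "dist c (ph xi)=2 * r * cmod xi" using r by (simp add: ph_def dist_norm norm_mult)
   also have "... <= 2 * r" using that r by (simp add: mult_left_le)
   finally show ?thesis using r by simp
  qed
  have holph: "ph holomorphic_on cball 0 1" unfolding ph_def by (intro holomorphic_intros)
  have imph: "ph ` cball 0 1<=ball c (4 * r)" using ph by blast
  have "(%xi. - k (ph xi)) holomorphic_on cball 0 1"
   unfolding k_def
  proof (intro holomorphic_intros)
   have "l o ph holomorphic_on cball 0 1"
    by (rule holomorphic_on_compose_gen[OF holph l(1) imph])
   then show "(%xi. l (ph xi)) holomorphic_on cball 0 1" by (simp add: o_def)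
  qed auto
  moreover have "cmod (- k (ph 0))<=1" by (simp add: ph_def k_def)
  moreover have "~  (- k (ph xi)=0 | - k (ph xi)=1)" if "xi:cball 0 1" for xi
   using km[OF ph[OF that]] by (metis exp_not_eq_zero k_def minus_equation_iff neg_equal_0_iff_equal)
  moreover have "cmod ((z-c) / of_real (2 * r))<=1/2"
  proof -
   have "cmod (z-c)<=r" using z by (simp add: dist_norm norm_minus_commute)
   then have "cmod (z-c)/(2 * r)<=1/2" using r by (simp add: field_simps)
   then show ?thesis using r by (simp only: norm_divide norm_of_real abs_of_pos)
  qed
  ultimately have "cmod (- k (ph ((z-c) / of_real (2 * r))))<=E"
   unfolding E_def by (intro Schottky[of "%xi. - k (ph xi)" 1 "1/2"]) auto
  moreover have "ph ((z-c) / of_real (2 * r))=z" using r by (simp add: ph_def)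
  ultimately have "cmod (k z)<=E" by simp
  then have "cmod ((k z)\<^sup>2)<=E\<^sup>2" by (simp add: norm_power power_mono)
  moreover have "z:ball c (4 * r)" using z r by simp
  ultimately show ?thesis using k2 by simp
 qed
 then show ?thesis by blast
qed

context expansion
begin

lemma deriv_iter_fixed:
 assumes "f ze=ze" shows "((f ^^ n) has_field_derivative (deriv f ze ^ n)) (at ze)"
proof (induction n)
 case 0
 then show ?case using DERIV_ident[of "at ze"] by (simp add: id_def[abs_def])
next
 case (Suc n)
 have fixn: "(f ^^ n) ze=ze" using assms by (induction n) auto
 have "(f has_field_derivative deriv f ze) (at ((f ^^ n) ze))"
  unfolding fixn using holomorphic_derivI[OF holf open_UNIV UNIV_I] .
 from DERIV_chain[OF this Suc] show ?case by (simp add: o_def)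
qed

definition lands :: "(nat => real => complex) => complex => bool" where
 "lands aa ze \<longleftrightarrow> (ALL ep>0. EX J. ALL n>=J. ALL t:{0..1}. cmod (aa n t-ze)<ep)"

text \<open>Near a fixed point with multiplier below \<open>1\<close> in modulus, \<open>f\<close>
  decreases the distance to it. A backward orbit then moves away and cannot land there.\<close>

lemma landing_not_attracting:
 assumes b: "bchain aa" and fz: "f ze=ze" and la: "lands aa ze" and U: "ze ~: U"
 shows "cmod (deriv f ze)>=1"
proof (rule ccontr)
 assume "~  ?thesis"
 then have l: "cmod (deriv f ze)<1" by simp
 have "(f has_field_derivative deriv f ze) (at ze)" by (rule holomorphic_derivI[OF holf open_UNIV UNIV_I])
 then have "((%z. (f z-f ze)/(z-ze)) \<longlongrightarrow> deriv f ze) (at ze)" by (simp add: has_field_derivative_iff)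
 then have "((%z. cmod ((f z-f ze)/(z-ze))) \<longlongrightarrow> cmod (deriv f ze)) (at ze)" by (rule tendsto_norm)
 then have "\<forall>\<^sub>F z in at ze. cmod ((f z-f ze)/(z-ze))<1" using l order_tendstoD(2) by blast
 then obtain d where d: "d>0" "ALL z. z~=ze & dist z ze<d --> cmod ((f z-f ze)/(z-ze))<1"
  unfolding eventually_at by auto
 obtain J where J: "ALL n>=J. ALL t:{0..1}. cmod (aa n t-ze)<d" using la d(1) unfolding lands_def by blast
 define x where "x n=aa n 0" for n
 have xU: "x n:U" and fx: "f (x (Suc n))=x n" for n using b unfolding bchain_def x_def by auto
 have xz: "x n~=ze" for n using xU[of n] U by auto
 have inc: "cmod (x n-ze)<=cmod (x (Suc n)-ze)" if "n>=J" for n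
 proof -
  have "dist (x (Suc n)) ze<d" using J that unfolding x_def by (simp add: dist_norm)
  then have "cmod ((f (x (Suc n))-f ze)/(x (Suc n)-ze))<1" using d(2) xz by blast
  then show ?thesis using xz[of "Suc n"] fx fz by (simp add: norm_divide divide_less_eq_1)
 qed
 have "cmod (x J-ze)<=cmod (x (J + i)-ze)" for i
 proof (induction i)
  case (Suc i)
  then show ?case using inc[of "J + i"] by simp
 qed simp
 moreover have pos: "cmod (x J-ze)>0" using xz by simp
 then obtain J2 where J2: "ALL n>=J2. ALL t:{0..1}. cmod (aa n t-ze)<cmod (x J-ze)"
  using la unfolding lands_def by blast
 then have "cmod (x (J + J2)-ze)<cmod (x J-ze)" unfolding x_def by simp
 ultimately show False by (meson not_le)
qed

text \<open>Thickens the backward orbit of \<open>aa 0 s\<close> to inverse branches on a disc that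
  are compatible under \<open>f\<close>. Since their centres converge to \<open>ze\<close>,
  \<open>shrink_ball\<close> forces uniform convergence.\<close>

lemma bchain_branches:
 assumes b: "bchain aa" and la: "lands aa ze" and s: "s:{0..1}" and r: "r>0" "ball (aa 0 s) (8 * r)<=U"
 obtains h where "!!n. branch n (aa 0 s) (8 * r) (h n)" "!!n. h n (aa 0 s)=aa n s"
  "!!n i z. z:ball (aa 0 s) (8 * r) ==> (f ^^ i) (h (n + i) z)=h n z"
  "!!n z. z:ball (aa 0 s) (8 * r) ==> h n z:U"
  "!!ep. ep>0 ==> EX J. ALL n>=J. ALL z:cball (aa 0 s) r. cmod (h n z-ze)<ep"
proof -
 let ?c = "aa 0 s" let ?B = "ball (aa 0 s) (8 * r)"
 have it: "(f ^^ n) (aa n s)=?c" for n using bchain_iter[OF b s, of n 0] by simp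
 have "EX h. branch n ?c (8 * r) h & h ?c=aa n s & (ALL z:?B. h z:U)" for n
 proof -
  have "(f ^^ n) (aa n s):?B" using it r(1) by simp
  then show ?thesis by (rule branch_iter[OF r(2)]) (use it[of n] in "auto simp: branch_def")
 qed
 then obtain h where h: "!!n. branch n ?c (8 * r) (h n)" "!!n. h n ?c=aa n s" "!!n. ALL z:?B. h n z:U" by metis
 have ch: "cont ?B (h n)" for n using h(1) holo_cont unfolding branch_def by blast
 have shift: "(f ^^ i) (h (n + i) z)=h n z" if z: "z:?B" for n i z
 proof (rule lift_unique[of ?B "%z. (f ^^ i) (h (n + i) z)" "h n" ?c z n])
  show "cont ?B (%z. (f ^^ i) (h (n + i) z))"
   by (rule cont_comp[OF contf_iter[of UNIV] ch]) auto
  show "(f ^^ i) (h (n + i) ?c)=h n ?c" using bchain_iter[OF b s, of i n] h(2) by (simp add: add.commute)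
  show "(f ^^ n) ((f ^^ i) (h (n + i) z))=(f ^^ n) (h n z)" "(f ^^ n) ((f ^^ i) (h (n + i) z)):U"
   if "z:?B" for z
   using h(1)[of "n + i"] h(1)[of n] that r(2) unfolding branch_def by (auto simp: funpow_add)
 qed (use ch r z in auto)
 have lim: "EX J. ALL n>=J. ALL z:cball ?c r. cmod (h n z-ze)<ep" if ep: "ep>0" for ep
 proof -
  define e where "e=min (ep/2) 1"
  have e: "e>0" "e<=1" "e + e<=ep" using ep by (auto simp: e_def)
  obtain J1 where J1: "ALL n>=J1. ALL t:{0..1}. cmod (aa n t-ze)<e" using la e(1) unfolding lands_def by blast
  obtain J2 where J2: "ALL n>=J2. ALL h. branch n ?c (8 * r) h --> (EX z:cball ?c r. cmod (h z)<=cmod ze+1) -->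
   (ALL z:cball ?c r. ALL w:cball ?c r. cmod (h z-h w)<e)" using shrink_ball[OF r e(1), of "cmod ze+1"] by blast
  have "cmod (h n z-ze)<ep" if n: "n>=max J1 J2" and z: "z:cball ?c r" for n z
  proof -
   have cc: "?c:cball ?c r" using r(1) by simp
   have 1: "cmod (h n ?c-ze)<e" using J1 n s h(2) by simp
   then have "cmod (h n ?c)<=cmod ze+1" using e(2) norm_triangle_ineq2[of "h n ?c" ze] by linarith
   then have "cmod (h n z-h n ?c)<e" using J2 n h(1)[of n] cc z by (meson max.boundedE)
   then show ?thesis using 1 e(3) norm_triangle_ineq[of "h n z-h n ?c" "h n ?c-ze"] by simp
  qed
  then show ?thesis by blast
 qed
 show ?thesis by (rule that[of h]) (use h shift lim in auto)
qed

lemma landing_rational: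
 assumes b: "bchain aa" and fz: "f ze=ze" and la: "lands aa ze" and U: "ze ~: U"
  and l1: "cmod (deriv f ze)=1"
 shows "EX q>0. deriv f ze ^ q=1"
proof (rule ccontr)
 assume "~  ?thesis"
 then have irr: "deriv f ze ^ n~=1" if "n>0" for n using that by blast
 text \<open>Rotations by \<open>f'(ze)\<close> spread a definite piece of the image of an inverse branch over a whole circle about
    \<open>ze\<close>, so a high iterate is injective-like on the disc inside and its derivative at \<open>ze\<close> is too large.\<close>
 define nu where "nu=deriv f ze"
 have nu1: "cmod nu=1" "nu ^ n~=1" if "n>0" for n using l1 irr that by (auto simp: nu_def)
 have nun: "cmod nu=1" using l1 by (simp add: nu_def)
 have nune: "nu~=1" using irr[of 1] by (simp add: nu_def)
 have cont0: "cont {0..1} (aa 0)" and im0: "aa 0 ` {0..1}<=U" using b unfolding bchain_def by auto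
 have cQ: "compact (aa 0 ` {0..1})" by (rule compact_continuous_image[OF cont0]) simp
 obtain r where gr: "good_radius (aa 0 ` {0..1}) r" by (rule good_radius_exists[OF cQ im0])
 then have r: "r>0" "!!s. s:{0..1} ==> ball (aa 0 s) (8 * r)<=U" unfolding good_radius_def
 proof -
  fix s :: real assume a: "compact (aa 0 ` {0..1}) & 0<r & (ALL q:aa 0 ` {0..1}. ball q (32 * r)<=U)" and s: "s:{0..1}"
  then have "ball (aa 0 s) (8 * r)<=ball (aa 0 s) (32 * r)" by auto
  then show "ball (aa 0 s) (8 * r)<=U" using a s by blast
 qed auto
 have aaU: "aa n s:U" if "s:{0..1}" for n s using b that unfolding bchain_def by blast
 have nz: "aa n s-ze~=0" if "s:{0..1}" for n s using aaU[OF that, of n] U by auto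
 have uc: "uniformly_continuous_on {0..1} (aa 0)" by (rule compact_uniformly_continuous[OF cont0]) simp
 then obtain d where d: "d>0" "ALL x:{0..1}. ALL y:{0..1}. dist y x<d --> dist (aa 0 y) (aa 0 x)<r"
  using r(1) unfolding uniformly_continuous_on_def by blast
 obtain N :: nat where N: "N>0" "1/real N<d" using d(1) by (metis nat_approx_posE of_nat_Suc zero_less_Suc)
 define s where "s i=real i/real N" for i
 have s01: "s i:{0..1}" if "i<=N" for i using that N(1) by (auto simp: s_def)
 have sN: "s 0=0" "s N=1" using N(1) by (auto simp: s_def)
 have close: "aa 0 (s (Suc i)):ball (aa 0 (s i)) r" if i: "i<N" for i
 proof -
  have "s (Suc i)-s i=1/real N" by (simp add: s_def add_divide_distrib)
  then have "dist (s (Suc i)) (s i)=1/real N" by (simp add: dist_real_def)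
  then have "dist (s (Suc i)) (s i)<d" using N by simp
  moreover have "s i:{0..1}" "s (Suc i):{0..1}" using s01 i by auto
  ultimately show ?thesis using d(2) by (auto simp: dist_commute)
 qed
 \<comment> \<open>If all these ratios tended to \<open>1\<close>, so would
   \<open>(aa n 1-ze)/(aa n 0-ze)\<close>. As \<open>aa n 1=aa (Suc n) 0\<close>, that ratio tends
   to \<open>1/nu\<close>, and \<open>nu~=1\<close>.\<close>
 have "EX i<N. ~  (%n. (aa n (s (Suc i))-ze)/(aa n (s i)-ze)) \<longlonglongrightarrow> 1"
 proof (rule ccontr)
  assume "~  ?thesis"
  then have lim: "(%n. (aa n (s (Suc i))-ze)/(aa n (s i)-ze)) \<longlonglongrightarrow> 1" if "i<N" for i using that by blast
  have "(%n. (aa n (s i)-ze)/(aa n (s 0)-ze)) \<longlonglongrightarrow> 1" if "i<=N" for i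
   using that
  proof (induction i)
   case 0
   have "(aa n (s 0)-ze)/(aa n (s 0)-ze)=1" for n using nz[OF s01[of 0]] by simp
   then show ?case by simp
  next
   case (Suc i)
   have "(%n. ((aa n (s (Suc i))-ze)/(aa n (s i)-ze))*((aa n (s i)-ze)/(aa n (s 0)-ze))) \<longlonglongrightarrow> 1*1"
    by (rule tendsto_mult) (use Suc lim in auto)
   moreover have "s i:{0..1}" using s01 Suc.prems by simp
   then have eq: "((aa n (s (Suc i))-ze)/(aa n (s i)-ze))*((aa n (s i)-ze)/(aa n (s 0)-ze))=(aa n (s (Suc i))-ze)/(aa n (s 0)-ze)" for n
    using nz[of "s i" n] by simp
   ultimately show ?case by (simp only: eq mult_1)
  qed
  from this[of N] have 1: "(%n. (aa n 1-ze)/(aa n 0-ze)) \<longlonglongrightarrow> 1" by (simp add: sN)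
  have "(%n. (f (aa (Suc n) 0)-f ze)/(aa (Suc n) 0-ze)) \<longlonglongrightarrow> nu"
  proof -
   have "(f has_field_derivative nu) (at ze)" unfolding nu_def by (rule holomorphic_derivI[OF holf open_UNIV UNIV_I])
   then have D: "((%z. (f z-f ze)/(z-ze)) \<longlongrightarrow> nu) (at ze)" by (simp add: has_field_derivative_iff)
   have "(%n. aa n 0) \<longlonglongrightarrow> ze"
   proof (rule LIMSEQ_I)
    fix e :: real assume "e>0"
    then obtain J where "ALL n>=J. ALL t:{0..1}. cmod (aa n t-ze)<e" using la unfolding lands_def by blast
    then show "EX no. ALL n>=no. norm (aa n 0-ze)<e" by (intro exI[of _ J]) auto
   qed
   then have "filterlim (%n. aa (Suc n) 0) (at ze) sequentially"
    using nz[of 0] unfolding filterlim_at by (auto intro: LIMSEQ_Suc)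
   from filterlim_compose[OF D this] show ?thesis .
  qed
  moreover have "(f (aa (Suc n) 0)-f ze)/(aa (Suc n) 0-ze)=inverse ((aa n 1-ze)/(aa n 0-ze))" for n
   using b fz unfolding bchain_def by simp
  moreover have "(%n. inverse ((aa n 1-ze)/(aa n 0-ze))) \<longlonglongrightarrow> inverse 1" by (rule tendsto_inverse[OF 1]) simp
  ultimately have "nu=1" using LIMSEQ_unique by fastforce
  then show False using nune by simp
 qed
 then obtain i where i: "i<N" "~  (%n. (aa n (s (Suc i))-ze)/(aa n (s i)-ze)) \<longlonglongrightarrow> 1" by blast
 define c where "c=aa 0 (s i)"
 define w where "w=aa 0 (s (Suc i))"
 have si: "s i:{0..1}" "s (Suc i):{0..1}" using s01 i(1) by auto
 have wc: "w:ball c r" using close[OF i(1)] by (simp add: w_def c_def)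
 obtain h where h: "!!n. branch n c (8 * r) (h n)" "!!n. h n c=aa n (s i)"
  "!!n i z. z:ball c (8 * r) ==> (f ^^ i) (h (n + i) z)=h n z"
  "!!n z. z:ball c (8 * r) ==> h n z:U"
  "!!ep. ep>0 ==> EX J. ALL n>=J. ALL z:cball c r. cmod (h n z-ze)<ep"
  unfolding c_def using bchain_branches[OF b la si(1) r(1) r(2)[OF si(1)]] by metis
 have hw: "h n w=aa n (s (Suc i))" for n
 proof -
  define S where "S={s i..s (Suc i)}"
  have len: "s (Suc i)-s i=1/real N" by (simp add: s_def add_divide_distrib)
  have S01: "S<={0..1}" using si by (auto simp: S_def)
  have le: "s i<=s (Suc i)" using N(1) by (simp add: s_def divide_right_mono)
  have mem: "s i:S" "s (Suc i):S" using le by (auto simp: S_def)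
  have near: "aa 0 x:ball c (8 * r)" if x: "x:S" for x
  proof -
   have "dist x (s i)<d" using x len N(2) by (auto simp: S_def dist_real_def)
   then have "dist (aa 0 x) (aa 0 (s i))<r" using d(2) si x S01 by blast
   then show ?thesis using r(1) by (simp add: c_def dist_commute)
  qed
  have "aa n x=h n (aa 0 x)" if x: "x:S" for x
  proof (rule lift_unique[of S "aa n" "%x. h n (aa 0 x)" "s i" x n])
   show "connected S" by (simp add: S_def)
   show "cont S (aa n)" using b S01 cont_sub unfolding bchain_def by blast
   have ch: "cont (ball c (8 * r)) (h n)" using h(1) holo_cont unfolding branch_def by blast
   show "cont S (%x. h n (aa 0 x))"
    by (rule cont_comp[OF ch cont_sub[OF cont0 S01]]) (use near in auto)
   show "aa n (s i)=h n (aa 0 (s i))" using h(2) by (simp add: c_def)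
   fix z assume z: "z:S"
   have e: "(f ^^ n) (aa n z)=aa 0 z" using bchain_iter[OF b, of z n 0] S01 z by auto
   show "(f ^^ n) (aa n z)=(f ^^ n) (h n (aa 0 z))" using e h(1)[of n] near[OF z] unfolding branch_def by simp
   show "(f ^^ n) (aa n z):U" unfolding e using aaU S01 z by blast
  qed (use mem x in auto)
  from this[OF mem(2)] show ?thesis by (simp add: w_def)
 qed
 have cc: "c:cball c r" using r(1) by simp
 have hne: "h n z~=ze" if "z:ball c (8 * r)" for n z using h(4)[OF that, of n] U by auto
 have cB: "c:ball c (8 * r)" using r(1) by simp
 \<comment> \<open>The branches rescaled by \<open>h n c-ze\<close>. They stay bounded because
   \<open>h n-ze\<close> is injective without zeros. The choice of \<open>i\<close> yields a limit
   \<open>g\<close> that is not constant, with \<open>g c=1\<close> and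
   \<open>g w~=1\<close>.\<close>
 define v where "v n z=(h n z-ze)/(h n c-ze)" for n z
 obtain M where M: "!!c r h. r>0 ==> h holomorphic_on ball c (4 * r) ==> inj_on h (ball c (4 * r)) ==>
  (ALL z:ball c (4 * r). h z~=(0::complex)) ==> (ALL z:cball c r. cmod (h z/h c)<=M)"
  using nonvanishing_injective_bound by blast
 have holh: "h n holomorphic_on ball c (8 * r)" for n using h(1) unfolding branch_def by blast
 have vM: "cmod (v n z)<=M" if "z:cball c (2 * r)" for n z
 proof -
  have "inj_on (%z. h n z-ze) (ball c (8 * r))"
  proof (rule inj_onI)
   fix x y assume "x:ball c (8 * r)" "y:ball c (8 * r)" "h n x-ze=h n y-ze"
   then show "x=y" using h(1)[of n] unfolding branch_def by (metis add_diff_cancel diff_add_cancel)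
  qed
  moreover have "(%z. h n z-ze) holomorphic_on ball c (8 * r)" by (intro holomorphic_intros holh)
  ultimately have "ALL z:cball c (2 * r). cmod ((h n z-ze)/(h n c-ze))<=M"
   using M[of "2 * r" "%z. h n z-ze" c] r(1) hne by simp
  then show ?thesis using that unfolding v_def by blast
 qed
 have holv: "v n holomorphic_on ball c (8 * r)" for n
  unfolding v_def by (intro holomorphic_intros holh) (use hne[OF cB] in auto)
 have holv2: "v n holomorphic_on ball c (2 * r)" for n by (rule holomorphic_on_subset[OF holv]) (use r(1) in auto)
 have "~  (%n. v n w) \<longlonglongrightarrow> 1" using i(2) by (simp add: v_def hw h(2))
 then obtain e where e: "e>0" "ALL N. EX n>=N. cmod (v n w-1)>=e" unfolding LIMSEQ_iff by (auto simp: not_less)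
 then obtain ta where ta: "ALL N::nat. ta N>=N & cmod (v (ta N) w-1)>=e" by metis
 define H where "H={k. k holomorphic_on ball c (2 * r) & (ALL z:ball c (2 * r). cmod (k z)<=M)}"
 obtain g sy where g: "g holomorphic_on ball c (2 * r)" "strict_mono (sy :: nat => nat)"
  "!!x. x:ball c (2 * r) ==> (%n. v (ta (sy n)) x) \<longlonglongrightarrow> g x"
  "!!K. compact K ==> K<=ball c (2 * r) ==> uniform_limit K ((%n. v (ta n)) o sy) g sequentially"
 proof (rule Montel[of "ball c (2 * r)" H "%n. v (ta n)"])
  show "EX B. ALL h:H. ALL z:K. norm (h z)<=B" if "K<=ball c (2 * r)" for K
   using that unfolding H_def by (intro exI[of _ M]) blast
  show "range (%n. v (ta n))<=H" unfolding H_def using vM holv2 by auto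
 qed (auto simp: H_def)
 have c2: "c:ball c (2 * r)" and w2: "w:ball c (2 * r)" using r(1) wc by auto
 have vc: "v n c=1" for n using hne[OF cB] by (simp add: v_def)
 have gc: "g c=1" using g(3)[OF c2] LIMSEQ_unique[OF tendsto_const] unfolding vc by metis
 have gw: "g w~=1"
 proof
  assume "g w=1"
  with g(3)[OF w2] have "(%n. v (ta (sy n)) w) \<longlonglongrightarrow> 1" by simp
  from LIMSEQ_D[OF this e(1)] obtain no where "ALL n>=no. norm (v (ta (sy n)) w-1)<e" by blast
  then show False using ta by (meson order_refl not_less)
 qed
 obtain ro0 where ro0: "ro0>0" "!!z. z:ball c ro0-{c} ==> g z-1~=0"
 proof (rule isolated_zeros[of "%z. g z-1" "ball c (2 * r)" c w])
  show "(%z. g z-1) holomorphic_on ball c (2 * r)" by (intro holomorphic_intros g(1))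
 qed (use c2 w2 gc gw in auto)
 define s' where "s'=min r (ro0/2)"
 have s': "s'>0" "s'<=r" "s'<ro0" using r(1) ro0(1) by (auto simp: s'_def)
 have sub': "cball c s'<=ball c (2 * r)" using s' r(1) by auto
 obtain et where et: "et>0" "!!z. dist c z=s' ==> 2 * et<=cmod (g z-g c)"
 proof -
  have "cont (sphere c s') (%z. cmod (g z-g c))"
   by (intro continuous_intros cont_sub[OF holo_cont[OF g(1)]]) (use sub' in auto)
  then obtain z0 where z0: "z0:sphere c s'" "ALL z:sphere c s'. cmod (g z0-g c)<=cmod (g z-g c)"
   using continuous_attains_inf[OF compact_sphere, of c s' "%z. cmod (g z-g c)"] s'(1) by auto
  have "z0:ball c ro0-{c}" using z0(1) s' by auto
  then have "cmod (g z0-g c)>0" using ro0(2) gc by auto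
  then show ?thesis by (intro that[of "cmod (g z0-g c)/2"]) (use z0(2) in auto)
 qed
 have "uniform_limit (cball c s') ((%n. v (ta n)) o sy) g sequentially" by (rule g(4)) (use sub' in auto)
 moreover have "et/4>0" using et by simp
 ultimately obtain k0 where k0: "ALL n>=k0. ALL x:cball c s'. dist (v (ta (sy n)) x) (g x)<et/4"
  unfolding uniform_limit_iff eventually_sequentially o_def by blast
 have covers: "ball 1 (et/4)<=v (ta (sy n)) ` ball c s'" if n: "n>=k0" for n
  unfolding gc[symmetric]
 proof (rule approx_covers[OF g(1) open_ball sub' s'(1) holv2 et(2) et(1)])
  show "cmod (v (ta (sy n)) z-g z)<=et/4" if "z:cball c s'" for z
   using k0 n that by (simp add: dist_norm less_imp_le)
 qed
 have "et/8>0" using et by simp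
 from irrational_rotation_dense[OF nun _ this] obtain J
  where J: "ALL w. cmod w=1 --> (EX j<=J. cmod (nu ^ j * w-1)<et/8)" using nu1(2) by blast
 define et' where "et'=min (et/8) 1"
 have et': "et'>0" "et'<=et/8" "et'<=1" using et by (auto simp: et'_def)
 have "EX de>0. ALL z. cmod (z-ze)<de --> cmod ((f ^^ j) z-ze-nu ^ j * (z-ze))<=et' * cmod (z-ze)" for j
 proof -
  have fixj: "(f ^^ j) ze=ze" using fz by (induction j) auto
  have "((f ^^ j) has_derivative (%h. nu ^ j * h)) (at ze)"
   using deriv_iter_fixed[OF fz, of j] unfolding nu_def has_field_derivative_def .
  then show ?thesis using et'(1) fixj unfolding has_derivative_at_alt by metis
 qed
 then obtain de where de: "!!j::nat. de j>0" "!!j z. cmod (z-ze)<de j ==>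
  cmod ((f ^^ j) z-ze-nu ^ j * (z-ze))<=et' * cmod (z-ze)" by metis
 define de0 where "de0=Min (de ` {..J})"
 have de0: "de0>0" "!!j. j<=J ==> de0<=de j" using de(1) by (auto simp: de0_def)
 have "deriv f ze~=0" using l1 by auto
 from local_inverse[OF holf this] obtain V where V: "open V" "ze:V" "inj_on f V" by metis
 then obtain ro where ro: "ro>0" "ball ze ro<=V" using openE by blast
 have injro: "inj_on f (ball ze ro)" by (rule inj_on_subset[OF V(3) ro(2)])
 have "ro/2>0" using ro by simp
 from h(5)[OF this] obtain N0 where N0: "ALL n>=N0. ALL z:cball c r. cmod (h n z-ze)<ro/2" by blast
 have r8: "cball c r<=ball c (8 * r)" using r(1) by auto
 have "EX d>0. ALL z:cball c r. d<=cmod (h (N0 + j) z-ze)" for j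
 proof -
  have "cont (cball c r) (%z. cmod (h (N0 + j) z-ze))"
   by (intro continuous_intros cont_sub[OF holo_cont[OF holh]] r8)
  then obtain z0 where z0: "z0:cball c r" "ALL z:cball c r. cmod (h (N0 + j) z0-ze)<=cmod (h (N0 + j) z-ze)"
   using continuous_attains_inf[OF compact_cball, of c r "%z. cmod (h (N0 + j) z-ze)"] r(1) by auto
  then show ?thesis using hne[of z0 "N0 + j"] r8 by (intro exI[of _ "cmod (h (N0 + j) z0-ze)"]) auto
 qed
 then obtain D where D: "!!j. D j>0" "!!j z. z:cball c r ==> D j<=cmod (h (N0 + j) z-ze)" by metis
 define D0 where "D0=Min (D ` {..J})"
 have D0: "D0>0" "!!j. j<=J ==> D0<=D j" using D(1) by (auto simp: D0_def)
 \<comment> \<open>Below \<open>de0\<close> the iterates \<open>f ^^ j\<close> with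
   \<open>j<=J\<close> are nearly rotations, \<open>ro/4\<close> keeps these first iterates within
   \<open>ro/2\<close> of \<open>ze\<close>, and \<open>D0\<close> is kept for the final
   contradiction.\<close>
 define E where "E=min de0 (min (ro/4) D0)"
 have E: "E>0" "E<=de0" "E<=ro/4" "E<=D0" using de0 ro D0 by (auto simp: E_def)
 from h(5)[OF E(1)] obtain N1 where N1: "ALL n>=N1. ALL z:cball c r. cmod (h n z-ze)<E" by blast
 define k where "k=max k0 (max N1 (N0 + J))"
 define n where "n=ta (sy k)"
 have nk: "n>=k" using ta seq_suble[OF g(2), of k] unfolding n_def by (meson order_trans)
 define m where "m=n-N0"
 have m: "n=N0 + m" "J<=m" using nk by (auto simp: m_def k_def)
 define R where "R=cmod (h n c-ze)"
 have R: "R>0" "R<E" using hne[OF cB, of n] N1 nk cc by (auto simp: R_def k_def)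
 \<comment> \<open>Some \<open>nu ^ j\<close> with \<open>j<=J\<close> turns the direction of
   \<open>z-ze\<close> almost into that of \<open>h n c-ze\<close>. The iterate
   \<open>f ^^ j\<close> is close to this rotation, and the rescaled branch \<open>v n\<close>
   covers a disc about \<open>1\<close>.\<close>
 have circ: "EX j<=J. EX b:cball c r. (f ^^ j) z=h n b" if z: "cmod (z-ze)=R" for z
 proof -
  define y where "y=h n c-ze"
  have y: "y~=0" "cmod y=R" using R by (auto simp: y_def R_def)
  have "cmod ((z-ze)/y)=1" using z y R(1) by (simp add: norm_divide)
  then obtain j where j: "j<=J" "cmod (nu ^ j * ((z-ze)/y)-1)<et/8" using J by blast
  have "cmod (z-ze)<de j" using z R(2) E(2) de0(2)[OF j(1)] by linarith
  from de(2)[OF this] have a1: "cmod ((f ^^ j) z-ze-nu ^ j * (z-ze))<=et/8 * R"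
   using et'(2) R(1) z by (smt (verit) mult_right_mono)
  have qq: "((f ^^ j) z-ze)/y-1=((f ^^ j) z-ze-nu ^ j * (z-ze))/y+(nu ^ j * ((z-ze)/y)-1)"
   using y by (simp add: field_simps)
  have "cmod (((f ^^ j) z-ze-nu ^ j * (z-ze))/y)<=et/8"
   using a1 y R(1) by (simp add: norm_divide pos_divide_le_eq)
  then have "cmod (((f ^^ j) z-ze)/y-1)<et/4"
   unfolding qq using j(2) norm_triangle_ineq[of "((f ^^ j) z-ze-nu ^ j * (z-ze))/y" "nu ^ j * ((z-ze)/y)-1"] by linarith
  then have "((f ^^ j) z-ze)/y:ball 1 (et/4)" by (simp add: dist_norm norm_minus_commute)
  moreover have "ball 1 (et/4)<=v n ` ball c s'" unfolding n_def by (rule covers) (simp add: k_def)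
  ultimately obtain b where b: "b:ball c s'" "((f ^^ j) z-ze)/y=v n b" by blast
  have "(f ^^ j) z=h n b" using b(2) y(1) by (simp add: v_def y_def)
  moreover have "b:cball c r" using b(1) s'(2) by auto
  ultimately show ?thesis using j(1) by blast
 qed
 \<comment> \<open>From time \<open>j\<close> on, the orbit runs through the images of branches of
   decreasing index, which are small as long as the index is at least \<open>N0\<close>; earlier
   times are covered by the linear approximation.\<close>
 have orb: "cmod ((f ^^ i) z-ze)<=ro/2" if z: "cmod (z-ze)=R" and i: "i<=m" for z i
 proof -
  obtain j b where j: "j<=J" "b:cball c r" "(f ^^ j) z=h n b" using circ[OF z] by blast
  show ?thesis
  proof (cases "j<=i")
   case True
   have "(f ^^ i) z=(f ^^ (i-j)) ((f ^^ j) z)" using True by (simp flip: funpow_add[THEN fun_cong, unfolded o_def])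
   also have "... = h (N0+(m-(i-j))) b"
    using h(3)[of b "i-j" "N0+(m-(i-j))"] j(2,3) r8 i m(1) by (auto simp: add.assoc)
   finally show ?thesis using N0 j(2) by (simp add: less_imp_le)
  next
   case False
   then have "i<=J" using j(1) by simp
   then have "cmod (z-ze)<de i" using z R(2) E(2) de0(2) by (smt (verit))
   from de(2)[OF this] have "cmod ((f ^^ i) z-ze-nu ^ i * (z-ze))<=et' * R" unfolding z .
   moreover have "et' * R<=R" using et' R by (simp add: mult_left_le_one_le)
   moreover have "cmod (nu ^ i * (z-ze))=R" using z nun by (simp add: norm_mult norm_power)
   ultimately have "cmod ((f ^^ i) z-ze)<=R + R"
    using norm_triangle_ineq2[of "(f ^^ i) z-ze" "nu ^ i * (z-ze)"] by linarith
   then show ?thesis using R(2) E(3) by linarith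
  qed
 qed
 have disc: "cmod ((f ^^ i) z-ze)<=ro/2" if z: "z:cball ze R" and i: "i<=m" for z i
 proof (rule maximum_modulus_frontier[of "%z. (f ^^ i) z-ze" "cball ze R"])
  show "(%z. (f ^^ i) z-ze) holomorphic_on interior (cball ze R)"
   by (intro holomorphic_intros holomorphic_on_subset[OF holf_iter]) auto
  show "cont (closure (cball ze R)) (%z. (f ^^ i) z-ze)" by (intro continuous_intros contf_iter)
  show "norm ((f ^^ i) z-ze)<=ro/2" if "z:frontier (cball ze R)" for z
   using orb[OF _ i, of z] that by (auto simp: dist_norm norm_minus_commute)
 qed (use z in auto)
 have zero: "z=ze" if z: "z:cball ze R" and "i<=m" "(f ^^ i) z=ze" for z i
  using that(2,3)
 proof (induction i)
  case (Suc i)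
  have "(f ^^ i) z:ball ze ro" using disc[OF z, of i] Suc.prems ro(1) by (simp add: dist_norm norm_minus_commute)
  moreover have "f ((f ^^ i) z)=f ze" using Suc.prems fz by simp
  ultimately have "(f ^^ i) z=ze" using injro ro(1) by (meson centre_in_ball inj_onD)
  then show ?case using Suc by simp
 qed simp
 have fixm: "(f ^^ m) ze=ze" for m using fz by (induction m) auto
 \<comment> \<open>\<open>G\<close> has modulus \<open>1\<close> at \<open>ze\<close> and no zeros
   on the disc, since \<open>f\<close> is injective on the region visited. On the circle
   \<open>f ^^ m\<close> reaches distance at least \<open>D0\<close> from \<open>ze\<close>, so
   \<open>1/G\<close> is at most \<open>R/D0<1\<close> there, against the maximum principle.\<close>
 define G where "G z=(if z=ze then deriv (f ^^ m) ze else ((f ^^ m) z-(f ^^ m) ze)/(z-ze))" for z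
 have holG: "G holomorphic_on UNIV" unfolding G_def by (rule pole_lemma_open[OF holf_iter open_UNIV])
 have G0: "cmod (G ze)=1" using DERIV_imp_deriv[OF deriv_iter_fixed[OF fz, of m]] nun
  by (simp add: G_def norm_power nu_def)
 have Gnz: "G z~=0" if z: "z:cball ze R" for z
 proof (cases "z=ze")
  case True
  then show ?thesis using G0 by auto
 next
  case False
  then show ?thesis using zero[OF z, of m] by (auto simp: G_def fixm)
 qed
 have "norm (inverse (G ze))<=R/D0"
 proof (rule maximum_modulus_frontier[of "%z. inverse (G z)" "cball ze R"])
  show "(%z. inverse (G z)) holomorphic_on interior (cball ze R)"
   by (intro holomorphic_intros holomorphic_on_subset[OF holG]) (use Gnz in auto)
  show "cont (closure (cball ze R)) (%z. inverse (G z))"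
   by (intro continuous_intros cont_sub[OF holo_cont[OF holG]]) (use Gnz in auto)
  show "norm (inverse (G z))<=R/D0" if "z:frontier (cball ze R)" for z
  proof -
   have z: "cmod (z-ze)=R" using that by (auto simp: dist_norm norm_minus_commute)
   obtain j b where j: "j<=J" "b:cball c r" "(f ^^ j) z=h n b" using circ[OF z] by blast
   have jm: "j<=m" using j m by simp
   have "(f ^^ m) z=(f ^^ (m-j)) ((f ^^ j) z)" using jm by (simp flip: funpow_add[THEN fun_cong, unfolded o_def])
   also have "... = h (N0 + j) b"
    using h(3)[of b "m-j" "N0 + j"] j(2,3) r8 jm m(1) by auto
   finally have "D0<=cmod ((f ^^ m) z-ze)" using D(2)[OF j(2), of j] D0(2)[OF j(1)] by simp
   moreover have "z~=ze" using z R by auto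
   ultimately show ?thesis using z D0(1) R(1)
    by (simp add: G_def fixm norm_inverse norm_divide frac_le)
  qed
 qed (use R in auto)
 then have "1<=R/D0" using G0 by (simp add: norm_inverse)
 then show False using R E(4) D0(1) by (simp add: field_simps)
qed

end

text \<open>The Fatou coordinate \<open>-1 / (b (z - ze)^p)\<close> turns the germ into an approximate translation by \<open>1\<close>.\<close>

lemma fatou_coordinate:
 assumes f: "f holomorphic_on UNIV" and fz: "f ze=ze" "deriv f ze=1" and ne: "f x~=x"
 obtains b p ro where "b~=0" "p>0" "ro>0"
  "ALL z. 0<cmod (z-ze) & cmod (z-ze)<ro -->
   f z~=ze & cmod (- 1/(b * (f z-ze) ^ p) - - 1/(b * (z-ze) ^ p)-1)<=1/20 &
   7<=cmod (- 1/(b * (z-ze) ^ p))"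
proof -
 define F where "F z=f z-z" for z
 have holF: "F holomorphic_on UNIV" unfolding F_def by (intro holomorphic_intros f)
 have F0: "F ze=0" using fz by (simp add: F_def)
 have "~  F constant_on UNIV" using F0 ne unfolding constant_on_def F_def by (metis UNIV_I diff_eq_diff_eq diff_self)
 then obtain g r n where g: "0<n" "0<r" "g holomorphic_on ball ze r"
  "!!w. w:ball ze r ==> F w=(w-ze) ^ n * g w" "!!w. w:ball ze r ==> g w~=0"
  using holomorphic_factor_zero_nonconstant[OF holF open_UNIV connected_UNIV UNIV_I F0] by metis
 have z0: "ze:ball ze r" using g(2) by simp
 have dF: "(F has_field_derivative 0) (at ze)"
 proof -
  have "(f has_field_derivative 1) (at ze)" using holomorphic_derivI[OF f open_UNIV, of ze] fz by simp
  then show ?thesis unfolding F_def by (auto intro!: derivative_eq_intros)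
 qed
 have n1: "n~=1"
 proof
  assume n: "n=1"
  have "((%w. (w-ze) * g w) has_field_derivative 1 * g ze + deriv g ze * (ze-ze)) (at ze)"
   by (rule DERIV_mult[OF _ holomorphic_derivI[OF g(3) open_ball z0]]) (auto intro!: derivative_eq_intros)
  then have d: "((%w. (w-ze) * g w) has_field_derivative g ze) (at ze)" by simp
  have "(F has_field_derivative g ze) (at ze)"
   by (rule has_field_derivative_transform_within_open[OF d open_ball z0]) (use g(4) n in auto)
  then have "g ze=0" using dF DERIV_unique by blast
  then show False using g(5) z0 by blast
 qed
 define p where "p=n-1"
 have p: "p>0" "n=Suc p" using n1 g(1) by (auto simp: p_def)
 \<comment> \<open>As \<open>f z-z=(z-ze) ^ Suc p * g z\<close>, to first order one step adds
   \<open>p * g ze/b\<close> to the coordinate; this \<open>b\<close> makes the amount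
   \<open>1\<close>.\<close>
 define b where "b = of_nat p * g ze"
 have b: "b~=0" using p g(5)[OF z0] by (simp add: b_def)
 define u where "u z=(z-ze) ^ p * g z" for z
 have gc: "(g \<longlongrightarrow> g ze) (at ze)"
  using holo_cont[OF g(3)] z0 continuous_on_eq_continuous_at[OF open_ball] isCont_def by blast
 have near: "\<forall>\<^sub>F z in at ze. z:ball ze r & z~=ze"
  unfolding eventually_at by (intro exI[of _ r]) (auto simp: dist_commute g(2))
 have u0: "(u \<longlongrightarrow> 0) (at ze)"
 proof -
  have "((%z. (z-ze) ^ p * g z) \<longlongrightarrow> (ze-ze) ^ p * g ze) (at ze)" by (intro tendsto_intros gc)
  then show ?thesis by (simp add: u_def[abs_def] zero_power[OF p(1)])
 qed
 have "filterlim u (at 0) (at ze)"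
  unfolding filterlim_at using u0 near by (auto simp: u_def g(5) elim!: eventually_mono)
 moreover have "((%u::complex. (inverse ((1 + u) ^ p)-1)/u) \<longlongrightarrow> - of_nat p) (at 0)"
 proof -
  have "((%u::complex. inverse ((1 + u) ^ p)) has_field_derivative - of_nat p) (at 0)"
   by (auto intro!: derivative_eq_intros)
  then show ?thesis by (simp add: has_field_derivative_iff)
 qed
 ultimately have "((%z. (inverse ((1 + u z) ^ p)-1)/u z) \<longlongrightarrow> - of_nat p) (at ze)" by (rule filterlim_compose[rotated])
 then have lim: "((%z. - (g z/b)*((inverse ((1 + u z) ^ p)-1)/u z)) \<longlongrightarrow>-(g ze/b) * - of_nat p) (at ze)"
  by (intro tendsto_intros gc b)
 have one: "- (g ze/b) * - of_nat p=1" using b p by (simp add: b_def field_simps)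
 have "\<forall>\<^sub>F z in at ze. dist (- (g z/b)*((inverse ((1 + u z) ^ p)-1)/u z)) 1<1/20"
  using tendstoD[OF lim, of "1/20"] unfolding one by simp
 moreover have "\<forall>\<^sub>F z in at ze. dist (u z) 0<1" by (rule tendstoD[OF u0]) simp
 moreover have "\<forall>\<^sub>F z in at ze. dist (b * (z-ze) ^ p) 0<1/7"
 proof (rule tendstoD)
  have "((%z. b * (z-ze) ^ p) \<longlongrightarrow> b * (ze-ze) ^ p) (at ze)" by (intro tendsto_intros)
  then show "((%z. b * (z-ze) ^ p) \<longlongrightarrow> 0) (at ze)" by (simp add: zero_power[OF p(1)])
 qed simp
 ultimately have "\<forall>\<^sub>F z in at ze. f z~=ze & cmod (- 1/(b * (f z-ze) ^ p) - - 1/(b * (z-ze) ^ p)-1)<=1/20 &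
   7<=cmod (- 1/(b * (z-ze) ^ p))"
  using near
 proof eventually_elim
  case (elim z)
  have gz: "g z~=0" using g(5) elim by blast
  have y: "z-ze~=0" using elim by simp
  have fe: "f z-ze=(z-ze)*(1 + u z)"
   using g(4)[of z] elim p(2) unfolding F_def u_def by (simp add: algebra_simps)
  have "1 + u z~=0"
  proof
   assume "1 + u z=0"
   then have "u z = - 1" by (simp add: add_eq_0_iff)
   then show False using elim by simp
  qed
  moreover have "- 1/(b * (f z-ze) ^ p) - - 1/(b * (z-ze) ^ p) = - (g z/b)*((inverse ((1 + u z) ^ p)-1)/u z)"
   unfolding fe u_def power_mult_distrib using b y gz calculation unfolding u_def by (simp add: field_simps)
  moreover have "7<=cmod (- 1/(b * (z-ze) ^ p))"
  proof -
   have "cmod (b * (z-ze) ^ p)>0" using b y by simp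
   moreover have "cmod (b * (z-ze) ^ p)<1/7" using elim by (simp only: dist_norm diff_zero)
   ultimately have "7<=1/cmod (b * (z-ze) ^ p)" by (simp add: field_simps)
   then show ?thesis by (simp add: norm_divide)
  qed
  ultimately show ?case using y fe elim by (auto simp: dist_norm)
 qed
 then obtain ro where "ro>0" "ALL z. z~=ze & dist z ze<ro --> f z~=ze &
   cmod (- 1/(b * (f z-ze) ^ p) - - 1/(b * (z-ze) ^ p)-1)<=1/20 & 7<=cmod (- 1/(b * (z-ze) ^ p))"
  unfolding eventually_at by auto
 then show ?thesis using b p(1) by (intro that[of b p ro]) (auto simp: dist_norm)
qed

section \<open>Orbits near a parabolic fixed point\<close>

text \<open>The cross term in the square of \<open>cmod (w + k)\<close> is at least
  \<open>- k * cmod w/4\<close>, which the squares outweigh. The bound \<open>k/20\<close> is the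
  error accumulated in \<open>k\<close> approximate unit steps.\<close>

lemma approximate_translation_far:
 assumes "cmod e<=real k/20" "- cmod w/8<=Re w"
 shows "3/4 * cmod w<=cmod (w + of_nat k + e)"
proof -
 define x where "x=cmod w"
 have x: "x>=0" "(Re w)\<^sup>2+(Im w)\<^sup>2=x\<^sup>2" by (auto simp: x_def cmod_power2)
 have k: "real k>=0" by simp
 have "(3/4 * x + real k/20)\<^sup>2<=(Re w + real k)\<^sup>2+(Im w)\<^sup>2"
 proof -
  have "- (x * real k/4)<=2*(Re w * real k)" using mult_right_mono[OF assms(2) k] by (simp add: x_def)
  moreover have "0<=(x-real k)\<^sup>2" by simp
  moreover have "x * real k>=0" "x\<^sup>2>=0" "(real k)\<^sup>2>=0" using x by auto
  moreover have "(3/4 * x + real k/20)\<^sup>2=9/16 * x\<^sup>2+3/40*(x * real k)+(real k)\<^sup>2/400"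
   by (simp add: power2_sum power_mult_distrib power_divide)
  moreover have "(Re w + real k)\<^sup>2=(Re w)\<^sup>2+2*(Re w * real k)+(real k)\<^sup>2" by (simp add: power2_sum)
  moreover have "(x-real k)\<^sup>2=x\<^sup>2-2*(x * real k)+(real k)\<^sup>2" by (simp add: power2_diff)
  ultimately show ?thesis using x(2) by linarith
 qed
 also have "... = (cmod (w + of_nat k))\<^sup>2" by (simp add: cmod_power2)
 finally have "3/4 * x + real k/20<=cmod (w + of_nat k)" using power2_le_imp_le by fastforce
 moreover have "cmod (w + of_nat k)<=cmod (w + of_nat k + e) + cmod e" using norm_triangle_ineq4[of "w + of_nat k + e" e] by simp
 ultimately show ?thesis using assms(1) by (simp add: x_def)
qed

text \<open>Two statements support each other: closeness to \<open>ze\<close> keeps the step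
  estimate applicable, and the step estimate keeps the coordinate above \<open>3/4\<close> of its
  initial modulus. That loss costs at most a factor \<open>4/3\<close> in distance, as
  \<open>p>=1\<close>.\<close>

lemma attracting_orbit:
 assumes b: "b~=0" "p>0" and W: "!!z. 0<cmod (z-ze) & cmod (z-ze)<ro ==>
   f z~=ze & cmod (- 1/(b * (f z-ze) ^ p) - - 1/(b * (z-ze) ^ p)-1)<=1/20"
  and y: "0<cmod (y-ze)" "cmod (y-ze)<ro/2" and w: "w = - 1/(b * (y-ze) ^ p)" "- cmod w/8<=Re w"
 shows "0<cmod ((f ^^ k) y-ze) & cmod ((f ^^ k) y-ze)<=4/3 * cmod (y-ze) &
  cmod (- 1/(b * ((f ^^ k) y-ze) ^ p)-(w + of_nat k))<=real k/20"
proof (induction k)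
 case 0
 then show ?case using y w by simp
next
 case (Suc k)
 let ?z = "(f ^^ k) y"
 have "cmod (?z-ze)<ro" using Suc y by linarith
 then have z: "f ?z~=ze" "cmod (- 1/(b * (f ?z-ze) ^ p) - - 1/(b * (?z-ze) ^ p)-1)<=1/20" using W Suc by blast+
 have e: "cmod (- 1/(b * (f ?z-ze) ^ p)-(w + of_nat (Suc k)))<=real (Suc k)/20"
 proof -
  have "- 1/(b * (f ?z-ze) ^ p)-(w + of_nat (Suc k)) =
   (- 1/(b * (f ?z-ze) ^ p) - - 1/(b * (?z-ze) ^ p)-1)+(- 1/(b * (?z-ze) ^ p)-(w + of_nat k))" by simp
  also have "cmod ... <= 1/20 + real k/20" by (rule norm_triangle_le, rule add_mono) (use z(2) Suc in auto)
  finally show ?thesis by (simp add: add_divide_distrib)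
 qed
 have "3/4 * cmod w<=cmod (w + of_nat (Suc k)+(- 1/(b * (f ?z-ze) ^ p)-(w + of_nat (Suc k))))"
  by (rule approximate_translation_far[OF e w(2)])
 then have "3/4 * cmod w<=cmod (1/(b * (f ?z-ze) ^ p))" by simp
 then have "3/4*(1/(cmod b * cmod (y-ze) ^ p))<=1/(cmod b * cmod (f ?z-ze) ^ p)"
  unfolding w(1) by (simp add: norm_divide norm_mult norm_power)
 then have "cmod (f ?z-ze) ^ p<=4/3 * cmod (y-ze) ^ p" using y(1) z(1) b(1) by (simp add: field_simps)
 also have "... <= (4/3) ^ p * cmod (y-ze) ^ p"
  using self_le_power[of "4/3::real" p] b(2) by (intro mult_right_mono) auto
 also have "... = (4/3 * cmod (y-ze)) ^ p" by (simp only: power_mult_distrib)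
 finally have "cmod (f ?z-ze)<=4/3 * cmod (y-ze)"
  using b(2) by (simp add: power_mono_iff)
 then show ?case using z(1) e by simp
qed

text \<open>A step of about \<open>+1\<close> that does not decrease the modulus cannot start far to
  the left. The bound \<open>7\<close> absorbs the constant terms into the slope
  \<open>1/8\<close>.\<close>

lemma fatou_right_half_plane:
 assumes "cmod w<=cmod w'" "cmod (w'-w-1)<=1/20" "7<=cmod w" shows "- cmod w/8<Re w"
proof -
 have "w'=(w+1)+(w'-w-1)" by simp
 then have "cmod w'<=cmod (w+1) + cmod (w'-w-1)" by (metis norm_triangle_ineq)
 then have "cmod w-1/20<=cmod (w+1)" using assms by linarith
 then have "(cmod w-1/20)\<^sup>2<=(cmod (w+1))\<^sup>2" using assms(3) by (intro power_mono) auto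
 also have "... = (cmod w)\<^sup>2+2 * Re w+1" unfolding cmod_power2 by (simp add: power2_sum)
 finally have "- (cmod w/10)+1/400<=2 * Re w+1" by (simp add: power2_diff power_divide)
 then show ?thesis using assms(3) by linarith
qed

text \<open>At a parabolic \<open>ze\<close>, a point that is not moved farther away lies outside a
  left sector in the Fatou coordinate, from where the entire orbit stays near; this is an open
  condition. Near a repelling point every other point is moved farther away, so the premise
  fails.\<close>

lemma trapped_at_fixed_point:
 assumes f: "f holomorphic_on UNIV" and fz: "f ze=ze" and ne: "f x~=x"
  and l: "cmod (deriv f ze)>1 | deriv f ze=1"
 obtains ro where "ro>0" "ALL z. 0<cmod (z-ze) & cmod (z-ze)<ro & cmod (f z-ze)<=cmod (z-ze) -->
  (EX N. open N & z:N & (ALL y:N. ALL s. cmod ((f ^^ s) y-ze)<2 * cmod (z-ze)))"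
proof (cases "deriv f ze=1")
 case True
 obtain b p ro where W: "b~=0" "p>0" "ro>0"
  "ALL z. 0<cmod (z-ze) & cmod (z-ze)<ro -->
   f z~=ze & cmod (- 1/(b * (f z-ze) ^ p) - - 1/(b * (z-ze) ^ p)-1)<=1/20 &
   7<=cmod (- 1/(b * (z-ze) ^ p))" by (rule fatou_coordinate[OF f fz True ne])
 define w where "w z = - 1/(b * (z-ze) ^ p)" for z
 have "EX N. open N & z:N & (ALL y:N. ALL s. cmod ((f ^^ s) y-ze)<2 * cmod (z-ze))"
  if z: "0<cmod (z-ze)" "cmod (z-ze)<ro/4" "cmod (f z-ze)<=cmod (z-ze)" for z
 proof -
  have Wz: "f z~=ze" "cmod (w (f z)-w z-1)<=1/20" "7<=cmod (w z)"
   using W(4)[rule_format, of z] z unfolding w_def by auto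
  have "cmod (f z-ze) ^ p<=cmod (z-ze) ^ p" using z(3) by (simp add: power_mono)
  then have "cmod (w z)<=cmod (w (f z))" using Wz(1) z(1) W(1) unfolding w_def
   by (simp add: norm_divide norm_mult norm_power frac_le)
  then have re: "- cmod (w z)/8<Re (w z)" using fatou_right_half_plane Wz by blast
  have cw: "cont (- {ze}) w" unfolding w_def using W(1) by (intro continuous_intros) auto
  define N where "N={y : - {ze}. 0<Re (w y) + cmod (w y)/8} Int {y. cmod (y-ze)<3/2 * cmod (z-ze)}"
  have "open N" unfolding N_def
  proof (rule open_Int)
   have "openin (top_of_set (- {ze})) ((- {ze}) Int (%y. Re (w y) + cmod (w y)/8) -` {0<..})"
    by (rule continuous_openin_preimage_gen) (auto intro!: continuous_intros cw)
   then have "open ((- {ze}) Int (%y. Re (w y) + cmod (w y)/8) -` {0<..})"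
    using openin_open_trans open_Compl[OF closed_singleton] by blast
   moreover have "(- {ze}) Int (%y. Re (w y) + cmod (w y)/8) -` {0<..}={y : - {ze}. 0<Re (w y) + cmod (w y)/8}" by auto
   ultimately show "open {y : - {ze}. 0<Re (w y) + cmod (w y)/8}" by simp
   show "open {y. cmod (y-ze)<3/2 * cmod (z-ze)}" by (intro open_Collect_less continuous_intros)
  qed
  moreover have "z:N" using re z by (auto simp: N_def)
  moreover have "cmod ((f ^^ s) y-ze)<2 * cmod (z-ze)" if y: "y:N" for y s
  proof -
   have "cmod ((f ^^ s) y-ze)<=4/3 * cmod (y-ze)"
   proof (rule attracting_orbit[OF W(1,2), THEN conjunct2, THEN conjunct1])
    show "0<cmod (y-ze)" "cmod (y-ze)<ro/2" using y z(2) W(3) by (auto simp: N_def)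
    show "- cmod (w y)/8<=Re (w y)" using y by (simp add: N_def)
   qed (use W(4) in "auto simp: w_def")
   then show ?thesis using y unfolding N_def by simp
  qed
  ultimately show ?thesis by blast
 qed
 then show ?thesis using W(3) by (intro that[of "ro/4"]) auto
next
 case False
 then have l: "cmod (deriv f ze)>1" using l by blast
 have "(f has_field_derivative deriv f ze) (at ze)" by (rule holomorphic_derivI[OF f open_UNIV UNIV_I])
 then have "((%z. (f z-f ze)/(z-ze)) \<longlongrightarrow> deriv f ze) (at ze)" by (simp add: has_field_derivative_iff)
 then have "((%z. cmod ((f z-f ze)/(z-ze))) \<longlongrightarrow> cmod (deriv f ze)) (at ze)" by (rule tendsto_norm)
 then have "\<forall>\<^sub>F z in at ze. 1<cmod ((f z-f ze)/(z-ze))" using l order_tendstoD(1) by blast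
 then obtain d where d: "d>0" "ALL z. z~=ze & dist z ze<d --> 1<cmod ((f z-f ze)/(z-ze))"
  unfolding eventually_at by auto
 have "cmod (f z-ze)>cmod (z-ze)" if "0<cmod (z-ze)" "cmod (z-ze)<d" for z
  using d(2)[rule_format, of z] that fz by (simp add: dist_norm norm_divide)
 then show ?thesis using d(1) by (intro that[of d]) (auto simp: not_le[symmetric])
qed

section \<open>Isolated points of the complement are repelling\<close>

context expansion
begin

text \<open>Over the punctured disc the inverse exists in a logarithmic coordinate. It agrees with
  the local inverse near \<open>ze\<close>, so it is \<open>2 pi i\<close> periodic and descends to
  the disc. The gain over a local inverse is the given radius \<open>e\<close>, which serves all
  iterates alike.\<close>

lemma isolated_inverse:
 assumes fz: "f ze=ze" "deriv f ze~=0" and e: "e>0" "ball ze e-{ze}<=U"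
 obtains ph where "ph holomorphic_on ball ze e" "ph ze=ze" "ALL z:ball ze e. f (ph z)=z"
proof -
 obtain N g where g: "open N" "ze:N" "inj_on f N" "open (f ` N)" "g holomorphic_on f ` N" "ALL z:N. g (f z)=z"
  by (rule local_inverse[OF holf fz(2)])
 have "ze:f ` N" using g(2) fz(1) by force
 then obtain de' where de': "de'>0" "ball ze de'<=f ` N" using g(4) openE by blast
 define de where "de=min de' e"
 have de: "de>0" "ball ze de<=f ` N" "de<=e" using de' e by (auto simp: de_def)
 have fg: "f (g z)=z" if "z:ball ze de" for z using g(6) de(2) that by force
 have gze: "g ze=ze" using g(2,6) fz(1) by force
 define T where "T de={om. Re om<ln de}" for de
 have convT: "convex (T de)" "open (T de)" for de unfolding T_def by (auto simp: convex_halfspace_Re_lt open_halfspace_Re_lt)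
 define E where "E om=ze + exp om" for om
 have Ein: "E om:ball ze de-{ze}" if "om:T de" "de>0" for om de
 proof -
  have "exp (Re om)<exp (ln de)" using that unfolding T_def by (simp only: exp_less_cancel_iff mem_Collect_eq)
  then show ?thesis using that by (simp add: E_def dist_norm)
 qed
 have contE: "cont A E" for A unfolding E_def by (intro continuous_intros)
 define om0 where "om0=complex_of_real (ln (de/2))"
 have Tsub: "T de<=T e" using de unfolding T_def by auto (meson ln_le_cancel_iff less_le_trans order_less_le_trans)
 have om0: "om0:T de" using de(1) by (simp add: om0_def T_def)
 have "E om0:ball ze de" using Ein[OF om0 de(1)] by simp
 then have w: "(f ^^ 1) (g (E om0))=E om0" using fg by simp
 have EU: "E ` T e<=U" using Ein e by blast
 obtain h where h: "cont (T e) h" "h om0=g (E om0)" "ALL om:T e. h om:U & (f ^^ 1) (h om)=E om"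
  using lift_iter[OF convex_imp_simply_connected[OF convT(1)] convex_imp_locally_path_connected[OF convT(1)] contE EU subsetD[OF Tsub om0] w] by blast
 have hg: "h om=g (E om)" if "om:T de" for om
 proof (rule lift_unique[of "T de" h "%om. g (E om)" om0 om 1])
  show "connected (T de)" by (rule convex_connected[OF convT(1)])
  show "cont (T de) h" by (rule cont_sub[OF h(1) Tsub])
  show "cont (T de) (%om. g (E om))"
   by (rule cont_comp[OF holo_cont[OF g(5)] contE]) (use Ein de in blast)
  fix z assume z: "z:T de"
  show "(f ^^ 1) (h z)=(f ^^ 1) (g (E z))" using h(3) Tsub z fg Ein[OF z de(1)] by auto
  show "(f ^^ 1) (h z):U" using h(3) Tsub z EU by auto
 qed (use that om0 h in auto)
 have per: "h om=h (om + of_real (of_int (2 * k) * pi) * \<i>)" if w: "om:T e" for om k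
 proof (rule lift_unique[of "T e" h "%om. h (om + of_real (of_int (2 * k) * pi) * \<i>)" om0 om 1])
  have Ek: "E (om + of_real (of_int (2 * k) * pi) * \<i>)=E om" for om
   unfolding E_def by (metis exp_eq)
  have Tk: "om:T d ==> om + of_real (of_int (2 * k) * pi) * \<i>:T d" for om d unfolding T_def by simp
  show "connected (T e)" by (rule convex_connected[OF convT(1)])
  show "cont (T e) (%om. h (om + of_real (of_int (2 * k) * pi) * \<i>))"
   by (rule cont_comp[OF h(1)]) (auto intro!: continuous_intros Tk simp del: of_int_mult of_real_mult)
  show "h om0=h (om0 + of_real (of_int (2 * k) * pi) * \<i>)" using hg[OF om0] hg[OF Tk[OF om0]] Ek by simp
  fix z assume z: "z:T e"
  show "(f ^^ 1) (h z)=(f ^^ 1) (h (z + of_real (of_int (2 * k) * pi) * \<i>))" using h(3) z Tk[OF z] Ek by metis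
  show "(f ^^ 1) (h z):U" using h(3) z EU by auto
 qed (use w h om0 Tsub in auto)
 define ph where "ph z=(if z=ze then ze else h (Ln (z-ze)))" for z
 have LnT: "Ln (z-ze):T d" if "z:ball ze d" "z~=ze" for z d
 proof -
  have "0<cmod (z-ze)" "cmod (z-ze)<d" using that by (auto simp: dist_norm norm_minus_commute)
  then have "ln (cmod (z-ze))<ln d" by (metis less_trans ln_less_cancel_iff)
  then show ?thesis using that(2) unfolding T_def by simp
 qed
 have ELn: "E (Ln (z-ze))=z" if "z~=ze" for z using that by (simp add: E_def)
 have fph: "f (ph z)=z" if "z:ball ze e" for z
  using h(3) LnT[OF that] ELn[of z] fz(1) by (auto simp: ph_def)
 have phg: "ph z=g z" if "z:ball ze de" for z
  using hg[OF LnT[OF that]] ELn[of z] gze by (auto simp: ph_def)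
 have "isCont ph z" if z: "z:ball ze e" for z
 proof (cases "z=ze")
  case True
  have "cont (ball ze de) ph"
   by (rule continuous_on_eq[OF cont_sub[OF holo_cont[OF g(5)] de(2)]]) (simp add: phg)
  then show ?thesis using de(1) True by (simp add: continuous_on_eq_continuous_at)
 next
  case False
  define S where "S=ball z (cmod (z-ze)) Int ball ze e"
  have S: "convex S" "open S" "z:S" "ze ~: S"
   using z False by (auto simp: S_def convex_Int dist_norm norm_minus_commute)
  obtain l where l: "cont S l" "ALL y:S. exp (l y)=y-ze"
   using continuous_log_convex[OF S(1), of "%y. y-ze"] S(4) by (force intro!: continuous_intros)
  have lT: "l y:T e" if y: "y:S" for y
  proof -
   have "exp (Re (l y))=cmod (y-ze)" using l(2) y by (metis norm_exp_eq_Re)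
   moreover have "cmod (y-ze)<e" using y by (simp add: S_def dist_norm norm_minus_commute)
   ultimately show ?thesis unfolding T_def using e(1) by (metis exp_less_cancel_iff exp_ln mem_Collect_eq)
  qed
  have "ph y=h (l y)" if y: "y:S" for y
  proof -
   have yze: "y~=ze" using y S(4) by blast
   then have "exp (l y)=exp (Ln (y-ze))" using l(2) y by simp
   then obtain k where "l y=Ln (y-ze) + of_real (of_int (2 * k) * pi) * \<i>" unfolding exp_eq by blast
   then show ?thesis using per[of "Ln (y-ze)" k] LnT[of y e] y yze unfolding ph_def S_def by simp
  qed
  moreover have "cont S (%y. h (l y))" by (rule cont_comp[OF h(1) l(1)]) (use lT in auto)
  ultimately have "cont S ph" by (metis (no_types, lifting) continuous_on_cong)
  then show ?thesis using S by (simp add: continuous_on_eq_continuous_at)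
 qed
 then have "cont (ball ze e) ph" by (simp add: continuous_on_eq_continuous_at)
 then have "ph holomorphic_on ball ze e" by (rule holomorphic_right_inverse[OF open_ball _ holf fph])
 then show ?thesis by (rule that) (use fph in "auto simp: ph_def")
qed

text \<open>For every \<open>n\<close> the inverse of \<open>f ^^ n\<close> fixing \<open>ze\<close>
  exists on the same disc. Over a circle in \<open>U\<close> it shrinks as \<open>n\<close> grows,
  so by the maximum principle it maps the disc into a smaller one, and Cauchy's estimate bounds its
  derivative at \<open>ze\<close> by \<open>2/3\<close>.\<close>

lemma isolated_repelling:
 assumes fz: "f ze=ze" "deriv f ze~=0" and e: "e>0" "ball ze e-{ze}<=U"
 shows "cmod (deriv f ze)>1"
proof -
 have fixn: "(f ^^ n) ze=ze" for n using fz(1) by (induction n) auto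
 have dn: "deriv (f ^^ n) ze=deriv f ze ^ n" for n using DERIV_imp_deriv[OF deriv_iter_fixed[OF fz(1)]] .
 have inv: "EX ph. ph holomorphic_on ball ze e & ph ze=ze & (ALL z:ball ze e. (f ^^ n) (ph z)=z)" if n: "n>0" for n
 proof -
  interpret it: expansion "f ^^ n" U R0 by (rule iterate[OF n])
  have "deriv (f ^^ n) ze~=0" using fz(2) by (simp add: dn)
  then show ?thesis using it.isolated_inverse[OF fixn _ e] by metis
 qed
 obtain a where a: "a:U" "f a ~: U" using pt by blast
 have aze: "a~=ze" using a fz(1) by auto
 obtain M where M: "!!c r h. r>0 ==> h holomorphic_on ball c (4 * r) ==> inj_on h (ball c (4 * r)) ==>
  (ALL z:ball c (4 * r). h z~=(0::complex)) ==> (ALL z:cball c r. cmod (h z/h c)<=M)"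
  using nonvanishing_injective_bound by blast
 define r where "r=e/8"
 have r: "r>0" "r<e" "r<e/4" using e(1) by (auto simp: r_def)
 define p where "p t=ze + of_real r * exp (2 * of_real pi * \<i> * of_real t)" for t :: real
 have pr: "cmod (p t-ze)=r" for t using r(1) by (simp add: p_def norm_mult)
 have cp: "cont {0..1} p" unfolding p_def by (intro continuous_intros)
 have pU: "p ` {0..1}<=U"
 proof
  fix z assume "z:p ` {0..1}"
  then have "cmod (z-ze)=r" using pr by auto
  then have "z:ball ze e-{ze}" using r by (auto simp: dist_norm norm_minus_commute)
  then show "z:U" using e(2) by blast
 qed
 have onto: "EX t:{0..1}. p t=z" if "cmod (z-ze)=r" for z
 proof -
  have "z:path_image (circlepath ze r)" using that r(1) by (simp add: dist_norm norm_minus_commute)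
  then show ?thesis unfolding path_image_def circlepath p_def by auto
 qed
 have "r/2>0" using r by simp
 from path_shrink[OF cp pU _ this, of "cmod a + M * cmod (ze-a)"] obtain J where J: "ALL n>=J. ALL de.
  cont {0..1} de --> (ALL t:{0..1}. (f ^^ n) (de t)=p t) -->
  (EX t:{0..1}. cmod (de t)<=cmod a + M * cmod (ze-a)) -->
  (ALL s:{0..1}. ALL t:{0..1}. cmod (de s-de t)<r/2)" by auto
 define n where "n=Suc J"
 obtain ph where ph: "ph holomorphic_on ball ze e" "ph ze=ze" "ALL z:ball ze e. (f ^^ n) (ph z)=z"
  using inv[of n] unfolding n_def by blast
 have pha: "ph z~=a" if z: "z:ball ze e" for z
 proof
  assume "ph z=a"
  then have "(f ^^ n) a=z" using ph(3) z by blast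
  then show False using ph(2) \<open>ph z=a\<close> aze e(2) z sub_iter_pos[of n a] a(2) by (cases "z=ze") (auto simp: n_def)
 qed
 \<comment> \<open>\<open>path_shrink\<close> requires a bound that does not depend on
   \<open>n\<close>. It exists because \<open>ph-a\<close> is injective, has no zeros, and has the
   fixed value \<open>ze-a\<close> at the centre.\<close>
 have bnd: "cmod (ph z)<=cmod a + M * cmod (ze-a)" if z: "cmod (z-ze)<=e/4" for z
 proof -
  have "inj_on (%z. ph z-a) (ball ze e)"
  proof (rule inj_onI)
   fix x y assume "x:ball ze e" "y:ball ze e" "ph x-a=ph y-a"
   then show "x=y" using ph(3) by (metis diff_add_cancel)
  qed
  moreover have "(%z. ph z-a) holomorphic_on ball ze e" by (intro holomorphic_intros ph)
  ultimately have "ALL z:cball ze (e/4). cmod ((ph z-a)/(ph ze-a))<=M"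
   using M[of "e/4" "%z. ph z-a" ze] e(1) pha by simp
  moreover have "z:cball ze (e/4)" using z by (simp add: dist_norm norm_minus_commute)
  ultimately have "cmod ((ph z-a)/(ze-a))<=M" unfolding ph(2) by blast
  then have "cmod (ph z-a)<=M * cmod (ze-a)" using aze by (simp add: norm_divide field_simps)
  then show ?thesis using norm_triangle_ineq2[of "ph z" a] by linarith
 qed
 have pe: "p t:ball ze e" for t using pr[of t] r by (simp add: dist_norm norm_minus_commute)
 have sh: "cmod (ph (p s)-ph (p t))<r/2" if "s:{0..1}" "t:{0..1}" for s t
 proof -
  have "cont {0..1} (%t. ph (p t))"
   by (rule cont_comp[OF holo_cont[OF ph(1)] cp]) (use pe in auto)
  moreover have "ALL t:{0..1}. (f ^^ n) (ph (p t))=p t" using ph(3) pe by blast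
  moreover have "cmod (ph (p 0))<=cmod a + M * cmod (ze-a)" by (rule bnd) (use pr r in simp)
  then have "EX t:{0..1}. cmod (ph (p t))<=cmod a + M * cmod (ze-a)" by (intro bexI[of _ 0]) auto
  moreover have "J<=n" by (simp add: n_def)
  ultimately show ?thesis using J that by blast
 qed
 have sub: "cball ze r<=ball ze e" using r by auto
 have disc: "cmod (ph z-ph (p 0))<=r/2" if z: "z:cball ze r" for z
 proof (rule maximum_modulus_frontier[of "%z. ph z-ph (p 0)" "cball ze r"])
  show "(%z. ph z-ph (p 0)) holomorphic_on interior (cball ze r)"
   by (intro holomorphic_intros holomorphic_on_subset[OF ph(1)]) (use r in auto)
  show "cont (closure (cball ze r)) (%z. ph z-ph (p 0))"
   by (intro continuous_intros cont_sub[OF holo_cont[OF ph(1)]]) (use sub in simp)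
  show "norm (ph z-ph (p 0))<=r/2" if z: "z:frontier (cball ze r)" for z
  proof -
   have "cmod (z-ze)=r" using z by (auto simp: dist_norm norm_minus_commute)
   then obtain t where "t:{0..1}" "p t=z" using onto by blast
   then show ?thesis using sh[of t 0] by auto
  qed
 qed (use z in auto)
 have "norm ((deriv ^^ 1) ph ze)<=(fact 1)*(2/3 * r)/r ^ 1"
 proof (rule Cauchy_higher_deriv_bound[where y = "ph (p 0)"])
  show "ph holomorphic_on ball ze r" using ph(1) holomorphic_on_subset sub ball_subset_cball by blast
  show "cont (cball ze r) ph" using ph(1) holo_cont holomorphic_on_subset sub by blast
  show "ph w:ball (ph (p 0)) (2/3 * r)" if "w:ball ze r" for w
   using disc[of w] that r(1) by (simp add: dist_norm norm_minus_commute)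
 qed (use r in auto)
 then have d23: "cmod (deriv ph ze)<=2/3" using r by simp
 have "deriv f ze ^ n * deriv ph ze=1"
 proof -
  have dh: "(ph has_field_derivative deriv ph ze) (at ze)"
   using holomorphic_derivI[OF ph(1) open_ball, of ze] e by simp
  have "((f ^^ n) has_field_derivative (deriv f ze ^ n)) (at (ph ze))" unfolding ph(2) by (rule deriv_iter_fixed[OF fz(1)])
  from DERIV_chain[OF this dh] have "((f ^^ n) o ph has_field_derivative deriv f ze ^ n * deriv ph ze) (at ze)" .
  moreover have "((f ^^ n) o ph has_field_derivative 1) (at ze)"
  proof (rule has_field_derivative_transform_within_open[of "%z. z" 1 ze "ball ze e"])
   show "((%z. z) has_field_derivative 1) (at ze)" by (rule DERIV_ident)
  qed (use ph(3) e in auto)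
  ultimately show ?thesis by (rule DERIV_unique)
 qed
 then have "cmod (deriv f ze) ^ n * cmod (deriv ph ze)=1" by (metis norm_mult norm_one norm_power)
 moreover have "cmod (deriv f ze) ^ n * cmod (deriv ph ze)<=cmod (deriv f ze) ^ n * (2/3)"
  by (rule mult_left_mono[OF d23]) simp
 ultimately have "cmod (deriv f ze) ^ n>=3/2" by simp
 then show ?thesis using power_le_one[of "cmod (deriv f ze)" n] norm_ge_zero[of "deriv f ze"] by linarith
qed

end

section \<open>Equivalence of legs, and a normal form\<close>

text \<open>Injectivity is dropped from legs, because the curves built from germs, connecting paths
  and rays need not be simple.\<close>

definition leg_curve :: "complex set => complex => (real => complex) => bool" where
 "leg_curve U z0 ga \<longleftrightarrow> cont {0..} ga & ga 0=z0 & ga ` {0<..}<=U & filterlim ga at_infinity at_top"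


lemma leg_curve_equivalent:
 assumes "legs_equivalent U z0 ga de" shows "leg_curve U z0 ga" "leg_curve U z0 de"
proof -
 obtain H :: "real*real => complex" where H: "cont ({0..1} \<times> {0..}) H"
  "ALL t>=0. H (0, t)=ga t" "ALL t>=0. H (1, t)=de t"
  "ALL s:{0..1}. H (s, 0)=z0" "ALL s:{0..1}. ALL t>0. H (s, t):U"
  "ALL R. EX T. ALL s:{0..1}. ALL t>=T. R<cmod (H (s, t))" using assms unfolding legs_equivalent_def by blast
 have *: "leg_curve U z0 c" if s: "s:{0..1}" and c: "ALL t>=0. H (s, t)=c t" for s c
 proof -
  have "cont {0..} (%t. H (s, t))" by (rule cont_comp[OF H(1)]) (use s in "auto intro!: continuous_intros")
  then have "cont {0..} c" by (rule continuous_on_eq) (use c in auto)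
  moreover have "EX T. ALL t>=T. R<cmod (c t)" for R
  proof -
   obtain T where T: "ALL s:{0..1}. ALL t>=T. R<cmod (H (s, t))" using H(6) by blast
   then have "ALL t>=max T 0. R<cmod (c t)" using c s by (metis max.boundedE)
   then show ?thesis by blast
  qed
  moreover have "c 0=z0" using c H(4) s by (metis order_refl)
  moreover have "c ` {0<..}<=U" using c H(5) s by (metis greaterThan_iff image_subsetI less_imp_le)
  ultimately show ?thesis unfolding leg_curve_def tends_to_infinity_iff by blast
 qed
 show "leg_curve U z0 ga" "leg_curve U z0 de" using *[of 0 ga] *[of 1 de] H(2,3) by auto
qed

lemma legs_equivalent_sym:
 assumes "legs_equivalent U z0 ga de" shows "legs_equivalent U z0 de ga"
proof -
 obtain H :: "real*real => complex" where H: "cont ({0..1} \<times> {0..}) H"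
  "ALL t>=0. H (0, t)=ga t" "ALL t>=0. H (1, t)=de t"
  "ALL s:{0..1}. H (s, 0)=z0" "ALL s:{0..1}. ALL t>0. H (s, t):U"
  "ALL R. EX T. ALL s:{0..1}. ALL t>=T. R<cmod (H (s, t))" using assms unfolding legs_equivalent_def by blast
 have "cont ({0..1} \<times> {0..}) (%p. H (1-fst p, snd p))"
  by (rule cont_comp[OF H(1)]) (auto intro!: continuous_intros)
 moreover have "ALL R. EX T. ALL s:{0..1}. ALL t>=T. R<cmod (H (1-s, t))"
 proof
  fix R
  obtain T where "ALL s:{0..1}. ALL t>=T. R<cmod (H (s, t))" using H(6) by blast
  then show "EX T. ALL s:{0..1}. ALL t>=T. R<cmod (H (1-s, t))" by (intro exI[of _ T]) auto
 qed
 ultimately show ?thesis unfolding legs_equivalent_def using H(2-5)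
  by (intro exI[of _ "%p. H (1-fst p, snd p)"]) auto
qed

lemma legs_equivalent_trans:
 assumes "legs_equivalent U z0 ga de" "legs_equivalent U z0 de ep" shows "legs_equivalent U z0 ga ep"
proof -
 obtain H :: "real*real => complex" where H: "cont ({0..1} \<times> {0..}) H"
  "ALL t>=0. H (0, t)=ga t" "ALL t>=0. H (1, t)=de t"
  "ALL s:{0..1}. H (s, 0)=z0" "ALL s:{0..1}. ALL t>0. H (s, t):U"
  "ALL R. EX T. ALL s:{0..1}. ALL t>=T. R<cmod (H (s, t))" using assms(1) unfolding legs_equivalent_def by blast
 obtain K :: "real*real => complex" where K: "cont ({0..1} \<times> {0..}) K"
  "ALL t>=0. K (0, t)=de t" "ALL t>=0. K (1, t)=ep t"
  "ALL s:{0..1}. K (s, 0)=z0" "ALL s:{0..1}. ALL t>0. K (s, t):U"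
  "ALL R. EX T. ALL s:{0..1}. ALL t>=T. R<cmod (K (s, t))" using assms(2) unfolding legs_equivalent_def by blast
 define L where "L p=(if fst p<=1/2 then H (2 * fst p, snd p) else K (2 * fst p-1, snd p))" for p
 have e: "{0..1} \<times> {0..}={0..1/2} \<times> {0..} Un {1/2..1::real} \<times> {0::real..}" by auto
 have "cont ({0..1} \<times> {0..}) L" unfolding e L_def
 proof (rule continuous_on_cases)
  show "closed ({0..1/2::real} \<times> {0::real..})" "closed ({1/2..1::real} \<times> {0::real..})" by (auto intro: closed_Times)
  show "cont ({0..1/2} \<times> {0..}) (%p. H (2 * fst p, snd p))"
   by (rule cont_comp[OF H(1)]) (auto intro!: continuous_intros)
  show "cont ({1/2..1} \<times> {0..}) (%p. K (2 * fst p-1, snd p))"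
   by (rule cont_comp[OF K(1)]) (auto intro!: continuous_intros)
  show "ALL p. p:{0..1/2::real} \<times> {0::real..} & ~  fst p<=1/2 | p:{1/2..1} \<times> {0..} & fst p<=1/2 -->
   H (2 * fst p, snd p)=K (2 * fst p-1, snd p)"
  proof (intro allI impI)
   fix p :: "real*real"
   assume "p:{0..1/2} \<times> {0..} & ~  fst p<=1/2 | p:{1/2..1} \<times> {0..} & fst p<=1/2"
   then have "2 * fst p=1" "snd p>=0" by (auto simp: mem_Times_iff)
   then show "H (2 * fst p, snd p)=K (2 * fst p-1, snd p)" using H(3) K(2) by simp
  qed
 qed
 moreover have "EX T. ALL s:{0..1}. ALL t>=T. R<cmod (L (s, t))" for R
 proof -
  obtain T1 where T1: "ALL s:{0..1}. ALL t>=T1. R<cmod (H (s, t))" using H(6) by blast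
  obtain T2 where T2: "ALL s:{0..1}. ALL t>=T2. R<cmod (K (s, t))" using K(6) by blast
  show ?thesis using T1 T2 unfolding L_def by (intro exI[of _ "max T1 T2"]) auto
 qed
 ultimately show ?thesis unfolding legs_equivalent_def using H K by (intro exI[of _ L]) (auto simp: L_def)
qed

lemma legs_equivalent_reparametrise:
 assumes ga: "leg_curve U z0 ga" and ro: "cont {0..} ro" "ro 0=0" "!!t. t>0 ==> ro t>0"
  "filterlim ro at_top at_top"
 shows "legs_equivalent U z0 ga (%t. ga (ro t))"
proof -
 have ro0: "ro t>=0" if "t>=0" for t using ro(2) ro(3)[of t] that by (cases "t=0") auto
 define H where "H p=ga ((1-fst p) * snd p + fst p * ro (snd p))" for p
 have "cont ({0..1} \<times> {0..}) H" unfolding H_def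
  by (rule cont_comp[of "{0..}" ga])
   (use ga in "auto simp: leg_curve_def ro0 intro!: continuous_intros cont_comp[OF ro(1)]")
 moreover have "H (s, t):U" if "s:{0..1}" "t>0" for s t
 proof -
  have "(1-s) * t + s * ro t>0"
  proof (cases "s=0")
   case False
   then show ?thesis using that ro(3)[OF that(2)] by (intro add_nonneg_pos mult_nonneg_nonneg mult_pos_pos) auto
  qed (use that in auto)
  then show ?thesis using ga unfolding leg_curve_def H_def by auto
 qed
 moreover have "EX T. ALL s:{0..1}. ALL t>=T. R<cmod (H (s, t))" for R
 proof -
  obtain T1 where T1: "ALL t>=T1. R<cmod (ga t)" using ga unfolding leg_curve_def tends_to_infinity_iff by blast
  obtain T2 where T2: "ALL t>=T2. T1<=ro t" using ro(4) unfolding filterlim_at_top eventually_at_top_linorder by blast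
  have "R<cmod (H (s, t))" if "s:{0..1}" "t>=max T1 T2" for s t
  proof -
   have "(1-s) * T1 + s * T1<=(1-s) * t + s * ro t"
    using that T2 by (intro add_mono mult_left_mono) auto
   then show ?thesis using T1 unfolding H_def by (simp add: algebra_simps)
  qed
  then show ?thesis by blast
 qed
 ultimately show ?thesis unfolding legs_equivalent_def using ga ro(2)
  by (intro exI[of _ H]) (auto simp: H_def leg_curve_def)
qed

lemma continuous_on_split_time:
 fixes H1 H2 :: "real*real => complex"
 assumes "cont ({0..1} \<times> {a..b}) H1" "cont ({0..1} \<times> {b..}) H2"
  "!!s. s:{0..1} ==> H1 (s, b)=H2 (s, b)" "a<=b"
 shows "cont ({0..1} \<times> {a..}) (%p. if snd p<=b then H1 p else H2 p)"
proof -
 have e: "{0..1} \<times> {a..}={0..1} \<times> {a..b} Un {0..1::real} \<times> {b..}" using assms(4) by auto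
 show ?thesis unfolding e
 proof (rule continuous_on_cases)
  show "closed ({0..1::real} \<times> {a..b})" "closed ({0..1::real} \<times> {b..})" by (auto intro: closed_Times)
  show "ALL p. p:{0..1} \<times> {a..b} & ~  snd p<=b | p:{0..1} \<times> {b..} & snd p<=b --> H1 p=H2 p"
  proof (intro allI impI)
   fix p :: "real*real"
   assume "p:{0..1} \<times> {a..b} & ~  snd p<=b | p:{0..1} \<times> {b..} & snd p<=b"
   then have "snd p=b" "fst p:{0..1}" by (auto simp: mem_Times_iff)
   then show "H1 p=H2 p" using assms(3)[of "fst p"] by (metis prod.collapse)
  qed
 qed (use assms in auto)
qed

text \<open>Outside a large disc both tails have logarithms that can be made to agree at time
  \<open>ta\<close> and interpolated linearly. The tails may wind differently, since near infinity a
  homotopy only has to keep the modulus large.\<close>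

lemma legs_equivalent_tail:
 assumes c: "leg_curve U z0 ga" "leg_curve U z0 de" and R: "0<R" "!!z. R<cmod z ==> z:U"
  and ta: "0<ta" "!!t. t:{0..ta} ==> ga t=de t" "!!t. t>=ta ==> R<cmod (ga t) & R<cmod (de t)"
 shows "legs_equivalent U z0 ga de"
proof -
 have cont: "cont {ta..} ga" "cont {ta..} de"
  using c ta(1) unfolding leg_curve_def by (auto elim: cont_sub)
 have nz: "ga t~=0" "de t~=0" if "t:{ta..}" for t using ta(3)[of t] that R(1) by auto
 obtain l where l: "cont {ta..} l" "ALL t:{ta..}. exp (l t)=ga t"
  using continuous_log_convex[OF _ cont(1) nz(1)] by auto
 obtain m0 where m0: "cont {ta..} m0" "ALL t:{ta..}. exp (m0 t)=de t"
  using continuous_log_convex[OF _ cont(2) nz(2)] by auto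
 define m where "m t=m0 t+(l ta-m0 ta)" for t
 have "exp (l ta)=exp (m0 ta)" using l(2) m0(2) ta(1) ta(2)[of ta] by simp
 then have m: "cont {ta..} m" "ALL t:{ta..}. exp (m t)=de t" "m ta=l ta"
  using m0 unfolding m_def by (auto intro!: continuous_intros simp: exp_add exp_diff)
 define H1 where "H1 p=ga (snd p)" for p :: "real*real"
 define H2 where "H2 p=exp ((1 - of_real (fst p)) * l (snd p) + of_real (fst p) * m (snd p))" for p :: "real*real"
 define H where "H p=(if snd p<=ta then H1 p else H2 p)" for p
 have "cont ({0..1} \<times> {0..}) H" unfolding H_def
 proof (rule continuous_on_split_time)
  show "cont ({0..1} \<times> {0..ta}) H1" unfolding H1_def
   by (rule cont_comp[of "{0..}" ga]) (use c(1) in "auto simp: leg_curve_def intro!: continuous_intros")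
  show "cont ({0..1} \<times> {ta..}) H2" unfolding H2_def
   by (intro continuous_intros cont_comp[OF l(1)] cont_comp[OF m(1)]) auto
  show "H1 (s, ta)=H2 (s, ta)" for s using l(2) m(3) by (simp add: H1_def H2_def algebra_simps)
 qed (use ta(1) in simp)
 moreover have big: "min (cmod (ga t)) (cmod (de t))<=cmod (H (s, t))" if st: "s:{0..1}" "t>=ta" for s t
 proof -
  have H2: "H (s, t)=H2 (s, t)" using st l(2) m(3) by (auto simp: H_def H1_def H2_def algebra_simps)
  have e: "exp (Re (l t))=cmod (ga t)" "exp (Re (m t))=cmod (de t)" using l(2) m(2) st by (metis atLeast_iff norm_exp_eq_Re)+
  define mw where "mw=min (Re (l t)) (Re (m t))"
  have "(1-s) * mw + s * mw<=(1-s) * Re (l t) + s * Re (m t)"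
   using st by (intro add_mono mult_left_mono) (auto simp: mw_def)
  then have "exp mw<=exp ((1-s) * Re (l t) + s * Re (m t))" by (simp add: algebra_simps)
  moreover have "exp mw=min (cmod (ga t)) (cmod (de t))" unfolding mw_def e[symmetric] by (auto simp: min_def)
  ultimately show ?thesis unfolding H2 H2_def by (simp add: norm_exp_eq_Re)
 qed
 moreover have "H (s, t):U" if "s:{0..1}" "t>0" for s t
 proof (cases "t<=ta")
  case True
  then show ?thesis using c(1) that unfolding H_def H1_def leg_curve_def by auto
 next
  case False
  then show ?thesis using big[of s t] ta(3)[of t] that by (intro R(2)) auto
 qed
 moreover have "EX T. ALL s:{0..1}. ALL t>=T. B<cmod (H (s, t))" for B
 proof -
  obtain T1 where T1: "ALL t>=T1. B<cmod (ga t)" using c(1) unfolding leg_curve_def tends_to_infinity_iff by blast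
  obtain T2 where T2: "ALL t>=T2. B<cmod (de t)" using c(2) unfolding leg_curve_def tends_to_infinity_iff by blast
  have "B<cmod (H (s, t))" if "s:{0..1}" "t>=max ta (max T1 T2)" for s t
   using big[of s t] T1 T2 that by (auto simp: min_def split: if_splits intro: less_le_trans)
  then show ?thesis by blast
 qed
 moreover have "H (0, t)=ga t" "H (1, t)=de t" if "t>=0" for t
  using that l(2) m(2) ta(2)[of t] by (auto simp: H_def H1_def H2_def)
 moreover have "H (s, 0)=z0" for s using c(1) ta(1) by (simp add: H_def H1_def leg_curve_def)
 ultimately show ?thesis unfolding legs_equivalent_def by (intro exI[of _ H]) auto
qed

text \<open>A normal form: a germ, a compact path, and the radial ray from its end point. It reduces
  equivalence of legs to homotopy of compact paths.\<close>

definition extend :: "(real => complex) => (real => complex) => real => complex" where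
 "extend c P t=(if t<=1 then c t else if t<=2 then P (t-1) else of_real (t-1) * P 1)"

text \<open>Both the germ and the far end of the path may move. \<open>extend_absorb\<close>
  exploits the first freedom and \<open>extend_drop\<close> the second.\<close>

lemma extend_equivalent:
 fixes H K :: "real*real => complex"
 assumes H: "cont ({0..1} \<times> {0..1}) H" "!!s. s:{0..1} ==> H (s, 0)=z0"
  "!!s t. s:{0..1} ==> t:{0<..1} ==> H (s, t):U"
  and K: "cont ({0..1} \<times> {0..1}) K" "!!s. s:{0..1} ==> K (s, 0)=H (s, 1)"
  "!!s t. s:{0..1} ==> t:{0..1} ==> K (s, t):U"
  and R: "0<R" "!!z. R<cmod z ==> z:U" "!!s. s:{0..1} ==> R<cmod (K (s, 1))"
 shows "legs_equivalent U z0 (extend (%t. H (0, t)) (%t. K (0, t))) (extend (%t. H (1, t)) (%t. K (1, t)))"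
proof -
 define L where "L p=extend (%t. H (fst p, t)) (%t. K (fst p, t)) (snd p)" for p
 have Le: "L=(%p. if snd p<=1 then H p else if snd p<=2 then K (fst p, snd p-1) else of_real (snd p-1) * K (fst p, 1))"
  by (auto simp: L_def extend_def fun_eq_iff)
 have "cont ({0..1} \<times> {0..}) L" unfolding Le
 proof (rule continuous_on_split_time[OF H(1)])
  show "cont ({0..1} \<times> {1..}) (%p. if snd p<=2 then K (fst p, snd p-1) else of_real (snd p-1) * K (fst p, 1))"
   by (rule continuous_on_split_time) (auto intro!: continuous_intros cont_comp[OF K(1)])
 qed (use K(2) in auto)
 moreover have "L (s, t):U" if s: "s:{0..1}" and t: "t>0" for s t
 proof -
  have "of_real (t-1) * K (s, 1):U" if "t>2"
  proof (rule R(2))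
   have "1 * R<(t-1) * cmod (K (s, 1))" using that R(1) R(3)[OF s] by (intro mult_strict_mono) auto
   then show "R<cmod (of_real (t-1) * K (s, 1))" using that by (simp add: norm_mult del: of_real_diff)
  qed
  then show ?thesis using H(3)[OF s, of t] K(3)[OF s, of "t-1"] t by (auto simp: Le)
 qed
 moreover have "EX T. ALL s:{0..1}. ALL t>=T. B<cmod (L (s, t))" for B
 proof -
  have p: "\<bar>B\<bar>/R>=0" using R(1) by simp
  have "B<cmod (L (s, t))" if s: "s:{0..1}" and t: "t>=3 + \<bar>B\<bar>/R" for s t
  proof -
   have "(\<bar>B\<bar>/R+1) * R<(t-1) * cmod (K (s, 1))"
    by (rule mult_le_less_imp_less) (use t p R(1) R(3)[OF s] in linarith)+
   moreover have "\<bar>B\<bar><(\<bar>B\<bar>/R+1) * R" using R(1) by (simp add: field_simps)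
   moreover have "cmod (L (s, t))=(t-1) * cmod (K (s, 1))" using t p by (simp add: Le norm_mult del: of_real_diff)
   ultimately show ?thesis by linarith
  qed
  then show ?thesis by blast
 qed
 ultimately show ?thesis unfolding legs_equivalent_def using H(2) by (intro exI[of _ L]) (auto simp: L_def extend_def)
qed

lemma leg_curve_extend:
 assumes "cont {0..1} c" "c 0=z0" "c ` {0<..1}<=U" "path P" "path_image P<=U" "P 0=c 1"
  and R: "0<R" "!!z. R<cmod z ==> z:U" "R<cmod (P 1)"
 shows "leg_curve U z0 (extend c P)"
proof (rule leg_curve_equivalent(1))
 have "legs_equivalent U z0 (extend (%t. c (snd (0::real, t))) (%t. P (snd (0::real, t))))
   (extend (%t. c (snd (1::real, t))) (%t. P (snd (1::real, t))))"
 proof (rule extend_equivalent[OF _ _ _ _ _ _ R(1,2)])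
  show "cont ({0..1} \<times> {0..1}) (%p. c (snd p))" by (rule cont_comp[OF assms(1)]) (auto intro!: continuous_intros)
  show "cont ({0..1} \<times> {0..1}) (%p. P (snd p))"
   by (rule cont_comp[OF assms(4)[unfolded path_def]]) (auto intro!: continuous_intros)
  show "P (snd (s, t)):U" if "t:{0..1}" for s t :: real using assms(5) that unfolding path_image_def by auto
 qed (use assms in auto)
 then show "legs_equivalent U z0 (extend c P) (extend c P)" by simp
qed

lemma extend_homotopic:
 assumes c: "cont {0..1} c" "c 0=z0" "c ` {0<..1}<=U" and h: "homotopic_paths U P Q" "P 0=c 1"
  and R: "0<R" "!!z. R<cmod z ==> z:U" "R<cmod (P 1)"
 shows "legs_equivalent U z0 (extend c P) (extend c Q)"
proof -
 obtain h where h: "cont ({0..1} \<times> {0..1}) h" "h:({0..1} \<times> {0..1}) \<rightarrow> U"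
  "ALL x:{0..1}. h (0, x)=P x" "ALL x:{0..1}. h (1, x)=Q x"
  "ALL t:{0..1::real}. pathstart (h o Pair t)=pathstart P & pathfinish (h o Pair t)=pathfinish P"
  using h(1) unfolding homotopic_paths by auto
 have "legs_equivalent U z0 (extend (%t. c (snd (0::real, t))) (%t. h (0, t))) (extend (%t. c (snd (1::real, t))) (%t. h (1, t)))"
 proof (rule extend_equivalent[OF _ _ _ h(1) _ _ R(1,2)])
  show "cont ({0..1} \<times> {0..1}) (%p. c (snd p))" by (rule cont_comp[OF c(1)]) (auto intro!: continuous_intros)
  fix s :: real assume s: "s:{0..1}"
  show "h (s, 0)=c (snd (s, 1))" using h(5) s assms(5) by (auto simp: pathstart_def)
  show "R<cmod (h (s, 1))" using h(5) s R(3) by (auto simp: pathfinish_def)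
  show "h (s, t):U" if "t:{0..1}" for t using h(2) s that by auto
 qed (use c in auto)
 moreover have "extend (%t. c (snd (0::real, t))) (%t. h (0, t))=extend c P" "extend (%t. c (snd (1::real, t))) (%t. h (1, t))=extend c Q"
  using h(3,4) by (auto simp: extend_def fun_eq_iff)
 ultimately show ?thesis by simp
qed

lemma extend_truncate:
 assumes d: "leg_curve U z0 d" and c: "!!t. t:{0..1} ==> d t=c t"
  and ro: "cont {0..1} ro" "ro 0=1" "ro 1=ta" "!!u. u:{0..1} ==> ro u>0"
  and P: "!!u. u:{0..1} ==> P u=d (ro u)"
  and R: "0<R" "!!z. R<cmod z ==> z:U" "!!t. t>=ta ==> R<cmod (d t)"
 shows "legs_equivalent U z0 d (extend c P)"
proof -
 define sy where "sy t=(if t<=1 then t else if t<=2 then ro (t-1) else ta+(t-2))" for t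
 have cont: "cont {0..} sy"
 proof -
  have "cont ({0..1} Un {1..}) (%t. if t<=1 then t else if t<=2 then ro (t-1) else ta+(t-2))"
  proof (rule continuous_on_cases)
   have "cont ({1..2} Un {2..}) (%t. if t<=2 then ro (t-1) else ta+(t-2))"
    by (rule continuous_on_cases) (use ro in "auto intro!: continuous_intros cont_comp[OF ro(1)] simp: not_le")
   moreover have "{1..2} Un {2..}={1::real..}" by auto
   ultimately show "cont {1..} (%t. if t<=2 then ro (t-1) else ta+(t-2))" by simp
  qed (use ro in "auto intro!: continuous_intros")
  moreover have "{0..1} Un {1..}={0::real..}" by auto
  ultimately show ?thesis unfolding sy_def[abs_def] by simp
 qed
 have ta: "ta>0" using ro(3) ro(4)[of 1] by simp
 have e1: "legs_equivalent U z0 d (%t. d (sy t))"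
 proof (rule legs_equivalent_reparametrise[OF d cont])
  show "sy t>0" if "t>0" for t using that ro(4)[of "t-1"] ta by (auto simp: sy_def)
  have "filterlim (%t. ta+(t-2)) at_top at_top" by real_asymp
  moreover have "eventually (%t. ta+(t-2)=sy t) at_top" using eventually_gt_at_top[of 2] by eventually_elim (simp add: sy_def)
  ultimately show "filterlim sy at_top at_top" by (rule filterlim_cong[OF refl refl, THEN iffD1, rotated])
 qed (simp add: sy_def)
 have P1: "P 1=d ta" using P[of 1] ro(3) by simp
 have "leg_curve U z0 (extend c P)"
 proof (rule leg_curve_extend[OF _ _ _ _ _ _ R(1,2)])
  have cd: "cont {0..1} d" using d unfolding leg_curve_def by (auto elim: cont_sub)
  show "cont {0..1} c" by (rule continuous_on_eq[OF cd]) (use c in auto)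
  show "c 0=z0" using c[of 0] d unfolding leg_curve_def by simp
  show "c ` {0<..1}<=U"
  proof
   fix z assume "z:c ` {0<..1}"
   then obtain t where "t:{0<..1}" "z=c t" by blast
   then show "z:U" using c[of t] d unfolding leg_curve_def by auto
  qed
  have "cont {0..1} (%u. d (ro u))"
   by (rule cont_comp[of "{0..}" d, OF _ ro(1)]) (use d ro(4) in "auto simp: leg_curve_def less_imp_le")
  then show "path P" unfolding path_def by (rule continuous_on_eq) (use P in auto)
  show "path_image P<=U" unfolding path_image_def using P d ro(4) unfolding leg_curve_def by (auto simp: image_subset_iff)
  show "P 0=c 1" using P[of 0] ro(2) c[of 1] by simp
  show "R<cmod (P 1)" using P1 R(3)[of ta] by simp
 qed
 moreover have "legs_equivalent U z0 (%t. d (sy t)) (extend c P)"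
 proof (rule legs_equivalent_tail[OF leg_curve_equivalent(2)[OF e1] calculation R(1,2), of 2])
  show "d (sy t)=extend c P t" if "t:{0..2}" for t using that c[of t] P[of "t-1"] by (auto simp: sy_def extend_def)
  show "R<cmod (d (sy t)) & R<cmod (extend c P t)" if t: "t>=2" for t
  proof
   have "sy t=ta+(t-2)" using t ro(3) by (cases "t=2") (auto simp: sy_def)
   then show "R<cmod (d (sy t))" using R(3) t by simp
   have "extend c P t = of_real (t-1) * P 1" using t by (cases "t=2") (auto simp: extend_def)
   moreover have "1 * cmod (P 1)<=(t-1) * cmod (P 1)" using t by (intro mult_right_mono) auto
   ultimately show "R<cmod (extend c P t)" using R(3)[of ta] P1 t by (simp add: norm_mult del: of_real_diff)
  qed
 qed auto
 ultimately show ?thesis using e1 legs_equivalent_trans by blast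
qed

section \<open>Lifting legs through the fixed point\<close>

context expansion
begin

text \<open>The covering lifts only the part over \<open>t>0\<close>, as \<open>z0\<close> need not
  lie in \<open>U\<close>. Near \<open>t=0\<close> the local inverse at \<open>z0\<close> is used on
  a strip of uniform width \<open>t0\<close>, and uniqueness of lifts on that strip glues the
  two.\<close>

lemma lift_homotopy_from_fixed:
 fixes H :: "real*real => complex"
 assumes fz: "f z0=z0" "deriv f z0~=0"
  and H: "cont ({0..1} \<times> {0..}) H" "!!s. s:{0..1} ==> H (s, 0)=z0"
   "!!s t. s:{0..1} ==> t>0 ==> H (s, t):U"
 shows "EX K. cont ({0..1} \<times> {0..}) K & (ALL s:{0..1}. K (s, 0)=z0) &
  (ALL s:{0..1}. ALL t>0. K (s, t):U) & (ALL s:{0..1}. ALL t>=0. f (K (s, t))=H (s, t))"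
proof -
 obtain N g where g: "open N" "z0:N" "inj_on f N" "open (f ` N)" "g holomorphic_on f ` N" "ALL z:N. g (f z)=z"
  by (rule local_inverse[OF holf fz(2)])
 have "z0:f ` N" using g(2) fz(1) by force
 have gz: "g z0=z0" using g(2,6) fz(1) by force
 have fg: "f (g z)=z" if "z:f ` N" for z using g(6) that by force
 have cS: "compact ({0..1::real} \<times> {0::real})" by (intro compact_Times) auto
 define S where "S=({0..1} \<times> {0..}) Int H -` (f ` N)"
 have "openin (top_of_set ({0..1} \<times> {0..})) S" unfolding S_def
  by (rule continuous_openin_preimage_gen[OF H(1) g(4)])
 then obtain V where V: "open V" "S=({0..1} \<times> {0..}) Int V" by (auto simp: openin_open)
 have "{0..1} \<times> {0::real}<=S" using H(2) \<open>z0:f ` N\<close> by (auto simp: S_def)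
 then have "{0..1} \<times> {0::real}<=V" using V(2) by blast
 then obtain e where e: "e>0" "{p. EX q:{0..1} \<times> {0}. dist p q<e}<=V" 
  using compact_subset_open_imp_ball_epsilon_subset[OF cS V(1)]
  by (auto simp: subset_iff dist_commute)
 define t0 where "t0=e/2"
 have t0: "t0>0" using e by (simp add: t0_def)
 have near: "H (s, t):f ` N" if "s:{0..1}" "t:{0..t0}" for s t
 proof -
  have "dist (s, t) (s, 0)<e" using that t0 by (auto simp: dist_Pair_Pair t0_def)
  then have "(s, t):V" using e(2) that(1) by blast
  then show ?thesis using V(2) that by (auto simp: S_def)
 qed
 define T where "T={0..1::real} \<times> {0::real<..}"
 have cT: "convex T" unfolding T_def by (intro convex_Times) auto
 have b: "(0, t0):T" using t0 by (simp add: T_def)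
 have HT: "cont T H" "H ` T<=U" using H(3) by (auto simp: T_def intro: cont_sub[OF H(1)])
 have "(f ^^ 1) (g (H (0, t0)))=H (0, t0)" using fg[OF near[of 0 t0]] t0 by simp
 then obtain h where h: "cont T h" "h (0, t0)=g (H (0, t0))" "ALL p:T. h p:U & (f ^^ 1) (h p)=H p"
  using lift_iter[OF convex_imp_simply_connected[OF cT] convex_imp_locally_path_connected[OF cT] HT b] by blast
 have hg: "h p=g (H p)" if p: "p:{0..1} \<times> {0<..t0}" for p
 proof (rule lift_unique[of "{0..1} \<times> {0<..t0}" h "%p. g (H p)" "(0, t0)" p 1])
  have sub: "{0..1} \<times> {0<..t0}<=T" by (auto simp: T_def)
  show "connected ({0..1::real} \<times> {0<..t0})" by (intro connected_Times) auto
  show "cont ({0..1} \<times> {0<..t0}) h" by (rule cont_sub[OF h(1) sub])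
  show "cont ({0..1} \<times> {0<..t0}) (%p. g (H p))"
   by (rule cont_comp[OF holo_cont[OF g(5)] cont_sub[OF HT(1) sub]])
    (use near in auto)
  fix p :: "real*real" assume p: "p:{0..1} \<times> {0<..t0}"
  have "H p:f ` N" using near[of "fst p" "snd p"] p by (auto simp: mem_Times_iff)
  then show "(f ^^ 1) (h p)=(f ^^ 1) (g (H p))" using h(3) sub p fg by auto
  show "(f ^^ 1) (h p):U" using h(3) sub p HT(2) by auto
 qed (use p h(2) t0 in auto)
 define K where "K p=(if snd p<=t0 then g (H p) else h p)" for p
 have Kh: "K p=h p" if "p:T" for p using hg[of p] that by (auto simp: K_def T_def mem_Times_iff)
 show ?thesis
 proof (intro exI[of _ K] conjI ballI allI impI)
  show "cont ({0..1} \<times> {0..}) K" unfolding K_def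
  proof (rule continuous_on_split_time)
   show "cont ({0..1} \<times> {0..t0}) (%p. g (H p))"
    by (rule cont_comp[OF holo_cont[OF g(5)] cont_sub[OF H(1)]]) (use near in auto)
   show "cont ({0..1} \<times> {t0..}) h" by (rule cont_sub[OF h(1)]) (use t0 in "auto simp: T_def")
  qed (use hg t0 in auto)
  show "K (s, 0)=z0" if "s:{0..1}" for s using H(2)[OF that] t0 gz by (simp add: K_def)
  show "K (s, t):U" if "s:{0..1}" "t>0" for s t using Kh[of "(s, t)"] h(3) that by (auto simp: T_def)
  show "f (K (s, t))=H (s, t)" if "s:{0..1}" "t>=0" for s t
  proof (cases "t=0")
   case True
   then show ?thesis using H(2)[OF that(1)] t0 gz fz by (simp add: K_def)
  next
   case False
   then show ?thesis using Kh[of "(s, t)"] h(3) that by (auto simp: T_def)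
  qed
 qed
qed

lemma lift_from_fixed_unique:
 fixes a b :: "real => complex"
 assumes fz: "f z0=z0" "deriv f z0~=0" and c: "!!t. t>0 ==> f (a t):U"
  and a: "cont {0..} a" "a 0=z0" and b: "cont {0..} b" "b 0=z0"
  and eq: "!!t. t>=0 ==> f (a t)=f (b t)" and t: "t>=0"
 shows "a t=b t"
proof -
 obtain N g where g: "open N" "z0:N" "inj_on f N" by (rule local_inverse[OF holf fz(2)]) 
 then obtain e where e: "e>0" "ball z0 e<=N" using openE by blast
 have "EX d>0. ALL t>=0. t<d --> k t:ball z0 e" if k: "cont {0..} k" "k 0=z0" for k :: "real => complex"
 proof -
  obtain d where "d>0" "ALL x:{0..}. dist x 0<d --> dist (k x) (k 0)<e"
   using k(1) e(1) unfolding continuous_on_iff by (metis atLeast_iff order_refl)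
  then show ?thesis using k(2) by (intro exI[of _ d]) (auto simp: dist_commute)
 qed
 then obtain d1 d2 where d: "d1>0" "d2>0" "ALL t>=0. t<d1 --> a t:ball z0 e" "ALL t>=0. t<d2 --> b t:ball z0 e"
  using a b by metis
 define u where "u=min d1 d2/2"
 have u: "u>0" "u<d1" "u<d2" using d by (auto simp: u_def)
 have au: "a u=b u" using g(3) e(2) d(3,4) u eq[of u] by (auto dest!: inj_onD)
 show ?thesis
 proof (cases "t=0")
  case False
  show ?thesis
  proof (rule lift_unique[of "{0<..}" a b u t 1])
   show "cont {0<..} a" "cont {0<..} b" using a b by (auto elim: cont_sub)
  qed (use au u t False eq c in auto)
 qed (use a b in simp)
qed

lemma lift_tends_to_infinity:
 assumes "ALL R. EX T. ALL s:S. ALL t>=T. R<cmod (f (K s t))" shows "EX T. ALL s:S. ALL t>=(T::real). R<cmod (K s t)"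
proof -
 obtain M where M: "ALL z. cmod z<=R --> cmod (f z)<=M" using bounded_preimage by blast
 obtain T where "ALL s:S. ALL t>=T. M<cmod (f (K s t))" using assms by blast
 then have "ALL s:S. ALL t>=T. R<cmod (K s t)" using M by (meson not_le)
 then show ?thesis by blast
qed

lemma leg_curve_lift:
 assumes fz: "f z0=z0" "deriv f z0~=0" and c: "leg_curve U z0 ga"
 obtains de where "leg_curve U z0 de" "!!t. t>=0 ==> f (de t)=ga t"
proof -
 have cont: "cont ({0..1::real} \<times> {0..}) (%p. ga (snd p))"
  using c unfolding leg_curve_def by (auto intro!: cont_comp[of "{0..}" ga] continuous_intros)
 obtain K :: "real*real => complex" where K: "cont ({0..1} \<times> {0..}) K" "ALL s:{0..1}. K (s, 0)=z0"
  "ALL s:{0..1}. ALL t>0. K (s, t):U" "ALL s:{0..1}. ALL t>=0. f (K (s, t))=ga t"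
 proof -
  have "ga (snd (s, 0))=z0" "t>0 ==> ga (snd (s, t)):U" for s t :: real using c by (auto simp: leg_curve_def)
  then show ?thesis using lift_homotopy_from_fixed[OF fz, of "%p. ga (snd p)", OF cont] that by auto
 qed
 define de where "de t=K (0, t)" for t :: real
 have fde: "f (de t)=ga t" if "t>=0" for t using K(4) that by (simp add: de_def)
 have "ALL R. EX T. ALL s:{0::nat}. ALL t>=T. R<cmod (f (de t))"
 proof
  fix R
  obtain T where T: "ALL t>=T. R<cmod (ga t)" using c unfolding leg_curve_def tends_to_infinity_iff by blast
  then show "EX T. ALL s:{0::nat}. ALL t>=T. R<cmod (f (de t))" using fde by (intro exI[of _ "max T 0"]) auto
 qed
 then have "ALL R. EX T. ALL t>=T. R<cmod (de t)" using lift_tends_to_infinity[of "{0::nat}" "%s. de"] by auto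
 moreover have "cont {0..} de" unfolding de_def by (rule cont_comp[OF K(1)]) (auto intro!: continuous_intros)
 ultimately show ?thesis using K fde by (intro that[of de]) (auto simp: leg_curve_def tends_to_infinity_iff de_def)
qed

lemma legs_equivalent_lift:
 assumes fz: "f z0=z0" "deriv f z0~=0" and e: "legs_equivalent U z0 ga de"
  and a: "cont {0..} a" "a 0=z0" "!!t. t>=0 ==> f (a t)=ga t"
  and b: "cont {0..} b" "b 0=z0" "!!t. t>=0 ==> f (b t)=de t"
 shows "legs_equivalent U z0 a b"
proof -
 obtain H :: "real*real => complex" where H: "cont ({0..1} \<times> {0..}) H"
  "ALL t>=0. H (0, t)=ga t" "ALL t>=0. H (1, t)=de t"
  "ALL s:{0..1}. H (s, 0)=z0" "ALL s:{0..1}. ALL t>0. H (s, t):U"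
  "ALL R. EX T. ALL s:{0..1}. ALL t>=T. R<cmod (H (s, t))" using e unfolding legs_equivalent_def by blast
 have "EX K. cont ({0..1} \<times> {0..}) K & (ALL s:{0..1}. K (s, 0)=z0) &
  (ALL s:{0..1}. ALL t>0. K (s, t):U) & (ALL s:{0..1}. ALL t>=0. f (K (s, t))=H (s, t))"
  by (rule lift_homotopy_from_fixed[OF fz H(1)]) (use H in auto)
 then obtain K :: "real*real => complex" where K: "cont ({0..1} \<times> {0..}) K" "ALL s:{0..1}. K (s, 0)=z0"
  "ALL s:{0..1}. ALL t>0. K (s, t):U" "ALL s:{0..1}. ALL t>=0. f (K (s, t))=H (s, t)" by auto
 have inf: "ALL R. EX T. ALL s:{0..1}. ALL t>=T. R<cmod (f (K (s, t)))"
 proof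
  fix R
  obtain T where "ALL s:{0..1}. ALL t>=T. R<cmod (H (s, t))" using H(6) by blast
  then show "EX T. ALL s:{0..1}. ALL t>=T. R<cmod (f (K (s, t)))" using K(4) by (intro exI[of _ "max T 0"]) auto
 qed
 have "EX T. ALL s:{0..1}. ALL t>=T. R<cmod (K (s, t))" for R by (rule lift_tends_to_infinity[OF inf])
 moreover have "K (s, t)=c t" if s: "s:{0..1}" and c: "cont {0..} c" "c 0=z0" "!!t. t>=0 ==> f (c t)=H (s, t)" and t: "t>=0" for s t c
 proof (rule lift_from_fixed_unique[OF fz, of "%t. K (s, t)" c])
  show "cont {0..} (%t. K (s, t))" by (rule cont_comp[OF K(1)]) (use s in "auto intro!: continuous_intros")
 qed (use s K H c t in auto)
 then have "K (0, t)=a t" "K (1, t)=b t" if "t>=0" for t using a b H(2,3) that by auto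
 ultimately show ?thesis unfolding legs_equivalent_def using K by (intro exI[of _ K]) auto
qed

end

section \<open>Replacing the iterated lifts by tame curves\<close>

definition join_at_one :: "(real => complex) => (real => complex) => real => complex" where
 "join_at_one c d t=(if t<=1 then c t else d (t-1))"

lemma continuous_join_at_one:
 assumes "cont {0..1} c" "cont {0..} d" "d 0=c 1"
 shows "cont {0..} (join_at_one c d)"
proof -
 have "cont ({0..1} Un {1..}) (%t. if t<=1 then c t else d (t-1))"
  by (rule continuous_on_cases) (use assms in "auto intro!: continuous_intros cont_comp[OF assms(2)]")
 moreover have "{0..1} Un {1..}={0::real..}" by auto
 ultimately show ?thesis unfolding join_at_one_def[abs_def] by simp
qed

lemma tends_to_infinity_join:
 assumes "filterlim d at_infinity at_top" shows "filterlim (join_at_one c d) at_infinity at_top"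
 unfolding tends_to_infinity_iff
proof
 fix R
 obtain T where "ALL t>=T. R<cmod (d t)" using assms unfolding tends_to_infinity_iff by blast
 then show "EX T. ALL t>=T. R<cmod (join_at_one c d t)" by (intro exI[of _ "max T 1+1"]) (auto simp: join_at_one_def)
qed

lemma leg_curve_join:
 assumes "cont {0..1} c" "c 0=z0" "c ` {0<..1}<=U"
  and "cont {0..} d" "d 0=c 1" "!!t. t>=0 ==> d t:U" "filterlim d at_infinity at_top"
 shows "leg_curve U z0 (join_at_one c d)"
 unfolding leg_curve_def using continuous_join_at_one[OF assms(1,4,5)] tends_to_infinity_join[OF assms(7)] assms
 by (auto simp: join_at_one_def image_subset_iff)

text \<open>Cutting at the last time spent in the closed disc of radius \<open>R\<close> keeps the
  discarded tail outside it, which is what allows \<open>extend_truncate\<close> to exchange the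
  tail for a ray.\<close>

lemma radial_truncation:
 fixes d :: "real => complex"
 assumes d: "cont {0..} d" "!!t. t>=0 ==> d t:U" "cmod (d 0)<R" "filterlim d at_infinity at_top"
  and R: "0<R0" "R0<R" "!!z. R0<cmod z ==> z:U"
 shows "EX g ta. cont {0..} g & (ALL t>=0. g t:U) & ta>0 & cmod (g ta)=R &
  (ALL t>ta. g t = of_real (1 + t-ta) * g ta) & (ALL t:{0..ta}. g t=d t) & (ALL t>=ta. R<=cmod (d t))"
proof -
 define S where "S={0..} Int (%t. cmod (d t)) -` {..R}"
 have "closed S" unfolding S_def by (rule continuous_closed_preimage) (auto intro!: continuous_intros d(1))
 obtain T where T: "ALL t>=T. R<cmod (d t)" using d(4) unfolding tends_to_infinity_iff by blast
 have "t<=T" if "t:S" for t using T that unfolding S_def by (meson IntD2 atMost_iff linear not_le vimageD)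
 then have "S<={0..T}" by (auto simp: S_def)
 then have "bounded S" using bounded_closed_interval bounded_subset by blast
 then have "compact S" using \<open>closed S\<close> compact_eq_bounded_closed by blast
 moreover have "S~={}" using d(3) by (auto simp: S_def intro!: exI[of _ 0])
 ultimately obtain ta where ta: "ta:S" "ALL t:S. t<=ta" using compact_attains_sup by blast
 have ta0: "ta>=0" "cmod (d ta)<=R" using ta(1) by (auto simp: S_def)
 have out: "R<cmod (d t)" if "t>ta" for t 
 proof (rule ccontr)
  assume "~  R<cmod (d t)"
  then have "t:S" using that ta0(1) by (simp add: S_def)
  then show False using ta(2) that by force
 qed
 have "((%t. cmod (d t)) \<longlongrightarrow> cmod (d ta)) (at_right ta)"
 proof -
  have "(d \<longlongrightarrow> d ta) (at ta within {0..})" using d(1) ta0(1) unfolding continuous_on_def by auto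
  then have "(d \<longlongrightarrow> d ta) (at_right ta)" by (rule tendsto_within_subset) (use ta0(1) in auto)
  then show ?thesis by (rule tendsto_norm)
 qed
 moreover have "eventually (%t. R<=cmod (d t)) (at_right ta)"
  using eventually_at_right_less[of ta] by eventually_elim (use out less_imp_le in auto)
 ultimately have "R<=cmod (d ta)" by (rule tendsto_lowerbound) simp
 then have dR: "cmod (d ta)=R" using ta0(2) by simp
 have tap: "ta>0" using ta0(1) dR d(3) by (cases "ta=0") auto
 define g where "g t=(if t<=ta then d t else of_real (1 + t-ta) * d ta)" for t
 have "cont ({0..ta} Un {ta..}) g" unfolding g_def
  by (rule continuous_on_cases) (use ta0 in "auto intro!: continuous_intros cont_sub[OF d(1)]")
 moreover have "{0..ta} Un {ta..}={0..}" using ta0(1) by auto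
 moreover have "g t:U" if t: "t>=0" for t
 proof (cases "t<=ta")
  case False
  have "1 * R<=(1 + t-ta) * R" using False R by (intro mult_right_mono) auto
  then have "R0<(1 + t-ta) * R" using R(2) by linarith
  then have "R0<cmod (of_real (1 + t-ta) * d ta)" using False dR by (simp add: norm_mult del: of_real_add of_real_diff)
  then show ?thesis using R(3) False by (simp add: g_def)
 qed (use d(2) t in "simp add: g_def")
 ultimately show ?thesis using tap dR out by (intro exI[of _ g] exI[of _ ta]) (auto simp: g_def le_less)
qed

text \<open>\<open>Ga n\<close> are the iterated lifts of a leg, \<open>H\<close> is a homotopy between the germs at \<open>z0\<close> of \<open>Ga 0\<close> and \<open>Ga 1\<close>,
  and its endpoint moves along \<open>aa 0\<close>.\<close>

locale leg_chain=expansion +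
 fixes z0 :: complex and Ga :: "nat => real => complex" and t0 R1 :: real
  and H :: "real*real => complex" and aa :: "nat => real => complex"
 assumes z0: "f z0=z0" "deriv f z0~=0" and Ga: "!!n. leg_curve U z0 (Ga n)"
  "!!n t. t>=0 ==> f (Ga (Suc n) t)=Ga n t" and t0: "t0>0"
  and H: "cont ({0..1} \<times> {0..1}) H" "!!s. s:{0..1} ==> H (s, 0)=z0"
   "!!s t. s:{0..1} ==> t:{0<..1} ==> H (s, t):U"
   "!!t. t:{0..1} ==> H (0, t)=Ga 0 (t0 * t)" "!!t. t:{0..1} ==> H (1, t)=Ga 1 (t0 * t)"
   "!!s. s:{0..1} ==> H (s, 1)=aa 0 s"
  and aa: "bchain aa" and R1: "R0<R1" "!!k t. t:{0..1} ==> cmod (aa k t)<R1"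
begin

abbreviation germ :: "real => complex" where "germ t == Ga 0 (t0 * t)"

lemma germ: "cont {0..1} germ" "germ 0=z0" "germ ` {0<..1}<=U" "germ 1=aa 0 0"
 using Ga(1)[of 0] t0 H(4)[of 1] H(6)[of 0] unfolding leg_curve_def
 by (auto intro!: continuous_intros cont_comp[of "{0..}" "Ga 0"])

text \<open>The ray is run through at constant speed \<open>R1\<close>, so that times on it measure
  distances; \<open>tau_step\<close> and \<open>radial_traj\<close> rely on this.\<close>

definition tame :: "(real => complex) => real => bool" where
 "tame g ta \<longleftrightarrow> cont {0..} g & (ALL t>=0. g t:U) & ta>0 & cmod (g ta)=R1 &
  (ALL t>ta. g t = of_real (1 + t-ta) * g ta) & g 0=aa 0 0"

definition lft :: "nat => (real => complex) => real => complex" where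
 "lft k g=(SOME h. cont {0..} h & h 0=aa k 0 & (ALL t:{0..}. h t:U & (f ^^ k) (h t)=g t))"

lemma lft:
 assumes "tame g ta"
 shows "cont {0..} (lft k g)" "lft k g 0=aa k 0" "!!t. t>=0 ==> lft k g t:U"
  "!!t. t>=0 ==> (f ^^ k) (lft k g t)=g t"
proof -
 have g: "cont {0..} g" "g ` {0..}<=U" "g 0=aa 0 0" using assms unfolding tame_def by auto
 have "(f ^^ k) (aa k 0)=g 0" using bchain_iter[OF aa, of 0 k 0] g(3) by simp
 then have "EX h. cont {0..} h & h 0=aa k 0 & (ALL t:{0..}. h t:U & (f ^^ k) (h t)=g t)"
  by (intro lift_iter[OF convex_imp_simply_connected convex_imp_locally_path_connected g(1,2)]) auto
 from someI_ex[OF this, folded lft_def]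
 show "cont {0..} (lft k g)" "lft k g 0=aa k 0" "!!t. t>=0 ==> lft k g t:U"
  "!!t. t>=0 ==> (f ^^ k) (lft k g t)=g t" by auto
qed

lemma lft_unique:
 assumes g: "tame g ta" and h: "cont {0..b} h" "h 0=aa k 0" "!!t. t:{0..b} ==> (f ^^ k) (h t)=g t"
  and t: "t:{0..b}"
 shows "lft k g t=h t"
proof (rule lift_unique[of "{0..b}" "lft k g" h 0 t k])
 show "cont {0..b} (lft k g)" by (rule cont_sub[OF lft(1)[OF g]]) auto
 show "(f ^^ k) (lft k g z)=(f ^^ k) (h z)" "(f ^^ k) (lft k g z):U" if "z:{0..b}" for z
  using lft(4)[OF g, of z k] h(3)[OF that] that g unfolding tame_def by auto
qed (use t h lft(2)[OF g] in auto)

lemma lft_Suc: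
 assumes g: "tame g ta" and t: "t>=0" shows "f (lft (Suc k) g t)=lft k g t"
proof -
 have "lft k g t=f (lft (Suc k) g t)"
 proof (rule lft_unique[OF g, of t])
  show "cont {0..t} (%t. f (lft (Suc k) g t))"
   by (rule cont_comp[OF contf[of UNIV] cont_sub[OF lft(1)[OF g]]]) auto
  show "f (lft (Suc k) g 0)=aa k 0" using lft(2)[OF g] aa unfolding bchain_def by simp
  show "(f ^^ k) (f (lft (Suc k) g s))=g s" if "s:{0..t}" for s
   using lft(4)[OF g, of s "Suc k"] that by (simp add: funpow_swap1)
 qed (use t in auto)
 then show ?thesis by simp
qed

lemma tame_at_infinity: assumes "tame g ta" shows "filterlim g at_infinity at_top"
 unfolding tends_to_infinity_iff
proof
 fix B
 have g: "ta>0" "cmod (g ta)=R1" "!!t. t>ta ==> g t = of_real (1 + t-ta) * g ta" using assms unfolding tame_def by auto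
 have R: "R1>0" using R1(1) R0 by simp
 have "B<cmod (g t)" if t: "t>=ta + \<bar>B\<bar>/R1" for t
 proof -
  have p: "\<bar>B\<bar>/R1>=0" using R by simp
  have "\<bar>B\<bar><(\<bar>B\<bar>/R1+1) * R1" using R by (simp add: field_simps)
  also have "... <= (1 + t-ta) * R1" using t R by (intro mult_right_mono) auto
  also have "... = cmod (g t)"
  proof -
   have "t>=ta" using t p by linarith
   then show ?thesis using g(2) g(3)[of t] by (cases "t=ta") (auto simp: norm_mult simp del: of_real_add of_real_diff)
  qed
  finally show ?thesis by linarith
 qed
 then show "EX T. ALL t>=T. B<cmod (g t)" by blast
qed

lemma lft_at_infinity: assumes g: "tame g ta" shows "filterlim (lft 1 g) at_infinity at_top"
proof -
 have "ALL R. EX T. ALL s:{0::nat}. ALL t>=T. R<cmod (f (lft 1 g t))"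
 proof
  fix R
  obtain T where "ALL t>=T. R<cmod (g t)" using tame_at_infinity[OF g] unfolding tends_to_infinity_iff by blast
  then show "EX T. ALL s:{0::nat}. ALL t>=T. R<cmod (f (lft 1 g t))"
   using lft(4)[OF g, of _ 1] by (intro exI[of _ "max T 0"]) auto
 qed
 from lift_tends_to_infinity[OF this] show ?thesis unfolding tends_to_infinity_iff by auto
qed

definition leg_path :: "(real => complex) => real => real => complex" where
 "leg_path g ta u=g (u * ta)"

lemma truncate_equivalent:
 assumes d: "cont {0..} d" "!!t. t>=0 ==> d t:U" "d 0=aa 0 0" "filterlim d at_infinity at_top"
 shows "EX g ta. tame g ta & (ALL t:{0..ta}. g t=d t) & (ALL t>=ta. R1<=cmod (d t)) &
  legs_equivalent U z0 (join_at_one germ d) (extend germ (leg_path g ta))"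
proof -
 have "cmod (d 0)<R1" using d(3) R1(2)[of 0 0] by simp
 from radial_truncation[OF d(1,2) this d(4) R0 R1(1) bigU] obtain g ta where g: "cont {0..} g" "ALL t>=0. g t:U" "ta>0"
  "cmod (g ta)=R1" "ALL t>ta. g t = of_real (1 + t-ta) * g ta" "ALL t:{0..ta}. g t=d t" "ALL t>=ta. R1<=cmod (d t)" by auto
 have "legs_equivalent U z0 (join_at_one germ d) (extend germ (leg_path g ta))"
 proof (rule extend_truncate[where ro = "%u. 1 + u * ta" and ta = "1 + ta" and R=R0])
  show "leg_curve U z0 (join_at_one germ d)" by (rule leg_curve_join[OF germ(1-3) d(1)]) (use d germ in auto)
  show "leg_path g ta u=join_at_one germ d (1 + u * ta)" if "u:{0..1}" for u
  proof (cases "u=0")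
   case False
   then have "0<u * ta" "u * ta<=ta" using that g(3) by (auto simp: mult_left_le_one_le)
   then show ?thesis using g(6) by (simp add: leg_path_def join_at_one_def)
  qed (use g(3,6) d(3) germ(4) in "simp add: leg_path_def join_at_one_def")
  show "R0<cmod (join_at_one germ d t)" if "t>=1 + ta" for t using that g(3) g(7)[rule_format, of "t-1"] R1(1) by (auto simp: join_at_one_def)
  show "0<1 + u * ta" if "u:{0..1}" for u using that g(3) by (simp add: add_pos_nonneg)
 qed (use R0 bigU in "auto intro!: continuous_intros simp: join_at_one_def")
 then show ?thesis using g d(3) unfolding tame_def by (intro exI[of _ g] exI[of _ ta]) auto
qed

text \<open>Sliding the germ along \<open>H\<close> costs the path traced by its end point: at stage
  \<open>s\<close> the curve follows \<open>H\<close> at \<open>s\<close>, then the rest of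
  \<open>aa 0\<close> beyond \<open>s\<close>, then \<open>d\<close>.\<close>

lemma germ_homotopy_equivalent:
 assumes d: "cont {0..} d" "!!t. t>=0 ==> d t:U" "d 0=aa 0 1" "filterlim d at_infinity at_top"
 shows "legs_equivalent U z0 (join_at_one germ (join_at_one (aa 0) d))
  (join_at_one (%t. Ga 1 (t0 * t)) (join_at_one (%t. aa 0 1) d))"
proof -
 have caa: "cont {0..1} (aa 0)" and aaU: "!!t. t:{0..1} ==> aa 0 t:U" using aa unfolding bchain_def by auto
 define K where "K p=(if snd p<=1 then H p else if snd p<=2 then aa 0 (fst p+(1-fst p)*(snd p-1)) else d (snd p-2))" for p
 have sub: "s+(1-s)*(t-1):{0..1}" if "s:{0..1}" "t:{1..2}" for s t :: real
  using that convex_bound_le[of "t-1" 1 1 "1-s" s] by (auto intro!: add_nonneg_nonneg)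
 have "cont ({0..1} \<times> {0..}) K" unfolding K_def
 proof (rule continuous_on_split_time[OF H(1)])
  show "cont ({0..1} \<times> {1..}) (%p. if snd p<=2 then aa 0 (fst p+(1-fst p)*(snd p-1)) else d (snd p-2))"
   by (rule continuous_on_split_time)
    (use sub d(3) in "auto intro!: continuous_intros cont_comp[OF caa] cont_comp[OF d(1)]")
 qed (use H(6) in auto)
 moreover have "EX T. ALL s:{0..1}. ALL t>=T. R<cmod (K (s, t))" for R
 proof -
  obtain T where "ALL t>=T. R<cmod (d t)" using d(4) unfolding tends_to_infinity_iff by blast
  then show ?thesis by (intro exI[of _ "max T 1+2"]) (auto simp: K_def)
 qed
 moreover have "K (s, t):U" if "s:{0..1}" "t>0" for s t
  using H(3)[of s t] aaU[OF sub[of s t]] d(2)[of "t-2"] that by (auto simp: K_def)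
 ultimately show ?thesis unfolding legs_equivalent_def using H(2,4,5) by (intro exI[of _ K]) (auto simp: K_def join_at_one_def)
qed

text \<open>The recursion of the construction. Lifting the germ followed by \<open>g\<close> gives
  the germ of \<open>Ga 1\<close> followed by \<open>lft 1 g\<close>; exchanging that germ for
  \<open>germ\<close> inserts \<open>aa 0\<close>, and truncation restores a tame curve.\<close>

lemma next_tame_curve:
 assumes g: "tame g ta" and e: "legs_equivalent U z0 (Ga n) (extend germ (leg_path g ta))"
 shows "EX g' ta'. tame g' ta' & (ALL t:{0..ta'}. g' t=join_at_one (aa 0) (lft 1 g) t) &
  (ALL t>=ta'. R1<=cmod (join_at_one (aa 0) (lft 1 g) t)) & legs_equivalent U z0 (Ga (Suc n)) (extend germ (leg_path g' ta'))"
proof -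
 have caa: "cont {0..1} (aa 0)" and aaU: "!!t. t:{0..1} ==> aa 0 t:U" and aa1: "aa 0 1=aa 1 0" using aa unfolding bchain_def by auto
 have ta: "ta>0" and gray: "!!t. t>ta ==> g t = of_real (1 + t-ta) * g ta" using g unfolding tame_def by auto
 define h where "h=lft 1 g"
 have h: "cont {0..} h" "h 0=aa 0 1" "!!t. t>=0 ==> h t:U" "!!t. t>=0 ==> f (h t)=g t" "filterlim h at_infinity at_top"
  using lft(1,2)[OF g, of 1] lft(3,4)[OF g, of _ 1] lft_at_infinity[OF g] aa1 unfolding h_def by auto
 \<comment> \<open>\<open>extend\<close> spends one unit of time on the path while \<open>g\<close>
   takes time \<open>ta\<close>; \<open>ro\<close> converts between the two clocks.\<close>
 define ro where "ro t=(if t<=1 then t * ta else ta+(t-1))" for t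
 have cro: "cont {0..} ro"
 proof -
  have "cont ({0..1} Un {1..}) ro" unfolding ro_def by (rule continuous_on_cases) (auto intro!: continuous_intros)
  moreover have "{0..1} Un {1..}={0::real..}" by auto
  ultimately show ?thesis by simp
 qed
 have ro0: "ro t>=0" if "t>=0" for t using that ta by (auto simp: ro_def)
 have roinf: "filterlim ro at_top at_top"
 proof -
  have "filterlim (%t. ta+(t-1)) at_top at_top" by real_asymp
  moreover have "eventually (%t. ta+(t-1)=ro t) at_top" using eventually_gt_at_top[of 1] by eventually_elim (simp add: ro_def)
  ultimately show ?thesis by (rule filterlim_cong[OF refl refl, THEN iffD1, rotated])
 qed
 define k where "k t=h (ro t)" for t
 have k: "cont {0..} k" "k 0=aa 0 1" "!!t. t>=0 ==> k t:U" "filterlim k at_infinity at_top"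
 proof -
  show "cont {0..} k" unfolding k_def by (rule cont_comp[OF h(1) cro]) (use ro0 in auto)
  show "filterlim k at_infinity at_top" unfolding k_def by (rule filterlim_compose[OF h(5) roinf])
 qed (use h ro0 in "auto simp: k_def ro_def")
 define c1 where "c1 t=Ga 1 (t0 * t)" for t
 have c1: "cont {0..1} c1" "c1 0=z0" "c1 ` {0<..1}<=U" "c1 1=aa 0 1"
  using Ga(1)[of 1] t0 H(5)[of 1] H(6)[of 1] unfolding leg_curve_def c1_def
  by (auto simp del: One_nat_def intro!: continuous_intros cont_comp[of "{0..}" "Ga 1"])
 let ?de = "join_at_one c1 k"
 have de: "leg_curve U z0 ?de" by (rule leg_curve_join[OF c1(1-3) k(1)]) (use k c1 in auto)
 have 1: "legs_equivalent U z0 (Ga (Suc n)) ?de"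
 proof (rule legs_equivalent_lift[OF z0 e])
  show "f (?de t)=extend germ (leg_path g ta) t" if t: "t>=0" for t
  proof -
   have "g (ta+(t-2)) = of_real (t-1) * g ta" if "t>2" using gray[of "ta+(t-2)"] that by (simp add: algebra_simps)
   then show ?thesis using t Ga(2)[of "t0 * t" 0] h(4)[of "ro (t-1)"] ro0[of "t-1"] t0
    by (auto simp: join_at_one_def extend_def leg_path_def c1_def k_def ro_def algebra_simps)
  qed
 qed (use de Ga in "auto simp: leg_curve_def")
 \<comment> \<open>Inserts a pause at \<open>aa 0 1\<close>, which is the form of the last stage in
   \<open>germ_homotopy_equivalent\<close>.\<close>
 have 2: "legs_equivalent U z0 ?de (join_at_one c1 (join_at_one (%t. aa 0 1) k))"
 proof -
  define sy where "sy t=(if t<=1 then t else if t<=2 then 1 else t-1)" for t :: real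
  have s: "sy t=min t (max 1 (t-1))" for t by (auto simp: sy_def min_def max_def)
  have "legs_equivalent U z0 ?de (%t. ?de (sy t))"
  proof (rule legs_equivalent_reparametrise[OF de])
   show "cont {0..} sy" unfolding s by (intro continuous_intros)
   have "filterlim (%t::real. t-1) at_top at_top" by real_asymp
   then show "filterlim sy at_top at_top" by (rule filterlim_at_top_mono) (auto simp: sy_def intro!: always_eventually)
  qed (auto simp: sy_def)
  moreover have "(%t. ?de (sy t))=join_at_one c1 (join_at_one (%t. aa 0 1) k)"
   using c1(4) by (auto simp: fun_eq_iff join_at_one_def sy_def)
  ultimately show ?thesis by simp
 qed
 have 3: "legs_equivalent U z0 (join_at_one germ (join_at_one (aa 0) k)) (join_at_one c1 (join_at_one (%t. aa 0 1) k))"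
  unfolding c1_def by (rule germ_homotopy_equivalent[OF k(1)]) (use k in auto)
 have D: "cont {0..} (join_at_one (aa 0) h)" "!!t. t>=0 ==> join_at_one (aa 0) h t:U"
  "join_at_one (aa 0) h 0=aa 0 0" "filterlim (join_at_one (aa 0) h) at_infinity at_top"
  using continuous_join_at_one[OF caa h(1,2)] h(3) aaU tends_to_infinity_join[OF h(5)] by (auto simp: join_at_one_def)
 have 4: "legs_equivalent U z0 (join_at_one germ (join_at_one (aa 0) h)) (join_at_one germ (join_at_one (aa 0) k))"
 proof -
  let ?d = "join_at_one germ (join_at_one (aa 0) h)"
  define sy where "sy t=(if t<=2 then t else 2 + ro (t-2))" for t :: real
  have "legs_equivalent U z0 ?d (%t. ?d (sy t))"
  proof (rule legs_equivalent_reparametrise)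
   show "leg_curve U z0 ?d" by (rule leg_curve_join[OF germ(1-3) D(1)]) (use D germ in auto)
   have "cont ({0..2} Un {2..}) sy" unfolding sy_def
   proof (rule continuous_on_cases)
    show "cont {2..} (%t. 2 + ro (t-2))" by (intro continuous_intros cont_comp[OF cro]) auto
   qed (auto simp: ro_def)
   moreover have "{0..2} Un {2..}={0::real..}" by auto
   ultimately show "cont {0..} sy" by simp
   have "filterlim (%t. ro (t-2)) at_top at_top"
   proof (rule filterlim_compose[OF roinf])
    show "filterlim (%t::real. t-2) at_top at_top" by real_asymp
   qed
   then show "filterlim sy at_top at_top"
    by (rule filterlim_at_top_mono) (use eventually_gt_at_top[of 2] in eventually_elim, auto simp: sy_def)
   show "sy t>0" if "t>0" for t using that ro0[of "t-2"] by (auto simp: sy_def)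
  qed (simp add: sy_def)
  moreover have "?d (sy t)=join_at_one germ (join_at_one (aa 0) k) t" for t
  proof (cases "t>2")
   case True
   have "sy t-2=ro (t-2)" "ro (t-2)>0" using True ta by (auto simp: sy_def ro_def)
   then show ?thesis using True by (auto simp: join_at_one_def k_def algebra_simps)
  qed (auto simp: sy_def join_at_one_def)
  ultimately show ?thesis by simp
 qed
 obtain g' ta' where g': "tame g' ta'" "ALL t:{0..ta'}. g' t=join_at_one (aa 0) h t" "ALL t>=ta'. R1<=cmod (join_at_one (aa 0) h t)"
  "legs_equivalent U z0 (join_at_one germ (join_at_one (aa 0) h)) (extend germ (leg_path g' ta'))"
  using truncate_equivalent[OF D] by blast
 have "legs_equivalent U z0 (Ga (Suc n)) (extend germ (leg_path g' ta'))"
  using 1 2 3 4 g'(4) legs_equivalent_trans legs_equivalent_sym by meson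
 then show ?thesis using g' unfolding h_def by blast
qed

lemma first_tame_curve: "EX g ta. tame g ta & legs_equivalent U z0 (Ga 0) (extend germ (leg_path g ta))"
proof -
 have L: "cont {0..} (Ga 0)" "Ga 0 ` {0<..}<=U" "filterlim (Ga 0) at_infinity at_top" using Ga(1)[of 0] unfolding leg_curve_def by auto
 define d where "d t=Ga 0 (t0 + t)" for t
 have "filterlim (%t. t0 + t) at_top at_top" by (simp add: filterlim_tendsto_add_at_top[OF tendsto_const filterlim_ident])
 then have inf: "filterlim d at_infinity at_top" unfolding d_def by (rule filterlim_compose[OF L(3)])
 have d: "cont {0..} d" "!!t. t>=0 ==> d t:U" "d 0=aa 0 0"
  using L t0 germ(4) unfolding d_def by (auto intro!: continuous_intros cont_comp[OF L(1)])
 obtain g ta where g: "tame g ta" "legs_equivalent U z0 (join_at_one germ d) (extend germ (leg_path g ta))"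
  using truncate_equivalent[OF d inf] by blast
 define sy where "sy t=(if t<=1 then t0 * t else t0+(t-1))" for t
 have "legs_equivalent U z0 (Ga 0) (%t. Ga 0 (sy t))"
 proof (rule legs_equivalent_reparametrise[OF Ga(1)])
  have "cont ({0..1} Un {1..}) sy" unfolding sy_def by (rule continuous_on_cases) (auto intro!: continuous_intros)
  moreover have "{0..1} Un {1..}={0::real..}" by auto
  ultimately show "cont {0..} sy" by simp
  have "filterlim (%t. t0+(t-1)) at_top at_top" by real_asymp
  moreover have "eventually (%t. t0+(t-1)=sy t) at_top" using eventually_gt_at_top[of 1] by eventually_elim (simp add: sy_def)
  ultimately show "filterlim sy at_top at_top" by (rule filterlim_cong[OF refl refl, THEN iffD1, rotated])
 qed (use t0 in "auto simp: sy_def")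
 moreover have "(%t. Ga 0 (sy t))=join_at_one germ d" by (auto simp: fun_eq_iff sy_def join_at_one_def d_def)
 ultimately show ?thesis using g legs_equivalent_trans by metis
qed

lemma tame_sequence:
 "EX g ta. ALL n. tame (g n) (ta n) & legs_equivalent U z0 (Ga n) (extend germ (leg_path (g n) (ta n))) &
  (ALL t:{0..ta (Suc n)}. g (Suc n) t=join_at_one (aa 0) (lft 1 (g n)) t) &
  (ALL t>=ta (Suc n). R1<=cmod (join_at_one (aa 0) (lft 1 (g n)) t))"
proof -
 define Q where "Q n p \<longleftrightarrow> tame (fst p) (snd p) & legs_equivalent U z0 (Ga n) (extend germ (leg_path (fst p) (snd p)))" for n p
 define S where "S p q \<longleftrightarrow> (ALL t:{0..snd q}. fst q t=join_at_one (aa 0) (lft 1 (fst p)) t) &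
  (ALL t>=snd q. R1<=cmod (join_at_one (aa 0) (lft 1 (fst p)) t))" for p q :: "(real => complex)*real"
 have "EX p. Q 0 p" using first_tame_curve unfolding Q_def by auto
 moreover have "EX q. Q (Suc n) q & S p q" if "Q n p" for p n using next_tame_curve[of "fst p" "snd p" n] that unfolding Q_def S_def by auto
 ultimately obtain F where F: "!!n. Q n (F n)" "!!n. S (F n) (F (Suc n))" using dependent_nat_choice[of Q "%_. S"] by metis
 show ?thesis by (rule exI[of _ "%n. fst (F n)"], rule exI[of _ "%n. snd (F n)"]) (use F in "auto simp: Q_def S_def")
qed

text \<open>On one piece the lift is an inverse branch applied to the curve below;
  \<open>branch_bound\<close> and Cauchy's estimate bound the derivative of that branch.\<close>

lemma traj_lipschitz_step:
 assumes Q: "good_radius Q r"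
 shows "EX C>=0. ALL n de a b. n>=1 --> traj Q r d 1 n de a b --> (EX t:{a..b}. cmod (de t)<=B) -->
  (ALL s:{a..b}. ALL t:{a..b}. cmod (de s-de t)<=C * cmod ((f ^^ n) (de s)-(f ^^ n) (de t)))"
proof -
 have r: "r>0" using Q unfolding good_radius_def by auto
 obtain M where M: "ALL n c r h. n>=1 --> 0<r --> ball c (4 * r)<=U --> branch n c (4 * r) h -->
  (EX z:cball c r. cmod (h z)<=B) --> (ALL z:cball c r. cmod (h z)<=M)" using branch_bound by blast
 have "cmod (de s-de t)<=(\<bar>M\<bar> + 1)/r * cmod ((f ^^ n) (de s)-(f ^^ n) (de t))"
  if n: "n>=1" and T: "traj Q r d 1 n de a b" and t0: "t0:{a..b}" "cmod (de t0)<=B"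
   and st: "s:{a..b}" "t:{a..b}" for n de a b t0 s t
 proof -
  define c where "c=(f ^^ n) (de t0)"
  have near: "(f ^^ n) (de s):cball c r" if s: "s:{a..b}" for s
  proof -
   have "\<bar>t0-s\<bar><=d" using T s t0 unfolding traj_def by auto
   then show ?thesis using T s t0 unfolding traj_def c_def by (simp add: dist_norm)
  qed
  have "c:Q" using T t0 unfolding traj_def c_def by blast
  moreover have "ball c (4*(2 * r))<=ball c (32 * r)" using r by auto
  ultimately have cU: "ball c (4*(2 * r))<=U" using Q unfolding good_radius_def by blast
  have cd: "cont {a..b} de" using T unfolding traj_def by blast
  have near8: "(f ^^ n) (de s):ball c (4*(2 * r))" if "s:{a..b}" for s using near[OF that] r by auto
  obtain h where h: "branch n c (4*(2 * r)) h" "ALL t:{a..b}. de t=h ((f ^^ n) (de t))"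
   by (rule branch_through[OF connected_Icc cd t0(1) cU near8])
  have "c:cball c (2 * r)" using r by simp
  moreover have "cmod (h c)<=B" using h(2) t0 unfolding c_def by auto
  ultimately have hM: "ALL z:cball c (2 * r). cmod (h z)<=M" using M n h(1) cU r by (smt (verit) mult_pos_pos)
  have holh: "h holomorphic_on ball c (4*(2 * r))" using h(1) unfolding branch_def by blast
  have D: "(h has_field_derivative deriv h w) (at w within cball c r)" if "w:cball c r" for w
   using holomorphic_derivI[OF holh open_ball, of w] that r by (auto intro: has_field_derivative_at_within)
  have "norm (deriv h w)<=(\<bar>M\<bar> + 1)/r" if w: "w:cball c r" for w
  proof -
   have sub: "cball w r<=cball c (2 * r)" "cball c (2 * r)<=ball c (4*(2 * r))"
    using w r by (auto simp: cball_subset_cball_iff cball_subset_ball_iff dist_commute)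
   have "norm ((deriv ^^ 1) h w)<=(fact 1)*(\<bar>M\<bar> + 1)/r ^ 1"
   proof (rule Cauchy_higher_deriv_bound[where y=0])
    show "h holomorphic_on ball w r" by (rule holomorphic_on_subset[OF holh]) (use sub ball_subset_cball in blast)
    show "cont (cball w r) h" by (rule cont_sub[OF holo_cont[OF holh]]) (use sub in blast)
    show "h z:ball 0 (\<bar>M\<bar> + 1)" if "z:ball w r" for z
    proof -
     have "z:cball c (2 * r)" using sub(1) that ball_subset_cball by blast
     then show ?thesis using hM by (force simp: dist_norm)
    qed
   qed (use r in auto)
   then show ?thesis by simp
  qed
  then have "norm (h ((f ^^ n) (de s))-h ((f ^^ n) (de t)))<=(\<bar>M\<bar> + 1)/r * norm ((f ^^ n) (de s)-(f ^^ n) (de t))"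
   using field_differentiable_bound[OF convex_cball D] near st by blast
  then show ?thesis using h(2) st by metis
 qed
 moreover have "(\<bar>M\<bar> + 1)/r>=0" using r by simp
 ultimately show ?thesis by blast
qed

end

section \<open>Shape of the tame curves after many lifts\<close>

text \<open>\<open>trap\<close> is the form in which the repelling or parabolic nature of
  \<open>ze\<close> is used. The inequality for \<open>R1\<close> ensures that an orbit trapped
  within \<open>2 * r\<close> of \<open>ze\<close> cannot reach the rays.\<close>

locale tame_chain=leg_chain +
 fixes g :: "nat => real => complex" and ta :: "nat => real" and ze :: complex and r ep :: real
 assumes tame: "!!n. tame (g n) (ta n)"
  and step: "!!n t. t:{0..ta (Suc n)} ==> g (Suc n) t=join_at_one (aa 0) (lft 1 (g n)) t"
  and lands: "lands aa ze" and r: "r>0" "cmod ze+2 * r<R1"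
  and trap: "ep>0" "!!z s. cmod (z-ze)=r ==> cmod (f z-ze)<r + ep ==> cmod ((f ^^ s) z-ze)<2 * r"
begin

abbreviation G :: "nat => nat => real => complex" where "G n k == lft k (g n)"

lemma g: "cont {0..} (g n)" "t>=0 ==> g n t:U" "ta n>0" "cmod (g n (ta n))=R1"
  "t>=ta n ==> g n t = of_real (1 + t-ta n) * g n (ta n)"
 using tame[of n] unfolding tame_def by (auto, cases "t=ta n") auto

lemma R1p: "R1>0" using R1(1) R0 by simp

lemma G_add: "t>=0 ==> (f ^^ j) (G n (j + k) t)=G n k t"
proof (induction j)
 case (Suc j)
 then show ?case using lft_Suc[OF tame, of t "j + k" n] by (simp add: funpow_swap1)
qed simp

lemma G0: "t>=0 ==> G n 0 t=g n t"
 using lft(4)[OF tame, of t 0 n] by simp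

lemma G_Suc: assumes t: "t:{0..ta (Suc n)}" shows "G (Suc n) k t=join_at_one (aa k) (G n (Suc k)) t"
proof (rule lft_unique[OF tame _ _ _ t])
 have aak: "cont {0..1} (aa k)" "aa k 1=aa (Suc k) 0" using aa unfolding bchain_def by auto
 show "cont {0..ta (Suc n)} (join_at_one (aa k) (G n (Suc k)))"
  by (rule cont_sub[OF continuous_join_at_one[OF aak(1) lft(1)[OF tame]]]) (use lft(2)[OF tame] aak(2) in auto)
 show "join_at_one (aa k) (G n (Suc k)) 0=aa k 0" by (simp add: join_at_one_def)
 show "(f ^^ k) (join_at_one (aa k) (G n (Suc k)) s)=g (Suc n) s" if s: "s:{0..ta (Suc n)}" for s
  unfolding step[OF s] using bchain_iter[OF aa, of s k 0] G_add[of "s-1" k 1 n] s by (auto simp: join_at_one_def)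
qed

text \<open>The first \<open>n\<close> units of time of \<open>g n\<close> are spent on
  \<open>aa 0\<close> to \<open>aa (n-1)\<close>, which stay inside the circle where curves are cut,
  so the cut comes later. All \<open>k\<close> are treated at once because \<open>G_Suc\<close>
  raises the order of the lift.\<close>

lemma tau_ge: "ta n>=real n & (ALL k m t. m<n --> t:{real m..real m+1} --> G n k t=aa (k + m) (t-real m))"
proof (induction n)
 case 0
 then show ?case using g(3)[of 0] by simp
next
 case (Suc n)
 have A: "join_at_one (aa k) (G n (Suc k)) t=aa (k + m) (t-real m)" if m: "m<Suc n" and t: "t:{real m..real m+1}" for k m t
 proof (cases m)
  case 0
  then show ?thesis using t by (simp add: join_at_one_def)
 next
  case (Suc m')
  have "m'<n" "t-1:{real m'..real m'+1}" using m t Suc by auto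
  then have "G n (Suc k) (t-1)=aa (Suc k + m') (t-1-real m')" using Suc.IH by blast
  moreover have "aa k 1=aa (Suc k) 0" using aa unfolding bchain_def by blast
  ultimately show ?thesis using t Suc by (cases "t=1") (auto simp: join_at_one_def algebra_simps)
 qed
 have "ta (Suc n)>=real (Suc n)"
 proof (rule ccontr)
  assume c: "~  ?thesis"
  define m where "m=nat \<lfloor>ta (Suc n)\<rfloor>"
  have m: "m<Suc n" "ta (Suc n):{real m..real m+1}" using c g(3)[of "Suc n"] unfolding m_def by (auto, linarith+)
  have "g (Suc n) (ta (Suc n))=aa (0 + m) (ta (Suc n)-real m)"
   using A[OF m, of 0] step[of "ta (Suc n)" n] g(3)[of "Suc n"] by simp
  then show False using R1(2)[of "ta (Suc n)-real m" m] g(4)[of "Suc n"] m(2) by simp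
 qed
 moreover have "G (Suc n) k t=aa (k + m) (t-real m)" if "m<Suc n" "t:{real m..real m+1}" for k m t
 proof -
  have "t:{0..ta (Suc n)}" using that calculation by auto
  then show ?thesis using G_Suc A that by metis
 qed
 ultimately show ?case by blast
qed

text \<open>\<open>R1 * M1\<close> bounds \<open>f\<close> on the disc of radius \<open>R1\<close>,
  so the lift of a ray is outside that disc once the ray has run for more than time
  \<open>M1\<close>.\<close>

definition M1 :: real where "M1=(SOME M. M>=0 & (ALL z. cmod z<=R1 --> cmod (f z)<=M))/R1"

lemma tau_step: "ta (Suc n)<=ta n + M1+1" "M1>=0"
proof -
 obtain M where "ALL z. cmod z<=R1 --> cmod (f z)<=M" using bounded_preimage by blast
 then have "max M 0>=0 & (ALL z. cmod z<=R1 --> cmod (f z)<=max M 0)" by (simp add: le_max_iff_disj)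
 then have "EX M>=0. ALL z. cmod z<=R1 --> cmod (f z)<=M" by blast
 from someI_ex[OF this] have M: "R1 * M1>=0" "!!z. cmod z<=R1 ==> cmod (f z)<=R1 * M1"
  using R1p unfolding M1_def by auto
 show M1: "M1>=0" using M(1) R1p by (simp add: zero_le_mult_iff)
 show "ta (Suc n)<=ta n + M1+1"
 proof (rule ccontr)
  assume c: "~  ?thesis"
  define s where "s=ta (Suc n)-1"
  have s: "s>ta n + M1" "s>0" using c M1 g(3)[of n] by (auto simp: s_def)
  have "g (Suc n) (ta (Suc n))=G n 1 s" using step[of "ta (Suc n)" n] s by (simp add: join_at_one_def s_def)
  then have "cmod (g n s)<=R1 * M1" using M(2)[of "G n 1 s"] lft(4)[OF tame, of s 1 n] s(2) g(4)[of "Suc n"] by simp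
  moreover have "cmod (g n s)=(1 + s-ta n) * R1"
   using g(5)[of n s] g(4)[of n] s M1 by (simp add: norm_mult del: of_real_add of_real_diff)
  ultimately have "1 + s-ta n<=M1" using R1p by (simp add: mult.commute)
  then show False using s by linarith
 qed
qed

definition Q where "Q={z::complex. R1<=cmod z & cmod z<=R1*(1 + M1)}"

lemma Q: "compact Q" "Q<=U"
proof -
 have "Q=cball 0 (R1*(1 + M1))-ball 0 R1" by (auto simp: Q_def)
 then show "compact Q" by (simp add: compact_diff)
 show "Q<=U" using bigU R1(1) by (auto simp: Q_def)
qed

lemma radial_traj:
 assumes Qr: "good_radius Q ro" and N: "M1<=real N * (ro/R1)"
  and ab: "ta n<=a" "a<=b" "b<=ta n + M1"
 shows "traj Q ro (ro/R1) N k (G n k) a b" "!!s t. s:{a..b} ==> t:{a..b} ==>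
  cmod ((f ^^ k) (G n k s)-(f ^^ k) (G n k t))=R1 * \<bar>s-t\<bar>"
proof -
 have fk: "(f ^^ k) (G n k t) = of_real (1 + t-ta n) * g n (ta n)" if "t:{a..b}" for t
  using lft(4)[OF tame, of t k n] g(3)[of n] g(5)[of n t] that ab by simp
 show *: "cmod ((f ^^ k) (G n k s)-(f ^^ k) (G n k t))=R1 * \<bar>s-t\<bar>" if "s:{a..b}" "t:{a..b}" for s t
 proof -
  have "(f ^^ k) (G n k s)-(f ^^ k) (G n k t) = of_real (s-t) * g n (ta n)" unfolding fk[OF that(1)] fk[OF that(2)] by (simp add: algebra_simps)
  then show ?thesis using g(4)[of n] by (simp add: norm_mult del: of_real_diff)
 qed
 have "(f ^^ k) (G n k t):Q" if t: "t:{a..b}" for t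
 proof -
  have "cmod ((f ^^ k) (G n k t))=(1 + t-ta n) * R1" unfolding fk[OF t] using t ab g(4)[of n]
   by (simp add: norm_mult del: of_real_diff of_real_add)
  moreover have "1 * R1<=(1 + t-ta n) * R1" "(1 + t-ta n) * R1<=(1 + M1) * R1"
   using t ab R1p by (auto intro!: mult_right_mono)
  ultimately show ?thesis by (simp add: Q_def mult.commute)
 qed
 moreover have "cont {a..b} (G n k)" using ab g(3)[of n] by (intro cont_sub[OF lft(1)[OF tame]]) auto
 moreover have "R1 * \<bar>s-t\<bar><=ro" if "\<bar>s-t\<bar><=ro/R1" for s t using that R1p by (simp add: field_simps)
 ultimately show "traj Q ro (ro/R1) N k (G n k) a b" unfolding traj_def using ab N * by auto
qed

text \<open>What is new in \<open>G (Suc n) k\<close> is a lifted piece of ray. Suppose it left the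
  disc of radius \<open>r\<close>. At the exit point, its image under \<open>f\<close> is still
  within \<open>r + ep\<close>, because the lift of order \<open>k\<close> moves by less than
  \<open>ep\<close> along the ray. Then \<open>trap\<close> confines the forward orbit to radius
  \<open>2 * r\<close>, yet \<open>f ^^ Suc k\<close> puts the point on a ray outside radius
  \<open>R1\<close>.\<close>

lemma eventually_near:
 "EX T. ALL n. ALL k>=T. ALL t:{0..ta n}. cmod (G n k t-ze)<r"
proof -
 have r2: "r/2>0" using r by simp
 obtain J1 where J1: "ALL n>=J1. ALL t:{0..1}. cmod (aa n t-ze)<r/2" using lands r2 unfolding lands_def by blast
 have "cont {0..ta 0} (g 0)" "g 0 ` {0..ta 0}<=U" "0<=ta 0" using g(1,3)[of 0] g(2)[of _ 0] by (auto elim: cont_sub simp: less_imp_le)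
 from path_shrink[OF this r2, of "cmod ze + r"] obtain J2 where J2: "ALL n>=J2. ALL de. cont {0..ta 0} de --> (ALL t:{0..ta 0}. (f ^^ n) (de t)=g 0 t) -->
  (EX t:{0..ta 0}. cmod (de t)<=cmod ze + r) --> (ALL s:{0..ta 0}. ALL t:{0..ta 0}. cmod (de s-de t)<r/2)" by blast
 obtain ro where ro: "good_radius Q ro" by (rule good_radius_exists[OF Q])
 then have rop: "ro/R1>0" using R1p unfolding good_radius_def by simp
 obtain N where N: "M1<=real N * (ro/R1)" using reals_Archimedean3[OF rop] less_imp_le by blast
 obtain J3 where J3: "ALL n>=J3. ALL de a b. traj Q ro (ro/R1) N n de a b --> (EX t:{a..b}. cmod (de t)<=cmod ze + r) -->
  (ALL s:{a..b}. ALL t:{a..b}. cmod (de s-de t)<ep)" using traj_shrink[OF ro rop trap(1)] by blast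
 define T where "T=max J1 (max J2 (Suc J3))"
 have "ALL k>=T. ALL t:{0..ta n}. cmod (G n k t-ze)<r" for n
 proof (induction n)
  case 0
  have "cmod (G 0 k t-ze)<r" if k: "k>=T" and t: "t:{0..ta 0}" for k t
  proof -
   have s: "cmod (G 0 k 0-ze)<r/2" using J1 k lft(2)[OF tame, of k 0] unfolding T_def by auto
   then have "cmod (G 0 k 0)<=cmod ze + r" using norm_triangle_ineq2[of "G 0 k 0" ze] r by linarith
   moreover have "cont {0..ta 0} (G 0 k)" by (rule cont_sub[OF lft(1)[OF tame]]) auto
   moreover have "ALL t:{0..ta 0}. (f ^^ k) (G 0 k t)=g 0 t" using lft(4)[OF tame] by auto
   moreover have "k>=J2" "0:{0..ta 0}" using k g(3)[of 0] unfolding T_def by auto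
   ultimately have "cmod (G 0 k t-G 0 k 0)<r/2" using J2 t by blast
   then show ?thesis using s norm_triangle_ineq[of "G 0 k t-G 0 k 0" "G 0 k 0-ze"] by simp
  qed
  then show ?case by blast
 next
  case (Suc n)
  have ray: "cmod (G n (Suc k) t-ze)<r" if k: "k>=T" and t: "ta n<=t" "t<=ta n + M1" for k t
  proof (rule ccontr)
   assume c: "~  ?thesis"
   have st: "cmod (G n j (ta n)-ze)<r" if "j>=T" for j using Suc.IH that g(3)[of n] by simp
   have dm: "cmod (G n j s-G n j t)<ep" if "j>=T" "s:{ta n..ta n + M1}" "t:{ta n..ta n + M1}" for j s t
   proof -
    have "traj Q ro (ro/R1) N j (G n j) (ta n) (ta n + M1)" by (rule radial_traj(1)[OF ro N]) (use tau_step(2) in auto)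
    moreover have "cmod (G n j (ta n))<=cmod ze + r" using st[OF that(1)] norm_triangle_ineq2[of "G n j (ta n)" ze] by linarith
    then have "EX t:{ta n..ta n + M1}. cmod (G n j t)<=cmod ze + r" using tau_step(2) by (intro bexI[of _ "ta n"]) auto
    moreover have "j>=J3" using that(1) unfolding T_def by simp
    ultimately show ?thesis using J3[rule_format, of j "G n j" "ta n" "ta n + M1" s t] that(2,3) by blast
   qed
   have "cont {ta n..t} (%t. cmod (G n (Suc k) t-ze))"
    using g(3)[of n] by (intro continuous_intros cont_sub[OF lft(1)[OF tame]]) auto
   then obtain s where s: "ta n<=s" "s<=t" "cmod (G n (Suc k) s-ze)=r"
    using IVT'[of "%t. cmod (G n (Suc k) t-ze)" "ta n" r t] st[of "Suc k"] k c t by auto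
   have s0: "s>=0" "s:{ta n..ta n + M1}" using s(1,2) t g(3)[of n] by auto
   have "f (G n (Suc k) s)=G n k s" by (rule lft_Suc[OF tame s0(1)])
   moreover have "cmod (G n k s-ze)<r + ep"
    using dm[OF k s0(2), of "ta n"] st[OF k] tau_step(2) norm_triangle_ineq[of "G n k s-G n k (ta n)" "G n k (ta n)-ze"] by simp
   ultimately have "cmod ((f ^^ Suc k) (G n (Suc k) s)-ze)<2 * r" using trap(2)[OF s(3), of "Suc k"] by simp
   moreover have "(f ^^ Suc k) (G n (Suc k) s) = of_real (1 + s-ta n) * g n (ta n)"
    using lft(4)[OF tame s0(1), of "Suc k" n] g(5)[OF s(1)] by simp
   moreover have "R1<=cmod (of_real (1 + s-ta n) * g n (ta n))"
   proof -
    have "1 * R1<=(1 + s-ta n) * R1" using s(1) R1p by (intro mult_right_mono) auto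
    then show ?thesis using s(1) g(4)[of n] by (simp add: norm_mult del: of_real_add of_real_diff)
   qed
   ultimately show False using r(2) norm_triangle_ineq2[of "(f ^^ Suc k) (G n (Suc k) s)" ze] by simp
  qed
  have "cmod (G (Suc n) k t-ze)<r" if k: "k>=T" and t: "t:{0..ta (Suc n)}" for k t
  proof (cases "t<=1")
   case True
   then have "cmod (aa k t-ze)<r/2" using J1 k t unfolding T_def by auto
   then show ?thesis using G_Suc[OF t] True r by (simp add: join_at_one_def)
  next
   case False
   then have e: "G (Suc n) k t=G n (Suc k) (t-1)" using G_Suc[OF t] by (simp add: join_at_one_def)
   show ?thesis
   proof (cases "t-1<=ta n")
    case True
    then show ?thesis using Suc.IH k False unfolding e by simp
   next
    case F: False
    then show ?thesis unfolding e using ray[OF k, of "t-1"] t tau_step(1)[of n] by simp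
   qed
  qed
  then show ?case by blast
 qed
 then show ?thesis by blast
qed

text \<open>The term for \<open>i\<close> is the cutting time of \<open>g (n-i)\<close> on the clock
  of \<open>g n\<close>, since each generation inserts one unit of time in front. Before all of
  these times, but after time \<open>j\<close>, the curve \<open>g n\<close> is a shifted
  \<open>j\<close>-fold lift of \<open>g (n-j)\<close>.\<close>

definition sy :: "nat => nat => real" where "sy j n=Min ((%i. ta (n-i) + real i) ` {..j})"

lemma sy_Suc: "sy (Suc j) n=min (ta (n-Suc j) + real (Suc j)) (sy j n)"
proof -
 have "(%i. ta (n-i) + real i) ` {..Suc j}=insert (ta (n-Suc j) + real (Suc j)) ((%i. ta (n-i) + real i) ` {..j})"
  by (auto simp: atMost_Suc)
 then show ?thesis unfolding sy_def by simp
qed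

lemma sy_0: "sy 0 n=ta n" by (simp add: sy_def)

lemma sy_le: "i<=j ==> sy j n<=ta (n-i) + real i" unfolding sy_def by (intro Min_le) auto

lemma sy_ge: assumes "j<=n" shows "sy j n>=real n"
proof -
 have "real n<=ta (n-i) + real i" if "i<=j" for i using tau_ge[of "n-i"] that assms by auto
 then show ?thesis unfolding sy_def by auto
qed

lemma sy_length: "j<=n ==> ta n<=sy j n + real j * M1"
proof (induction j)
 case (Suc j)
 have "ta (n-i)<=ta (n-Suc i) + M1+1" if "i<n" for i using tau_step(1)[of "n-Suc i"] that by (simp add: Suc_diff_Suc)
 then have "i<=n ==> ta n<=ta (n-i) + real i + real i * M1" for i
  by (induction i) (auto simp: algebra_simps, smt (verit) Suc_le_lessD)
 from this[of "Suc j"] show ?case using Suc tau_step(2) unfolding sy_Suc by (auto simp: min_def algebra_simps)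
qed (simp add: sy_0)

lemma g_shift: "j<=n ==> real j<=t ==> (!!i. i<j ==> t<=ta (n-i) + real i) ==> g n t=G (n-j) j (t-real j)"
proof (induction j)
 case 0
 then show ?case using G0[of t n] by simp
next
 case (Suc j)
 have 1: "g n t=G (n-j) j (t-real j)" using Suc by auto
 have nj: "n-j=Suc (n-Suc j)" using Suc.prems(1) by simp
 have "t-real j:{0..ta (Suc (n-Suc j))}" using Suc.prems(2) Suc.prems(3)[of j] unfolding nj by auto
 from G_Suc[OF this, of j] have "G (n-j) j (t-real j)=join_at_one (aa j) (G (n-Suc j) (Suc j)) (t-real j)" unfolding nj .
 moreover have "aa j 1=G (n-Suc j) (Suc j) 0" using lft(2)[OF tame] aa unfolding bchain_def by simp
 moreover have "t-real j>=1" using Suc.prems(2) by simp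
 ultimately show ?case unfolding 1 by (cases "t-real j=1") (auto simp: join_at_one_def algebra_simps)
qed

text \<open>The last \<open>j\<close> generations are lifts of radial segments, hence uniformly Lipschitz.\<close>

lemma late_part:
 "EX C d B. C>=0 & d>0 & (ALL n>=j. ALL s:{sy j n..ta n}. cmod (g n s)<=B & (EX i<=j. (f ^^ i) (g n s):Q) &
  (ALL t:{sy j n..ta n}. \<bar>s-t\<bar><=d --> cmod (g n s-g n t)<=C * \<bar>s-t\<bar>))"
proof (induction j)
 case 0
 have "g n (ta n):Q" "cmod (g n (ta n))<=R1" for n using g(4)[of n] R1p tau_step(2) by (auto simp: Q_def)
 then show ?case by (intro exI[of _ 0] exI[of _ 1] exI[of _ R1]) (auto simp: sy_0)
next
 case (Suc j)
 then obtain C d B where IH: "C>=0" "d>0" "ALL n>=j. ALL s:{sy j n..ta n}. cmod (g n s)<=B & (EX i<=j. (f ^^ i) (g n s):Q) &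
  (ALL t:{sy j n..ta n}. \<bar>s-t\<bar><=d --> cmod (g n s-g n t)<=C * \<bar>s-t\<bar>)" by blast
 obtain ro where ro: "good_radius Q ro" by (rule good_radius_exists[OF Q])
 then have rop: "ro/R1>0" using R1p unfolding good_radius_def by simp
 obtain N where N: "M1<=real N * (ro/R1)" using reals_Archimedean3[OF rop] less_imp_le by blast
 obtain B' where B': "ALL n de a b. n>=1 --> traj Q ro (ro/R1) N n de a b --> (EX t:{a..b}. cmod (de t)<=B) -->
  (ALL t:{a..b}. cmod (de t)<=B')" using traj_bound[OF ro rop] by blast
 obtain C' where C': "C'>=0" "ALL n de a b. n>=1 --> traj Q ro (ro/R1) 1 n de a b --> (EX t:{a..b}. cmod (de t)<=B') -->
  (ALL s:{a..b}. ALL t:{a..b}. cmod (de s-de t)<=C' * cmod ((f ^^ n) (de s)-(f ^^ n) (de t)))" using traj_lipschitz_step[OF ro] by blast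
 define C2 where "C2=max C (C' * R1)"
 define d2 where "d2=min d (ro/R1)"
 have main: "cmod (g n s)<=max B B' & (EX i<=Suc j. (f ^^ i) (g n s):Q) &
  (ALL t:{sy (Suc j) n..sy j n}. \<bar>s-t\<bar><=d2 --> cmod (g n s-g n t)<=C2 * \<bar>s-t\<bar>)"
  if n: "n>=Suc j" and s: "s:{sy (Suc j) n..sy j n}" for n s
 proof (cases "sy (Suc j) n=sy j n")
  case True
  have "sy j n<=ta n" using sy_le[of 0 j n] by simp
  then have "cmod (g n s)<=B & (EX i<=j. (f ^^ i) (g n s):Q)" using True s IH(3) n by simp
  moreover have "t=s" if "t:{sy (Suc j) n..sy j n}" for t using that True s by simp
  ultimately show ?thesis by (auto intro: le_SucI max.coboundedI1)
 next
  case False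
  then have e: "sy (Suc j) n=ta (n-Suc j) + real (Suc j)" using sy_Suc[of j n] by (auto simp: min_def split: if_splits)
  \<comment> \<open>The minimum has dropped, so the interval between the two values of
    \<open>sy\<close> runs along a lift under \<open>f ^^ Suc j\<close> of a piece of the ray of
    \<open>g m\<close>, of duration at most \<open>M1\<close>.\<close>
  define m where "m=n-Suc j"
  have nj: "n-j=Suc m" using n by (simp add: m_def)
  define de where "de=G m (Suc j)"
  define a where "a=ta m" define b where "b=sy j n-real (Suc j)"
  have ab: "ta m<=a" "a<=b" "b<=ta m + M1"
   using sy_Suc[of j n] sy_le[of j j n] tau_step(1)[of m] unfolding nj a_def b_def e m_def[symmetric] by (auto simp: min_def split: if_splits)
  have gs: "g n t=de (t-real (Suc j))" if t: "t:{sy (Suc j) n..sy j n}" for t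
   unfolding de_def m_def
  proof (rule g_shift[OF n])
   show "real (Suc j)<=t" using t e g(3)[of m] by (simp add: m_def)
   show "t<=ta (n-i) + real i" if "i<Suc j" for i using sy_le[of i j n] that t by simp
  qed
  have shift: "t-real (Suc j):{a..b}" if "t:{sy (Suc j) n..sy j n}" for t using that e unfolding a_def b_def m_def by auto
  have T: "traj Q ro (ro/R1) N (Suc j) de a b" unfolding de_def by (rule radial_traj(1)[OF ro N ab])
  have "sy j n:{sy j n..ta n}" using sy_le[of 0 j n] by simp
  then have "cmod (g n (sy j n))<=B" using IH(3) n Suc_leD by blast
  moreover have "sy j n:{sy (Suc j) n..sy j n}" using s by auto
  ultimately have "EX t:{a..b}. cmod (de t)<=B" using gs shift by metis
  then have bd: "cmod (de t)<=B'" if "t:{a..b}" for t using B' T that by (metis One_nat_def Suc_le_mono le0)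
  have "cmod (g n s-g n t)<=C2 * \<bar>s-t\<bar>" if t: "t:{sy (Suc j) n..sy j n}" "\<bar>s-t\<bar><=d2" for t
  proof -
   define a' where "a'=min s t-real (Suc j)" define b' where "b'=max s t-real (Suc j)"
   have ab': "a<=a'" "a'<=b'" "b'<=b" using shift[OF s] shift[OF t(1)] by (auto simp: a'_def b'_def min_def max_def)
   have "b'-a'<=ro/R1" using t(2) by (auto simp: a'_def b'_def d2_def)
   then have "traj Q ro (ro/R1) 1 (Suc j) de a' b'" using traj_sub[OF T ab'] by simp
   moreover have "EX t:{a'..b'}. cmod (de t)<=B'" using bd ab' by (intro bexI[of _ a']) auto
   moreover have "s-real (Suc j):{a'..b'}" "t-real (Suc j):{a'..b'}" by (auto simp: a'_def b'_def)
   ultimately have "cmod (de (s-real (Suc j))-de (t-real (Suc j))) <=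
    C' * cmod ((f ^^ Suc j) (de (s-real (Suc j)))-(f ^^ Suc j) (de (t-real (Suc j))))"
    using C'(2) by (metis One_nat_def Suc_le_mono le0)
   also have "... = C'*(R1 * \<bar>s-t\<bar>)"
    unfolding de_def using radial_traj(2)[OF ro N ab shift[OF s] shift[OF t(1)], of "Suc j"] by simp
   also have "... <= C2 * \<bar>s-t\<bar>" unfolding C2_def mult.assoc[symmetric] by (intro mult_right_mono) auto
   finally show ?thesis unfolding gs[OF s] gs[OF t(1)] .
  qed
  moreover have "(f ^^ Suc j) (g n s):Q" using T shift[OF s] gs[OF s] unfolding traj_def by auto
  ultimately show ?thesis using bd[OF shift[OF s]] gs[OF s] by (metis max.coboundedI2 order_refl)
 qed
 have "cmod (g n s)<=max B B' & (EX i<=Suc j. (f ^^ i) (g n s):Q) &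
  (ALL t:{sy (Suc j) n..ta n}. \<bar>s-t\<bar><=d2 --> cmod (g n s-g n t)<=C2 * \<bar>s-t\<bar>)"
  if n: "n>=Suc j" and s: "s:{sy (Suc j) n..ta n}" for n s
 proof -
  have C2: "x>=0 ==> C * x<=C2 * x" for x unfolding C2_def by (intro mult_right_mono) auto
  have sy: "sy (Suc j) n<=sy j n" "sy j n<=ta n" using sy_Suc[of j n] sy_le[of 0 j n] by auto
  have hi: "cmod (g n s-g n t)<=C2 * \<bar>s-t\<bar>" if "\<bar>s-t\<bar><=d2" "s:{sy j n..ta n}" "t:{sy j n..ta n}" for s t
  proof -
   have "j<=n" "\<bar>s-t\<bar><=d" using n that(1) by (auto simp: d2_def)
   then have "cmod (g n s-g n t)<=C * \<bar>s-t\<bar>" using IH(3) that(2,3) by blast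
   then show ?thesis using C2[of "\<bar>s-t\<bar>"] by simp
  qed
  have lo: "cmod (g n s-g n t)<=C2 * \<bar>s-t\<bar>" if "\<bar>s-t\<bar><=d2" "s:{sy (Suc j) n..sy j n}" "t:{sy (Suc j) n..sy j n}" for s t
   using main[OF n] that by blast
  have mix: "cmod (g n s-g n t)<=C2 * \<bar>s-t\<bar>" if "\<bar>s-t\<bar><=d2" "s:{sy (Suc j) n..sy j n}" "t:{sy j n..ta n}" for s t
  proof -
   have "cmod (g n s-g n (sy j n))<=C2 * \<bar>s-sy j n\<bar>" "cmod (g n (sy j n)-g n t)<=C2 * \<bar>sy j n-t\<bar>"
    using that sy by (intro lo hi; auto)+
   then have "cmod (g n s-g n t)<=C2 * \<bar>s-sy j n\<bar> + C2 * \<bar>sy j n-t\<bar>"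
    using norm_triangle_ineq[of "g n s-g n (sy j n)" "g n (sy j n)-g n t"] by simp
   also have "... = C2 * \<bar>s-t\<bar>" using that by (simp add: distrib_left[symmetric] abs_if)
   finally show ?thesis .
  qed
  have "cmod (g n s-g n t)<=C2 * \<bar>s-t\<bar>" if t: "t:{sy (Suc j) n..ta n}" "\<bar>s-t\<bar><=d2" for t
   using hi[of s t] lo[of s t] mix[of s t] mix[of t s] s t by (cases "s<=sy j n"; cases "t<=sy j n") (auto simp: norm_minus_commute abs_minus_commute)
  moreover have "cmod (g n s)<=max B B' & (EX i<=Suc j. (f ^^ i) (g n s):Q)"
  proof (cases "s<=sy j n")
   case True
   then show ?thesis using main[OF n, of s] s by auto
  next
   case False
   then have "cmod (g n s)<=B & (EX i<=j. (f ^^ i) (g n s):Q)" using IH(3) n s by simp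
   then show ?thesis by (meson le_SucI max.coboundedI1)
  qed
  ultimately show ?thesis by blast
 qed
 moreover have "C2>=0" "d2>0" using IH(1,2) rop by (auto simp: C2_def d2_def)
 ultimately show ?case by blast
qed

definition late :: "nat => nat => real => complex" where
 "late T n u=g n (sy T n + u * (ta n-sy T n))"

lemma early_near:
 assumes T: "ALL n. ALL k>=T. ALL t:{0..ta n}. cmod (G n k t-ze)<r" and n: "n>=T" and t: "t:{real T..sy T n}"
 shows "cmod (g n t-ze)<r"
proof -
 have "g n t=G (n-T) T (t-real T)" 
 proof (rule g_shift[OF n])
  show "t<=ta (n-i) + real i" if "i<T" for i using sy_le[of i T n] that t by simp
 qed (use t in auto)
 moreover have "t-real T:{0..ta (n-T)}" using t sy_le[of T T n] by auto
 ultimately show ?thesis using T by (metis order_refl)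
qed

text \<open>By \<open>sy_length\<close> the late part lasts at most \<open>T * M1\<close>, so
  rescaling it to the unit interval keeps the Lipschitz bounds of \<open>late_part\<close> uniform.
  The compact set \<open>K\<close> consists of bounded points that some iterate of order at most
  \<open>T\<close> sends into \<open>Q\<close>.\<close>

lemma late_converges:
 "EX nu E K. strict_mono (nu :: nat => nat) & compact K & K<=U & (ALL i. nu i>=T & late T (nu i) ` {0..1}<=K) &
  cont {0..1} E & (ALL et>0. EX I. ALL i>=I. ALL u:{0..1}. cmod (late T (nu i) u-E u)<et)"
proof -
 obtain C d B where L: "C>=0" "d>0" "ALL n>=T. ALL s:{sy T n..ta n}. cmod (g n s)<=B & (EX i<=T. (f ^^ i) (g n s):Q) &
  (ALL t:{sy T n..ta n}. \<bar>s-t\<bar><=d --> cmod (g n s-g n t)<=C * \<bar>s-t\<bar>)" using late_part by blast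
 define K where "K=(UN i:{..T}. cball 0 B Int (f ^^ i) -` Q)"
 have "compact (cball 0 B Int (f ^^ i) -` Q)" for i
  using continuous_closed_preimage[OF contf_iter closed_cball compact_imp_closed[OF Q(1)], of 0 B i]
  by (metis bounded_Int bounded_cball compact_eq_bounded_closed)
 then have cK: "compact K" unfolding K_def by (intro compact_UN) auto
 have KU: "K<=U" unfolding K_def using Q(2) sub_iter by blast
 have mem: "sy T n + u * (ta n-sy T n):{sy T n..ta n}" if "u:{0..1}" for n u
 proof -
  have "0<=ta n-sy T n" using sy_le[of 0 T n] by simp
  then have "u * (ta n-sy T n)<=1*(ta n-sy T n)" "0<=u * (ta n-sy T n)"
   using that by (intro mult_right_mono mult_nonneg_nonneg; simp)+
  then show ?thesis by simp
 qed
 have inK: "late T n ` {0..1}<=K" if "n>=T" for n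
 proof -
  have "cmod (late T n u)<=B & (EX i<=T. (f ^^ i) (late T n u):Q)" if "u:{0..1}" for u
   unfolding late_def using L(3) mem[OF that, of n] \<open>n>=T\<close> by blast
  then have "late T n u:K" if "u:{0..1}" for u using that unfolding K_def by (simp add: dist_norm) blast
  then show ?thesis by blast
 qed
 define A where "A=real T * M1+1"
 have A: "A>0" using tau_step(2) by (simp add: A_def add_nonneg_pos)
 have equi: "cmod (late T n u-late T n v)<e" if n: "n>=T" and uv: "u:{0..1}" "v:{0..1}" "\<bar>u-v\<bar><min (d/A) (e/((C+1) * A))" and e: "e>0" for n u v e
 proof -
  let ?s = "%u. sy T n + u * (ta n-sy T n)"
  have l: "\<bar>?s u-?s v\<bar><=\<bar>u-v\<bar> * A"
  proof -
   have "?s u-?s v=(u-v)*(ta n-sy T n)" by (simp add: algebra_simps)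
   moreover have "0<=ta n-sy T n" "ta n-sy T n<=A" using sy_le[of 0 T n] sy_length[OF n] by (auto simp: A_def)
   ultimately show ?thesis by (simp add: abs_mult mult_left_mono)
  qed
  also have "... <= d" using uv(3) A by (simp add: field_simps)
  finally have "cmod (late T n u-late T n v)<=C * \<bar>?s u-?s v\<bar>" unfolding late_def using L(3) n mem uv(1,2) by blast
  also have "... <= (C+1)*(\<bar>u-v\<bar> * A)" using l L(1) by (intro mult_mono) auto
  also have "... < e"
  proof -
   have "(C+1) * A>0" using A L(1) by simp
   then have "\<bar>u-v\<bar> * ((C+1) * A)<e" using uv(3) by (simp only: pos_less_divide_eq min_less_iff_conj)
   then show ?thesis by (simp add: mult_ac)
  qed
  finally show ?thesis .
 qed
 define F where "F i=late T (T + i)" for i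
 obtain E nu where E: "cont {0..1} E" "strict_mono (nu :: nat => nat)"
  "!!e. 0<e ==> EX N. ALL n x. n>=N & x:{0..1} --> norm (F (nu n) x-E x)<e"
 proof (rule Arzela_Ascoli[of "{0..1::real}" F B])
  show "norm (F n x)<=B" if "x:{0..1}" for n x
   unfolding F_def late_def using L(3) mem[OF that, of "T + n"] by simp
  show "EX d>0. ALL n y. y:{0..1} & norm (x-y)<d --> norm (F n x-F n y)<e" if "x:{0..1}" "0<e" for x e
   using equi[of "T + _" x _ e] that A L unfolding F_def by (intro exI[of _ "min (d/A) (e/((C+1) * A))"]) auto
 qed auto
 show ?thesis
 proof (rule exI[of _ "%i. T + nu i"], rule exI[of _ E], rule exI[of _ K], intro conjI)
  show "ALL i. T<=T + nu i & late T (T + nu i) ` {0..1}<=K" using inK by simp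
  show "ALL et>0. EX I. ALL i>=I. ALL u:{0..1}. cmod (late T (T + nu i) u-E u)<et" using E(3) unfolding F_def by blast
 qed (use E cK KU in "auto simp: strict_mono_def")
qed

end

section \<open>Winding numbers and accesses to the fixed point\<close>

definition seg :: "(real => complex) => real => real => real => complex" where
 "seg p l r w=p (l + w * (r-l))"

lemma seg_in: "l<=r ==> w:{0..1} ==> l + w * (r-l):{l..r}" for l r w :: real
 using mult_right_mono[of w 1 "r-l"] by auto

lemma seg: assumes "cont {l..r} p" "l<=r"
 shows "path (seg p l r)" "pathstart (seg p l r)=p l" "pathfinish (seg p l r)=p r" "path_image (seg p l r)<=p ` {l..r}"
proof -
 show "path (seg p l r)" unfolding path_def seg_def
  by (rule cont_comp[OF assms(1)]) (use seg_in[OF assms(2)] in "auto intro!: continuous_intros")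
 show "path_image (seg p l r)<=p ` {l..r}" unfolding path_image_def seg_def using seg_in[OF assms(2)] by blast
qed (simp_all add: seg_def pathstart_def pathfinish_def)

lemma seg_combine:
 assumes p: "cont {l..r} p" "x ~: p ` {l..r}" and "l<=m" "m<=r" "l<r"
 shows "winding_number (seg p l m) x + winding_number (seg p m r) x=winding_number (seg p l r) x"
proof -
 define v where "v=(m-l)/(r-l)"
 have v: "v:{0..1}" "v * (r-l)=m-l" using assms(3-5) by (auto simp: v_def divide_le_eq)
 have "subpath 0 v (seg p l r)=seg p l m" "subpath v 1 (seg p l r)=seg p m r" "subpath 0 1 (seg p l r)=seg p l r"
 proof -
  have 1: "v * w * (r-l)=w * (m-l)" for w unfolding v(2)[symmetric] by (simp add: mult_ac)
  have 2: "l+((1-v) * w + v)*(r-l)=m + w * (r-m)" for w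
   using v(2) 1[of w] by (simp add: algebra_simps)
  show "subpath 0 v (seg p l r)=seg p l m" by (simp only: subpath_def seg_def fun_eq_iff diff_zero add.right_neutral 1) simp
  show "subpath v 1 (seg p l r)=seg p m r" by (simp only: subpath_def seg_def fun_eq_iff 2) simp
 qed (simp add: subpath_def)
 moreover have "path (seg p l r)" "x ~: path_image (seg p l r)" using seg(1,4)[OF p(1)] p(2) assms(5) by auto
 ultimately show ?thesis using winding_number_subpath_combine[of "seg p l r" x 0 v 1] v(1) by simp
qed

lemma seg_exp:
 assumes "cont {l..r} p" "x ~: p ` {l..r}" "l<=r"
 shows "p r-x=exp (2 * of_real pi * \<i> * winding_number (seg p l r) x)*(p l-x)"
 using winding_number_exp_2pi[of "seg p l r" x] seg[OF assms(1,3)] assms(2) by auto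

lemma seg_winding_continuous:
 assumes "cont {l..r} p" "l<=r" "S Int p ` {l..r}={}"
 shows "cont S (winding_number (seg p l r))"
 using cont_sub[OF continuous_on_winding_number[OF seg(1)[OF assms(1,2)]], of S] seg(4)[OF assms(1,2)] assms(3) by blast

text \<open>Approaches to \<open>z0\<close> that form, together with a common curve, loops of equal winding numbers are separated
  neither by \<open>K\<close> nor locally: a logarithm of \<open>(x - a) / (x - b)\<close> on \<open>K\<close> (from the connection through \<open>U\<close>) and one on a
  small circle (from the connection through \<open>z0\<close>) agree where both are defined.\<close>

lemma same_access:
 assumes K: "compact K" "K Int U={}" and c: "leg_curve U z0 a" "leg_curve U z0 b" "cont {0..v} c" "c 0=z0" "c ` {0<..v}<=U"
  and uv: "0<u" "u<=v" "0<sa" "0<sb" "c v=a sa" "c u=b sb"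
  and w: "!!x. x:K-{z0} ==> winding_number (seg c 0 v) x-winding_number (seg a 0 sa) x =
   winding_number (seg c 0 u) x-winding_number (seg b 0 sb) x" and ep: "ep>0"
 shows "EX ta>0. ALL t:{0<..ta}. ALL t':{0<..ta}. connected_component (ball z0 ep-K) (a t) (b t')"
proof -
 have near: "EX ta>0. ALL t:{0..ta}. p t:ball z0 ep" if p: "leg_curve U z0 p" for p
 proof -
  have "EX d>0. ALL x:{0..}. dist x 0<d --> dist (p x) (p 0)<ep"
   using p ep unfolding leg_curve_def continuous_on_iff by (metis atLeast_iff order_refl)
  then obtain d where "d>0" "ALL x:{0..}. dist x 0<d --> dist (p x) (p 0)<ep" by blast
  then show ?thesis using p by (intro exI[of _ "d/2"]) (auto simp: leg_curve_def dist_commute)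
 qed
 obtain taa tab where taab: "taa>0" "tab>0" "ALL t:{0..taa}. a t:ball z0 ep" "ALL t:{0..tab}. b t:ball z0 ep"
  using near c(1,2) by metis
 define ta where "ta=min (min taa tab) (min sa sb)"
 have "connected_component (ball z0 ep-K) (a t) (b t')" if t: "t:{0<..ta}" "t':{0<..ta}" for t t'
 proof -
  have tt: "0<t" "t<=sa" "t<=taa" "0<t'" "t'<=sb" "t'<=tab" using t by (auto simp: ta_def)
  have ca: "cont {l..r} a" "cont {l..r} b" if "0<=l" for l r
   using c(1,2) that unfolding leg_curve_def by (auto elim: cont_sub)
  have aU: "a s:U" "b s:U" if "s>0" for s using c(1,2) that unfolding leg_curve_def by auto
  have a0: "a 0=z0" "b 0=z0" using c(1,2) unfolding leg_curve_def by auto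
  have cc: "cont {l..r} c" if "0<=l" "r<=v" for l r using c(3) that by (auto elim: cont_sub)
  define A B where "A=a t" and "B=b t'"
  let ?w = "winding_number"
  \<comment> \<open>\<open>2 pi i\<close> times \<open>e\<close> is a logarithm of
    \<open>(A-x)/(B-x)\<close> obtained by going through \<open>z0\<close>, and
    \<open>2 pi i\<close> times \<open>L\<close> is one obtained along \<open>c\<close>. The
    hypothesis on winding numbers says precisely that they agree on \<open>K-{z0}\<close>.\<close>
  define e where "e x=?w (seg a 0 t) x-?w (seg b 0 t') x" for x
  define L where "L x=?w (seg b t' sb) x+?w (seg c u v) x-?w (seg a t sa) x" for x
  have off: "x ~: p ` {l..r}" if x: "x:K" "l>0 | (l>=0 & x~=z0)" and p: "p 0=z0" "!!s. s:{0<..r} ==> p s:U" for p :: "real => complex" and x l r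
  proof
   assume "x:p ` {l..r}"
   then obtain s where s: "s:{l..r}" "x=p s" by blast
   then show False using x p(1) p(2)[of s] K(2) by (cases "s=0") auto
  qed
  have offa: "x ~: a ` {l..r}" "x ~: b ` {l..r}" if "x:K" "l>0 | (l>=0 & x~=z0)" for x l r
   using off[OF that, of a r] off[OF that, of b r] a0 aU by auto
  have offc: "x ~: c ` {l..v}" if "x:K" "l>0 | (l>=0 & x~=z0)" for x l
   using off[OF that, of c v] c(4,5) by blast
  have Le: "L x=e x" if x: "x:K-{z0}" for x
  proof -
   have "?w (seg a 0 t) x+?w (seg a t sa) x=?w (seg a 0 sa) x" by (rule seg_combine[OF ca(1) offa(1)]) (use x tt uv in auto)
   then have 1: "?w (seg a t sa) x=?w (seg a 0 sa) x-?w (seg a 0 t) x" by (simp add: eq_diff_eq add.commute)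
   have "?w (seg b 0 t') x+?w (seg b t' sb) x=?w (seg b 0 sb) x" by (rule seg_combine[OF ca(2) offa(2)]) (use x tt uv in auto)
   then have 2: "?w (seg b t' sb) x=?w (seg b 0 sb) x-?w (seg b 0 t') x" by (simp add: eq_diff_eq add.commute)
   have "?w (seg c 0 u) x+?w (seg c u v) x=?w (seg c 0 v) x" by (rule seg_combine[OF c(3) offc]) (use x uv in auto)
   then have 3: "?w (seg c u v) x=?w (seg c 0 v) x-?w (seg c 0 u) x" by (simp add: eq_diff_eq add.commute)
   have 4: "?w (seg c 0 v) x=?w (seg c 0 u) x-?w (seg b 0 sb) x+?w (seg a 0 sa) x" using w[OF x] by (simp add: diff_eq_eq)
   show ?thesis unfolding L_def e_def 1 2 3 4 by simp
  qed
  have expL: "A-x=exp (2 * of_real pi * \<i> * L x)*(B-x)" if x: "x:K" for x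
  proof -
   have 1: "b sb-x=exp (2 * of_real pi * \<i> * ?w (seg b t' sb) x)*(B-x)" unfolding B_def
    by (rule seg_exp[OF ca(2) offa(2)]) (use x tt in auto)
   have 2: "c v-x=exp (2 * of_real pi * \<i> * ?w (seg c u v) x)*(c u-x)" by (rule seg_exp[OF cc offc]) (use x uv in auto)
   have 3: "a sa-x=exp (2 * of_real pi * \<i> * ?w (seg a t sa) x)*(A-x)" unfolding A_def
    by (rule seg_exp[OF ca(1) offa(1)]) (use x tt in auto)
   have "exp (2 * of_real pi * \<i> * ?w (seg a t sa) x)*(A-x) =
    exp (2 * of_real pi * \<i> * ?w (seg c u v) x)*(exp (2 * of_real pi * \<i> * ?w (seg b t' sb) x)*(B-x))"
    using 1 2 3 uv(5,6) by simp
   then show ?thesis unfolding L_def by (simp add: distrib_left right_diff_distrib exp_add exp_diff field_simps)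
  qed
  have sph: "x ~: a ` {0..t}" "x ~: b ` {0..t'}" "x~=z0" if "x:sphere z0 ep" for x
  proof -
   have "a y~=x" if "y:{0..t}" for y using taab(3)[rule_format, of y] tt that \<open>x:sphere z0 ep\<close> by auto
   moreover have "b y~=x" if "y:{0..t'}" for y using taab(4)[rule_format, of y] tt that \<open>x:sphere z0 ep\<close> by auto
   ultimately show "x ~: a ` {0..t}" "x ~: b ` {0..t'}" "x~=z0" using that ep by (blast, blast, auto)
  qed
  have expe: "A-x=exp (2 * of_real pi * \<i> * e x)*(B-x)" if x: "x:sphere z0 ep" for x
  proof -
   have 1: "A-x=exp (2 * of_real pi * \<i> * ?w (seg a 0 t) x)*(z0-x)" unfolding A_def
    using seg_exp[OF ca(1)[of 0 t] sph(1)[OF x]] tt a0 by simp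
   have 2: "B-x=exp (2 * of_real pi * \<i> * ?w (seg b 0 t') x)*(z0-x)" unfolding B_def
    using seg_exp[OF ca(2)[of 0 t'] sph(2)[OF x]] tt a0 by simp
   show ?thesis unfolding 1 2 e_def by (simp add: right_diff_distrib exp_diff field_simps)
  qed
  define M where "M x=(if x:K then L x else e x)" for x
  have cM: "cont (K Un sphere z0 ep) M" unfolding M_def
  proof (rule continuous_on_cases)
   have d: "K Int b ` {t'..sb}={}" "K Int c ` {u..v}={}" "K Int a ` {t..sa}={}"
    by (intro disjoint_iff[THEN iffD2] allI impI offa offc; use tt uv in simp)+
   have "cont K (?w (seg b t' sb))" by (rule seg_winding_continuous[OF ca(2) _ d(1)]) (use tt in auto)
   moreover have "cont K (?w (seg c u v))" by (rule seg_winding_continuous[OF cc _ d(2)]) (use uv in auto)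
   moreover have "cont K (?w (seg a t sa))" by (rule seg_winding_continuous[OF ca(1) _ d(3)]) (use tt in auto)
   ultimately show "cont K L" unfolding L_def by (intro continuous_on_add continuous_on_diff)
   have d: "sphere z0 ep Int a ` {0..t}={}" "sphere z0 ep Int b ` {0..t'}={}" by (intro disjoint_iff[THEN iffD2] allI impI sph; assumption)+
   have "cont (sphere z0 ep) (?w (seg a 0 t))" by (rule seg_winding_continuous[OF ca(1) _ d(1)]) (use tt in auto)
   moreover have "cont (sphere z0 ep) (?w (seg b 0 t'))" by (rule seg_winding_continuous[OF ca(2) _ d(2)]) (use tt in auto)
   ultimately show "cont (sphere z0 ep) e" unfolding e_def by (rule continuous_on_diff)
  qed (use K(1) compact_imp_closed Le sph(3) in auto)
  have eM: "A-x=exp (2 * of_real pi * \<i> * M x)*(B-x)" if "x:K Un sphere z0 ep" for x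
   using that expL expe unfolding M_def by auto
  define S where "S=K Un sphere z0 ep"
  have S: "compact S" "A ~: S" "B ~: S"
  proof -
   have "A:ball z0 ep" "B:ball z0 ep" using taab(3,4) tt unfolding A_def B_def by auto
   then show "A ~: S" "B ~: S" using aU tt K(2) unfolding S_def A_def B_def by auto
  qed (use K(1) in "auto simp: S_def")
  \<comment> \<open>A continuous logarithm of the quotient makes the Borsuk maps of \<open>A\<close>
    and \<open>B\<close> homotopic on \<open>S\<close>, so the two points lie in one component of
    the complement of \<open>S\<close>. As \<open>S\<close> contains the sphere, that component
    stays in the ball.\<close>
  have "homotopic_with_canon (%x. True) S (sphere 0 1) (%x. (x-A) /\<^sub>R norm (x-A)) (%x. (x-B) /\<^sub>R norm (x-B))"
  proof -
   have "cont S (%x. (x-A) /\<^sub>R cmod (x-A))" "cont S (%x. (x-B) /\<^sub>R cmod (x-B))"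
    using S by (intro continuous_intros; force)+
   moreover have "(%x. (x-A) /\<^sub>R cmod (x-A)) ` S<=sphere 0 1" "(%x. (x-B) /\<^sub>R cmod (x-B)) ` S<=sphere 0 1"
    using S by (auto simp: divide_simps)
   moreover have "EX g. cont S g & (ALL x:S. (x-A) /\<^sub>R cmod (x-A)/((x-B) /\<^sub>R cmod (x-B))=exp (\<i> * complex_of_real (g x)))"
   proof (intro exI[of _ "%x. Im (2 * of_real pi * \<i> * M x)"] conjI ballI)
    show "cont S (%x. Im (2 * of_real pi * \<i> * M x))" unfolding S_def by (intro continuous_intros cM)
    fix x assume x: "x:S"
    define y where "y=2 * of_real pi * \<i> * M x"
    have nz: "x-B~=0" using x S by auto
    have "x-A=exp y * (x-B)" using eM[of x] x unfolding S_def y_def by (simp add: algebra_simps)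
    then have xA: "x-A=exp y * (x-B)" "cmod (x-A)=cmod (exp y) * cmod (x-B)" by (simp_all only: norm_mult)
    have E: "exp y = of_real (cmod (exp y)) * exp (\<i> * of_real (Im y))"
     unfolding norm_exp_eq_Re by (subst exp_eq_polar) (simp only: cis_conv_exp)
    have key: "of_real (inverse (m * k))*(of_real m * F * w)/(of_real (inverse k) * w)=F" if "m~=0" "k~=0" "w~=0"
     for m k :: real and F w :: complex using that by (simp add: of_real_inverse divide_simps)
    have xA3: "x-A = of_real (cmod (exp y)) * exp (\<i> * of_real (Im y))*(x-B)" by (subst E[symmetric]) (rule xA(1))
    show "(x-A) /\<^sub>R cmod (x-A)/((x-B) /\<^sub>R cmod (x-B))=exp (\<i> * complex_of_real (Im (2 * of_real pi * \<i> * M x)))"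
     unfolding y_def[symmetric] scaleR_conv_of_real xA(2) unfolding xA3 by (rule key) (use nz in auto)
   qed
   ultimately show ?thesis by (subst homotopic_circlemaps_divide) (auto simp: inessential_eq_continuous_logarithm_circle)
  qed
  then have "connected_component (- S) A B" using Borsuk_maps_homotopic_in_connected_component_eq[OF S] by simp
  then obtain C where C: "connected C" "C <= - S" "A:C" "B:C" unfolding connected_component_def by blast
  have "C Int frontier (ball z0 ep)={}" using C(2) ep by (auto simp: S_def)
  moreover have "a t:ball z0 ep" using taab(3) tt by auto
  ultimately have "C<=ball z0 ep" using connected_Int_frontier[OF C(1), of "ball z0 ep"] C(3) unfolding A_def by blast
  then show ?thesis using C unfolding connected_component_def A_def B_def S_def by blast
 qed
 moreover have "ta>0" using taab uv by (simp add: ta_def)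
 ultimately show ?thesis by blast
qed

lemma first_hit:
 fixes p :: "real => complex"
 assumes p: "cont {d..} p" and X: "closed X" "p d ~: X" "t>d" "p t:X"
 obtains s where "s>d" "p s:X" "ALL t:{d..<s}. p t ~: X"
proof -
 have "closed ({d..t} Int p -` X)" by (rule continuous_closed_preimage[OF cont_sub[OF p] _ X(1)]) auto
 then have "compact ({d..t} Int p -` X)" by (metis bounded_Int bounded_closed_interval compact_eq_bounded_closed)
 moreover have "t:{d..t} Int p -` X" using X by auto
 then have "{d..t} Int p -` X~={}" by blast
 ultimately obtain s where s: "s:{d..t} Int p -` X" "ALL x:{d..t} Int p -` X. s<=x" using compact_attains_inf by blast
 have "s~=d" using s(1) X(2) by auto
 then show ?thesis using s by (intro that[of s]) force+
qed

lemma norm_IVT: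
 fixes p :: "real => complex"
 assumes "cont {l..r} p" "cmod (p l)<ro" "ro<=cmod (p r)" "l<=r"
 shows "EX s:{l<..r}. cmod (p s)=ro"
proof -
 have "cont {l..r} (%t. cmod (p t))" by (intro continuous_intros assms)
 then obtain s where s: "l<=s" "s<=r" "cmod (p s)=ro"
  using IVT'[of "%t. cmod (p t)" l ro r, OF less_imp_le] assms by blast
 then show ?thesis using assms(2) by (intro bexI[of _ s]) (auto simp: le_less)
qed

text \<open>Each further leg and a common curve \<open>c\<close> bound a simple loop through
  \<open>z0\<close>. Its winding numbers are in \<open>{-1, 0, 1}\<close> and constant on each of
  the finitely many components of \<open>K-{z0}\<close>, so two legs give the same numbers and
  \<open>same_access\<close> applies. Injectivity of the legs is what makes the loops
  simple.\<close>

lemma finitely_many_accesses: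
 assumes U: "!!z. R0<cmod z ==> z:U" and K: "compact K" "K Int U={}" "finite (components (K-{z0}))" "z0:K"
  and a: "!!n::nat. is_leg U z0 (a n)"
 obtains i j where "i<j" "ALL ep>0. EX ta>0. ALL t:{0<..ta}. ALL t':{0<..ta}. connected_component (ball z0 ep-K) (a i t) (a j t')"
proof (rule ccontr)
 assume neg: "~  thesis"
 define W where "W i j \<longleftrightarrow> (ALL ep>0. EX ta>0. ALL t:{0<..ta}. ALL t':{0<..ta}. connected_component (ball z0 ep-K) (a i t) (a j t'))" for i j
 have Wsym: "W j i" if "W i j" for i j using that unfolding W_def by (metis connected_component_sym)
 have nW: "~  W i j" if "i~=j" for i j
  using neg that Wsym[of i j] \<open>!!i j. [|i<j; _|] ==> thesis\<close> unfolding W_def by (metis nat_neq_iff)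
 have L: "leg_curve U z0 (a n)" and inj: "inj_on (a n) {0..}" for n using a[of n] unfolding is_leg_def leg_curve_def by auto
 have ca: "cont {0..} (a n)" and a0: "a n 0=z0" and aU: "t>0 ==> a n t:U" for n t
  using L[of n] unfolding leg_curve_def by auto
 have z0U: "z0 ~: U" using K by blast
 have near: "EX ta>0. ALL t:{0..ta}. a n t:ball z0 ep" if e: "ep>0" for n ep
 proof -
  obtain d where "d>0" "ALL x:{0..}. dist x 0<d --> dist (a n x) (a n 0)<ep"
   using ca[of n] e unfolding continuous_on_iff by (metis atLeast_iff order_refl)
  then show ?thesis using a0[of n] by (intro exI[of _ "d/2"]) (auto simp: dist_commute)
 qed
 \<comment> \<open>Common points arbitrarily close to \<open>z0\<close> would connect the two germs
   inside every small ball, so the two legs would have the same access.\<close>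
 have apart: "EX ta>0. ALL t:{0<..ta}. ALL t':{0<..ta}. a 0 t~=a j t'" if j: "j~=0" for j
 proof (rule ccontr)
  assume c: "~  ?thesis"
  have "W 0 j" unfolding W_def
  proof (intro allI impI)
   fix ep :: real assume e: "ep>0"
   obtain ta1 ta2 where ta: "ta1>0" "ta2>0" "ALL t:{0..ta1}. a 0 t:ball z0 ep" "ALL t:{0..ta2}. a j t:ball z0 ep" using near e by metis
   define ta where "ta=min ta1 ta2"
   have ta0: "ta>0" using ta by (simp add: ta_def)
   then obtain s s' where s: "s:{0<..ta}" "s':{0<..ta}" "a 0 s=a j s'" using c by blast
   define C where "C n=a n ` {0<..ta}" for n
   have C: "connected (C n)" for n unfolding C_def
    by (rule connected_continuous_image[OF cont_sub[OF ca]]) auto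
   have "connected (C 0 Un C j)" by (rule connected_Un[OF C C]) (use s in "unfold C_def, blast")
   moreover have "C 0 Un C j<=ball z0 ep-K" using ta aU K(2) unfolding C_def ta_def by fastforce
   ultimately show "EX ta>0. ALL t:{0<..ta}. ALL t':{0<..ta}. connected_component (ball z0 ep-K) (a 0 t) (a j t')"
    using ta0 unfolding connected_component_def C_def by blast
  qed
  then show False using nW j by metis
 qed
 define ro where "ro=max R0 (cmod z0)+1"
 have reach: "EX t>d. cmod (a n t)=ro" if "d>=0" "cmod (a n d)<ro" for n d
 proof -
  obtain T where T: "ALL t>=T. ro<cmod (a n t)" using L[of n] unfolding leg_curve_def tends_to_infinity_iff by blast
  have "cont {d..max T d} (a n)" using that by (intro cont_sub[OF ca]) auto
  moreover have "ro<=cmod (a n (max T d))" using T by (simp add: less_imp_le)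
  ultimately show ?thesis using norm_IVT[of d "max T d" "a n" ro] that(2) by force
 qed
 have r0: "cmod (a n 0)<ro" for n by (simp add: a0 ro_def)
 obtain t1 where "t1>0" "cmod (a 0 t1)=ro" using reach[of 0 0] r0 by auto
 then obtain T where T: "T>0" "cmod (a 0 T)=ro" "ALL t:{0..<T}. cmod (a 0 t)~=ro"
  using first_hit[OF ca[of 0], of "sphere 0 ro" t1] r0[of 0] by auto
 have below: "cmod (a 0 t)<ro" if t: "t:{0..<T}" for t
 proof (rule ccontr)
  assume "~  ?thesis"
  then obtain s where "s:{0<..t}" "cmod (a 0 s)=ro"
   using norm_IVT[of 0 t "a 0" ro, OF cont_sub[OF ca]] r0[of 0] t by auto
  then show False using T(3) t by auto
 qed
 text \<open>Closing \<open>a 0\<close> up by a circle forces every other leg to hit it.\<close>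
 define c where "c t=(if t<=T then a 0 t else a 0 T * exp (\<i> * of_real (t-T)))" for t
 have cont: "cont {0..} c"
 proof -
  have "cont ({0..T} Un {T..}) c" unfolding c_def
   by (rule continuous_on_cases) (use T in "auto intro!: continuous_intros cont_sub[OF ca]")
  moreover have "{0..T} Un {T..}={0..}" using T(1) by auto
  ultimately show ?thesis by simp
 qed
 have circ: "cmod (c t)=ro" if "t>T" for t using that T(2) by (simp add: c_def norm_mult)
 have ro0: "ro>0" "ro>R0" using norm_ge_zero[of z0] unfolding ro_def by linarith+
 have cU: "c t:U" if "t>0" for t using aU[OF that, of 0] circ[of t] U ro0 by (cases "t<=T") (auto simp: c_def)
 have c0: "c 0=z0" using T(1) a0 by (simp add: c_def)
 have injc: "inj_on c {0..<T+2 * pi}"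
 proof (rule linorder_inj_onI')
  fix s t assume st: "s:{0..<T+2 * pi}" "t:{0..<T+2 * pi}" "s<t"
  show "c s~=c t"
  proof (cases "t<=T")
   case True
   then show ?thesis using inj_onD[OF inj[of 0], of s t] st by (auto simp: c_def)
  next
   case F: False
   show ?thesis
   proof (cases "s<T")
    case True
    then show ?thesis using below[of s] circ[of t] st F by (auto simp: c_def)
   next
    case False
    have cs: "c s=a 0 T * exp (\<i> * of_real (s-T))" using False by (cases "s=T") (auto simp: c_def)
    have nz: "a 0 T~=0" using T(2) ro0 by auto
    show ?thesis
    proof
     assume "c s=c t"
     then have "exp (\<i> * of_real (s-T))=exp (\<i> * of_real (t-T))" using nz F unfolding cs by (simp add: c_def)
     then obtain n :: int where "\<i> * of_real (s-T)=\<i> * of_real (t-T) + of_real (of_int (2 * n) * pi) * \<i>" unfolding exp_eq by blast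
     then have "\<i> * of_real (s-T)=\<i> * of_real (t-T + of_int (2 * n) * pi)" by (simp add: algebra_simps)
     then have "s-T=t-T + of_int (2 * n) * pi" by (simp del: of_real_add of_real_diff of_real_mult)
     then have e: "t-s = - of_int n * (2 * pi)" by simp
     moreover have "0<t-s" "t-s<1*(2 * pi)" using st False by auto
     ultimately have "0 < - of_int n * (2 * pi)" "- of_int n * (2 * pi)<1*(2 * pi)" by simp_all
     then have "0 < - (of_int n :: real)" "- (of_int n :: real)<1" by (simp_all only: zero_less_mult_iff mult_less_cancel_right, auto)
     then have "real_of_int n<real_of_int 0" "real_of_int (- 1)<real_of_int n" by simp_all
     then show False unfolding of_int_less_iff by simp
    qed
   qed
  qed
 qed
 have sphere_c: "EX t:{0<..<T+2 * pi}. c t=z" if z: "cmod z=ro" for z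
 proof -
  have "cmod (z/a 0 T)=1" using z T(2) ro0 by (simp add: norm_divide)
  then obtain x where x: "0<=x" "x<2 * pi" "z/a 0 T=exp (\<i> * of_real x)"
   using complex_norm_eq_1_exp by (metis Arg2pi exp_complex_eqI mult.commute norm_one mult_1 of_real_1)
  have nz: "a 0 T~=0" using T(2) ro0 by auto
  have "c (T + x)=z" using x nz by (cases "x=0") (auto simp: c_def field_simps)
  then show ?thesis using x T(1) by (intro bexI[of _ "T + x"]) auto
 qed
 \<comment> \<open>The leg has to cross the circle of radius \<open>ro\<close>, all of which lies on
   \<open>c\<close>, and close to \<open>z0\<close> it is disjoint from \<open>a 0\<close>. Hence a
   first meeting with \<open>a 0\<close> or the circle exists at a positive time, and it lies on
   \<open>c\<close>.\<close>
 have hit: "EX s t. s>0 & t:{0<..<T+2 * pi} & a j s=c t & (ALL x:{0<..<s}. a j x ~: c ` {0..t})" if j: "j~=0" for j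
 proof -
  obtain ta' where ta': "ta'>0" "ALL t:{0<..ta'}. ALL t':{0<..ta'}. a 0 t~=a j t'" using apart[OF j] by blast
  define ta where "ta=min ta' (T/2)"
  define X where "X=a 0 ` {ta..T} Un sphere 0 ro"
  have ta0: "ta>0" "ta<=T" "ta<=ta'" using ta' T(1) by (auto simp: ta_def)
  have "compact (a 0 ` {ta..T})" by (rule compact_continuous_image[OF cont_sub[OF ca]]) (use ta0 in auto)
  then have cX: "closed X" unfolding X_def by (intro closed_Un compact_imp_closed) auto
  have "z0 ~: X" using aU[of _ 0] z0U ta0 r0[of 0] a0 by (force simp: X_def)
  then obtain e where e: "e>0" "ball z0 e <= - X" using cX openE[of "- X" z0] by (metis ComplI open_Compl)
  obtain d' where d': "d'>0" "ALL t:{0..d'}. a j t:ball z0 e" using near[OF e(1)] by blast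
  define d where "d=min d' ta"
  have d: "d>0" "d<=d'" "d<=ta" using d' ta0 by (auto simp: d_def)
  have early: "a j x ~: X Un a 0 ` {0..T}" if x: "x:{0<..d}" for x
  proof -
   have "a j x:ball z0 e" using d'(2)[rule_format, of x] x d by simp
   then have "a j x ~: X" using e(2) by blast
   moreover have "a j x~=a 0 t" if "t:{0..ta}" for t
   proof (cases "t=0")
    case True
    then show ?thesis using aU[of x j] z0U a0[of 0] x by auto
   next
    case False
    then show ?thesis using ta'(2)[rule_format, of t x] x d ta0 that by auto
   qed
   ultimately show ?thesis unfolding X_def by (fastforce simp: not_le)
  qed
  define Y where "Y=a 0 ` {0..T} Un sphere 0 ro"
  have "compact (a 0 ` {0..T})" by (rule compact_continuous_image[OF cont_sub[OF ca]]) auto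
  then have cY: "closed Y" unfolding Y_def by (intro closed_Un compact_imp_closed) auto
  have "a j d ~: Y" using early[of d] d unfolding X_def Y_def by auto
  moreover have "cmod (a j d)<ro"
  proof (rule ccontr)
   assume "~  ?thesis"
   then obtain s where s: "s:{0<..d}" "cmod (a j s)=ro"
    using norm_IVT[of 0 d "a j" ro, OF cont_sub[OF ca]] r0[of j] d by auto
   then show False using early[OF s(1)] unfolding X_def by auto
  qed
  then obtain t2 where "t2>d" "cmod (a j t2)=ro" using reach[of d j] d by auto
  ultimately obtain s where s: "s>d" "a j s:Y" "ALL x:{d..<s}. a j x ~: Y"
   using first_hit[OF cont_sub[OF ca[of j]] cY, of d t2] d unfolding Y_def by auto
  have noY: "a j x ~: Y" if "x:{0<..<s}" for x using early[of x] s(3) that unfolding X_def Y_def by (cases "x<d") auto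
  have cY: "c x:Y" if "x>=0" for x using circ[of x] that by (cases "x<=T") (auto simp: Y_def c_def)
  have "EX t:{0<..<T+2 * pi}. c t=a j s"
  proof (cases "cmod (a j s)=ro")
   case False
   then obtain t where t: "t:{0..T}" "a j s=a 0 t" using s(2) unfolding Y_def by auto
   then have "t~=0" using aU[of s j] z0U a0[of 0] s(1) d by auto
   then show ?thesis using t pi_gt_zero by (intro bexI[of _ t]) (auto simp: c_def simp del: pi_gt_zero)
  qed (use sphere_c in blast)
  then obtain t where t: "t:{0<..<T+2 * pi}" "c t=a j s" by blast
  have "a j x ~: c ` {0..t}" if "x:{0<..<s}" for x using noY[OF that] cY by auto
  then show ?thesis using t s(1) d by (intro exI[of _ s] exI[of _ t]) auto
 qed
 define P where "P j s t \<longleftrightarrow> s>0 & t:{0<..<T+2 * pi} & a j s=c t & (ALL x:{0<..<s}. a j x ~: c ` {0..t})" for j s t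
 have "ALL j. EX s t. j~=0 --> P j s t" using hit unfolding P_def by blast
 from choice[OF this] obtain s where "ALL j. EX t. j~=0 --> P j (s j) t" by blast
 from choice[OF this] obtain t where "ALL j. j~=0 --> P j (s j) (t j)" by blast
 then have st: "s j>0 & t j:{0<..<T+2 * pi} & a j (s j)=c (t j) & (ALL x:{0<..<s j}. a j x ~: c ` {0..t j})" if "j~=0" for j
  using that unfolding P_def by blast
 define v where "v j x=winding_number (seg c 0 (t j)) x-winding_number (seg (a j) 0 (s j)) x" for j x
 have loop: "EX J. simple_path J & pathfinish J=pathstart J & path_image J<=insert z0 U & (ALL x:K-{z0}. winding_number J x=v j x)"
  if j: "j~=0" for j
 proof -
  have sj: "s j>0" "t j>0" "t j<T+2 * pi" "a j (s j)=c (t j)" using st[OF j] by auto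
  have c1: "cont {0..t j} c" "cont {0..s j} (a j)" by (auto intro: cont_sub[OF cont] cont_sub[OF ca])
  note sc=seg[OF c1(1) less_imp_le[OF sj(2)]] and sa=seg[OF c1(2) less_imp_le[OF sj(1)]]
  have inj_seg: "inj_on (seg p 0 r) {0..1}" if "inj_on p {0..r}" "r>0" for p r
  proof (rule inj_onI)
   fix x y assume "x:{0..1}" "y:{0..1}" "seg p 0 r x=seg p 0 r y"
   then have "x * r=y * r" using inj_onD[OF that(1), of "x * r" "y * r"] that(2) by (simp add: seg_def mult_left_le_one_le)
   then show "x=y" using that(2) by simp
  qed
  have "{0..t j}<={0..<T+2 * pi}" using sj by auto
  then have "inj_on c {0..t j}" "inj_on (a j) {0..s j}" using inj_on_subset[OF injc] inj_on_subset[OF inj[of j]] by auto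
  then have arcs: "arc (seg c 0 (t j))" "arc (seg (a j) 0 (s j))" unfolding arc_def
   using sc(1) sa(1) inj_seg sj by auto
  let ?J = "seg c 0 (t j) +++ reversepath (seg (a j) 0 (s j))"
  have "c ` {0..t j} Int a j ` {0..s j}<={z0, c (t j)}"
  proof
   fix z assume "z:c ` {0..t j} Int a j ` {0..s j}"
   then obtain x where x: "x:{0..s j}" "z=a j x" "z:c ` {0..t j}" by blast
   then show "z:{z0, c (t j)}" using st[OF j] a0[of j] by (cases "x=0"; cases "x=s j") auto
  qed
  then have "path_image (seg c 0 (t j)) Int path_image (reversepath (seg (a j) 0 (s j)))<={z0, c (t j)}"
   using sc(4) sa(4) by auto
  then have "simple_path ?J"
   by (intro simple_path_join_loop) (use arcs sc sa c0 a0 sj in "auto simp: arc_reversepath")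
  moreover have "pathfinish ?J=pathstart ?J" using sc(2) sa(2) c0 a0 by simp
  moreover have img: "path_image ?J<=insert z0 U"
  proof -
   have i: "c ` {0..t j}<=insert z0 U" "a j ` {0..s j}<=insert z0 U"
    using cU c0 aU a0 by (auto simp: le_less)
   have "path_image ?J=path_image (seg c 0 (t j)) Un path_image (seg (a j) 0 (s j))"
    by (subst path_image_join) (use sc sa sj in auto)
   then show ?thesis using order_trans[OF sc(4) i(1)] order_trans[OF sa(4) i(2)] by simp
  qed
  moreover have "winding_number ?J x=v j x" if x: "x:K-{z0}" for x
  proof -
   have "x ~: insert z0 U" using x K(2) by auto
   then have "x ~: path_image (seg c 0 (t j))" "x ~: path_image (seg (a j) 0 (s j))" using img sc sa sj by (auto simp: path_image_join)
   then show ?thesis using sc sa sj by (simp add: v_def winding_number_join winding_number_reversepath)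
  qed
  ultimately show ?thesis by blast
 qed
 \<comment> \<open>The index is \<open>Suc j\<close> because the leg \<open>a 0\<close> has been
   used up in \<open>c\<close>. One representative point per component suffices, as \<open>v\<close>
   is constant on components.\<close>
 define q where "q j=(\<lambda>C\<in>components (K-{z0}). v (Suc j) (SOME x. x:C))" for j
 have const: "v j x:{-1, 0, 1} & v j x=v j y" if j: "j~=0" and C: "C:components (K-{z0})" and xy: "x:C" "y:C" for j C x y
 proof -
  obtain J where J: "simple_path J" "pathfinish J=pathstart J" "path_image J<=insert z0 U" "ALL x:K-{z0}. winding_number J x=v j x" using loop[OF j] by blast
  have CK: "C<=K-{z0}" "connected C" using C in_components_subset in_components_connected by blast+
  have "C Int path_image J={}" using CK J(3) K(2) by blast
  then have "winding_number J x=winding_number J y" using winding_number_eq[OF simple_path_imp_path[OF J(1)] J(2) xy CK(2)] by simp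
  moreover have "winding_number J x:{-1, 0, 1}"
   by (rule simple_closed_path_winding_number_cases[OF J(1,2)]) (use \<open>C Int path_image J={}\<close> xy in blast)
  ultimately show ?thesis using J(4) CK(1) xy by (metis subsetD)
 qed
 have "q j:components (K-{z0}) \<rightarrow>\<^sub>E {-1, 0, 1}" for j
 proof -
  have "v (Suc j) (SOME x. x:C):{-1, 0, 1}" if C: "C:components (K-{z0})" for C
  proof -
   have "(SOME x. x:C):C" using in_components_nonempty[OF C] by (simp add: some_in_eq)
   then show ?thesis using const[OF _ C] by blast
  qed
  then show ?thesis unfolding q_def by (intro restrict_PiE_iff[THEN iffD2] ballI)
 qed
 then have "range q<=components (K-{z0}) \<rightarrow>\<^sub>E {-1, 0, 1}" by blast
 moreover have "finite (components (K-{z0}) \<rightarrow>\<^sub>E {-1, 0, 1 :: complex})" by (rule finite_PiE[OF K(3)]) auto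
 ultimately have "finite (range q)" by (rule finite_subset)
 then have "~  inj q" using finite_imageD infinite_UNIV_nat by blast
 then obtain j k where jk: "j~=k" "q j=q k" unfolding inj_def by blast
 have vq: "v (Suc j) x=v (Suc k) x" if x: "x:K-{z0}" for x
 proof -
  obtain C where C: "C:components (K-{z0})" "x:C" using x by (metis Union_components UnionE)
  then have "(SOME x. x:C):C" by (metis someI)
  then have "v (Suc i) x=q i C" for i using const[OF _ C(1), of "Suc i" x "SOME x. x:C"] C unfolding q_def by simp
  then show ?thesis using jk(2) by metis
 qed
 have fin: "W (Suc j) (Suc k)" if le: "t (Suc k)<=t (Suc j)" and vq: "!!x. x:K-{z0} ==> v (Suc j) x=v (Suc k) x" for j k
  unfolding W_def
 proof (intro allI impI)
  fix ep :: real assume "ep>0"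
  moreover have "c ` {0<..t (Suc j)}<=U" using cU by auto
  moreover have "winding_number (seg c 0 (t (Suc j))) x-winding_number (seg (a (Suc j)) 0 (s (Suc j))) x =
    winding_number (seg c 0 (t (Suc k))) x-winding_number (seg (a (Suc k)) 0 (s (Suc k))) x" if "x:K-{z0}" for x
   using vq[OF that] unfolding v_def .
  moreover have "cont {0..t (Suc j)} c" by (rule cont_sub[OF cont]) auto
  ultimately show "EX ta>0. ALL x:{0<..ta}. ALL t':{0<..ta}. connected_component (ball z0 ep-K) (a (Suc j) x) (a (Suc k) t')"
   using same_access[of K U z0 "a (Suc j)" "a (Suc k)" "t (Suc j)" c "t (Suc k)" "s (Suc j)" "s (Suc k)" ep]
    K(1,2) L c0 le st[of "Suc j"] st[of "Suc k"] by auto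
 qed
 show False
 proof (cases "t (Suc k)<=t (Suc j)")
  case True
  then show ?thesis using fin[OF True] vq nW[of "Suc j" "Suc k"] jk(1) by auto
 next
  case False
  then have "t (Suc j)<=t (Suc k)" by simp
  then show ?thesis using fin[of j k] vq nW[of "Suc k" "Suc j"] jk(1) by (metis Suc_inject)
 qed
qed

section \<open>Homotopies between germs in one access\<close>

text \<open>A loop in \<open>W\<close> winds around no outside point. Points of \<open>K\<close> are
  joined within \<open>K\<close> to a point outside the ball; a point of another component is
  joined, through that component, to a boundary point of it, which is in \<open>K\<close> or outside
  the ball.\<close>

lemma component_simply_connected:
 fixes K :: "complex set"
 assumes K: "closed K" "connected K" "~  K<=ball z e" and W: "W:components (ball z e-K)"
 shows "simply_connected W" "open W"
proof -
 have oB: "open (ball z e-K)" using K(1) by (simp add: open_Diff)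
 show oW: "open W" by (rule open_components[OF oB W])
 have cW: "connected W" and WB: "W<=ball z e-K" using W in_components_connected in_components_subset by blast+
 have "winding_number g x=0" if g: "path g" "path_image g<=W" "pathfinish g=pathstart g" and x: "x ~: W" for g x
 proof -
  have out: "winding_number g y=0" if "y ~: ball z e" for y
   by (rule winding_number_zero_outside[OF g(1) convex_ball g(3) that]) (use g(2) WB in auto)
  have inK: "winding_number g y=0" if y: "y:K" for y
  proof -
   obtain k where k: "k:K" "k ~: ball z e" using K(3) by blast
   have "K Int path_image g={}" using g(2) WB by blast
   then show ?thesis using winding_number_eq[OF g(1,3) y k(1) K(2)] out[OF k(2)] by simp
  qed
  show ?thesis
  proof (cases "x:ball z e-K")
   case True
   then obtain C where C: "C:components (ball z e-K)" "x:C" by (metis Union_components UnionE)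
   have oC: "open C" by (rule open_components[OF oB C(1)])
   have CW: "C Int W={}" using components_eq[OF C(1) W] C(2) x by blast
   have Cb: "C<=ball z e-K" using C(1) in_components_subset by blast
   then have "bounded C" using bounded_subset[OF bounded_ball[of z e]] by blast
   then have "frontier C~={}" using C(2) frontier_not_empty[of C] not_bounded_UNIV by blast
   then obtain p where p: "p:closure C" "p ~: C" using oC by (auto simp: frontier_def interior_open)
   have pB: "p ~: ball z e-K"
   proof
    assume "p:ball z e-K"
    then obtain D where D: "D:components (ball z e-K)" "p:D" by (metis Union_components UnionE)
    have "D Int C~={}" using open_Int_closure_eq_empty[OF open_components[OF oB D(1)], of C] p(1) D(2) by blast
    then show False using components_eq[OF D(1) C(1)] D(2) p(2) by blast
   qed
   have wp: "winding_number g p=0" using pB out inK by blast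
   have "connected (insert p C)"
    by (rule connected_intermediate_closure[OF in_components_connected[OF C(1)]]) (use p(1) closure_subset in auto)
   moreover have "insert p C Int path_image g={}" using CW pB g(2) WB by blast
   ultimately show ?thesis using winding_number_eq[OF g(1,3), of x "insert p C" p] C(2) wp by simp
  qed (use out inK in blast)
 qed
 then show "simply_connected W" unfolding simply_connected_eq_winding_number_zero[OF oW] using cW by blast
qed

text \<open>\<open>W\<close> is homeomorphic to a disc and hence an absolute retract, so the map
  prescribed on the four sides of the rectangle extends over it.\<close>

lemma strip_extension:
 fixes a b p q :: "real => complex"
 assumes W: "simply_connected W" "open W" and lu: "l<u"
  and c: "cont {l..u} a" "cont {l..u} b" "cont {0..1} p" "cont {0..1} q"
  and im: "a ` {l..u}<=W" "b ` {l..u}<=W" "p ` {0..1}<=W" "q ` {0..1}<=W"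
  and eq: "p 0=a l" "p 1=b l" "q 0=a u" "q 1=b u"
 shows "EX F. cont ({0..1} \<times> {l..u}) F & F ` ({0..1} \<times> {l..u})<=W &
  (ALL t:{l..u}. F (0, t)=a t & F (1, t)=b t) & (ALL s:{0..1}. F (s, l)=p s & F (s, u)=q s)"
proof -
 have "W~={}" using im(3) by auto
 then have "W homeomorphic ball (0::complex) 1" using W simply_connected_eq_homeomorphic_to_disc by blast
 then have AR: "AR W" using homeomorphic_AR_iff_AR convex_imp_AR[OF convex_ball, of 0 1] by (metis ball_eq_empty not_one_le_zero)
 define B where "B=(({0} \<times> {l..u} Un {1} \<times> {l..u}) Un {0..1} \<times> {l}) Un {0..1::real} \<times> {u}"
 define be where "be x=(if fst x=0 then a (snd x) else if fst x=1 then b (snd x) else if snd x=l then p (fst x) else q (fst x))" for x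
 have "cont B be" unfolding B_def
 proof (intro continuous_on_closed_Un closed_Un closed_Times closed_singleton closed_atLeastAtMost)
  show "cont ({0} \<times> {l..u}) be"
   by (rule continuous_on_eq[of _ "%x. a (snd x)"]) (auto simp: be_def intro!: cont_comp[OF c(1)] continuous_intros)
  show "cont ({1} \<times> {l..u}) be"
   by (rule continuous_on_eq[of _ "%x. b (snd x)"]) (auto simp: be_def intro!: cont_comp[OF c(2)] continuous_intros)
  show "cont ({0..1} \<times> {l}) be"
   by (rule continuous_on_eq[of _ "%x. p (fst x)"]) (use eq in "auto simp: be_def intro!: cont_comp[OF c(3)] continuous_intros")
  show "cont ({0..1} \<times> {u}) be"
   by (rule continuous_on_eq[of _ "%x. q (fst x)"]) (use eq lu in "auto simp: be_def intro!: cont_comp[OF c(4)] continuous_intros")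
 qed
 moreover have "be ` B<=W" using im eq unfolding B_def be_def by (auto simp: image_subset_iff)
 moreover have "closed B" unfolding B_def by (intro closed_Un closed_Times closed_singleton closed_atLeastAtMost)
 ultimately obtain F where F: "cont UNIV F" "F ` UNIV<=W" "!!x. x:B ==> F x=be x"
  using AR_imp_absolute_extensor[OF AR, of B be UNIV] by auto
 have "cont ({0..1} \<times> {l..u}) F" by (rule cont_sub[OF F(1)]) simp
 moreover have "F (0, t)=a t & F (1, t)=b t" if "t:{l..u}" for t using F(3)[of "(0, t)"] F(3)[of "(1, t)"] that by (auto simp: B_def be_def)
 moreover have "F (s, l)=p s & F (s, u)=q s" if "s:{0..1}" for s
  using F(3)[of "(s, l)"] F(3)[of "(s, u)"] that eq lu by (auto simp: B_def be_def)
 ultimately show ?thesis using F(2) by (intro exI[of _ F]) auto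
qed

text \<open>Approaches in the same access are joined by rungs shrinking to \<open>z0\<close>, and the strips between consecutive
  rungs are filled in.\<close>

lemma germ_homotopy:
 assumes K: "compact K" "connected K" "z0:K" "x:K" "x~=z0" and e0: "e0>0" "ball z0 e0-K<=U"
  and L: "leg_curve U z0 a" "leg_curve U z0 b"
  and acc: "!!ep. ep>0 ==> EX ta>0. ALL t:{0<..ta}. ALL t':{0<..ta}. connected_component (ball z0 ep-K) (a t) (b t')"
 obtains t0 and H :: "real*real => complex" where "t0>0" "cont ({0..1} \<times> {0..t0}) H" "ALL s:{0..1}. H (s, 0)=z0"
  "ALL s:{0..1}. ALL t:{0<..t0}. H (s, t):U" "ALL t:{0..t0}. H (0, t)=a t & H (1, t)=b t"
proof -
 \<comment> \<open>Radii not exceeding the distance from \<open>z0\<close> to \<open>x\<close>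
   prevent \<open>K\<close> from fitting into the ball, as \<open>component_simply_connected\<close>
   requires.\<close>
 define e where "e i=min e0 (cmod (x-z0))/real (Suc i)" for i
 have m: "min e0 (cmod (x-z0))>0" using K(5) e0(1) by simp
 have e: "e i>0" "e i<=e0" "e i<=cmod (x-z0)" "e (Suc i)<=e i" for i
  using m frac_le[of "min e0 (cmod (x-z0))" "min e0 (cmod (x-z0))" 1 "real (Suc i)"]
   frac_le[of "min e0 (cmod (x-z0))" "min e0 (cmod (x-z0))" "real (Suc i)" "real (Suc (Suc i))"] unfolding e_def by auto
 have e_lim: "EX i. e i<d" if "d>0" for d
 proof -
  obtain i where "min e0 (cmod (x-z0))/d<real i" using reals_Archimedean2 by blast
  then show ?thesis using that m unfolding e_def by (intro exI[of _ i]) (simp add: field_simps)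
 qed
 define B where "B i=ball z0 (e i)-K" for i
 define P where "P i ta \<longleftrightarrow> ta>0 & (ALL t:{0<..ta}. ALL t':{0<..ta}. connected_component (B i) (a t) (b t'))" for i ta
 have "EX ta. P 0 ta" using acc[OF e(1)] unfolding P_def B_def by blast
 moreover have "EX ta'. P (Suc i) ta' & ta'<=ta/2" if "P i ta" for i ta
 proof -
  obtain ta' where "P (Suc i) ta'" using acc[OF e(1)] unfolding P_def B_def by blast
  then have "P (Suc i) (min ta' (ta/2))" using that unfolding P_def by auto
  then show ?thesis by (intro exI[of _ "min ta' (ta/2)"]) auto
 qed
 ultimately obtain ta where ta: "!!i. P i (ta i)" "!!i. ta (Suc i)<=ta i/2"
  using dependent_nat_choice[of P "%_ t t'. t'<=t/2"] by metis
 have tap: "ta i>0" "ta (Suc i)<ta i" for i using ta(1)[of i] ta(2)[of i] unfolding P_def by auto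
 have tamono: "i<=j ==> ta j<=ta i" for i j by (rule lift_Suc_antimono_le[of ta]) (use tap(2) less_imp_le in blast)+
 have talim: "EX i. ta i<t" if t: "t>0" for t
 proof -
  have "ta i<=ta 0/2 ^ i" for i
  proof (induction i)
   case (Suc i)
   then have "ta (Suc i)<=ta 0/2 ^ i/2" by (intro order_trans[OF ta(2)[of i]] divide_right_mono) auto
   then show ?case by simp
  qed simp
  moreover obtain i where "ta 0/t<2 ^ i" using real_arch_pow[of 2 "ta 0/t"] by auto
  then have "ta 0/2 ^ i<t" using t by (simp add: field_simps)
  ultimately show ?thesis by (meson le_less_trans)
 qed
 define W where "W i=connected_component_set (B i) (a (ta i))" for i
 have cc: "connected_component (B i) (a t) (b t')" if "t:{0<..ta i}" "t':{0<..ta i}" for i t t' using ta(1)[of i] that unfolding P_def by blast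
 have aW: "a t:W i" "b t:W i" if t: "t:{0<..ta i}" for t i
 proof -
  have tai: "ta i:{0<..ta i}" using tap by simp
  show "b t:W i" using cc[OF tai t] unfolding W_def by simp
  show "a t:W i" using connected_component_trans[OF cc[OF tai tai] connected_component_sym[OF cc[OF t tai]]] unfolding W_def by simp
 qed
 have "a (ta i):B i" for i using connected_component_in(1)[OF cc[of "ta i" i "ta i"]] tap by simp
 then have Wc: "W i:components (B i)" for i unfolding W_def components_def by blast
 have Ksub: "~  K<=ball z0 (e i)" for i using K(4) e(3)[of i] by (auto simp: dist_norm norm_minus_commute not_less)
 note Wsc=component_simply_connected[OF compact_imp_closed[OF K(1)] K(2) Ksub Wc[unfolded B_def]]
 have Wsub: "W (Suc i)<=W i" for i
 proof (rule components_maximal[OF Wc in_components_connected[OF Wc]])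
  show "W (Suc i)<=B i" using in_components_subset[OF Wc[of "Suc i"]] e(4)[of i] unfolding B_def by auto
  have "ta (Suc i):{0<..ta i}" "ta (Suc i):{0<..ta (Suc i)}" using tap[of i] tap[of "Suc i"] by auto
  then show "W i Int W (Suc i)~={}" using aW(1) by blast
 qed
 have "ALL i. EX ro. path ro & path_image ro<=W i & ro 0=a (ta i) & ro 1=b (ta i)"
 proof
  fix i
  have "path_connected (W i)" using connected_open_path_connected[OF Wsc(2)] in_components_connected[OF Wc] by blast
  moreover have "a (ta i):W i" "b (ta i):W i" using aW[of "ta i" i] tap by auto
  ultimately show "EX ro. path ro & path_image ro<=W i & ro 0=a (ta i) & ro 1=b (ta i)"
   unfolding path_connected_def pathstart_def pathfinish_def by blast
 qed
 from choice[OF this] obtain ro where "ALL i. path (ro i) & path_image (ro i)<=W i & ro i 0=a (ta i) & ro i 1=b (ta i)" by blast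
 then have ro: "path (ro i)" "path_image (ro i)<=W i" "ro i 0=a (ta i)" "ro i 1=b (ta i)" for i by auto
 have "ALL i. EX F. cont ({0..1} \<times> {ta (Suc i)..ta i}) F & F ` ({0..1} \<times> {ta (Suc i)..ta i})<=W i &
  (ALL t:{ta (Suc i)..ta i}. F (0, t)=a t & F (1, t)=b t) & (ALL s:{0..1}. F (s, ta (Suc i))=ro (Suc i) s & F (s, ta i)=ro i s)"
 proof (intro allI strip_extension[OF Wsc tap(2)])
  fix i
  have sub: "{ta (Suc i)..ta i}<={0<..ta i}" using tap(1)[of "Suc i"] by auto
  show "a ` {ta (Suc i)..ta i}<=W i" "b ` {ta (Suc i)..ta i}<=W i" using aW sub by auto
  show "cont {ta (Suc i)..ta i} a" "cont {ta (Suc i)..ta i} b"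
   using L tap(1)[of "Suc i"] unfolding leg_curve_def by (auto elim: cont_sub)
  show "ro (Suc i) ` {0..1}<=W i" "ro i ` {0..1}<=W i" 
   using order_trans[OF ro(2) Wsub] ro(2)[of i] unfolding path_image_def by auto
 qed (use ro in "auto simp: path_def")
 from choice[OF this] obtain F where "ALL i. cont ({0..1} \<times> {ta (Suc i)..ta i}) (F i) & F i ` ({0..1} \<times> {ta (Suc i)..ta i})<=W i &
  (ALL t:{ta (Suc i)..ta i}. F i (0, t)=a t & F i (1, t)=b t) & (ALL s:{0..1}. F i (s, ta (Suc i))=ro (Suc i) s & F i (s, ta i)=ro i s)" by (rule exE)
 then have F: "cont ({0..1} \<times> {ta (Suc i)..ta i}) (F i)" "F i ` ({0..1} \<times> {ta (Suc i)..ta i})<=W i"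
  "t:{ta (Suc i)..ta i} ==> F i (0, t)=a t & F i (1, t)=b t"
  "s:{0..1} ==> F i (s, ta (Suc i))=ro (Suc i) s & F i (s, ta i)=ro i s" for i s t by auto
 define ix where "ix t=(LEAST i. ta (Suc i)<t)" for t
 define H where "H p=(if snd p<=0 then z0 else F (ix (snd p)) p)" for p
 have ix: "ix t=i" if "ta (Suc i)<t" "t<=ta i" for i t unfolding ix_def
 proof (rule Least_equality)
  show "i<=j" if "ta (Suc j)<t" for j
  proof (rule ccontr)
   assume "~  i<=j"
   then have "ta i<=ta (Suc j)" using tamono[of "Suc j" i] by simp
   then show False using that \<open>t<=ta i\<close> by linarith
  qed
 qed (rule that(1))
 have strip: "EX i. ta (Suc i)<t & t<=ta i" if t: "0<t" "t<=ta 0" for t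
 proof -
  obtain i where "ta i<t" "ALL j<i. ~  ta j<t" using exists_least_iff[of "%i. ta i<t"] talim[OF t(1)] by blast
  then show ?thesis using t(2) by (cases i) (auto simp: not_less)
 qed
 have HF: "H (s, t)=F i (s, t)" if "s:{0..1}" "t:{ta (Suc i)..ta i}" for s t i
 proof (cases "t=ta (Suc i)")
  case True
  have "ix t=Suc i" by (rule ix) (use tap True in auto)
  then show ?thesis using True F(4)[OF that(1)] tap(1)[of "Suc i"] by (simp add: H_def)
 next
  case False
  have "ix t=i" by (rule ix) (use that False in auto)
  then show ?thesis using that tap(1)[of "Suc i"] by (simp add: H_def)
 qed
 have HW: "H (s, t):W i" if st: "s:{0..1}" "0<t" "t<=ta i" for s t i
 proof -
  obtain j where j: "ta (Suc j)<t" "t<=ta j" using strip[of t] st tamono[of 0 i] by force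
  have "~  j<i"
  proof
   assume "j<i"
   then have "ta i<=ta (Suc j)" using tamono[of "Suc j" i] by simp
   then show False using j(1) st(3) by linarith
  qed
  then have "i<=j" by simp
  then have "W j<=W i" using lift_Suc_antimono_le[of W, OF Wsub] by blast
  moreover have m: "s:{0..1}" "t:{ta (Suc j)..ta j}" using st j by auto
  then have "F j (s, t):W j" by (intro subsetD[OF F(2)] imageI) auto
  ultimately show ?thesis using HF[OF m] by auto
 qed
 have Hn: "cont ({0..1} \<times> {ta n..ta 0}) H" for n
 proof (induction n)
  case 0
  have "{0..1} \<times> {ta 0..ta 0}<={0..1} \<times> {ta (Suc 0)..ta 0}" using tap(2)[of 0] by auto
  from cont_sub[OF F(1) this] show ?case by (rule continuous_on_eq) (use HF[of _ _ 0] tap(2)[of 0] in auto)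
 next
  case (Suc n)
  have "{0..1} \<times> {ta (Suc n)..ta 0}={0..1} \<times> {ta (Suc n)..ta n} Un {0..1::real} \<times> {ta n..ta 0}"
   using tap(2)[of n] tamono[of 0 n] by auto
  moreover have "cont ({0..1} \<times> {ta (Suc n)..ta n}) H" by (rule continuous_on_eq[OF F(1)]) (use HF in auto)
  ultimately show ?case using Suc by (auto intro!: continuous_on_closed_Un closed_Times)
 qed
 have contH: "cont ({0..1} \<times> {0..ta 0}) H"
  unfolding continuous_on_iff
 proof (intro ballI allI impI)
  fix q :: "real*real" and d :: real assume q: "q:{0..1} \<times> {0..ta 0}" and d: "d>0"
  show "EX de>0. ALL y:{0..1} \<times> {0..ta 0}. dist y q<de --> dist (H y) (H q)<d"
  proof (cases "snd q=0")
   case True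
   \<comment> \<open>Continuity at the vertex: before time \<open>ta i\<close> all strips lie in the
     ball of radius \<open>e i\<close> about \<open>z0\<close>.\<close>
   obtain i where i: "e i<d" using e_lim[OF d] by blast
   have "dist (H y) (H q)<d" if y: "y:{0..1} \<times> {0..ta 0}" "dist y q<ta i" for y
   proof (cases "snd y=0")
    case False
    have "\<bar>snd y-snd q\<bar><ta i" using y(2) dist_snd_le[of y q] by (simp add: dist_real_def)
    then have "H y:W i" using HW[of "fst y" "snd y" i] y(1) False True by (auto simp: mem_Times_iff)
    then have "H y:ball z0 (e i)" using in_components_subset[OF Wc[of i]] unfolding B_def by blast
    then show ?thesis using i True by (simp add: H_def dist_commute)
   qed (use True d in "simp add: H_def")
   then show ?thesis using tap by blast
  next
   case False
   then have sq: "snd q>0" using q by auto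
   obtain n where n: "ta n<snd q" using talim[OF sq] by blast
   then have "q:{0..1} \<times> {ta n..ta 0}" using q by (auto simp: mem_Times_iff)
   then obtain de where de: "de>0" "ALL y:{0..1} \<times> {ta n..ta 0}. dist y q<de --> dist (H y) (H q)<d"
    using Hn[of n] d unfolding continuous_on_iff by blast
   have "dist (H y) (H q)<d" if y: "y:{0..1} \<times> {0..ta 0}" "dist y q<min de (snd q-ta n)" for y
   proof -
    have "\<bar>snd y-snd q\<bar><snd q-ta n" using y(2) dist_snd_le[of y q] by (simp add: dist_real_def)
    then have "y:{0..1} \<times> {ta n..ta 0}" using y(1) by (auto simp: mem_Times_iff)
    then show ?thesis using de(2) y(2) by auto
   qed
   then show ?thesis using de(1) n by (intro exI[of _ "min de (snd q-ta n)"]) auto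
  qed
 qed
 show ?thesis
 proof (rule that[OF tap(1)[of 0] contH])
  show "ALL s:{0..1}. H (s, 0)=z0" by (simp add: H_def)
  have "W 0<=U" using in_components_subset[OF Wc[of 0]] e(2)[of 0] e0(2) unfolding B_def by (auto simp: subset_iff)
  then show "ALL s:{0..1}. ALL t:{0<..ta 0}. H (s, t):U" using HW[of _ _ 0] by auto
  show "ALL t:{0..ta 0}. H (0, t)=a t & H (1, t)=b t"
  proof
   fix t assume t: "t:{0..ta 0}"
   show "H (0, t)=a t & H (1, t)=b t"
   proof (cases "t=0")
    case True
    then show ?thesis using L by (simp add: H_def leg_curve_def)
   next
    case False
    then obtain i where "ta (Suc i)<t" "t<=ta i" using strip[of t] t by auto
    then show ?thesis using HF[of 0 t i] HF[of 1 t i] F(3)[of t i] by auto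
   qed
  qed
 qed
qed

text \<open>At an isolated point there is only one access. Logarithms of both germs are interpolated
  linearly; their real parts tend to minus infinity at \<open>z0\<close>, so the interpolated curves
  land there as well.\<close>

lemma punctured_germ_homotopy:
 assumes e: "e>0" "ball z0 e-{z0}<=U" "z0 ~: U" and L: "leg_curve U z0 a" "leg_curve U z0 b"
 obtains t0 and H :: "real*real => complex" where "t0>0" "cont ({0..1} \<times> {0..t0}) H" "ALL s:{0..1}. H (s, 0)=z0"
  "ALL s:{0..1}. ALL t:{0<..t0}. H (s, t):ball z0 e-{z0}" "ALL t:{0..t0}. H (0, t)=a t & H (1, t)=b t"
proof -
 have near: "EX d>0. ALL t:{0..d}. cmod (p t-z0)<et" if p: "leg_curve U z0 p" "et>0" for p et
 proof -
  have "EX d>0. ALL x:{0..}. dist x 0<d --> dist (p x) (p 0)<et"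
   using p unfolding leg_curve_def continuous_on_iff by (metis atLeast_iff order_refl)
  then obtain d where "d>0" "ALL x:{0..}. dist x 0<d --> dist (p x) (p 0)<et" by blast
  then show ?thesis using p by (intro exI[of _ "d/2"]) (auto simp: leg_curve_def dist_norm)
 qed
 obtain d1 d2 where d: "d1>0" "d2>0" "ALL t:{0..d1}. cmod (a t-z0)<e" "ALL t:{0..d2}. cmod (b t-z0)<e" using near L e(1) by metis
 define t0 where "t0=min d1 d2"
 have t0: "t0>0" "t0<=d1" "t0<=d2" using d by (auto simp: t0_def)
 have c: "cont {0<..t0} (%t. a t-z0)" "cont {0<..t0} (%t. b t-z0)"
  using L unfolding leg_curve_def by (auto intro!: continuous_intros elim: cont_sub)
 have nz: "a t-z0~=0" "b t-z0~=0" if t: "t:{0<..t0}" for t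
 proof -
  have "a t:U" "b t:U" using L t unfolding leg_curve_def by auto
  then show "a t-z0~=0" "b t-z0~=0" using e(3) by auto
 qed
 obtain l m where l: "cont {0<..t0} l" "ALL t:{0<..t0}. exp (l t)=a t-z0"
  and m: "cont {0<..t0} m" "ALL t:{0<..t0}. exp (m t)=b t-z0"
  using continuous_log_convex[OF _ c(1) nz(1)] continuous_log_convex[OF _ c(2) nz(2)] by auto
 define H where "H p=(if snd p=0 then z0 else z0 + exp ((1 - of_real (fst p)) * l (snd p) + of_real (fst p) * m (snd p)))" for p :: "real*real"
 have small: "cmod (H (s, t)-z0)<et" if st: "s:{0..1}" "t:{0<..t0}" "cmod (a t-z0)<et" "cmod (b t-z0)<et" for s t et
 proof -
  have et: "et>0" using st(3) norm_ge_zero[of "a t-z0"] by linarith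
  have "exp (Re (l t))<et" "exp (Re (m t))<et" using l(2) m(2) st by (metis norm_exp_eq_Re)+
  then have "Re (l t)<ln et" "Re (m t)<ln et" using et by (metis exp_ln exp_less_cancel_iff)+
  then have "(1-s) * Re (l t) + s * Re (m t)<ln et" using convex_bound_lt[of "Re (l t)" "ln et" "Re (m t)" "1-s" s] st(1) by auto
  then have "exp ((1-s) * Re (l t) + s * Re (m t))<et" using et by (metis exp_ln exp_less_cancel_iff)
  then show ?thesis using st(2) by (simp add: H_def norm_exp_eq_Re)
 qed
 have "cont ({0..1} \<times> {0..t0}) H"
  unfolding continuous_on_eq_continuous_within
 proof
  fix q :: "real*real" assume q: "q:{0..1} \<times> {0..t0}"
  show "continuous (at q within {0..1} \<times> {0..t0}) H"
  proof (cases "snd q=0")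
   case True
   show ?thesis unfolding continuous_within_eps_delta
   proof (intro allI impI)
    fix et :: real assume et: "et>0"
    obtain c1 c2 where c: "c1>0" "c2>0" "ALL t:{0..c1}. cmod (a t-z0)<et" "ALL t:{0..c2}. cmod (b t-z0)<et" using near L et by metis
    have "dist (H y) (H q)<et" if y: "y:{0..1} \<times> {0..t0}" "dist y q<min c1 c2" for y
    proof (cases "snd y=0")
     case False
     have "\<bar>snd y-snd q\<bar><min c1 c2" using y(2) dist_snd_le[of y q] by (simp add: dist_real_def)
     then have "cmod (H (fst y, snd y)-z0)<et" using y(1) False True c by (intro small) (auto simp: mem_Times_iff)
     then show ?thesis using True by (simp add: H_def dist_norm)
    qed (use True et in "simp add: H_def")
    then show "EX d>0. ALL x':{0..1} \<times> {0..t0}. dist x' q<d --> dist (H x') (H q)<et" using c by (intro exI[of _ "min c1 c2"]) auto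
   qed
  next
   case False
   define S where "S={0..1::real} \<times> {0<..t0}"
   have "cont S (%p. z0 + exp ((1 - of_real (fst p)) * l (snd p) + of_real (fst p) * m (snd p)))"
    unfolding S_def by (intro continuous_intros cont_comp[OF l(1)] cont_comp[OF m(1)]) auto
   then have "cont S H" by (rule continuous_on_eq) (auto simp: S_def H_def)
   moreover have qS: "q:S" using q False by (auto simp: S_def)
   ultimately have "continuous (at q within S) H" by (simp add: continuous_on_eq_continuous_within)
   moreover have "at q within S=at q within {0..1} \<times> {0..t0}"
    by (rule at_within_nhd[of q "UNIV \<times> {0<..}"]) (use qS in "auto simp: S_def open_Times")
   ultimately show ?thesis by simp
  qed
 qed
 moreover have "H (s, t):ball z0 e-{z0}" if "s:{0..1}" "t:{0<..t0}" for s t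
  using small[of s t e] that d(3,4) t0 by (auto simp: dist_norm norm_minus_commute H_def)
 moreover have "ALL t:{0..t0}. H (0, t)=a t & H (1, t)=b t" using l(2) m(2) L by (auto simp: H_def leg_curve_def)
 ultimately show ?thesis using t0 by (intro that[of t0 H]) (auto simp: H_def)
qed

section \<open>Turning of simple legs, and removal of loops\<close>

lemma homotopic_square:
 fixes k :: "real*real => complex"
 assumes "cont ({0..1} \<times> {0..1}) k" "k ` ({0..1} \<times> {0..1})<=S"
 shows "homotopic_paths S (%t. k (0, t)) ((%s. k (s, 0)) +++ ((%t. k (1, t)) +++ reversepath (%s. k (s, 1))))"
proof -
 let ?Q = "{0..1} \<times> {0..1} :: (real*real) set"
 let ?l = "linepath (0, 0) (0, 1) :: real => real*real"
 let ?r = "linepath (0, 0) (1, 0) +++ (linepath (1, 0) (1, 1) +++ reversepath (linepath (0, 1) (1, 1))) :: real => real*real"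
 have conv: "convex ?Q" by (intro convex_Times) auto
 have s: "closed_segment x y<=?Q" if "x:?Q" "y:?Q" for x y using closed_segment_subset[OF that conv] .
 have "path_image ?l<=?Q" by (simp add: s)
 moreover have "path_image ?r<=?Q" by (intro subset_path_image_join) (simp_all add: s)
 ultimately have "?l t:?Q" "?r t:?Q" if "t:{0..1}" for t using that unfolding path_image_def by blast+
 then have "homotopic_paths ?Q ?l ?r" by (intro homotopic_paths_linear s) auto
 then have "homotopic_paths S (k o ?l) (k o ?r)" by (rule homotopic_paths_continuous_image) (use assms in auto)
 moreover have "k o ?l=(%t. k (0, t))" "k o ?r=(%s. k (s, 0)) +++ ((%t. k (1, t)) +++ reversepath (%s. k (s, 1)))"
  by (auto simp: fun_eq_iff linepath_def joinpaths_def reversepath_def)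
 ultimately show ?thesis by simp
qed

text \<open>While the cosine is nonnegative a continuous angle cannot leave the interval from
  \<open>- pi/2\<close> to \<open>pi/2\<close>; it could only reappear in another period by passing
  through negative cosines.\<close>

lemma cos_trap:
 fixes ph :: "real => real"
 assumes c: "cont {a..b} ph" "a<=b" and cs: "!!t. t:{a..b} ==> 0<=cos (ph t)" and s: "\<bar>ph a\<bar><=pi/2"
 shows "\<bar>ph b\<bar><=pi/2"
proof -
 have *: "ps b<=pi/2" if p: "cont {a..b} ps" "!!t. t:{a..b} ==> 0<=cos (ps t)" "ps a<=pi/2" for ps :: "real => real"
 proof (rule ccontr)
  assume n: "~  ?thesis"
  define v where "v=min (ps b) pi"
  have v: "pi/2<v" "v<=pi" "v<=ps b" using n pi_gt_zero by (auto simp: v_def)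
  obtain t where t: "a<=t" "t<=b" "ps t=v" using IVT'[of ps a v b] p v c(2) by auto
  have "cos v<cos (pi/2)" by (rule cos_monotone_0_pi) (use v pi_gt_zero in auto)
  then show False using p(2)[of t] t by simp
 qed
 have "- ph b<=pi/2" by (rule *[of "%t. - ph t"]) (use c cs s in "auto intro!: continuous_intros")
 moreover have "ph b<=pi/2" by (rule *) (use c cs s in auto)
 ultimately show ?thesis by linarith
qed

text \<open>For a simple curve with logarithm \<open>L\<close> the differences \<open>L t - L t' + 2 \<pi> i k\<close>, \<open>k\<close> nonzero, never vanish, so their
arguments are controlled on the whole quadrant; the argument for \<open>t' = 0\<close> is a homotopy invariant. It excludes that
\<open>L\<close> dives to the left, turns by more than \<open>2 \<pi> k\<close> there and comes back.\<close>

lemma simple_leg_turning: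
 assumes ga: "is_leg U z0 ga" and e: "legs_equivalent U z0 de ga" and ze: "ze ~: U" "ze~=z0" "z0 ~: U"
  and l: "cont {0..} l" "!!t. t>=0 ==> exp (l t)=de t-ze" and K: "(K::nat)>0" "s=1 | s = - 1"
  and t: "0<=t1" "t1<=t2" and p1: "!!t. t:{0..t1} ==> s * Im (l t-l 0)<2 * pi * real K"
  and p2: "!!t. t:{t1..t2} ==> Re (l t)<Re (l 0)" and p3: "!!t. t>=t2 ==> 2 * pi * real K<s * Im (l t-l 0)"
 shows False
proof -
 obtain H :: "real*real => complex" where H: "cont ({0..1} \<times> {0..}) H"
  "ALL t>=0. H (0, t)=de t" "ALL t>=0. H (1, t)=ga t" "ALL s:{0..1}. H (s, 0)=z0" "ALL s:{0..1}. ALL t>0. H (s, t):U"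
  "ALL R. EX T. ALL s:{0..1}. ALL t>=T. R<cmod (H (s, t))" using e unfolding legs_equivalent_def by blast
 define S where "S={0..1::real} \<times> {0::real..}"
 have cS: "convex S" unfolding S_def by (intro convex_Times) auto
 have Hz: "H p-ze~=0" if p: "p:S" for p
 proof -
  have p': "fst p:{0..1}" "snd p>=0" using p by (auto simp: S_def)
  then have "snd p=0 & H (fst p, snd p)=z0 | H (fst p, snd p):U"
   using H(4)[rule_format, OF p'(1)] H(5)[rule_format, OF p'(1), of "snd p"] by fastforce
  then show ?thesis using ze by auto
 qed
 have "cont S (%p. H p-ze)" using H(1) unfolding S_def by (intro continuous_intros)
 from continuous_log_convex[OF cS this Hz] obtain L where L: "cont S L" "ALL p:S. exp (L p)=H p-ze" by auto
 have cL: "cont {0..} (%t. L (s, t))" "cont {0..1} (%s. L (s, t))" if "s:{0..1}" "t>=0" for s t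
  by (rule cont_comp[OF L(1)]; use that in "auto simp: S_def intro!: continuous_intros")+
 have L0: "L (s, 0)=L (0, 0)" if s: "s:{0..1}" for s
  using continuous_log_diff[of "{0..1}" "%s. L (s, 0)" "%s. L (0, 0)" s 0, OF _ cL(2)] s L(2) H(4) by (auto simp: S_def)
 have lL: "l t-l 0=L (0, t)-L (0, 0)" if "t>=0" for t
  using continuous_log_diff[of "{0..}" l "%t. L (0, t)" t 0, OF _ l(1) cL(1)] l(2) L(2) H(2) that by (auto simp: S_def algebra_simps)
 \<comment> \<open>The shift by \<open>K\<close> full turns, with sign opposite to \<open>s\<close>.
   Its exponential is \<open>1\<close>, so a zero of a shifted difference of logarithms would mean
   that the curve visits a point twice.\<close>
 define c where "c = - s * (2 * pi * real K)"
 have c0: "c~=0" "\<bar>c\<bar>=2 * pi * real K" using K by (auto simp: c_def abs_mult)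
 have ec: "exp (\<i> * of_real c)=1"
 proof -
  have "c=2 * pi * of_int (if s=1 then-int K else int K)" using K(2) by (auto simp: c_def)
  then have "cis c=1" by (simp only: cis_multiple_2pi[OF Ints_of_int])
  then show ?thesis by (simp add: cis_conv_exp)
 qed
 define b where "b = of_real (ln \<bar>c\<bar>) + \<i> * of_real (- s * (pi/2))"
 have eb: "exp b=\<i> * of_real c"
 proof -
  have "exp (complex_of_real (ln \<bar>c\<bar>)) = of_real \<bar>c\<bar>" using c0(1) by (simp only: exp_of_real exp_ln_iff) simp
  then have "exp b = of_real \<bar>c\<bar> * cis (- s * (pi/2))" unfolding b_def exp_add cis_conv_exp by simp
  moreover have "cis (- s * (pi/2)) = - of_real s * \<i>" using K(2) by (auto simp: complex_eq_iff)
  moreover have "c=\<bar>c\<bar> * - s" using K by (auto simp: c_def abs_mult)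
  then have "complex_of_real c = of_real \<bar>c\<bar> * - of_real s" by (metis of_real_minus of_real_mult)
  ultimately show ?thesis by (simp only: mult_ac)
 qed
 have Imb: "\<bar>Im b\<bar><=pi/2" "s * Im b = - (pi/2)" using K(2) by (auto simp: b_def)
 define D where "D p=L p-L (0, 0) + \<i> * of_real c" for p
 have D0: "D p~=0" if p: "p:S" for p
 proof
  assume D: "D p=0"
  then have "L p=L (0, 0)-\<i> * of_real c" unfolding D_def by (simp add: algebra_simps eq_neg_iff_add_eq_0)
  then have "exp (L p)=exp (L (0, 0))" using ec by (simp add: exp_diff)
  then have "H p=z0" using L(2) p H(4) by (auto simp: S_def)
  then have z: "H (fst p, snd p) ~: U" using ze(3) by simp
  have p': "fst p:{0..1}" "snd p>=0" using p by (auto simp: S_def)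
  have "snd p=0"
  proof (rule ccontr)
   assume "snd p~=0"
   then show False using z H(5)[rule_format, OF p'(1), of "snd p"] p' by linarith
  qed
  then have "L p=L (0, 0)" using L0[OF p'(1)] by (metis prod.collapse)
  then show False using D c0 by (simp add: D_def)
 qed
 have cD: "cont S D" unfolding D_def by (intro continuous_intros L)
 from continuous_log_convex[OF cS cD D0] obtain M0 where M0: "cont S M0" "ALL p:S. exp (M0 p)=D p" by auto
 define M where "M p=M0 p+(b-M0 (0, 0))" for p
 have M: "cont S M" "!!p. p:S ==> exp (M p)=D p" "M (0, 0)=b"
  using M0 eb unfolding M_def by (auto intro!: continuous_intros simp: exp_add exp_diff S_def D_def)
 have cM: "cont {0..} (%t. M (s, t))" "cont {0..1} (%s. M (s, t))" if "s:{0..1}" "t>=0" for s t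
  by (rule cont_comp[OF M(1)]; use that in "auto simp: S_def intro!: continuous_intros")+
 have M1: "M (1, 0)=b"
 proof -
  have "exp (M (s, 0))=exp b" if "s:{0..1}" for s using M(2)[of "(s, 0)"] L0[OF that] that unfolding eb by (simp add: S_def D_def)
  then show ?thesis using continuous_log_diff[of "{0..1}" "%s. M (s, 0)" "%s. b" 1 0, OF _ cM(2)[of 0 0]] M(3) by simp
 qed
 have parts: "exp (Re w) * cos (Im w)=Re z" "exp (Re w) * sin (Im w)=Im z" if "exp w=z" for w z :: complex
  using Re_exp[of w] Im_exp[of w] unfolding that by simp_all
 obtain T0 where T0: "ALL s:{0..1}. ALL t>=T0. cmod ze + cmod (z0-ze)<cmod (H (s, t))" using H(6) by blast
 have far: "0<=cos (Im (M (s, t)))" if "s:{0..1}" "t>=max T0 0" for s t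
 proof -
  have p: "(s, t):S" "(0, 0):S" using that by (auto simp: S_def)
  have "cmod (z0-ze)<cmod (H (s, t)-ze)" using T0 that norm_triangle_ineq2[of "H (s, t)" ze] by fastforce
  then have "exp (Re (L (0, 0)))<exp (Re (L (s, t)))" using L(2) p H(4) by (simp flip: norm_exp_eq_Re)
  then have "0<exp (Re (M (s, t))) * cos (Im (M (s, t)))" using parts(1)[OF M(2)[OF p(1)]] by (simp add: D_def)
  then show ?thesis by (simp add: zero_less_mult_iff)
 qed
 have lg: "cont {0..} ga" "inj_on ga {0..}" "filterlim ga at_infinity at_top" using ga unfolding is_leg_def by auto
 \<comment> \<open>At time \<open>T\<close> the simple curve \<open>ga\<close> is at its farthest
   from \<open>ze\<close> so far, so the difference of its logarithms at \<open>T\<close> and at an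
   earlier time has nonnegative real part.\<close>
 obtain T where T: "T>=max (max T0 0) t2" "ALL t:{0..T}. cmod (ga t-ze)<=cmod (ga T-ze)"
 proof -
  define a where "a=max (max T0 0) t2"
  have cn: "cont {0..x} (%t. cmod (ga t-ze))" for x by (intro continuous_intros cont_sub[OF lg(1)]) auto
  have ne: "{0..a}~={}" by (auto simp: a_def)
  obtain B where B: "ALL t:{0..a}. cmod (ga t-ze)<=B" using continuous_attains_sup[OF compact_Icc ne cn] by blast
  obtain T1 where T1: "ALL t>=T1. B + cmod ze<cmod (ga t)" using lg(3) unfolding tends_to_infinity_iff by blast
  define u where "u=max T1 a"
  have "{0..u}~={}" by (auto simp: u_def a_def)
  then obtain T where T: "T:{0..u}" "ALL t:{0..u}. cmod (ga t-ze)<=cmod (ga T-ze)" using continuous_attains_sup[OF compact_Icc _ cn] by blast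
  have "B<cmod (ga u-ze)" using T1 norm_triangle_ineq2[of "ga u" ze] unfolding u_def by (smt (verit) max.cobounded1)
  also have "... <= cmod (ga T-ze)" using T(2) by (auto simp: u_def a_def)
  finally have "T ~: {0..a}" using B by force
  then have "T>=a" using T(1) by simp
  then show ?thesis using that[of T] T(2) T(1) unfolding a_def by auto
 qed
 define D2 where "D2 p=L (1, fst p)-L (1, snd p) + \<i> * of_real c" for p
 define S2 where "S2={0::real..} \<times> {0::real..}"
 have cS2: "convex S2" unfolding S2_def by (intro convex_Times) auto
 have "D2 p~=0" if p: "p:S2" for p
 proof
  assume D: "D2 p=0"
  then have "L (1, fst p)=L (1, snd p)-\<i> * of_real c" unfolding D2_def by (simp add: algebra_simps eq_neg_iff_add_eq_0)
  then have "exp (L (1, fst p))=exp (L (1, snd p))" using ec by (simp add: exp_diff)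
  then have "ga (fst p)=ga (snd p)" using L(2) p H(3) by (auto simp: S_def S2_def)
  then have "fst p=snd p" using lg(2) p by (auto simp: S2_def dest: inj_onD)
  then show False using D c0 by (simp add: D2_def)
 qed
 moreover have "cont S2 D2" unfolding D2_def
  by (intro continuous_intros cont_comp[OF cL(1)[of 1 0]]) (auto simp: S2_def)
 ultimately obtain N0 where N0: "cont S2 N0" "ALL p:S2. exp (N0 p)=D2 p" using continuous_log_convex[OF cS2] by blast
 define N where "N p=N0 p+(b-N0 (0, 0))" for p
 have N: "cont S2 N" "!!p. p:S2 ==> exp (N p)=D2 p" "N (0, 0)=b"
  using N0 eb unfolding N_def by (auto intro!: continuous_intros simp: exp_add exp_diff S2_def D2_def)
 have T0': "T>=0" "T>=max T0 0" "T>=t2" using T(1) by auto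
 \<comment> \<open>On the diagonal the shifted difference is constant, so its argument at
   \<open>(T, T)\<close> is still that of \<open>b\<close>. Moving the second time back to
   \<open>0\<close>, and then the homotopy parameter back to \<open>de\<close>, keeps the real part
   nonnegative; hence the argument for \<open>de\<close> at \<open>T\<close> stays within
   \<open>pi/2\<close>.\<close>
 have "cont {0..T} (%t. N (t, t))" by (rule cont_comp[OF N(1)]) (auto simp: S2_def intro!: continuous_intros)
 then have NT: "N (T, T)=b"
  using continuous_log_diff[of "{0..T}" "%t. N (t, t)" "%t. b" T 0] N(2,3) eb T0' by (auto simp: S2_def D2_def)
 have "cont {0..} (%t. N (t, 0))" by (rule cont_comp[OF N(1)]) (auto simp: S2_def intro!: continuous_intros)
 then have NM: "N (T, 0)=M (1, T)"
  using continuous_log_diff[of "{0..}" "%t. N (t, 0)" "%t. M (1, t)" T 0, OF _ _ cM(1)[of 1 0]] N(2,3) M(2) M1 L0[of 1] T0'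
  by (auto simp: S_def S2_def D_def D2_def)
 have "\<bar>Im (N (T, T-T))\<bar><=pi/2"
 proof (rule cos_trap[of 0 T "%u. Im (N (T, T-u))"])
  show "cont {0..T} (%u. Im (N (T, T-u)))" by (intro continuous_intros cont_comp[OF N(1)]) (use T0' in "auto simp: S2_def")
  fix u assume u: "u:{0..T}"
  have "exp (Re (L (1, T-u)))<=exp (Re (L (1, T)))" using T(2) u L(2) H(3) T0' by (simp add: S_def flip: norm_exp_eq_Re)
  then have "0<=exp (Re (N (T, T-u))) * cos (Im (N (T, T-u)))" using parts(1)[OF N(2), of "(T, T-u)"] u by (simp add: D2_def S2_def)
  then show "0<=cos (Im (N (T, T-u)))" by (simp add: zero_le_mult_iff)
 qed (use T0' NT Imb in auto)
 then have "\<bar>Im (M (1-0, T))\<bar><=pi/2" using NM by simp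
 then have "\<bar>Im (M (1-1, T))\<bar><=pi/2"
  by (intro cos_trap[of 0 1 "%s. Im (M (1-s, T))"]) (use T0' far cM(2) in "auto intro!: continuous_intros cont_comp[OF cM(2)[of 0 T]]")
 then have fin: "\<bar>s * Im (M (0, T))\<bar><=pi/2" using K(2) by auto
 \<comment> \<open>The same argument followed along \<open>de\<close>. It starts at
   \<open>- pi/2\<close>; the signs of sine and cosine supplied by \<open>p1\<close>,
   \<open>p2\<close> and \<open>p3\<close> push it below \<open>- pi/2\<close> and then below
   \<open>- pi\<close>, where it remains up to \<open>T\<close>.\<close>
 define y where "y t=s * Im (M (0, t))" for t
 have cy: "cont {0..} y" unfolding y_def by (intro continuous_intros cM) auto
 have E: "exp (Re (M (0, t)))>0" for t by simp
 have ss: "exp (Re (M (0, t))) * sin (y t)=s * Im (l t-l 0)-2 * pi * real K" if t: "t>=0" for t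
 proof -
  have "exp (Re (M (0, t))) * sin (Im (M (0, t)))=Im (l t-l 0) + c" using parts(2)[OF M(2), of "(0, t)"] lL[OF t] t by (simp add: S_def D_def)
  then show ?thesis using K(2) unfolding y_def c_def by auto
 qed
 have cs: "exp (Re (M (0, t))) * cos (y t)=Re (l t)-Re (l 0)" if t: "t>=0" for t
 proof -
  have "exp (Re (M (0, t))) * cos (Im (M (0, t)))=Re (l t-l 0)" using parts(1)[OF M(2), of "(0, t)"] lL[OF t] t by (simp add: S_def D_def)
  then show ?thesis using K(2) unfolding y_def by auto
 qed
 have neg: "x<0" if "exp r * x=z" "z<0" for r x z :: real using that by (metis exp_gt_zero mult_less_0_iff not_less_iff_gr_or_eq)
 have pos: "0<x" if "exp r * x=z" "0<z" for r x z :: real using that by (metis exp_gt_zero zero_less_mult_pos)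
 have t12: "t1>=0" "t2>=0" using t by auto
 have y0: "y 0 = - (pi/2)" using M(3) Imb by (simp add: y_def)
 have a1: "\<bar>y t1 + pi/2\<bar><=pi/2"
 proof (rule cos_trap[of 0 t1 "%t. y t + pi/2"])
  show "0<=cos (y t + pi/2)" if "t:{0..t1}" for t using neg[OF ss[of t]] p1[OF that] that by (simp add: cos_add)
 qed (use t y0 in "auto intro!: continuous_intros cont_sub[OF cy]")
 have c1: "cos (y t)<0" if "t:{t1..t2}" for t using neg[OF cs[of t]] p2[OF that] that t by simp
 have "y t1 < - pi/2" using a1 c1[of t1] cos_ge_zero[of "y t1"] t by (force simp: not_less[symmetric])
 then have b1: "\<bar>y t1 + pi\<bar><=pi/2" using a1 by linarith
 have a2: "\<bar>y t2 + pi\<bar><=pi/2"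
  by (rule cos_trap[of t1 t2 "%t. y t + pi"]) (use t b1 c1 less_imp_le in "auto intro!: continuous_intros cont_sub[OF cy]")
 have s2: "sin (y t)>0" if "t>=t2" for t using pos[OF ss[of t]] p3[OF that] that t by simp
 have "y t2 < - pi"
 proof (rule ccontr)
  assume "~  ?thesis"
  then have "0 <= - y t2" "- y t2<=pi" using a2 by linarith+
  then have "0<=sin (- y t2)" by (rule sin_ge_zero)
  then show False using s2[of t2] by simp
 qed
 then have b2: "\<bar>y t2+3 * pi/2\<bar><=pi/2" using a2 by linarith
 have "\<bar>y T+3 * pi/2\<bar><=pi/2"
 proof (rule cos_trap[of t2 T "%t. y t+3 * pi/2"])
  have "cos (x+3 * pi/2)=sin x" for x :: real
  proof -
   have e: "x+3 * pi/2=(x + pi) + pi/2" by simp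
   show ?thesis unfolding e cos_add[of "x + pi"] by simp
  qed
  then show "0<=cos (y t+3 * pi/2)" if "t:{t2..T}" for t using s2[of t] that by simp
 qed (use t12 b2 T0' in "auto intro!: continuous_intros cont_sub[OF cy]")
 then show False using fin pi_gt_zero unfolding y_def by linarith
qed

lemma extend_drop:
 assumes c: "cont {0..1} c" "c 0=z0" "c ` {0<..1}<=U"
  and P: "path P" "path q" "pathfinish P=pathstart q" "path_image P<=U" "P 0=c 1" "!!t. t:{0..1} ==> R<cmod (q t)"
  and R: "0<R" "!!z. R<cmod z ==> z:U"
 shows "legs_equivalent U z0 (extend c (P +++ q)) (extend c P)"
proof -
 define K where "K p=(P +++ q) (snd p * (1-fst p/2))" for p :: "real*real"
 have in01: "snd p * (1-fst p/2):{0..1}" if "p:{0..1} \<times> {0..1}" for p :: "real*real"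
  using that by (auto intro!: mult_nonneg_nonneg mult_le_one)
 have "path (P +++ q)" using P(1,2,3) by simp
 then have cK: "cont ({0..1} \<times> {0..1}) K" unfolding K_def path_def
  by (rule cont_comp) (use in01 in "auto intro!: continuous_intros")
 have im: "(P +++ q) x:U" if "x:{0..1}" for x
 proof -
  have "path_image (P +++ q)<=U" using P(4,6) R(2) by (intro subset_path_image_join) (auto simp: path_image_def)
  then show ?thesis using that by (auto simp: path_image_def)
 qed
 have "legs_equivalent U z0 (extend (%t. c (snd (0::real, t))) (%t. K (0, t))) (extend (%t. c (snd (1::real, t))) (%t. K (1, t)))"
 proof (rule extend_equivalent[of "%p. c (snd p)" z0 U K, OF _ _ _ cK _ _ R])
  show "cont ({0..1} \<times> {0..1}) (%p. c (snd p))" by (rule cont_comp[OF c(1)]) (auto intro!: continuous_intros)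
  fix s :: real assume s: "s:{0..1}"
  show "c (snd (s, 0))=z0" "K (s, 0)=c (snd (s, 1))" using c P(5) by (auto simp: K_def joinpaths_def)
  show "K (s, t):U" if "t:{0..1}" for t using im in01[of "(s, t)"] s that by (simp add: K_def)
  show "c (snd (s, t)):U" if "t:{0<..1}" for t using c(3) that by auto
  show "R<cmod (K (s, 1))"
  proof (cases "s=1")
   case True
   then show ?thesis using P(3) P(6)[of 0] by (simp add: K_def joinpaths_def pathfinish_def pathstart_def)
  next
   case False
   then show ?thesis using P(6)[of "1-s"] s by (auto simp: K_def joinpaths_def)
  qed
 qed
 moreover have "extend (%t. c (snd (1::real, t))) (%t. K (1, t))=extend c P" "extend (%t. c (snd (0::real, t))) (%t. K (0, t))=extend c (P +++ q)"
  by (auto simp: fun_eq_iff extend_def K_def joinpaths_def diff_divide_distrib)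
 ultimately show ?thesis by simp
qed

text \<open>A loop around an isolated point \<open>z0\<close> of the complement is undone by rotating the germ at \<open>z0\<close>.\<close>

lemma extend_absorb:
 assumes e: "ball z0 e-{z0}<=U" and c: "cont {0..1} c" "c 0=z0" "c ` {0<..1}<=ball z0 e-{z0}"
  and Q: "path Q" "path_image Q<=ball z0 e-{z0}" "Q 0=c 1" "Q 1=c 1"
  and P: "path P" "path_image P<=U" "P 0=c 1" "R<cmod (P 1)"
  and R: "0<R" "!!z. R<cmod z ==> z:U"
 shows "legs_equivalent U z0 (extend c (Q +++ P)) (extend c P)"
proof -
 have Qn: "Q t-z0~=0" "cmod (Q t-z0)<e" if "t:{0..1}" for t
  using subsetD[OF Q(2), of "Q t"] that by (auto simp: path_image_def dist_norm norm_minus_commute)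
 have "cont {0..1} (%t. Q t-z0)" using Q(1) unfolding path_def by (intro continuous_intros)
 from continuous_log_convex[OF _ this Qn(1)] obtain q where q: "cont {0..1} q" "ALL t:{0..1}. exp (q t)=Q t-z0" by auto
 have "exp (q 1)=exp (q 0)" using q(2) Q(3,4) by simp
 then obtain k where k: "q 1=q 0 + of_int (2 * k) * pi * \<i>" unfolding exp_eq by auto
 \<comment> \<open>\<open>2 pi i\<close> times the winding number of the loop \<open>Q\<close>
   around \<open>z0\<close>.\<close>
 define be where "be=complex_of_real (of_int (2 * k) * pi) * \<i>"
 have k: "q 1=q 0 + be" "Re be=0" "exp be=1" using k by (auto simp: be_def exp_eq_1)
 define h where "h p=z0 + exp ((1 - of_real (fst p)) * q (snd p) + of_real (fst p)*(q 0 + be))" for p :: "real*real"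
 have ch: "cont ({0..1} \<times> {0..1}) h" unfolding h_def by (intro continuous_intros cont_comp[OF q(1)]) auto
 have qe: "exp (Re (q t))<e" if "t:{0..1}" for t using Qn(2)[OF that] q(2) that by (simp flip: norm_exp_eq_Re)
 have h: "h p:ball z0 e-{z0}" if "p:{0..1} \<times> {0..1}" for p
 proof -
  let ?M = "max (Re (q (snd p))) (Re (q 0))"
  have "(1-fst p) * Re (q (snd p)) + fst p * Re (q 0)<=(1-fst p) * ?M + fst p * ?M"
   using that by (intro add_mono mult_left_mono) auto
  also have "... = ?M" by (simp add: algebra_simps)
  finally have "cmod (h p-z0)<=exp ?M" using k(2) by (simp add: h_def norm_exp_eq_Re)
  also have "... < e" using qe[of "snd p"] qe[of 0] that by (auto simp: max_def)
  finally show ?thesis by (simp add: h_def dist_norm norm_minus_commute)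
 qed
 have h0: "h (s, 0)=z0 + exp (of_real s * be)*(c 1-z0)" "h (s, 1)=c 1" "h (0, t)=Q t" "h (1, t)=c 1" if "t:{0..1}" for s t
 proof -
  have e: "exp (q 0)=c 1-z0" "exp (q t)=Q t-z0" using q(2) Q(3) that by auto
  have "h (s, 0)=z0 + exp (q 0 + of_real s * be)" "h (s, 1)=z0 + exp (q 0 + be)" unfolding h_def using k(1) by (simp_all add: algebra_simps)
  then show "h (s, 0)=z0 + exp (of_real s * be)*(c 1-z0)" "h (s, 1)=c 1" using e k(3) by (simp_all add: exp_add mult.commute)
  show "h (0, t)=Q t" "h (1, t)=c 1" using e k(3) by (simp_all add: h_def exp_add)
 qed
 define K where "K p=(if snd p<=1/2 then h (fst p, 2 * snd p) else P (2 * snd p-1))" for p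
 have ag: "h (a, 2 * b)=P (2 * b-1)" if "b * 2=1" for a b
 proof -
  have b: "2 * b=1" using that by simp
  show ?thesis unfolding b using h0(2)[of 0] P(3) by simp
 qed
 have cK: "cont ({0..1} \<times> {0..1}) K"
 proof -
  have "cont ({0..1} \<times> {0..1/2} Un {0..1} \<times> {1/2..1}) K" unfolding K_def
  proof (rule continuous_on_cases)
   show "cont ({0..1} \<times> {0..1/2}) (%p. h (fst p, 2 * snd p))"
    by (rule cont_comp[OF ch]) (auto intro!: continuous_intros)
   show "cont ({0..1} \<times> {1/2..1}) (%p. P (2 * snd p-1))"
    by (rule cont_comp[OF P(1)[unfolded path_def]]) (auto intro!: continuous_intros)
  qed (auto simp: ag intro!: closed_Times)
  moreover have "{0..1} \<times> {0..1/2} Un {0..1} \<times> {1/2..1}={0..1::real} \<times> {0..1::real}" by auto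
  ultimately show ?thesis by simp
 qed
 \<comment> \<open>As the germ turns about \<open>z0\<close>, the start of the loop moves along with
   it, so \<open>h\<close> can contract \<open>Q\<close> to a point. At the end
   \<open>exp be=1\<close> and the germ is back in place.\<close>
 define Hg where "Hg p=z0 + exp (of_real (fst p) * be)*(c (snd p)-z0)" for p :: "real*real"
 have "legs_equivalent U z0 (extend (%t. Hg (0, t)) (%t. K (0, t))) (extend (%t. Hg (1, t)) (%t. K (1, t)))"
 proof (rule extend_equivalent[OF _ _ _ cK _ _ R])
  show "cont ({0..1} \<times> {0..1}) Hg" unfolding Hg_def by (intro continuous_intros cont_comp[OF c(1)]) auto
  fix s :: real assume s: "s:{0..1}"
  show "Hg (s, 0)=z0" "K (s, 0)=Hg (s, 1)" using c(2) h0(1)[of 0] by (auto simp: Hg_def K_def)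
  show "Hg (s, t):U" if "t:{0<..1}" for t
  proof -
   have "c t:ball z0 e-{z0}" using c(3) that by blast
   then have "Hg (s, t):ball z0 e-{z0}" using k(2) by (simp add: Hg_def dist_norm norm_mult norm_minus_commute)
   then show ?thesis using e by blast
  qed
  show "K (s, t):U" if t: "t:{0..1}" for t
  proof (cases "t<=1/2")
   case True
   then show ?thesis using h[of "(s, 2 * t)"] s t e by (auto simp: K_def)
  next
   case False
   then have "P (2 * t-1):path_image P" using t by (auto simp: path_image_def)
   then show ?thesis using False P(2) by (auto simp: K_def)
  qed
  show "R<cmod (K (s, 1))" using P(4) by (simp add: K_def)
 qed
 moreover have "extend (%t. Hg (0, t)) (%t. K (0, t))=extend c (Q +++ P)"
  by (auto simp: fun_eq_iff extend_def Hg_def K_def joinpaths_def h0)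
 moreover have "extend (%t. Hg (1, t)) (%t. K (1, t))=extend c (linepath (c 1) (c 1) +++ P)"
  using k(3) by (auto simp: fun_eq_iff extend_def Hg_def K_def joinpaths_def h0 linepath_refl)
 moreover have "homotopic_paths U (linepath (c 1) (c 1) +++ P) P" using homotopic_paths_lid[OF P(1,2)] P(3) by (simp add: pathstart_def)
 then have "legs_equivalent U z0 (extend c (linepath (c 1) (c 1) +++ P)) (extend c P)"
  by (intro extend_homotopic[OF c(1,2) _ _ _ R]) (use c(3) e P(4) in "auto simp: joinpaths_def linepath_def")
 ultimately show ?thesis using legs_equivalent_trans by metis
qed

text \<open>While the ratio stays in the right half plane, its principal argument stays below
  \<open>pi/2\<close> in modulus, and it differs from the difference of the given logarithms by a
  constant.\<close>

lemma log_ratio_bound: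
 fixes l l' :: "real => complex"
 assumes S: "connected S" "cont S l" "cont S l'" "!!t. t:S ==> 0<Re (exp (l t-l' t))" and ab: "a:S" "b:S"
 shows "\<bar>Im (l a-l' a)-Im (l b-l' b)\<bar><=pi"
proof -
 define d where "d t=Ln (exp (l t-l' t))" for t
 have "cont S d" unfolding d_def using S by (intro continuous_intros) (use S(4) in "force simp: complex_nonpos_Reals_iff")+
 from continuous_log_diff[OF S(1) _ this _ ab, of "%t. l t-l' t"] S(2,3)
 have "(l a-l' a)-d a=(l b-l' b)-d b" by (auto simp: d_def intro!: continuous_intros)
 then have "Im (l a-l' a)-Im (d a)=Im (l b-l' b)-Im (d b)" by (metis minus_complex.sel(2))
 moreover have "\<bar>Im (d t)\<bar><pi/2" if "t:S" for t unfolding d_def using S(4)[OF that] Re_Ln_pos_lt exp_not_eq_zero by blast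
 ultimately show ?thesis using ab by (smt (verit) field_sum_of_halves)
qed

text \<open>Logarithms with equal end values express equal winding around \<open>z\<close>.
  Interpolating them never meets \<open>z\<close>, and the larger of the two moduli bounds the
  distance from it.\<close>

lemma homotopic_paths_punctured:
 fixes p q l l' :: "real => complex"
 assumes p: "path p" "path q" "path_image p<=ball z r" "path_image q<=ball z r"
  and l: "cont {0..1} l" "cont {0..1} l'" "l 0=l' 0" "l 1=l' 1"
  and e: "!!t. t:{0..1} ==> p t=z + exp (l t)" "!!t. t:{0..1} ==> q t=z + exp (l' t)"
 shows "homotopic_paths (ball z r-{z}) p q"
proof -
 define h where "h x=z + exp ((1 - of_real (fst x)) * l (snd x) + of_real (fst x) * l' (snd x))" for x :: "real*real"
 have "cont ({0..1} \<times> {0..1}) h" unfolding h_def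
  by (intro continuous_intros cont_comp[OF l(1)] cont_comp[OF l(2)]) auto
 moreover have "h x:ball z r-{z}" if x: "x:{0..1} \<times> {0..1}" for x
 proof -
  let ?M = "max (Re (l (snd x))) (Re (l' (snd x)))"
  have "exp (Re (l t))<r" "exp (Re (l' t))<r" if "t:{0..1}" for t
   using subsetD[OF p(3), of "p t"] subsetD[OF p(4), of "q t"] e that by (auto simp: path_image_def dist_norm norm_exp_eq_Re)
  then have M: "exp ?M<r" using x by (auto simp: max_def)
  have "(1-fst x) * Re (l (snd x)) + fst x * Re (l' (snd x))<=(1-fst x) * ?M + fst x * ?M"
   using x by (intro add_mono mult_left_mono) auto
  also have "... = ?M" by (simp add: algebra_simps)
  finally have "cmod (h x-z)<=exp ?M" by (simp add: h_def norm_exp_eq_Re)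
  with M have "cmod (h x-z)<r" by linarith
  then show ?thesis by (auto simp: dist_norm norm_minus_commute) (simp add: h_def)
 qed
 ultimately show ?thesis unfolding homotopic_paths
  by (intro exI[of _ h]) (use e l in "auto simp: h_def pathstart_def pathfinish_def algebra_simps")
qed

section \<open>Recurrence for each type of landing point\<close>

locale tame_legs=tame_chain +
 fixes T :: nat
 assumes eqv: "!!n. legs_equivalent U z0 (Ga n) (extend germ (leg_path (g n) (ta n)))"
  and T: "T>=1" "ALL n. ALL k>=T. ALL t:{0..ta n}. cmod (G n k t-ze)<r"
begin

abbreviation late' where "late' == late T"
text \<open>The cuts are at times \<open>T\<close> and \<open>sy T n\<close>: \<open>early\<close>
  runs through \<open>prefix\<close> and then \<open>mid\<close>, and \<open>late'\<close> is the
  remainder.\<close>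

definition early where "early n u=g n (u * sy T n)"
definition mid where "mid n u=g n (real T + u * (sy T n-real T))"
definition prefix where "prefix u=g T (u * real T)"

lemma sig: "n>=T ==> real T<=sy T n & 0<sy T n & sy T n<=ta n"
 using sy_ge[of T n] sy_le[of 0 T n] T(1) by auto

lemma piece:
 assumes "0<=a" "a<=b"
 shows "path (%u. g n (a + u * (b-a)))" "path_image (%u. g n (a + u * (b-a)))<=g n ` {a..b}" "g n ` {a..b}<=U"
proof -
 have *: "a + u * (b-a):{a..b}" if "u:{0..1}" for u using seg_in[OF assms(2) that] .
 show "path (%u. g n (a + u * (b-a)))" unfolding path_def
  by (rule cont_comp[OF g(1)]) (use * assms(1) in "auto intro!: continuous_intros order_trans[OF assms(1)]")
 show "path_image (%u. g n (a + u * (b-a)))<=g n ` {a..b}" unfolding path_image_def using * by blast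
 show "g n ` {a..b}<=U" using g(2) assms by auto
qed

lemma parts:
 assumes n: "n>=T"
 shows "path (early n)" "path_image (early n)<=U" "early n 0=germ 1" "early n 1=late' n 0"
  "path (late' n)" "path_image (late' n)<=U" "late' n 1=g n (ta n)"
  "path (mid n)" "path_image (mid n)<=ball ze r Int U" "mid n 0=g T (real T)" "mid n 1=late' n 0"
  "path prefix" "path_image prefix<=U" "prefix 0=germ 1" "prefix 1=g T (real T)"
  "!!t. t:{0..real T} ==> g n t=g T t"
proof -
 note s=sig[OF n]
 have z: "g n 0=germ 1" for n using tame[of n] germ(4) unfolding tame_def by simp
 show pr: "g n t=g T t" if t: "t:{0..real T}" for t
 proof -
  \<comment> \<open>The minimum with \<open>T-1\<close> puts the end point \<open>t=T\<close> into
    the last unit interval.\<close>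
  define m where "m=min (nat \<lfloor>t\<rfloor>) (T-1)"
  have m: "m<T" "t:{real m..real m+1}"
   using T(1) t floor_correct[of t] le_nat_floor[of "T-1" t] by (auto simp: m_def min_def of_nat_diff not_le) linarith?
  then have "G n 0 t=aa (0 + m) (t-real m)" "G T 0 t=aa (0 + m) (t-real m)"
   using tau_ge[of n] tau_ge[of T] less_le_trans[OF m(1) n] by blast+
  then show ?thesis using G0[of t] t by simp
 qed
 show "path (early n)" "path_image (early n)<=U" "path (late' n)" "path_image (late' n)<=U"
  "path (mid n)" "path prefix" "path_image prefix<=U"
  unfolding early_def late_def mid_def prefix_def using piece[of 0 "sy T n" n] piece[of "sy T n" "ta n" n] piece[of "real T" "sy T n" n] piece[of 0 "real T" T] s
  by simp_all
 have "g n ` {real T..sy T n}<=ball ze r" using early_near[OF T(2) n] by (auto simp: dist_norm norm_minus_commute)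
 then show "path_image (mid n)<=ball ze r Int U" 
  using order_trans[OF piece(2)[of "real T" "sy T n" n]] piece(3)[of "real T" "sy T n" n] s unfolding mid_def by simp
 show "early n 0=germ 1" "early n 1=late' n 0" "late' n 1=g n (ta n)" "mid n 1=late' n 0" "prefix 0=germ 1" "prefix 1=g T (real T)"
  "mid n 0=g T (real T)" using z pr[of "real T"] by (simp_all add: early_def late_def mid_def prefix_def)
qed

lemma ends:
 assumes n: "n>=T"
 shows "pathstart (early n)=germ 1" "pathfinish (early n)=late' n 0" "pathstart (late' n)=late' n 0" "pathfinish (late' n)=late' n 1"
  "pathstart (mid n)=g T (real T)" "pathfinish (mid n)=late' n 0" "pathstart prefix=germ 1" "pathfinish prefix=g T (real T)"
 using parts[OF n] unfolding pathstart_def pathfinish_def by simp_all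

lemma splits:
 assumes n: "n>=T"
 shows "homotopic_paths U (leg_path (g n) (ta n)) (early n +++ late' n)" "homotopic_paths U (early n) (prefix +++ mid n)"
proof -
 note s=sig[OF n] and p=parts[OF n]
 have st: "homotopic_paths U P (subpath 0 v P +++ subpath v 1 P)" if "path P" "path_image P<=U" "v:{0..1}" for v P
  using homotopic_join_subpaths[OF that(1,2), of 0 v 1] that(3) by (auto intro: homotopic_paths_sym)
 have lp: "path (leg_path (g n) (ta n))" "path_image (leg_path (g n) (ta n))<=U"
  using piece[of 0 "ta n" n] g(3)[of n] unfolding leg_path_def by (auto simp: mult.commute)
 have "subpath 0 (sy T n/ta n) (leg_path (g n) (ta n))=early n" "subpath (sy T n/ta n) 1 (leg_path (g n) (ta n))=late' n"
  using g(3)[of n] unfolding fun_eq_iff subpath_def leg_path_def early_def late_def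
  by (auto intro!: arg_cong[of _ _ "g n"] simp: field_simps)
 then show "homotopic_paths U (leg_path (g n) (ta n)) (early n +++ late' n)" using st[OF lp, of "sy T n/ta n"] s by simp
 have m: "subpath (real T/sy T n) 1 (early n)=mid n" 
  using s unfolding fun_eq_iff subpath_def mid_def early_def by (auto intro!: arg_cong[of _ _ "g n"] simp: field_simps)
 have h: "homotopic_paths U (early n) (subpath 0 (real T/sy T n) (early n) +++ mid n)"
  using st[OF p(1,2), of "real T/sy T n"] s unfolding m by simp
 have "(subpath 0 (real T/sy T n) (early n) +++ mid n) x=(prefix +++ mid n) x" if "x:{0..1}" for x
 proof (cases "x<=1/2")
  case True
  then have "g n (2 * x * real T)=g T (2 * x * real T)" using that mult_right_mono[of "2 * x" 1 "real T"] by (intro p(16)) auto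
  moreover have "(real T/sy T n-0)*(2 * x) * sy T n=2 * x * real T" using s by simp
  ultimately show ?thesis using True by (simp add: joinpaths_def subpath_def early_def prefix_def)
 qed (simp add: joinpaths_def)
 then show "homotopic_paths U (early n) (prefix +++ mid n)"
  using homotopic_paths_imp_path[OF h] homotopic_paths_imp_subset[OF h] by (intro homotopic_paths_trans[OF h homotopic_paths_eq]) auto
qed

text \<open>Records only what a homotopy needs: straight segments between the late parts stay in
  \<open>U\<close>, and at the far end they stay beyond radius \<open>R0\<close>, so that
  \<open>extend_drop\<close> can remove them.\<close>

definition close :: "nat => nat => bool" where
 "close n m \<longleftrightarrow> n>=T & m>=T & (ALL u:{0..1}. closed_segment (late' n u) (late' m u)<=U) &
  (ALL z:closed_segment (late' n 1) (late' m 1). R0<cmod z)"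

lemma close_late:
 "EX nu d. strict_mono (nu :: nat => nat) & (ALL i. nu i>=T) & d>0 & (ALL i. ALL u:{0..1}. ball (late' (nu i) u) d<=U) &
  (ALL et>0. EX I. ALL i>=I. ALL j>=I. close (nu i) (nu j) & (ALL u:{0..1}. cmod (late' (nu i) u-late' (nu j) u)<et))"
proof -
 obtain nu E K where nu: "strict_mono (nu :: nat => nat)" "compact K" "K<=U" "ALL i. nu i>=T & late' (nu i) ` {0..1}<=K"
  "cont {0..1} E" "ALL et>0. EX I. ALL i>=I. ALL u:{0..1}. cmod (late' (nu i) u-E u)<et" using late_converges[of T] by blast
 obtain d where d: "d>0" "ALL x:K. ball x d<=U" using compact_subset_open_imp_ball_epsilon_subset[OF nu(2) openU nu(3)] by (metis UN_subset_iff)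
 have "EX I. ALL i>=I. ALL j>=I. close (nu i) (nu j) & (ALL u:{0..1}. cmod (late' (nu i) u-late' (nu j) u)<et)" if et: "et>0" for et
 proof -
  define et' where "et'=min et (min d (R1-R0))/2"
  have "et'>0" using et d R1(1) by (simp add: et'_def)
  then obtain I where I: "ALL i>=I. ALL u:{0..1}. cmod (late' (nu i) u-E u)<et'" using nu(6) by blast
  have n: "cmod (late' (nu i) u-late' (nu j) u)<min et (min d (R1-R0))" if "i>=I" "j>=I" "u:{0..1}" for i j u
  proof -
   have "cmod (late' (nu i) u-E u)<et'" "cmod (late' (nu j) u-E u)<et'" using I that by auto
   then have "cmod (late' (nu i) u-late' (nu j) u)<et' + et'" using norm_triangle_ineq4[of "late' (nu i) u-E u" "late' (nu j) u-E u"] by simp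
   then show ?thesis by (simp add: et'_def)
  qed
  have ds: "cmod (late' (nu i) u-z)<min et (min d (R1-R0))"
   if "i>=I" "j>=I" "u:{0..1}" "z:closed_segment (late' (nu i) u) (late' (nu j) u)" for i j u z
   using n[OF that(1-3)] segment_bound(1)[OF that(4)] by (simp add: norm_minus_commute)
  have cl: "close (nu i) (nu j)" if ij: "i>=I" "j>=I" for i j unfolding close_def
  proof (intro conjI ballI)
   show "T<=nu i" "T<=nu j" using nu(4) by auto
   show "closed_segment (late' (nu i) u) (late' (nu j) u)<=U" if u: "u:{0..1}" for u
   proof
    fix z assume "z:closed_segment (late' (nu i) u) (late' (nu j) u)"
    then have "z:ball (late' (nu i) u) d" using ds[OF ij u] by (simp add: dist_norm)
    moreover have "late' (nu i) u:K" using nu(4) u by blast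
    ultimately show "z:U" using d(2) by blast
   qed
   show "R0<cmod z" if "z:closed_segment (late' (nu i) 1) (late' (nu j) 1)" for z
   proof -
    have "cmod (late' (nu i) 1)=R1" using parts(7)[of "nu i"] nu(4) g(4) by simp
    then show ?thesis using ds[OF ij _ that] norm_triangle_ineq2[of "late' (nu i) 1" z] by auto
   qed
  qed
  show ?thesis by (intro exI[of _ I] allI impI conjI ballI cl less_le_trans[OF n min.cobounded1])
 qed
 moreover have "ball (late' (nu i) u) d<=U" if "u:{0..1}" for i u
 proof -
  have "late' (nu i) u:K" using nu(4) that by blast
  then show ?thesis using d(2) by blast
 qed
 ultimately show ?thesis using nu(1,4) d(1) by (intro exI[of _ nu] exI[of _ d]) auto
qed

text \<open>The square of segments between the late parts shows that only the early parts matter.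
  \<open>L\<close> is the loop by which these differ, and hypothesis \<open>a\<close> says that the
  germ absorbs it.\<close>

lemma equivalent_from_early:
 assumes c: "close n m" and L: "path L" "path_image L<=U" "pathfinish L=germ 1"
  and h: "homotopic_paths U (early n +++ linepath (late' n 0) (late' m 0)) (L +++ early m)"
  and a: "!!P. path P ==> path_image P<=U ==> P 0=germ 1 ==> R0<cmod (P 1) ==>
   legs_equivalent U z0 (extend germ (L +++ P)) (extend germ P)"
 shows "legs_equivalent U z0 (Ga n) (Ga m)"
proof -
 have nm: "n>=T" "m>=T" and sg: "ALL u:{0..1}. closed_segment (late' n u) (late' m u)<=U"
  and fn: "ALL z:closed_segment (late' n 1) (late' m 1). R0<cmod z" using c unfolding close_def by auto
 note pn=parts[OF nm(1)] ends[OF nm(1)] and pm=parts[OF nm(2)] ends[OF nm(2)]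
 define s0 s1 where "s0=linepath (late' n 0) (late' m 0)" and "s1=reversepath (linepath (late' n 1) (late' m 1))"
 define X where "X=late' m +++ s1"
 have s: "path s0" "path_image s0<=U" "path s1" "path_image s1<=U" using sg[rule_format, of 0] sg[rule_format, of 1] by (simp_all add: s0_def s1_def closed_segment_commute)
 have ends: "pathstart s0=late' n 0" "pathfinish s0=late' m 0" "pathstart s1=late' m 1" "pathfinish s1=late' n 1" by (auto simp: s0_def s1_def)
 have X: "path X" "path_image X<=U" "pathstart X=late' m 0" "pathfinish X=late' n 1"
  unfolding X_def using pm s ends by (simp_all add: path_image_join)
 define k where "k p=linepath (late' n (snd p)) (late' m (snd p)) (fst p)" for p :: "real*real"
 have "homotopic_paths U (%t. k (0, t)) ((%s. k (s, 0)) +++ ((%t. k (1, t)) +++ reversepath (%s. k (s, 1))))"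
 proof (rule homotopic_square)
  have "cont ({0..1} \<times> {0..1}) (%p::real*real. q (snd p))" if "path q" for q :: "real => complex"
   by (rule cont_comp[OF that[unfolded path_def]]) (auto intro!: continuous_intros)
  from this[OF pn(5)] this[OF pm(5)] show "cont ({0..1} \<times> {0..1}) k" unfolding k_def linepath_def
   by (intro continuous_intros)
  show "k ` ({0..1} \<times> {0..1})<=U"
  proof (rule image_subsetI)
   fix p :: "real*real" assume p: "p:{0..1} \<times> {0..1}"
   then have "k p:closed_segment (late' n (snd p)) (late' m (snd p))" unfolding k_def linepath_image_01[symmetric] by (intro imageI) auto
   then show "k p:U" using sg p by auto
  qed
 qed
 then have "homotopic_paths U (late' n) (s0 +++ X)" by (simp add: k_def X_def s0_def s1_def linepath_0' linepath_1')
 then have "homotopic_paths U (early n +++ late' n) (early n +++ (s0 +++ X))"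
  by (intro homotopic_paths_join) (use pn in simp_all)
 moreover have "homotopic_paths U (early n +++ (s0 +++ X)) ((early n +++ s0) +++ X)"
  by (intro homotopic_paths_assoc) (use pn s X ends in simp_all)
 moreover have "homotopic_paths U ((early n +++ s0) +++ X) ((L +++ early m) +++ X)"
  by (intro homotopic_paths_join h[folded s0_def]) (use X ends pn in simp_all)
 moreover have h5: "homotopic_paths U ((L +++ early m) +++ X) (L +++ (early m +++ X))"
  by (intro homotopic_paths_sym[OF homotopic_paths_assoc]) (use pm s X L in simp_all)
 have lm: "homotopic_paths U (early m +++ X) (leg_path (g m) (ta m) +++ s1)"
 proof -
  have "homotopic_paths U (early m +++ X) ((early m +++ late' m) +++ s1)" unfolding X_def
   by (intro homotopic_paths_assoc) (use pm s ends in simp_all)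
  moreover have "homotopic_paths U ((early m +++ late' m) +++ s1) (leg_path (g m) (ta m) +++ s1)"
   by (intro homotopic_paths_join homotopic_paths_sym[OF splits(1)]) (use pm s ends nm in simp_all)
  ultimately show ?thesis by (rule homotopic_paths_trans)
 qed
 moreover have "homotopic_paths U (L +++ (early m +++ X)) (L +++ (leg_path (g m) (ta m) +++ s1))"
  by (intro homotopic_paths_join lm) (use L pm in simp_all)
 ultimately have "homotopic_paths U (leg_path (g n) (ta n)) (L +++ (leg_path (g m) (ta m) +++ s1))"
  using splits(1)[OF nm(1)] h5 by (meson homotopic_paths_trans)
 then have "legs_equivalent U z0 (extend germ (leg_path (g n) (ta n))) (extend germ (L +++ (leg_path (g m) (ta m) +++ s1)))"
  by (rule extend_homotopic[OF germ(1-3) _ _ R0 bigU]) (use tame[of n] germ(4) R1 R0 in "auto simp: leg_path_def tame_def")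
 moreover have lp: "path (leg_path (g m) (ta m))" "path_image (leg_path (g m) (ta m))<=U" "leg_path (g m) (ta m) 0=germ 1" "leg_path (g m) (ta m) 1=late' m 1"
  using homotopic_paths_imp_path[OF splits(1)[OF nm(2)]] homotopic_paths_imp_subset[OF splits(1)[OF nm(2)]] tame[of m] germ(4) pm(7)
  by (simp_all add: leg_path_def tame_def)
 then have lp': "pathfinish (leg_path (g m) (ta m))=pathstart s1" using ends by (simp add: pathfinish_def)
 have "legs_equivalent U z0 (extend germ (L +++ (leg_path (g m) (ta m) +++ s1))) (extend germ (leg_path (g m) (ta m) +++ s1))"
 proof (rule a)
  show "path (leg_path (g m) (ta m) +++ s1)" "path_image (leg_path (g m) (ta m) +++ s1)<=U" using lp s ends lp' by (simp_all add: path_image_join)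
  show "(leg_path (g m) (ta m) +++ s1) 0=germ 1" "R0<cmod ((leg_path (g m) (ta m) +++ s1) 1)" using lp ends fn by (auto simp: joinpaths_def pathfinish_def)
 qed
 moreover have "legs_equivalent U z0 (extend germ (leg_path (g m) (ta m) +++ s1)) (extend germ (leg_path (g m) (ta m)))"
 proof (rule extend_drop[OF germ(1-3) lp(1) s(3) _ lp(2,3) _ R0 bigU])
  show "pathfinish (leg_path (g m) (ta m))=pathstart s1" by (rule lp')
  show "R0<cmod (s1 t)" if "t:{0..1}" for t
  proof -
   have "s1 t:path_image s1" using that by (simp add: path_image_def)
   then show ?thesis using fn by (simp add: s1_def closed_segment_commute)
  qed
 qed
 ultimately show ?thesis using eqv legs_equivalent_trans legs_equivalent_sym by meson
qed

lemma equivalent_from_mid: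
 assumes c: "close n m" and h: "homotopic_paths U (mid n +++ linepath (late' n 0) (late' m 0)) (mid m)"
 shows "legs_equivalent U z0 (Ga n) (Ga m)"
proof -
 have nm: "n>=T" "m>=T" and sg: "closed_segment (late' n 0) (late' m 0)<=U" using c unfolding close_def by auto
 note pn=parts[OF nm(1)] ends[OF nm(1)] and pm=parts[OF nm(2)] ends[OF nm(2)]
 let ?s = "linepath (late' n 0) (late' m 0)"
 have x: "germ 1:U" by (rule subsetD[OF germ(3)], rule imageI) simp
 have "homotopic_paths U (early n +++ ?s) ((prefix +++ mid n) +++ ?s)"
  by (intro homotopic_paths_join splits(2)) (use pn sg nm in simp_all)
 moreover have "homotopic_paths U ((prefix +++ mid n) +++ ?s) (prefix +++ (mid n +++ ?s))"
  by (intro homotopic_paths_sym[OF homotopic_paths_assoc]) (use pn sg in simp_all)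
 moreover have "homotopic_paths U (prefix +++ (mid n +++ ?s)) (prefix +++ mid m)"
  by (intro homotopic_paths_join h) (use pn in simp_all)
 moreover have "homotopic_paths U (prefix +++ mid m) (early m)" by (rule homotopic_paths_sym[OF splits(2)[OF nm(2)]])
 moreover have "homotopic_paths U (early m) (linepath (germ 1) (germ 1) +++ early m)"
  using homotopic_paths_sym[OF homotopic_paths_lid[OF pm(1,2)]] pm by simp
 ultimately have h': "homotopic_paths U (early n +++ ?s) (linepath (germ 1) (germ 1) +++ early m)" by (meson homotopic_paths_trans)
 show ?thesis
 proof (rule equivalent_from_early[OF c _ _ _ h'])
  fix P assume P: "path P" "path_image P<=U" "P 0=germ 1" "R0<cmod (P 1)"
  then have "homotopic_paths U P (linepath (germ 1) (germ 1) +++ P)" using homotopic_paths_sym[OF homotopic_paths_lid[OF P(1,2)]] by (simp add: pathstart_def)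
  from extend_homotopic[OF germ(1-3) this P(3) R0 bigU P(4)]
  show "legs_equivalent U z0 (extend germ (linepath (germ 1) (germ 1) +++ P)) (extend germ P)" by (rule legs_equivalent_sym)
 qed (use x in auto)
qed

end

context tame_legs
begin

lemma late_near: assumes n: "n>=T" shows "late' n 0:ball ze r"
 using subsetD[OF parts(9)[OF n] pathfinish_in_path_image] ends(6)[OF n] by simp

text \<open>Since \<open>K\<close> reaches out of the disc, the components of the disc minus
  \<open>K\<close> are simply connected. Both middle parts lie in the same one, so they are
  homotopic no matter how they run.\<close>

lemma recurrence_nonisolated:
 assumes K: "closed K" "connected K" "~  K<=ball ze r" "K Int U={}" "ball ze r-K<=U"
 shows "EX m n. m<n & legs_equivalent U z0 (Ga m) (Ga n)"
proof -
 obtain nu d where nu: "strict_mono (nu :: nat => nat)" "ALL i. nu i>=T"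
  "ALL et>0. EX I. ALL i>=I. ALL j>=I. close (nu i) (nu j) & (ALL u:{0..1}. cmod (late' (nu i) u-late' (nu j) u)<et)" using close_late by blast
 obtain I where I: "ALL i>=I. ALL j>=I. close (nu i) (nu j)" using nu(3) zero_less_one by blast
 define n m where "n=nu I" and "m=nu (Suc I)"
 have c: "close n m" and less: "n<m" using I nu(1) by (auto simp: n_def m_def strict_mono_def)
 have nm: "n>=T" "m>=T" and sg: "closed_segment (late' n 0) (late' m 0)<=U" using c unfolding close_def by auto
 note pn=parts[OF nm(1)] ends[OF nm(1)] and pm=parts[OF nm(2)] ends[OF nm(2)]
 define p where "p=mid n +++ linepath (late' n 0) (late' m 0)"
 have p: "path p" "pathstart p=g T (real T)" "pathfinish p=late' m 0" unfolding p_def using pn by simp_all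
 have seg: "closed_segment (late' n 0) (late' m 0)<=ball ze r" by (simp add: closed_segment_subset late_near nm del: mem_ball)
 have "path_image p=path_image (mid n) Un closed_segment (late' n 0) (late' m 0)" unfolding p_def using pn by (simp add: path_image_join)
 then have im: "path_image p<=ball ze r-K" "path_image (mid m)<=ball ze r-K" using pn(9) pm(9) K(4) sg seg by blast+
 define W where "W=connected_component_set (ball ze r-K) (g T (real T))"
 have b: "g T (real T):ball ze r-K" using subsetD[OF im(1) pathstart_in_path_image] p(2) by simp
 have W: "simply_connected W" "open W"
  using component_simply_connected[OF K(1-3), of W] b by (auto simp: W_def components_def)
 have "path_image p<=W" "path_image (mid m)<=W" unfolding W_def
  by (intro connected_component_maximal connected_path_image im p pm; use p pm pathstart_in_path_image[of p] pathstart_in_path_image[of "mid m"] in simp)+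
 then have "homotopic_paths W p (mid m)" using W(1) p pm unfolding simply_connected_eq_homotopic_paths by auto
 moreover have "W<=U" using connected_component_subset[of "ball ze r-K"] K(5) unfolding W_def by blast
 ultimately have "homotopic_paths U p (mid m)" using homotopic_paths_subset by blast
 then show ?thesis using equivalent_from_mid[OF c] less unfolding p_def by blast
qed

text \<open>The early parts, not just their middle parts, lie in the punctured disc, so two of them
  differ by a loop around \<open>z0\<close>; \<open>extend_absorb\<close> removes it however often
  it winds.\<close>

lemma recurrence_at_z0:
 assumes e: "ze=z0" "r<=e" "ball z0 e-{z0}<=U" "z0 ~: U"
  and gm: "germ ` {0..1}<=ball z0 e" and al: "!!k t. t:{0..1} ==> aa k t:ball z0 e"
 shows "EX m n. m<n & legs_equivalent U z0 (Ga m) (Ga n)"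
proof -
 obtain nu d where nu: "strict_mono (nu :: nat => nat)" "ALL i. nu i>=T"
  "ALL et>0. EX I. ALL i>=I. ALL j>=I. close (nu i) (nu j) & (ALL u:{0..1}. cmod (late' (nu i) u-late' (nu j) u)<et)" using close_late by blast
 obtain I where I: "ALL i>=I. ALL j>=I. close (nu i) (nu j)" using nu(3) zero_less_one by blast
 define n m where "n=nu I" and "m=nu (Suc I)"
 have c: "close n m" and less: "n<m" using I nu(1) by (auto simp: n_def m_def strict_mono_def)
 have nm: "n>=T" "m>=T" and sg: "closed_segment (late' n 0) (late' m 0)<=U" using c unfolding close_def by auto
 note pn=parts[OF nm(1)] ends[OF nm(1)] and pm=parts[OF nm(2)] ends[OF nm(2)]
 have ey: "path_image (early k)<=ball z0 e-{z0}" if k: "k>=T" for k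
 proof -
  have "g k t:ball z0 e" if t: "t:{0..sy T k}" for t
  proof (cases "t<=real T")
   case True
   define j where "j=min (nat \<lfloor>t\<rfloor>) (T-1)"
   have j: "j<T" "t:{real j..real j+1}"
    using T(1) t True floor_correct[of t] le_nat_floor[of "T-1" t] by (auto simp: j_def min_def of_nat_diff not_le) linarith?
   then have "G k 0 t=aa (0 + j) (t-real j)" using tau_ge[of k] less_le_trans[OF j(1) k] by blast
   then show ?thesis using al[of "t-real j" j] j(2) G0[of t k] t by simp
  next
   case False
   then show ?thesis using early_near[OF T(2) k, of t] t e(1,2) by (simp add: dist_norm norm_minus_commute)
  qed
  moreover have "path_image (early k)<=g k ` {0..sy T k}" using piece(2)[of 0 "sy T k" k] sig[OF k] by (simp add: early_def[abs_def])
  moreover have "path_image (early k)<=U" using parts(2)[OF k] .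
  ultimately show ?thesis using e(4) by blast
 qed
 have seg: "closed_segment (late' n 0) (late' m 0)<=ball ze r" by (simp add: closed_segment_subset late_near nm del: mem_ball)
 have ls: "closed_segment (late' n 0) (late' m 0)<=ball z0 e-{z0}" using order_trans[OF seg subset_ball[OF e(2)]] sg e(1,4) by auto
 define p where "p=early n +++ linepath (late' n 0) (late' m 0)"
 define L where "L=p +++ reversepath (early m)"
 have p: "path p" "path_image p<=ball z0 e-{z0}" "pathstart p=germ 1" "pathfinish p=late' m 0"
  unfolding p_def using pn ls ey[OF nm(1)] by (simp_all add: path_image_join)
 have L: "path L" "path_image L<=ball z0 e-{z0}" "pathstart L=germ 1" "pathfinish L=germ 1"
  unfolding L_def using p pm ey[OF nm(2)] by (simp_all add: path_image_join)
 have LU: "path_image L<=U" "path_image p<=U" using L(2) p(2) e(3) by blast+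
 have "legs_equivalent U z0 (Ga n) (Ga m)"
 proof (rule equivalent_from_early[OF c L(1) LU(1) L(4)])
  have "homotopic_paths U (reversepath (early m) +++ early m) (linepath (late' m 0) (late' m 0))"
   using homotopic_paths_linv[OF pm(1,2)] pm by simp
  then have "homotopic_paths U (p +++ (reversepath (early m) +++ early m)) (p +++ linepath (late' m 0) (late' m 0))"
   by (intro homotopic_paths_join) (use p pm LU in simp_all)
  moreover have "homotopic_paths U (p +++ linepath (late' m 0) (late' m 0)) p" using homotopic_paths_rid[OF p(1) LU(2)] p(4) by simp
  moreover have "homotopic_paths U (p +++ (reversepath (early m) +++ early m)) (L +++ early m)" unfolding L_def
   by (intro homotopic_paths_assoc) (use p pm LU in simp_all)
  ultimately show "homotopic_paths U (early n +++ linepath (late' n 0) (late' m 0)) (L +++ early m)" unfolding p_def[symmetric] by (meson homotopic_paths_trans homotopic_paths_sym)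
  have gi: "germ ` {0<..1}<=ball z0 e-{z0}" using gm germ(3) e(4) by (auto simp: image_subset_iff)
  fix P assume P: "path P" "path_image P<=U" "P 0=germ 1" "R0<cmod (P 1)"
  show "legs_equivalent U z0 (extend germ (L +++ P)) (extend germ P)"
   by (rule extend_absorb[OF e(3) germ(1,2) gi L(1,2) _ _ P R0 bigU]) (use L(3,4) in "simp_all add: pathstart_def pathfinish_def")
 qed
 then show ?thesis using less by blast
qed

text \<open>The initial and the late parts turn around \<open>ze\<close> by a bounded amount.
  Excessive turning in the disc would therefore satisfy the hypotheses of
  \<open>simple_leg_turning\<close>. So the angles \<open>y i\<close> at the end of the middle parts
  are bounded, two of them differ by less than \<open>1\<close>, and these two middle parts wind
  equally often.\<close>

lemma recurrence_isolated:
 assumes e: "ze~=z0" "r<cmod (z0-ze)" "ball ze r-{ze}<=U" "ze ~: U" "z0 ~: U" and si: "!!n. is_leg U z0 (Ga n)"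
 shows "EX m n. m<n & legs_equivalent U z0 (Ga m) (Ga n)"
proof -
 obtain nu d where nu: "strict_mono (nu :: nat => nat)" "ALL i. nu i>=T" "d>0" "ALL i. ALL u:{0..1}. ball (late' (nu i) u) d<=U"
  "ALL et>0. EX I. ALL i>=I. ALL j>=I. close (nu i) (nu j) & (ALL u:{0..1}. cmod (late' (nu i) u-late' (nu j) u)<et)" using close_late by blast
 obtain I where I: "ALL i>=I. ALL j>=I. close (nu i) (nu j) & (ALL u:{0..1}. cmod (late' (nu i) u-late' (nu j) u)<d)" using nu(3,5) by blast
 have far: "d<=cmod (late' (nu i) u-ze)" if "u:{0..1}" for i u
 proof (rule ccontr)
  assume "~  ?thesis"
  then have "ze:ball (late' (nu i) u) d" by (simp add: dist_norm)
  then show False using nu(4) that e(4) by blast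
 qed
 have ratio: "0<Re ((y-ze)/(x-ze))" if "cmod (y-x)<cmod (x-ze)" for x y
 proof -
  have "x-ze~=0" using le_less_trans[OF norm_ge_zero that] by auto
  then have "(y-ze)/(x-ze)=1+(y-x)/(x-ze)" by (simp add: divide_simps)
  moreover have "cmod ((y-x)/(x-ze))<1" using that le_less_trans[OF norm_ge_zero that] by (simp add: norm_divide)
  then have "\<bar>Re ((y-x)/(x-ze))\<bar><1" using abs_Re_le_cmod le_less_trans by blast
  ultimately show ?thesis by simp
 qed
 have gz: "g n t-ze~=0" if "t>=0" for n t using g(2)[OF that, of n] e(4) by auto
 have gU: "germ t-ze~=0" if "t:{0..1}" for t
  using subsetD[OF germ(3), of "germ t"] germ(2) that e(1,4) by (cases "t=0") auto
 have "cont {0..1} (%t. germ t-ze)" by (intro continuous_intros germ(1))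
 from continuous_log_convex[OF _ this gU] obtain c where c: "cont {0..1} c" "ALL t:{0..1}. exp (c t)=germ t-ze" by auto
 have "EX l. cont {0..} l & (ALL t>=0. exp (l t)=g n t-ze) & l 0=c 1" for n
 proof -
  have "cont {0..} (%t. g n t-ze)" by (intro continuous_intros g(1))
  from continuous_log_convex[OF _ this gz] obtain l where l: "cont {0..} l" "ALL t:{0..}. exp (l t)=g n t-ze" by auto
  have "exp (l 0)=exp (c 1)" using l(2) c(2) tame[of n] germ(4) unfolding tame_def by simp
  then show ?thesis using l by (intro exI[of _ "%t. l t+(c 1-l 0)"]) (auto intro!: continuous_intros simp: exp_add exp_diff)
 qed
 then obtain l where l: "!!n. cont {0..} (l n)" "!!n t. t>=0 ==> exp (l n t)=g n t-ze" "!!n. l n 0=c 1" by metis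
 have cl: "cont {a..b} (l n)" if "0<=a" for a b n by (rule cont_sub[OF l(1)]) (use that in auto)
 have agree: "l n t=l T t" if "n>=T" "t:{0..real T}" for n t
  using continuous_log_diff[of "{0..real T}" "l n" "l T" t 0] cl[of 0] l(2,3) parts(16)[OF that(1)] that(2) by auto
 define y where "y i=Im (l (nu i) (sy T (nu i)))" for i
 define v where "v i u=sy T (nu i) + u * (ta (nu i)-sy T (nu i))" for i u
 have s: "real T<=sy T (nu i)" "0<sy T (nu i)" "sy T (nu i)<=ta (nu i)" for i using sig nu(2) by auto
 have v: "v i u:{sy T (nu i)..ta (nu i)}" "v i u>=0" if "u:{0..1}" for i u
  using seg_in[OF s(3) that, of i] s(2)[of i] by (auto simp: v_def)
 have lv: "exp (l (nu i) (v i u))=late' (nu i) u-ze" "cont {0..1} (%u. l (nu i) (v i u))" if "u:{0..1}" for i u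
 proof -
  show "exp (l (nu i) (v i u))=late' (nu i) u-ze" using l(2)[OF v(2)[OF that]] by (simp add: late_def v_def)
  show "cont {0..1} (%u. l (nu i) (v i u))"
   by (rule cont_comp[OF l(1)]) (use v(2) in "auto simp: v_def intro!: continuous_intros")
 qed
 obtain C2 where C2: "ALL u:{0..1}. \<bar>Im (l (nu I) (v I u))-y I\<bar><=C2"
 proof -
  have "cont {0..1} (%u. \<bar>Im (l (nu I) (v I u))-y I\<bar>)" using lv(2)[of 0] by (intro continuous_intros) auto
  from continuous_attains_sup[OF compact_Icc _ this] that show ?thesis by force
 qed
 \<comment> \<open>The reference curve is at distance at least \<open>d\<close> from
   \<open>ze\<close> and the others are within \<open>d\<close> of it, so the ratio stays in the
   right half plane and the turnings differ by at most \<open>pi\<close>.\<close>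
 have late_turn: "\<bar>Im (l (nu i) (v i u))-y i\<bar><=C2 + pi" if i: "i>=I" and u: "u:{0..1}" for i u
 proof -
  have "\<bar>Im (l (nu i) (v i u)-l (nu I) (v I u))-Im (l (nu i) (v i 0)-l (nu I) (v I 0))\<bar><=pi"
  proof (rule log_ratio_bound[of "{0..1}"])
   fix t :: real assume t: "t:{0..1}"
   have "cmod (late' (nu i) t-late' (nu I) t)<cmod (late' (nu I) t-ze)" using I i t far[OF t, of I] by (meson less_le_trans order_refl)
   from ratio[OF this] show "0<Re (exp (l (nu i) (v i t)-l (nu I) (v I t)))" by (simp add: exp_diff lv(1)[OF t])
  qed (use lv(2)[of 0] u in auto)
  moreover have "v i 0=sy T (nu i)" for i by (simp add: v_def)
  ultimately show ?thesis using C2 u unfolding y_def by fastforce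
 qed
 have ray_turn: "\<bar>Im (l (nu i) t)-y i\<bar><=C2+2 * pi" if i: "i>=I" and t: "t>=sy T (nu i)" for i t
 proof (cases "t<=ta (nu i)")
  case True
  define u where "u=(if ta (nu i)=sy T (nu i) then 0 else (t-sy T (nu i))/(ta (nu i)-sy T (nu i)))"
  have "u:{0..1}" "v i u=t" using True t s(3)[of i] by (auto simp: u_def v_def divide_simps)
  then have "\<bar>Im (l (nu i) t)-y i\<bar><=C2 + pi" using late_turn[OF i, of u] by simp
  then show ?thesis using pi_gt_zero by linarith
 next
  case False
  let ?w = "g (nu i) (ta (nu i))"
  have w: "cmod ?w=R1" "cmod ze<R1" using g(4) r by auto
  have "\<bar>Im (l (nu i) t-Ln ?w)-Im (l (nu i) (ta (nu i))-Ln ?w)\<bar><=pi"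
  proof (rule log_ratio_bound[of "{ta (nu i)..t}" "l (nu i)" "%x. Ln ?w"])
   show "cont {ta (nu i)..t} (l (nu i))" using g(3)[of "nu i"] by (intro cl) simp
   fix x assume x: "x:{ta (nu i)..t}"
   have w0: "?w~=0" using w R1p by auto
   have "exp (l (nu i) x) = of_real (1 + x-ta (nu i)) * ?w-ze" using l(2)[of x "nu i"] g(5)[of "nu i" x] g(3)[of "nu i"] x by simp
   then have "exp (l (nu i) x-Ln ?w) = of_real (1 + x-ta (nu i))-ze/?w" using w0 by (simp add: exp_diff diff_divide_distrib)
   moreover have "\<bar>Re (ze/?w)\<bar><1" 
    by (rule le_less_trans[OF abs_Re_le_cmod]) (use w R1p in "simp add: norm_divide")
   ultimately show "0<Re (exp (l (nu i) x-Ln ?w))" using x by (simp add: abs_less_iff)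
  qed (use False in auto)
  moreover have "v i 1=ta (nu i)" by (simp add: v_def)
  then have "\<bar>Im (l (nu i) (ta (nu i)))-y i\<bar><=C2 + pi" using late_turn[OF i, of 1] by simp
  ultimately show ?thesis by simp
 qed
 define de where "de n=join_at_one germ (g n)" for n
 define L where "L n=join_at_one c (l n)" for n
 have dee: "legs_equivalent U z0 (de n) (Ga n)" for n
 proof -
  have gg: "g n 0=germ 1" using tame[of n] germ(4) unfolding tame_def by simp
  have "leg_curve U z0 (de n)" unfolding de_def by (rule leg_curve_join[OF germ(1-3) g(1) gg g(2) tame_at_infinity[OF tame]])
  then have "legs_equivalent U z0 (de n) (extend germ (leg_path (g n) (ta n)))"
  proof (rule extend_truncate[where ro = "%u. 1 + u * ta n" and ta = "1 + ta n", OF _ _ _ _ _ _ _ R0 bigU])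
   fix t assume t: "t>=1 + ta n"
   have "1 * R1<=(t-ta n) * R1" using t R1p by (intro mult_right_mono) auto
   moreover have "cmod (de n t)=(t-ta n) * R1" using g(5)[of n "t-1"] g(3,4)[of n] t
    by (auto simp: de_def join_at_one_def norm_mult simp flip: of_real_diff of_real_add)
   ultimately show "R0<cmod (de n t)" using R1(1) by linarith
  next
   show "leg_path (g n) (ta n) u=de n (1 + u * ta n)" if "u:{0..1}" for u
    using that g(3)[of n] gg by (auto simp: leg_path_def de_def join_at_one_def mult_le_0_iff)
  qed (use g(3)[of n] in "auto simp: de_def join_at_one_def add_pos_nonneg intro!: continuous_intros")
  then show ?thesis using eqv legs_equivalent_sym legs_equivalent_trans by blast
 qed
 have L: "cont {0..} (L n)" "!!t. t>=0 ==> exp (L n t)=de n t-ze" "L n 0=c 0" for n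
  using continuous_join_at_one[OF c(1) l(1,3)] c(2) l(2) by (auto simp: L_def de_def join_at_one_def)
 obtain C1 where C1: "ALL t:{0..1 + real T}. \<bar>Im (L T t-c 0)\<bar><=C1"
 proof -
  have "cont {0..1 + real T} (%t. \<bar>Im (L T t-c 0)\<bar>)" by (intro continuous_intros cont_sub[OF L(1)]) auto
  from continuous_attains_sup[OF compact_Icc _ this] that show ?thesis by force
 qed
 \<comment> \<open>\<open>K\<close> full turns exceed what the common initial part can do, as
   \<open>p1\<close> in \<open>simple_leg_turning\<close> demands.\<close>
 obtain k :: nat where k: "C1<real k" using reals_Archimedean2 by blast
 define K where "K=Suc k"
 have K: "K>0" "C1<2 * pi * real K"
 proof -
  have "1 * real K<=(2 * pi) * real K" using pi_gt3 by (intro mult_right_mono) auto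
  moreover have "C1<1 * real K" using k by (simp add: K_def)
  ultimately show "C1<2 * pi * real K" by linarith
 qed (simp add: K_def)
 have bd: "\<bar>y i-Im (c 0)\<bar><=C2+2 * pi+2 * pi * real K" if i: "i>=I" for i
 proof (rule ccontr)
  assume n: "~  ?thesis"
  define q :: real where "q=(if y i>=Im (c 0) then 1 else-1)"
  have q: "q=1 | q = - 1" "q * (y i-Im (c 0))>C2+2 * pi+2 * pi * real K" using n by (auto simp: q_def)
  let ?n = "nu i"
  show False
  proof (rule simple_leg_turning[OF si[of ?n] dee e(4,1,5) L(1,2) K(1) q(1), of "1 + real T" "1 + sy T ?n"])
   show "q * Im (L ?n t-L ?n 0)<2 * pi * real K" if t: "t:{0..1 + real T}" for t
   proof -
    have "L ?n t=L T t" using agree[of ?n "t-1"] nu(2) t by (auto simp: L_def join_at_one_def)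
    then have "\<bar>Im (L ?n t-L ?n 0)\<bar><=C1" using C1 t L(3) by auto
    then show ?thesis using q(1) K(2) by auto
   qed
   show "Re (L ?n t)<Re (L ?n 0)" if t: "t:{1 + real T..1 + sy T ?n}" for t
   proof -
    have "cmod (g ?n (t-1)-ze)<cmod (z0-ze)" using early_near[OF T(2), of ?n "t-1"] nu(2) t e(2) by auto
    moreover have "de ?n t=g ?n (t-1)" "de ?n 0=z0" using t T(1) germ(2) by (auto simp: de_def join_at_one_def)
    ultimately have "cmod (exp (L ?n t))<cmod (exp (L ?n 0))" using L(2)[of t ?n] L(2)[of 0 ?n] t by simp
    then show ?thesis by simp
   qed
   show "2 * pi * real K<q * Im (L ?n t-L ?n 0)" if t: "t>=1 + sy T ?n" for t
   proof -
    have "L ?n t=l ?n (t-1)" using t s(2)[of i] by (auto simp: L_def join_at_one_def)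
    then have "\<bar>Im (L ?n t)-y i\<bar><=C2+2 * pi" using ray_turn[OF i, of "t-1"] t by simp
    then show ?thesis using q L(3)[of ?n] by auto
   qed
  qed (use s(1)[of i] in auto)
 qed
 obtain i j where ij: "I<=i" "i<j" "\<bar>y i-y j\<bar><1"
 proof -
  have "\<bar>y (I + n)\<bar><=C2+2 * pi+2 * pi * real K + \<bar>Im (c 0)\<bar>" for n using bd[of "I + n"] by linarith
  then have "bounded (range (%n. y (I + n)))" unfolding bounded_real by auto
  then obtain x ro where ro: "strict_mono (ro :: nat => nat)" "((%n. y (I + n)) o ro) \<longlonglongrightarrow> x" using bounded_imp_convergent_subsequence by metis
  then have "Cauchy ((%n. y (I + n)) o ro)" using LIMSEQ_imp_Cauchy by blast
  then obtain N where "ALL m>=N. ALL n>=N. \<bar>y (I + ro m)-y (I + ro n)\<bar><1" using CauchyD[of _ 1] by fastforce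
  then show ?thesis using that[of "I + ro N" "I + ro (Suc N)"] ro(1) by (auto simp: strict_mono_def)
 qed
 define n m where "n=nu i" and "m=nu j"
 have cls: "close n m" and less: "n<m" using I ij nu(1) by (auto simp: n_def m_def strict_mono_def)
 have nm: "n>=T" "m>=T" using cls unfolding close_def by auto
 note pn=parts[OF nm(1)] ends[OF nm(1)] and pm=parts[OF nm(2)] ends[OF nm(2)]
 let ?a = "late' n 0" and ?b = "late' m 0"
 have ab: "cmod (?b-?a)<cmod (?a-ze)"
 proof -
  have "cmod (late' (nu i) 0-late' (nu j) 0)<d" using I ij(1,2) by auto
  then show ?thesis using far[of 0 i] by (simp add: n_def m_def norm_minus_commute)
 qed
 define w where "w u=(linepath ?a ?b u-ze)/(?a-ze)" for u
 have w: "0<Re (w u)" if u: "u:{0..1}" for u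
 proof -
  have "linepath ?a ?b u-?a=u *\<^sub>R (?b-?a)" by (simp add: linepath_def algebra_simps)
  then have "cmod (linepath ?a ?b u-?a)<=cmod (?b-?a)" using u by (simp add: mult_left_le_one_le)
  then show ?thesis using ratio[of "linepath ?a ?b u" ?a] ab unfolding w_def by simp
 qed
 define A where "A k u=l k (real T + u * (sy T k-real T))" for k u
 have A: "cont {0..1} (A k)" "!!u. u:{0..1} ==> mid k u=ze + exp (A k u)" "A k 1=l k (sy T k)" "A k 0=l T (real T)" if k: "k>=T" for k
 proof -
  have p: "0<=real T + u * (sy T k-real T)" if "u:{0..1}" for u using that sig[OF k] by (intro add_nonneg_nonneg mult_nonneg_nonneg) auto
  show "cont {0..1} (A k)" unfolding A_def by (rule cont_comp[OF l(1)]) (use p in "auto intro!: continuous_intros")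
  show "mid k u=ze + exp (A k u)" if "u:{0..1}" for u using l(2)[OF p[OF that]] by (simp add: mid_def A_def)
 qed (use agree[OF k, of "real T"] in "auto simp: A_def")
 define B where "B=A n +++ (%u. A n 1 + Ln (w u))"
 have w01: "w 0=1" "w 1=(?b-ze)/(?a-ze)" using ab by (auto simp: w_def linepath_0' linepath_1')
 have ea: "exp (A k 1)=late' k 0-ze" if k: "k>=T" for k using A(2)[OF k, of 1] parts(11)[OF k] by simp
 have cB: "cont {0..1} B"
 proof -
  have "path (%u. A n 1 + Ln (w u))" unfolding path_def w_def
   by (intro continuous_intros) (use w[unfolded w_def] ab in "force simp: complex_nonpos_Reals_iff")+
  then have "path B" using A(1)[OF nm(1)] w01 unfolding B_def by (intro path_join_imp) (auto simp: path_def pathfinish_def pathstart_def)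
  then show ?thesis by (simp add: path_def)
 qed
 have w0: "w u~=0" if "u:{0..1}" for u using w[OF that] by auto
 have B1: "B 1=A m 1"
 proof -
  have B1: "B 1=A n 1 + Ln (w 1)" by (simp add: B_def joinpaths_def)
  have "exp (A n 1 + Ln (w 1))=exp (A m 1)" using w0[of 1] w01 ea[OF nm(1)] ea[OF nm(2)] ab by (simp add: exp_add)
  then obtain z :: int where z: "A n 1 + Ln (w 1)=A m 1 + of_int (2 * z) * pi * \<i>" unfolding exp_eq by auto
  then have "y i + Im (Ln (w 1))=y j + of_int (2 * z) * pi" using A(3) nm by (auto simp: complex_eq_iff y_def n_def m_def)
  moreover have "\<bar>Im (Ln (w 1))\<bar><pi/2" using w[of 1] w0[of 1] Re_Ln_pos_lt[of "w 1"] by simp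
  \<comment> \<open>An angle below \<open>1\<close> and an argument below \<open>pi/2\<close>
    together leave no room for a full turn.\<close>
  ultimately have "\<bar>of_int z * (2 * pi)\<bar><1*(2 * pi)" using ij(3) pi_gt3 by (simp add: algebra_simps)
  then have "z=0" by (simp add: abs_mult)
  then show ?thesis using z B1 by simp
 qed
 have "homotopic_paths (ball ze r-{ze}) (mid n +++ linepath ?a ?b) (mid m)"
 proof (rule homotopic_paths_punctured[OF _ pm(8) _ _ cB A(1)[OF nm(2)] _ B1 _ A(2)[OF nm(2)]])
  show "path (mid n +++ linepath ?a ?b)" using pn by simp
  have "closed_segment ?a ?b<=ball ze r" by (simp add: closed_segment_subset late_near nm del: mem_ball)
  then show "path_image (mid n +++ linepath ?a ?b)<=ball ze r" using pn by (simp add: path_image_join)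
  show "path_image (mid m)<=ball ze r" using pm(9) by blast
  show "B 0=A m 0" using A(4) nm by (simp add: B_def joinpaths_def)
  show "(mid n +++ linepath ?a ?b) t=ze + exp (B t)" if t: "t:{0..1}" for t
  proof (cases "t<=1/2")
   case True
   then show ?thesis using A(2)[OF nm(1), of "2 * t"] t by (simp add: B_def joinpaths_def)
  next
   case False
   then have "exp (A n 1 + Ln (w (2 * t-1)))=linepath ?a ?b (2 * t-1)-ze"
    using w0[of "2 * t-1"] t ea[OF nm(1)] ab by (auto simp: exp_add w_def)
   then show ?thesis using False by (simp add: B_def joinpaths_def)
  qed
 qed
 then have "homotopic_paths U (mid n +++ linepath ?a ?b) (mid m)" using e(3) homotopic_paths_subset by blast
 then show ?thesis using equivalent_from_mid[OF cls] less by blast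
qed

end

section \<open>Passing to iterates, and conclusion\<close>

text \<open>Gives the slack \<open>ep\<close> uniformly on a circle. Otherwise bad points accumulate
  at a point that is not moved outwards, and its neighbourhood \<open>N\<close> from
  \<open>trapped_at_fixed_point\<close> contains bad points.\<close>

lemma trap_radius:
 assumes f: "f holomorphic_on UNIV" and fz: "f ze=ze" and ne: "f x~=x" and l: "cmod (deriv f ze)>1 | deriv f ze=1"
 shows "EX ro>0. ALL r. 0<r & r<ro --> (EX ep>0. ALL z s. cmod (z-ze)=r --> cmod (f z-ze)<r + ep --> cmod ((f ^^ s) z-ze)<2 * r)"
proof -
 obtain ro where ro: "ro>0" "ALL z. 0<cmod (z-ze) & cmod (z-ze)<ro & cmod (f z-ze)<=cmod (z-ze) -->
  (EX N. open N & z:N & (ALL y:N. ALL s. cmod ((f ^^ s) y-ze)<2 * cmod (z-ze)))" using trapped_at_fixed_point[OF assms] by blast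
 have "EX ep>0. ALL z s. cmod (z-ze)=r --> cmod (f z-ze)<r + ep --> cmod ((f ^^ s) z-ze)<2 * r" if r: "0<r" "r<ro" for r
 proof (rule ccontr)
  assume n: "~  ?thesis"
  have "EX z s. cmod (z-ze)=r & cmod (f z-ze)<r + inverse (real (Suc n)) & 2 * r<=cmod ((f ^^ s) z-ze)" for n
  proof (rule ccontr)
   assume "~  ?thesis"
   then have "ALL z s. cmod (z-ze)=r --> cmod (f z-ze)<r + inverse (real (Suc n)) --> cmod ((f ^^ s) z-ze)<2 * r" by (auto simp: not_le)
   then show False using n by (metis inverse_positive_iff_positive of_nat_0_less_iff zero_less_Suc)
  qed
  then obtain z s where z: "!!n. cmod (z n-ze)=r" "!!n. cmod (f (z n)-ze)<r + inverse (real (Suc n))" "!!n. 2 * r<=cmod ((f ^^ s n) (z n)-ze)" by metis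
  have "ALL n. z n:sphere ze r" using z(1) by (simp add: dist_norm norm_minus_commute)
  then obtain w sy where w: "w:sphere ze r" "strict_mono (sy :: nat => nat)" "(z o sy) \<longlonglongrightarrow> w"
   using compact_sphere[of ze r] unfolding compact_def by metis
  have cw: "cmod (w-ze)=r" using w(1) by (simp add: dist_norm norm_minus_commute)
  have "isCont f w" using f by (metis UNIV_I continuous_on_eq_continuous_at holo_cont open_UNIV)
  then have "(%n. cmod (f ((z o sy) n)-ze)) \<longlonglongrightarrow> cmod (f w-ze)" using w(3) by (intro tendsto_intros) (rule isCont_tendsto_compose)
  moreover have "(%n. r + inverse (real (Suc n))) \<longlonglongrightarrow> r+0" by (intro tendsto_intros LIMSEQ_inverse_real_of_nat)
  moreover have "cmod (f ((z o sy) n)-ze)<=r + inverse (real (Suc n))" for n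
  proof -
   have "inverse (real (Suc (sy n)))<=inverse (real (Suc n))" using seq_suble[OF w(2), of n] by (intro le_imp_inverse_le) auto
   then show ?thesis using z(2)[of "sy n"] unfolding o_def by linarith
  qed
  ultimately have "cmod (f w-ze)<=r+0" by (intro LIMSEQ_le[of _ _ "%n. r + inverse (real (Suc n))"]) auto
  then obtain N where N: "open N" "w:N" "ALL y:N. ALL s. cmod ((f ^^ s) y-ze)<2 * r" using ro(2)[rule_format, of w] cw r by auto
  then have "\<forall>\<^sub>F n in sequentially. (z o sy) n:N" using w(3) topological_tendstoD by blast
  then obtain n where "z (sy n):N" by (auto simp: eventually_sequentially)
  then show False using N(3) z(3)[of "sy n"] by (meson not_less)
 qed
 then show ?thesis using ro(1) by blast
qed

definition germ_hom :: "complex set => complex => real => (real => complex) => (real => complex) => (real*real => complex) => bool" where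
 "germ_hom U z0 t0 a b H \<longleftrightarrow> cont ({0..1} \<times> {0..1}) H & (ALL s:{0..1}. H (s, 0)=z0) &
  (ALL s:{0..1}. ALL t:{0<..1}. H (s, t):U) & (ALL t:{0..1}. H (0, t)=a (t0 * t) & H (1, t)=b (t0 * t))"

lemma germ_hom_rescale:
 fixes H :: "real*real => complex"
 assumes t0: "t0>0" and H: "cont ({0..1} \<times> {0..t0}) H" "ALL s:{0..1}. H (s, 0)=z0"
  "ALL s:{0..1}. ALL t:{0<..t0}. H (s, t):U" "ALL t:{0..t0}. H (0, t)=a t & H (1, t)=b t" and t1: "0<t1" "t1<=t0"
 shows "germ_hom U z0 t1 a b (%p. H (fst p, t1 * snd p))"
proof -
 have *: "t1 * t:{0..t0}" if "t:{0..1}" for t using that t1 mult_mono[of t1 t0 t 1] by auto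
 then have "cont ({0..1} \<times> {0..1}) (%p. H (fst p, t1 * snd p))"
  by (intro cont_comp[OF H(1)] continuous_intros) auto
 moreover have "t1 * t:{0<..t0}" if "t:{0<..1}" for t using *[of t] that t1 by auto
 ultimately show ?thesis using H(2-4) * unfolding germ_hom_def by auto
qed

lemma germ_hom_trans:
 assumes "germ_hom U z0 t0 a b H1" "germ_hom U z0 t0 b c H2"
 shows "EX H. germ_hom U z0 t0 a c H"
proof -
 define H where "H p=(if fst p<=1/2 then H1 (2 * fst p, snd p) else H2 (2 * fst p-1, snd p))" for p
 have "cont ({0..1/2} \<times> {0..1} Un {1/2..1} \<times> {0..1}) H" unfolding H_def
 proof (rule continuous_on_cases)
  show "cont ({0..1/2} \<times> {0..1}) (%p. H1 (2 * fst p, snd p))"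
   by (rule cont_comp[of "{0..1} \<times> {0..1}" H1]) (use assms in "auto simp: germ_hom_def intro!: continuous_intros")
  show "cont ({1/2..1} \<times> {0..1}) (%p. H2 (2 * fst p-1, snd p))"
   by (rule cont_comp[of "{0..1} \<times> {0..1}" H2]) (use assms in "auto simp: germ_hom_def intro!: continuous_intros")
  have "H1 (2 * x, y)=H2 (2 * x-1, y)" if "x * 2=1" "y:{0..1}" for x y
  proof -
   have x: "2 * x=1" using that(1) by simp
   show ?thesis unfolding x using assms that(2) by (simp add: germ_hom_def)
  qed
  then show "ALL p. p:{0..1/2} \<times> {0..1} & ~  fst p<=1/2 | p:{1/2..1} \<times> {0..1} & fst p<=1/2 -->
    H1 (2 * fst p, snd p)=H2 (2 * fst p-1, snd p)" by fastforce
 qed (auto intro!: closed_Times)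
 moreover have "{0..1/2} \<times> {0..1} Un {1/2..1} \<times> {0..1}={0..1::real} \<times> {0..1::real}" by auto
 ultimately have "germ_hom U z0 t0 a c H" using assms unfolding germ_hom_def H_def by simp
 then show ?thesis by blast
qed

context expansion
begin

lemma germ_hom_lift:
 assumes fz: "f z0=z0" "deriv f z0~=0" and t0: "t0>0" and H: "germ_hom U z0 t0 a b H"
  and a: "cont {0..} a'" "a' 0=z0" "!!t. t>=0 ==> f (a' t)=a t"
  and b: "cont {0..} b'" "b' 0=z0" "!!t. t>=0 ==> f (b' t)=b t"
 shows "EX K. germ_hom U z0 t0 a' b' K & (ALL s:{0..1}. ALL t:{0..1}. f (K (s, t))=H (s, t))"
proof -
 note H=H[unfolded germ_hom_def]
 have "EX K. cont ({0..1} \<times> {0..}) K & (ALL s:{0..1}. K (s, 0)=z0) &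
  (ALL s:{0..1}. ALL t>0. K (s, t):U) & (ALL s:{0..1}. ALL t>=0. f (K (s, t))=(%p. H (fst p, min (snd p) 1)) (s, t))"
 proof (rule lift_homotopy_from_fixed[OF fz])
  show "cont ({0..1} \<times> {0..}) (%p. H (fst p, min (snd p) 1))"
   by (rule cont_comp[OF conjunct1[OF H]]) (auto intro!: continuous_intros)
 qed (use H in auto)
 then obtain K where K: "cont ({0..1} \<times> {0..}) K" "ALL s:{0..1}. K (s, 0)=z0" "ALL s:{0..1}. ALL t>0. K (s, t):U"
  "ALL s:{0..1}. ALL t>=0. f (K (s, t))=H (s, min t 1)" by auto
 have e: "K (s, t)=c' (t0 * t)" if s: "s:{0..1}" and t: "t:{0..1}" and c: "cont {0..} c'" "c' 0=z0"
  "!!t. t>=0 ==> f (c' t)=c t" and Hc: "!!t. t:{0..1} ==> H (s, t)=c (t0 * t)" for s t c c'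
 proof -
  have "K (s, t)=c' (t0 * min t 1)"
  proof (rule lift_from_fixed_unique[OF fz, where a = "%t. K (s, t)" and b = "%t. c' (t0 * min t 1)"])
   show "cont {0..} (%t. K (s, t))" by (rule cont_comp[OF K(1)]) (use s in "auto intro!: continuous_intros")
   show "cont {0..} (%t. c' (t0 * min t 1))" by (rule cont_comp[OF c(1)]) (use t0 in "auto intro!: continuous_intros")
   show "f (K (s, t)):U" if "t>0" for t using K(4) H s that by auto
   show "f (K (s, t))=f (c' (t0 * min t 1))" if "t>=0" for t using K(4) Hc[of "min t 1"] c(3) s that t0 by auto
  qed (use K(2) s c t in auto)
  then show ?thesis using t by simp
 qed
 have "germ_hom U z0 t0 a' b' K" unfolding germ_hom_def
  using cont_sub[OF K(1) Sigma_mono[OF order_refl], of "%_. {0..1}"] K(2,3) e[OF _ _ a, of 0] e[OF _ _ b, of 1] H by auto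
 then show ?thesis using K(4) by (intro exI[of _ K]) auto
qed

text \<open>The end points of the successively lifted homotopies form the \<open>bchain\<close>.
  Concatenating the homotopies joins the germ of \<open>Ga 0\<close> to that of any later curve,
  which is what passing to an iterate requires.\<close>

lemma germ_chain:
 assumes fz: "f z0=z0" "deriv f z0~=0" and t0: "t0>0" and H: "germ_hom U z0 t0 (Ga 0) (Ga (Suc 0)) H"
  and G: "!!n. leg_curve U z0 (Ga n)" "!!n t. t>=0 ==> f (Ga (Suc n) t)=Ga n t"
 shows "EX aa. bchain aa & (ALL s. H (s, 1)=aa 0 s) & (ALL k. aa k 0=Ga k t0)" "p>0 ==> EX H. germ_hom U z0 t0 (Ga 0) (Ga p) H"
proof -
 have "EX h. ALL n. (germ_hom U z0 t0 (Ga n) (Ga (Suc n)) (h n) & (n=0 --> h n=H)) & (ALL s:{0..1}. ALL t:{0..1}. f (h (Suc n) (s, t))=h n (s, t))"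
 proof (rule dependent_nat_choice)
  show "EX h. germ_hom U z0 t0 (Ga 0) (Ga (Suc 0)) h & (0=0 --> h=H)" using H by blast
  fix h n assume h: "germ_hom U z0 t0 (Ga n) (Ga (Suc n)) h & (n=0 --> h=H)"
  have c: "cont {0..} (Ga m)" "Ga m 0=z0" for m using G(1)[of m] unfolding leg_curve_def by auto
  show "EX k. (germ_hom U z0 t0 (Ga (Suc n)) (Ga (Suc (Suc n))) k & (Suc n=0 --> k=H)) & (ALL s:{0..1}. ALL t:{0..1}. f (k (s, t))=h (s, t))"
   using germ_hom_lift[OF fz t0 conjunct1[OF h] c(1,2) G(2) c(1,2) G(2)] by blast
 qed
 then obtain h where h: "!!n. germ_hom U z0 t0 (Ga n) (Ga (Suc n)) (h n)" "h 0=H" "!!n s t. s:{0..1} ==> t:{0..1} ==> f (h (Suc n) (s, t))=h n (s, t)"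
  by metis
 have e: "h n (0, 1)=Ga n t0" "h n (1, 1)=Ga (Suc n) t0" for n using h(1)[of n] unfolding germ_hom_def by auto
 have "bchain (%k s. h k (s, 1))" unfolding bchain_def
 proof (intro conjI allI ballI)
  fix k
  show "cont {0..1} (%s. h k (s, 1))" by (rule cont_comp[of "{0..1} \<times> {0..1}" "h k"])
   (use h(1)[of k] in "auto simp: germ_hom_def intro!: continuous_intros")
  fix t :: real assume t: "t:{0..1}"
  show "h k (t, 1):U" "f (h (Suc k) (t, 1))=h k (t, 1)" using h(1)[of k] h(3)[OF t] t unfolding germ_hom_def by auto
 qed (simp add: e)
 then show "EX aa. bchain aa & (ALL s. H (s, 1)=aa 0 s) & (ALL k. aa k 0=Ga k t0)" using e h(2) by (intro exI[of _ "%k s. h k (s, 1)"]) auto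
 show "EX H. germ_hom U z0 t0 (Ga 0) (Ga p) H" if "p>0"
  using that
 proof (induction p)
  case (Suc p)
  show ?case
  proof (cases "p=0")
   case False
   then obtain H' where "germ_hom U z0 t0 (Ga 0) (Ga p) H'" using Suc.IH by auto
   from germ_hom_trans[OF this h(1)[of p]] show ?thesis .
  qed (rule exI[of _ H], use H in simp)
 qed simp
qed

text \<open>The other components of the complement are finitely many closed sets, so they keep a
  positive distance from \<open>ze\<close>.\<close>

lemma component_in_ball:
 assumes "ze ~: U"
 obtains e where "e>0" "ball ze e-connected_component_set (- U) ze<=U"
proof -
 define C where "C=connected_component_set (- U) ze"
 have "closed (\<Union>(components (- U)-{C}))"
 proof (rule closed_Union)
  show "ALL D:components (- U)-{C}. closed D" using closed_components[of "- U"] openU by (simp add: closed_def)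
 qed (use fin in simp)
 moreover have "C:components (- U)" unfolding C_def components_def using assms by (intro imageI) simp
 moreover have "ze:C" using assms by (simp add: C_def)
 ultimately have "closed (\<Union>(components (- U)-{C}))" "ze : - \<Union>(components (- U)-{C})"
  using components_nonoverlap[of C "- U"] by auto
 then obtain e where e: "e>0" "ball ze e <= - \<Union>(components (- U)-{C})" unfolding closed_def open_contains_ball by blast
 have "x:U" if "x:ball ze e" "x ~: C" for x
 proof (rule ccontr)
  assume "x ~: U"
  then have "connected_component_set (- U) x:components (- U)" "x:connected_component_set (- U) x" by (simp_all add: componentsI)
  then show False using e that by blast
 qed
 then show ?thesis using e that unfolding C_def by blast
qed

text \<open>\<open>iso\<close> concerns the case in which loops around \<open>z0\<close> must be
  absorbed; the germ and the chain then have to lie in one disc, which depends on how they were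
  chosen and is left to the caller.\<close>

lemma recurrence_core:
 assumes fz: "f z0=z0" "deriv f z0~=0" and t0: "t0>0" and H: "germ_hom U z0 t0 (Ga 0) (Ga (Suc 0)) H"
  and G: "!!n. is_leg U z0 (Ga n)" "!!n t. t>=0 ==> f (Ga (Suc n) t)=Ga n t" and nU: "z0 ~: U"
  and ch: "bchain aa" "!!s. H (s, 1)=aa 0 s" "lands aa ze" and ze: "f ze=ze" "cmod (deriv f ze)>1 | deriv f ze=1"
  and iso: "ze=z0 ==> connected_component_set (- U) z0={z0} ==>
   EX e>0. ball z0 e-{z0}<=U & (ALL t:{0..1}. Ga 0 (t0 * t):ball z0 e & (ALL k. aa k t:ball z0 e))"
 shows "EX m n. m<n & legs_equivalent U z0 (Ga m) (Ga n)"
proof -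
 have lc: "leg_curve U z0 (Ga n)" for n using G(1)[of n] unfolding is_leg_def leg_curve_def by blast
 obtain B where B: "!!k t. t:{0..1} ==> cmod (aa k t)<=B"
 proof -
  obtain J where J: "ALL n>=J. ALL t:{0..1}. cmod (aa n t-ze)<1" using ch(3) unfolding lands_def by (meson zero_less_one)
  have "compact (\<Union>k<J. aa k ` {0..1})" using ch(1) unfolding bchain_def by (intro compact_UN compact_continuous_image) auto
  then obtain B where B: "ALL x:(\<Union>k<J. aa k ` {0..1}). cmod x<=B" using compact_imp_bounded bounded_iff by metis
  have "cmod (aa k t)<=max B (cmod ze+1)" if t: "t:{0..1}" for k t
  proof (cases "k<J")
   case True
   then have "aa k t:(\<Union>k<J. aa k ` {0..1})" using t by blast
   then have "cmod (aa k t)<=B" by (rule bspec[OF B])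
   then show ?thesis by simp
  next
   case False
   then have "cmod (aa k t-ze)<1" using J t by simp
   then show ?thesis using norm_triangle_ineq2[of "aa k t" ze] by simp
  qed
  then show ?thesis using that by blast
 qed
 \<comment> \<open>The \<open>+2\<close> leaves room for \<open>2 * r\<close>, as \<open>r\<close>
   is taken below \<open>1\<close>.\<close>
 define R1 where "R1=max R0 (max B (cmod ze+2))+1"
 have bd: "R0<R1" "cmod ze+2<R1" by (auto simp: R1_def)
 have bd': "cmod (aa k t)<R1" if "t:{0..1}" for k t using B[OF that, of k] by (simp add: R1_def)
 obtain x where "f x~=x" using pt by metis
 from trap_radius[OF holf ze(1) this ze(2)] obtain ro where ro: "ro>0"
  "!!r. 0<r ==> r<ro ==> EX ep>0. ALL z s. cmod (z-ze)=r --> cmod (f z-ze)<r + ep --> cmod ((f ^^ s) z-ze)<2 * r" by blast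
 interpret leg_chain f U R0 z0 Ga t0 R1 H aa
 proof unfold_locales
  show "H (s, 1)=aa 0 s" for s by (rule ch(2))
 qed (use fz lc G(2) t0 H[unfolded germ_hom_def] ch(1) bd(1) bd' in auto)
 obtain g ta where gt: "!!n. tame (g n) (ta n) & legs_equivalent U z0 (Ga n) (extend germ (leg_path (g n) (ta n))) &
  (ALL t:{0..ta (Suc n)}. g (Suc n) t=join_at_one (aa 0) (lft 1 (g n)) t)" using tame_sequence by blast
 have main: "EX T. tame_legs f U R0 z0 Ga t0 R1 H aa g ta ze r ep T" if r: "0<r" "r<1"
  and ep: "ep>0" "!!z s. cmod (z-ze)=r ==> cmod (f z-ze)<r + ep ==> cmod ((f ^^ s) z-ze)<2 * r" for r ep
 proof -
  interpret tame_chain f U R0 z0 Ga t0 R1 H aa g ta ze r ep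
   by unfold_locales (use gt ch(3) r bd(2) ep in auto)
  obtain T where T: "ALL n. ALL k>=T. ALL t:{0..ta n}. cmod (G n k t-ze)<r" using eventually_near by blast
  have "tame_legs f U R0 z0 Ga t0 R1 H aa g ta ze r ep (Suc T)" by unfold_locales (use gt T in auto)
  then show ?thesis by blast
 qed
 have tl: "EX r ep T. r<e & r>0 & tame_legs f U R0 z0 Ga t0 R1 H aa g ta ze r ep T" if e: "e>0" for e
 proof -
  define r where "r=min (min 1 ro) e/2"
  have r: "0<r" "r<1" "r<ro" "r<e" using e ro(1) by (auto simp: r_def)
  then show ?thesis using ro(2)[OF r(1,3)] main[OF r(1,2)] by blast
 qed
 show ?thesis
 proof (cases "ze:U")
  case True
  then obtain e where e: "e>0" "ball ze e<=U" using openU open_contains_ball by blast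
  obtain r ep T where t: "r<e" "r>0" "tame_legs f U R0 z0 Ga t0 R1 H aa g ta ze r ep T" using tl[OF e(1)] by blast
  have "ball ze r<=U" using e(2) subset_ball[of r e ze] t(1) by force
  \<comment> \<open>A small disc about \<open>ze\<close> lies in \<open>U\<close>, hence is simply
    connected within \<open>U\<close>; the single point \<open>z0\<close> outside it can play the
    part of \<open>K\<close>.\<close>
  then show ?thesis using nU by (intro tame_legs.recurrence_nonisolated[OF t(3), of "{z0}"]) auto
 next
  case False
  then obtain e where e: "e>0" "ball ze e-connected_component_set (- U) ze<=U" using component_in_ball by blast
  define C where "C=connected_component_set (- U) ze"
  have "closed C" unfolding C_def using openU by (intro closed_connected_component) (simp add: closed_def)
  then have C: "closed C" "connected C" "C Int U={}" "ze:C"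
   using False connected_component_subset[of "- U" ze] by (auto simp: C_def)
  show ?thesis
  proof (cases "C={ze}")
   case False
   then obtain x where x: "x:C" "x~=ze" using C(4) by blast
   obtain r ep T where t: "r<min e (cmod (x-ze))" "r>0" "tame_legs f U R0 z0 Ga t0 R1 H aa g ta ze r ep T"
    using tl[of "min e (cmod (x-ze))"] e(1) x(2) by auto
   have "x ~: ball ze r" using t(1) by (simp add: dist_norm norm_minus_commute)
   moreover have "ball ze r-C<=U" using e(2) subset_ball[of r e ze] t(1) unfolding C_def by force
   ultimately show ?thesis using x(1) C by (intro tame_legs.recurrence_nonisolated[OF t(3), of C]) auto
  next
   case C1: True
   show ?thesis
   proof (cases "ze=z0")
    case True
    obtain e where e: "e>0" "ball z0 e-{z0}<=U" "ALL t:{0..1}. germ t:ball z0 e & (ALL k. aa k t:ball z0 e)"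
     using iso[OF True] C1 unfolding C_def True by auto
    obtain r ep T where t: "r<e" "r>0" "tame_legs f U R0 z0 Ga t0 R1 H aa g ta ze r ep T" using tl[OF e(1)] by blast
    show ?thesis by (rule tame_legs.recurrence_at_z0[OF t(3) True less_imp_le[OF t(1)] e(2) nU]) (use e(3) in auto)
   next
    case nz: False
    obtain r ep T where t: "r<min e (cmod (z0-ze))" "r>0" "tame_legs f U R0 z0 Ga t0 R1 H aa g ta ze r ep T"
     using tl[of "min e (cmod (z0-ze))"] e(1) nz by auto
    have "ball ze r-{ze}<=U" using e(2) subset_ball[of r e ze] t(1) C1 unfolding C_def by force
    then show ?thesis by (intro tame_legs.recurrence_isolated[OF t(3) nz _ _ \<open>ze ~: U\<close> nU G(1)]) (use t(1) in auto)
   qed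
  qed
 qed
qed

text \<open>An isolated \<open>z0\<close> is repelling, so an inverse \<open>ph\<close> contracts a
  disc about it. Building the chain from iterates of \<open>ph\<close> keeps it inside that disc and
  makes it land at \<open>z0\<close>, which provides \<open>iso\<close>.\<close>

lemma recurrence_punctured:
 assumes fz: "f z0=z0" "deriv f z0~=0" and e0: "e0>0" "ball z0 e0-{z0}<=U" and nU: "z0 ~: U"
  and G: "!!n. is_leg U z0 (Ga n)" "!!n t. t>=0 ==> f (Ga (Suc n) t)=Ga n t"
 shows "EX m n. m<n & legs_equivalent U z0 (Ga m) (Ga n)"
proof -
 have lc: "leg_curve U z0 (Ga n)" for n using G(1)[of n] unfolding is_leg_def leg_curve_def by blast
 have rep: "cmod (deriv f z0)>1" by (rule isolated_repelling[OF fz e0])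
 obtain ph where ph: "ph holomorphic_on ball z0 e0" "ph z0=z0" "ALL z:ball z0 e0. f (ph z)=z" using isolated_inverse[OF fz e0] by blast
 define c where "c=(1 + cmod (deriv f z0))/2"
 have c: "c>1" "c<cmod (deriv f z0)" using rep by (auto simp: c_def)
 have "(f has_field_derivative deriv f z0) (at z0)" using holf by (simp add: holomorphic_derivI)
 then have "(%z. cmod ((f z-f z0)/(z-z0))) \<midarrow>z0\<rightarrow> cmod (deriv f z0)" unfolding has_field_derivative_iff by (rule tendsto_norm)
 from order_tendstoD(1)[OF this c(2)] obtain d where d: "d>0" "!!z. z~=z0 ==> dist z z0<d ==> c<cmod ((f z-f z0)/(z-z0))"
  unfolding eventually_at by auto
 have "cont (ball z0 e0) ph" using ph(1) holo_cont by blast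
 then have "isCont ph z0" using e0(1) by (simp add: continuous_on_eq_continuous_at)
 then obtain e1 where e1: "e1>0" "!!z. dist z z0<e1 ==> dist (ph z) z0<d" unfolding continuous_at_eps_delta using d(1) ph(2) by metis
 define e where "e=min e0 e1"
 have e: "e>0" "ball z0 e<=ball z0 e0" using e0(1) e1(1) by (auto simp: e_def)
 have con: "c * cmod (ph z-z0)<=cmod (z-z0)" if z: "z:ball z0 e" for z
 proof (cases "ph z=z0")
  case False
  have "c<cmod ((f (ph z)-f z0)/(ph z-z0))" using d(2)[OF False] e1(2)[of z] z by (simp add: e_def dist_commute)
  then show ?thesis using ph(3) z e(2) False fz(1) by (auto simp: norm_divide divide_simps)
 qed simp
 have phB: "ph z:ball z0 e-{z0}" if z: "z:ball z0 e-{z0}" for z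
 proof -
  have "cmod (ph z-z0)<=c * cmod (ph z-z0)" using c(1) mult_right_mono[of 1 c "cmod (ph z-z0)"] by simp
  then have "cmod (ph z-z0)<e" using con[of z] z by (auto simp: dist_norm norm_minus_commute)
  moreover have "ph z~=z0" using ph(3) z e(2) fz(1) by (metis DiffE insertI1 subsetD)
  ultimately show ?thesis by (simp add: dist_norm norm_minus_commute)
 qed
 have eU: "ball z0 e-{z0}<=U" using e(2) e0(2) by blast
 obtain t0 and H :: "real*real => complex" where t0: "t0>0" and H: "cont ({0..1} \<times> {0..t0}) H" "ALL s:{0..1}. H (s, 0)=z0"
  "ALL s:{0..1}. ALL t:{0<..t0}. H (s, t):ball z0 e-{z0}" "ALL t:{0..t0}. H (0, t)=Ga 0 t & H (1, t)=Ga (Suc 0) t"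
  by (rule punctured_germ_homotopy[OF e(1) eU nU lc[of 0] lc[of "Suc 0"]])
 have H': "germ_hom U z0 t0 (Ga 0) (Ga (Suc 0)) (%p. H (fst p, t0 * snd p))"
  by (rule germ_hom_rescale[OF t0 H(1,2) _ H(4) t0 order_refl]) (use H(3) eU in blast)
 define aa where "aa k s=(ph ^^ k) (H (s, t0*1))" for k s
 have aaB: "aa k s:ball z0 e-{z0}" if "s:{0..1}" for k s
  by (induction k) (use H(3) t0 that phB in "auto simp: aa_def simp del: Diff_iff")
 have G0: "Ga 0 t:ball z0 e" if "t:{0..t0}" for t
 proof (cases "t=0")
  case True
  then show ?thesis using e(1) lc[of 0] by (simp add: leg_curve_def)
 next
  case False
  then have "H (0, t):ball z0 e-{z0}" using H(3) that by (intro bspec[OF bspec[OF H(3)]]) auto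
  then show ?thesis using H(4) that by auto
 qed
 \<comment> \<open>This makes consecutive paths fit together: near \<open>z0\<close> the germ of the
   second curve is the image under \<open>ph\<close> of the first, by uniqueness of the lift from
   \<open>z0\<close>.\<close>
 have phGa: "Ga (Suc 0) t0=ph (Ga 0 t0)"
 proof -
  have cm: "cont {0..} (%t. Ga n (min t t0))" for n
   by (rule cont_comp[of "{0..}" "Ga n"]) (use lc[of n] t0 in "auto simp: leg_curve_def intro!: continuous_intros")
  have "Ga (Suc 0) (min t0 t0)=ph (Ga 0 (min t0 t0))"
  proof (rule lift_from_fixed_unique[OF fz, where a = "%t. Ga (Suc 0) (min t t0)" and b = "%t. ph (Ga 0 (min t t0))"])
   show "cont {0..} (%t. Ga (Suc 0) (min t t0))" by (rule cm)
   show "cont {0..} (%t. ph (Ga 0 (min t t0)))"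
    by (rule cont_comp[OF holo_cont[OF ph(1)] cm]) (use G0 e(2) t0 in "auto simp: image_subset_iff simp del: mem_ball")
   show "f (Ga (Suc 0) (min t t0)):U" if "t>0" for t using G(2)[of "min t t0" 0] lc[of 0] that t0 by (auto simp: leg_curve_def)
   show "f (Ga (Suc 0) (min t t0))=f (ph (Ga 0 (min t t0)))" if "t>=0" for t
    using G(2)[of "min t t0" 0] ph(3) G0[of "min t t0"] e(2) that t0 by (auto simp del: mem_ball)
  qed (use lc[of 0] lc[of "Suc 0"] ph(2) t0 in "auto simp: leg_curve_def")
  then show ?thesis by simp
 qed
 have b: "bchain aa" unfolding bchain_def
 proof (intro conjI allI ballI)
  fix k
  have "cont {0..1} (%s. H (s, t0))"
   by (intro cont_comp[OF H(1)] continuous_intros) (use t0 in auto)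
  then have c0: "cont {0..1} (aa 0)" by (simp add: aa_def[abs_def])
  show "cont {0..1} (aa k)"
  proof (induction k)
   case (Suc k)
   have "cont {0..1} (%s. ph (aa k s))"
    by (rule cont_comp[OF holo_cont[OF ph(1)] Suc]) (use aaB e(2) in "auto simp: image_subset_iff simp del: mem_ball")
   then show ?case by (simp add: aa_def[abs_def])
  qed (rule c0)
  show "aa k 1=aa (Suc k) 0" using phGa H(4) t0 by (simp add: aa_def funpow_swap1)
  fix t :: real assume t: "t:{0..1}"
  show "aa k t:U" using aaB[OF t] eU by blast
  have "aa k t:ball z0 e0" using aaB[OF t] e(2) by blast
  then show "f (aa (Suc k) t)=aa k t" using ph(3) by (simp add: aa_def)
 qed
 have la: "lands aa z0" unfolding lands_def
 proof (intro allI impI)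
  fix ep :: real assume ep: "ep>0"
  obtain J where J: "e<ep * c ^ J" using real_arch_pow[OF c(1), of "e/ep"] ep by (auto simp: divide_simps mult.commute)
  have k: "c ^ k * cmod (aa k t-z0)<e" if "t:{0..1}" for k t
  proof (induction k)
   case 0
   then show ?case using aaB[OF that, of 0] by (simp add: dist_norm norm_minus_commute)
  next
   case (Suc k)
   have "c * cmod (aa (Suc k) t-z0)<=cmod (aa k t-z0)" using con[of "aa k t"] aaB[OF that, of k] by (simp add: aa_def)
   then have "c ^ k * (c * cmod (aa (Suc k) t-z0))<=c ^ k * cmod (aa k t-z0)" using c(1) by (intro mult_left_mono) auto
   then show ?case using Suc by (simp add: mult_ac)
  qed
  have "cmod (aa n t-z0)<ep" if "n>=J" "t:{0..1}" for n t
  proof (rule ccontr)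
   assume "~  ?thesis"
   then have "ep * c ^ J<=cmod (aa n t-z0) * c ^ n" using c(1) that(1) ep by (intro mult_mono power_increasing) auto
   then show False using k[OF that(2), of n] J by (simp add: mult.commute)
  qed
  then show "EX J. ALL n>=J. ALL t:{0..1}. cmod (aa n t-z0)<ep" by blast
 qed
 show ?thesis
 proof (rule recurrence_core[OF fz t0 H' G nU b _ la fz(1)])
  show "1<cmod (deriv f z0) | deriv f z0=1" using rep by blast
  have "Ga 0 (t0 * t):ball z0 e" if "t:{0..1}" for t using that t0 by (intro G0) (auto intro: mult_left_le)
  then show "EX e>0. ball z0 e-{z0}<=U & (ALL t:{0..1}. Ga 0 (t0 * t):ball z0 e & (ALL k. aa k t:ball z0 e))"
   using e(1) eU aaB by (intro exI[of _ e]) blast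
  show "H (fst (s, 1), t0 * snd (s, 1))=aa 0 s" for s by (simp add: aa_def)
 qed
qed

text \<open>Unless the multiplier at the landing point is already suitable, it has modulus
  \<open>1\<close> and is a root of unity, so it becomes \<open>1\<close> for an iterate. The chain
  of the iterate lands at the same point, since its starting points are a subsequence of the old
  ones.\<close>

lemma recurrence_of_germ_hom:
 assumes fz: "f z0=z0" "deriv f z0~=0" and t0: "t0>0" and H: "germ_hom U z0 t0 (Ga 0) (Ga (Suc 0)) H"
  and G: "!!n. is_leg U z0 (Ga n)" "!!n t. t>=0 ==> f (Ga (Suc n) t)=Ga n t" and nU: "z0 ~: U"
  and ni: "connected_component_set (- U) z0~={z0}"
 shows "EX m n. m<n & legs_equivalent U z0 (Ga m) (Ga n)"
proof -
 have lc: "leg_curve U z0 (Ga n)" for n using G(1)[of n] unfolding is_leg_def leg_curve_def by blast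
 obtain aa where aa: "bchain aa" "ALL s. H (s, 1)=aa 0 s" "ALL k. aa k 0=Ga k t0" using germ_chain(1)[OF fz t0 H lc G(2)] by blast
 obtain ze where ze: "f ze=ze" "lands aa ze" using bchain_lands[OF aa(1)] unfolding lands_def by metis
 show ?thesis
 proof (cases "cmod (deriv f ze)>1 | deriv f ze=1")
  case True
  show ?thesis by (rule recurrence_core[OF fz t0 H G nU aa(1) _ ze(2,1) True]) (use aa(2) ni in auto)
 next
  case False
  have nz: "ze ~: U"
  proof
   assume U: "ze:U"
   then obtain N where N: "open N" "ze:N" "inj_on f N" using inj_loc[of ze] ze(1) by auto
   have "deriv f ze~=0" using holomorphic_injective_imp_regular[OF holomorphic_on_subset[OF holf] N(1,3,2)] by simp
   moreover obtain e where "e>0" "ball ze e<=U" using U openU open_contains_ball by blast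
   ultimately show False using isolated_repelling[OF ze(1), of e] False by blast
  qed
  have "cmod (deriv f ze)=1" using landing_not_attracting[OF aa(1) ze nz] False by linarith
  then obtain p where p: "p>0" "deriv f ze ^ p=1" using landing_rational[OF aa(1) ze nz] by blast
  interpret F: expansion "f ^^ p" U R0 by (rule iterate[OF p(1)])
  have fx: "(f ^^ n) w=w" if "f w=w" for n w by (induction n) (simp_all add: that)
  have dF: "deriv (f ^^ p) w=deriv f w ^ p" "(f ^^ p) w=w" if "f w=w" for w
   by (rule DERIV_imp_deriv[OF deriv_iter_fixed[OF that]], rule fx[OF that])
  define De where "De n=Ga (p * n)" for n
  have it: "(f ^^ j) (Ga (j + n) t)=Ga n t" if "t>=0" for j n t
   by (induction j) (use G(2) that in "auto simp: funpow_swap1")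
  have D: "is_leg U z0 (De n)" "leg_curve U z0 (De n)" "t>=0 ==> (f ^^ p) (De (Suc n) t)=De n t" for n t
   using G(1) lc it[of t p "p * n"] by (auto simp: De_def)
  obtain H2 where H2: "germ_hom U z0 t0 (De 0) (De (Suc 0)) H2" using germ_chain(2)[OF fz t0 H lc G(2) p(1)] by (auto simp: De_def)
  have fz': "(f ^^ p) z0=z0" "deriv (f ^^ p) z0~=0" using dF[OF fz(1)] fz(2) by auto
  obtain be where be: "F.bchain be" "ALL s. H2 (s, 1)=be 0 s" "ALL k. be k 0=De k t0" using F.germ_chain(1)[OF fz' t0 H2 D(2,3)] by blast
  obtain xi where xi: "(f ^^ p) xi=xi" "F.lands be xi" using F.bchain_lands[OF be(1)] unfolding F.lands_def by metis
  have "(%k. be k 0) \<longlonglongrightarrow> xi" using xi(2) unfolding F.lands_def LIMSEQ_def dist_norm by (metis atLeastAtMost_iff order_refl zero_le_one)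
  moreover have "(%k. aa k 0) \<longlonglongrightarrow> ze" using ze(2) unfolding lands_def LIMSEQ_def dist_norm by (metis atLeastAtMost_iff order_refl zero_le_one)
  then have "((%k. aa k 0) o (%k. p * k)) \<longlonglongrightarrow> ze" using p(1) by (intro LIMSEQ_subseq_LIMSEQ) (auto simp: strict_mono_def)
  then have "(%k. be k 0) \<longlonglongrightarrow> ze" using aa(3) be(3) by (simp add: o_def De_def)
  ultimately have eq: "xi=ze" using LIMSEQ_unique by blast
  have "EX m n. m<n & legs_equivalent U z0 (De m) (De n)"
   by (rule F.recurrence_core[OF fz' t0 H2 D(1,3) nU be(1) _ xi(2,1)]) (use be(2) ni dF(1)[OF ze(1)] p(2) eq in auto)
  then show ?thesis using p(1) unfolding De_def by (metis mult_less_mono2)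
 qed
qed

lemma recurrence:
 assumes fz: "f z0=z0" "deriv f z0~=0" and nU: "z0 ~: U"
  and G: "!!n. is_leg U z0 (Ga n)" "!!n t. t>=0 ==> f (Ga (Suc n) t)=Ga n t"
  and fc: "finite (components (connected_component_set (- U) z0-{z0}))"
 shows "EX m n. m<n & legs_equivalent U z0 (Ga m) (Ga n)"
proof -
 define K where "K=connected_component_set (- U) z0"
 obtain e0 where e0: "e0>0" "ball z0 e0-K<=U" using component_in_ball[OF nU] unfolding K_def by blast
 show ?thesis
 proof (cases "K={z0}")
  case True
  then have e: "ball z0 e0-{z0}<=U" using e0(2) by simp
  show ?thesis by (rule recurrence_punctured[where Ga=Ga, OF fz e0(1) e nU G])
 next
  case False
  have KU: "K <= - U" "z0:K" "connected K" using nU connected_component_subset[of "- U" z0] by (auto simp: K_def)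
  then obtain x where x: "x:K" "x~=z0" using False by blast
  have "closed K" unfolding K_def using openU by (intro closed_connected_component) (simp add: closed_def)
  moreover have "w:cball 0 R0" if "w:K" for w using bigU[of w] KU(1) that by (cases "R0<cmod w") auto
  then have "K<=cball 0 R0" by (rule subsetI)
  ultimately have cK: "compact K" by (metis bounded_cball bounded_subset compact_eq_bounded_closed)
  have disj: "K Int U={}" using KU(1) by blast
  obtain i j where ij: "i<j" "ALL ep>0. EX ta>0. ALL t:{0<..ta}. ALL t':{0<..ta}. connected_component (ball z0 ep-K) (Ga i t) (Ga j t')"
   by (rule finitely_many_accesses[OF bigU cK disj fc[folded K_def] KU(2) G(1)])
  define q where "q=j-i"
  have q: "q>0" "j=i + q" using ij(1) by (auto simp: q_def)
  interpret F: expansion "f ^^ q" U R0 by (rule iterate[OF q(1)])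
  \<comment> \<open>Starting at \<open>Ga i\<close> and using \<open>f ^^ q\<close>, the first two
    curves share their access, so \<open>germ_homotopy\<close> applies to them.\<close>
  define De where "De n=Ga (i + q * n)" for n
  have it: "(f ^^ k) (Ga (k + n) t)=Ga n t" if "t>=0" for k n t
   by (induction k) (use G(2) that in "auto simp: funpow_swap1")
  have D: "is_leg U z0 (De n)" "leg_curve U z0 (De n)" "t>=0 ==> (f ^^ q) (De (Suc n) t)=De n t" for n t
   using G(1)[of "i + q * n"] it[of t q "i + q * n"] by (auto simp: De_def is_leg_def leg_curve_def ac_simps)
  have "(f ^^ n) z0=z0" for n by (induction n) (simp_all add: fz(1))
  then have fz': "(f ^^ q) z0=z0" "deriv (f ^^ q) z0~=0" using DERIV_imp_deriv[OF deriv_iter_fixed[OF fz(1), of q]] fz(2) by simp_all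
  have acc: "EX ta>0. ALL t:{0<..ta}. ALL t':{0<..ta}. connected_component (ball z0 ep-K) (De 0 t) (De (Suc 0) t')" if "ep>0" for ep
   using ij(2) that q(2) by (simp add: De_def)
  obtain t0 and H :: "real*real => complex" where H: "t0>0" "cont ({0..1} \<times> {0..t0}) H" "ALL s:{0..1}. H (s, 0)=z0"
   "ALL s:{0..1}. ALL t:{0<..t0}. H (s, t):U" "ALL t:{0..t0}. H (0, t)=De 0 t & H (1, t)=De (Suc 0) t"
   by (rule germ_homotopy[OF cK KU(3,2) x e0 D(2) D(2) acc])
  have "EX m n. m<n & legs_equivalent U z0 (De m) (De n)"
   by (rule F.recurrence_of_germ_hom[OF fz' H(1) germ_hom_rescale[OF H H(1) order_refl] D(1,3) nU]) (use False in "auto simp: K_def")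
  then show ?thesis using q(1) unfolding De_def by (metis add_strict_left_mono mult_less_mono2)
 qed
qed

text \<open>The choice in \<open>leg_map\<close> is harmless: a lift exists and is unique for
  \<open>t>=0\<close>. Its injectivity is inherited from \<open>ga\<close>, because \<open>f\<close>
  maps it to \<open>ga\<close>.\<close>

lemma is_leg_leg_map:
 assumes fz: "f z0=z0" "deriv f z0~=0" and c: "is_leg U z0 ga"
 shows "is_leg U z0 (leg_map f z0 ga)" "t>=0 ==> f (leg_map f z0 ga t)=ga t"
proof -
 have lc: "leg_curve U z0 ga" using c unfolding is_leg_def leg_curve_def by blast
 obtain de where de: "leg_curve U z0 de" "!!t. t>=0 ==> f (de t)=ga t" using leg_curve_lift[OF fz lc] by blast
 define l where "l=leg_map f z0 ga"
 have "cont {0..} l & l 0=z0 & (ALL t>=0. f (l t)=ga t)" unfolding l_def leg_map_def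
  by (rule someI[of _ de]) (use de in "auto simp: leg_curve_def")
 then have l: "cont {0..} l" "l 0=z0" "!!t. t>=0 ==> f (l t)=ga t" by auto
 have e: "l t=de t" if "t>=0" for t
  by (rule lift_from_fixed_unique[OF fz _ l(1,2)]) (use de l(3) lc that in "auto simp: leg_curve_def")
 have "\<forall>\<^sub>F t in at_top. l t=de t" using eventually_ge_at_top[of 0] by eventually_elim (rule e)
 from filterlim_cong[OF refl refl this] have "filterlim l at_infinity at_top" using de(1) unfolding leg_curve_def by simp
 moreover have "inj_on l {0..}"
 proof (rule inj_onI)
  fix s t assume "s:{0..}" "t:{0..}" "l s=l t"
  then have "ga s=ga t" using l(3) by (metis atLeast_iff)
  then show "s=t" using c \<open>s : _\<close> \<open>t : _\<close> unfolding is_leg_def inj_on_def by blast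
 qed
 ultimately show "is_leg U z0 (leg_map f z0 ga)" using l de(1) e unfolding is_leg_def leg_curve_def l_def[symmetric] by auto
 show "t>=0 ==> f (leg_map f z0 ga t)=ga t" using l(3) unfolding l_def .
qed

end

lemma expansion_of_admissible:
 assumes f: "transcendental_entire f" and U: "admissible_expansion_domain f z0 U"
 shows "EX R. expansion f U R"
proof -
 note U=U[unfolded admissible_expansion_domain_def]
 have hf: "f holomorphic_on UNIV" and np: "~  (EX p. ALL z. f z=poly p z)" using f unfolding transcendental_entire_def by auto
 obtain R where R: "{z. R<cmod z}<=U" using U by blast
 have ss: "critical_values f Un asymptotic_values f<=postsingular_set f"
 proof -
  have "singular_set f<=(\<Union>n. (f ^^ n) ` singular_set f)" by (intro subsetI UN_I[of 0]) auto
  then show ?thesis unfolding singular_set_def postsingular_set_def using closure_subset by (meson order_trans)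
 qed
 then have sU: "critical_values f Int U={}" "asymptotic_values f Int U={}" using U by auto
 have crit: "deriv f w~=0" if "f w:U" for w
 proof
  assume "deriv f w=0"
  then have "f w:critical_values f" unfolding critical_values_def by blast
  then show False using sU(1) that by blast
 qed
 have ne: "f -` U~={}"
 proof
  assume e: "f -` U={}"
  have "f z:cball 0 R" for z
  proof (rule ccontr)
   assume "f z ~: cball 0 R"
   then have "f z:U" using R by auto
   then show False using e by blast
  qed
  then have "bounded (range f)" by (intro bounded_subset[OF bounded_cball[of 0 R]]) blast
  then obtain c where "!!z. f z=c" using Liouville_theorem[OF hf] unfolding constant_on_def by auto
  then have "ALL z. f z=poly [:c:] z" by simp
  then show False using np by blast
 qed
 have cov: "covering_space (f -` U) f U"
 proof (rule covering_space_of_branches[OF holo_cont[OF hf] _ _ ne])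
  show "EX h. cont (ball (f w) r) h & h (f w)=w & (ALL z:ball (f w) r. f (h z)=z)" if "r>0" "ball (f w) r<=U" for r w
   using disc_branch[OF hf _ crit sU(2) that] U by blast
 qed (use U in auto)
 have "expansion f U (max R 1)"
 proof
  show "z:U" if "max R 1<cmod z" for z using R that by auto
  show "EX a:U. f a ~: U" "!!z. f z:U ==> z:U" using U by blast+
 qed (use hf np cov U in auto)
 then show ?thesis by blast
qed

theorem mainTheorem7:
  fixes f :: "complex \<Rightarrow> complex" and z0 :: complex and U :: "complex set"
    and \<gamma> :: "real \<Rightarrow> complex"
  assumes "transcendental_entire f"
    and "repelling_fixed_point f z0 \<or> parabolic_fixed_point f z0"
    and "admissible_expansion_domain f z0 U"
    and "is_leg U z0 \<gamma>"
  shows "\<exists>m n. m < n \<and> legs_equivalent U z0 ((leg_map f z0 ^^ m) \<gamma>) ((leg_map f z0 ^^ n) \<gamma>)"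
proof -
 obtain R where "expansion f U R" using expansion_of_admissible assms by blast
 then interpret expansion f U R .
 have fz: "f z0=z0" "deriv f z0~=0"
  using assms(2) unfolding repelling_fixed_point_def parabolic_fixed_point_def by (auto simp: power_0_left)
 have nU: "z0 ~: U" and fc: "finite (components (connected_component_set (- U) z0-{z0}))"
  using assms(3) unfolding admissible_expansion_domain_def by auto
 have l: "is_leg U z0 ((leg_map f z0 ^^ n) \<gamma>)" for n by (induction n) (use assms(4) is_leg_leg_map(1)[OF fz] in auto)
 show ?thesis by (rule recurrence[OF fz nU l _ fc]) (use is_leg_leg_map(2)[OF fz l] in simp)
qed

end
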